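(* Let $0<\sigma<1$ and let $M_\sigma(x)=\sum_{n=0}^\infty \frac{(-x)^n}{n!\,\Gamma(-n\sigma+1-\sigma)}$. With $\kappa=1-\sigma$, $\vartheta=\sigma-\tfrac12$, $h=\sigma^\sigma$, $X=\kappa(hx)^{1/\kappa}$, $A(\sigma)=\sqrt{\frac{2\pi}{\sigma}}\left(\frac{\sigma}{\kappa}\right)^{\sigma}$, and the coefficients $c_j(\sigma)$ (with $c_0(\sigma)=1$) defined in the context, the following asymptotic expansions hold as $x\to+\infty$: $$M_\sigma(x)\sim \frac{A(\sigma)}{2\pi}\, X^{\vartheta}e^{-X}\sum_{j=0}^\infty c_j(\sigma)(-X)^{-j}\qquad(0<\sigma<1),$$ and $$M_\sigma(-x)\sim\begin{cases}\hat E(x)+\hat H(x) & (0<\sigma<\tfrac12),\\ \hat H(x) & (\tfrac12<\sigma<1),\end{cases}$$ where $\hat E(x)$ and $\hat H(x)$ are the formal exponential and algebraic expansions $$\hat E(x):=\frac{A(\sigma)}{\pi}X^{\vartheta}e^{X\cos(\pi\sigma/\kappa)}\sum_{j=0}^\infty c_j(\sigma)(-X)^{-j}\cos\left[X\sin\frac{\pi\sigma}{\kappa}+\frac{\pi}{\kappa}(\vartheta-j)\right],$$ $$\hat H(x):=\frac1\sigma\sum_{k=1}^\infty\frac{x^{-(k+\sigma)/\sigma}}{k!\,\Gamma\left(-\frac{k}{\sigma}\right)}.$$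
   Context: Here $x$ is real and positive, $\sigma$ is fixed, and $1/\Gamma$ is the entire reciprocal gamma function (so it is $0$ at non-positive integers). The series for $M_\sigma$ converges for all finite arguments. Coefficients $c_j(\sigma)$: put $\vartheta'=1-\vartheta$. The $c_j(\sigma)$ are the coefficients in the inverse factorial expansion, valid for every positive integer $M$ and every small $\epsilon>0$, $$\frac{\Gamma(\sigma s+\sigma)\Gamma(\kappa s+\vartheta')}{\Gamma(1+s)}=\kappa A(\sigma)(h\kappa^\kappa)^s\left\{\sum_{j=0}^{M-1}\frac{c_j(\sigma)}{(\kappa s+\vartheta')_j}+\frac{O(1)}{(\kappa s+\vartheta')_M}\right\}$$ as $|s|\to\infty$ uniformly in $|\arg s|\le\pi-\epsilon$, where $(a)_j=\Gamma(a+j)/\Gamma(a)$. In particular $c_0(\sigma)=1$ and $c_1(\sigma)=\frac{(2-\sigma)(1-2\sigma)}{24\sigma}$. Meaning of $\sim$: asymptotic expansion in the Poincaré sense for fixed $\sigma$. The first expansion means that for every $M\ge1$, $M_\sigma(x)=\frac{A(\sigma)}{2\pi}X^{\vartheta}e^{-X}\left\{\sum_{j=0}^{M-1}c_j(\sigma)(-X)^{-j}+O(X^{-M})\right\}$. For $M_\sigma(-x)\sim\hat E(x)+\hat H(x)$: for all $M,N\ge1$, $M_\sigma(-x)$ equals the sum of $\hat E(x)$ truncated to $0\le j\le M-1$ and $\hat H(x)$ truncated to $1\le k\le N-1$, up to an error $O\left(X^{\vartheta-M}e^{X\cos(\pi\sigma/\kappa)}\right)+O\left(x^{-(N+\sigma)/\sigma}\right)$.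 For $M_\sigma(-x)\sim\hat H(x)$: for every $N\ge1$ the error of truncating $\hat H$ to $1\le k\le N-1$ is $O\left(x^{-(N+\sigma)/\sigma}\right)$. *)

theory Defs
  imports "HOL-Analysis.Analysis" "HOL-Library.Landau_Symbols"
begin

definition M_wright :: "real \<Rightarrow> real \<Rightarrow> real" where
  "M_wright \<sigma> x = (\<Sum>n. (- x) ^ n / fact n * rGamma (- (real n * \<sigma>) + 1 - \<sigma>))"

definition kap :: "real \<Rightarrow> real" where
  "kap \<sigma> = 1 - \<sigma>"

definition vth :: "real \<Rightarrow> real" where
  "vth \<sigma> = \<sigma> - 1 / 2"

definition hpar :: "real \<Rightarrow> real" where
  "hpar \<sigma> = \<sigma> powr \<sigma>"

definition Apar :: "real \<Rightarrow> real" where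
  "Apar \<sigma> = sqrt (2 * pi / \<sigma>) * (\<sigma> / kap \<sigma>) powr \<sigma>"

definition Xvar :: "real \<Rightarrow> real \<Rightarrow> real" where
  "Xvar \<sigma> x = kap \<sigma> * (hpar \<sigma> * x) powr (1 / kap \<sigma>)"

text \<open>
  The filter below is \<open>|s| \<rightarrow> \<infinity>\<close> inside the closed sector \<open>|arg s| \<le> \<pi> - \<epsilon>\<close>; an \<open>O\<close>-estimate
  along it is uniform in \<open>arg s\<close>.
\<close>

definition sector_at_infinity :: "real \<Rightarrow> complex filter" where
  "sector_at_infinity \<epsilon> = inf at_infinity (principal {s. \<bar>Arg s\<bar> \<le> pi - \<epsilon>})"

text \<open>
  \<open>c\<close> is the sequence of coefficients in the inverse factorial expansion of
  \<open>\<Gamma>(\<sigma>s + \<sigma>) \<Gamma>(\<kappa>s + \<vartheta>') / \<Gamma>(1 + s)\<close>, where \<open>\<vartheta>' = 1 - \<vartheta>\<close>. These conditions determine \<open>c\<close>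
  uniquely, and the rising factorial \<open>(a)\<^sub>j = \<Gamma>(a + j) / \<Gamma>(a)\<close> is \<open>pochhammer a j\<close>.
\<close>

definition inverse_factorial_coeffs :: "real \<Rightarrow> (nat \<Rightarrow> real) \<Rightarrow> bool" where
  "inverse_factorial_coeffs \<sigma> c \<longleftrightarrow>
    (\<forall>M\<ge>1. \<forall>\<epsilon>. 0 < \<epsilon> \<and> \<epsilon> < pi \<longrightarrow>
      (\<lambda>s::complex.
          Gamma (of_real \<sigma> * s + of_real \<sigma>) * Gamma (of_real (kap \<sigma>) * s + of_real (1 - vth \<sigma>))
            / Gamma (1 + s)
            / (of_real (kap \<sigma> * Apar \<sigma>) * of_real (hpar \<sigma> * kap \<sigma> powr kap \<sigma>) powr s)
          - (\<Sum>j<M. of_real (c j) / pochhammer (of_real (kap \<sigma>) * s + of_real (1 - vth \<sigma>)) j))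
        \<in> O[sector_at_infinity \<epsilon>](\<lambda>s.
              1 / pochhammer (of_real (kap \<sigma>) * s + of_real (1 - vth \<sigma>)) M))"

definition E_trunc :: "real \<Rightarrow> (nat \<Rightarrow> real) \<Rightarrow> nat \<Rightarrow> real \<Rightarrow> real" where
  "E_trunc \<sigma> c M x =
    Apar \<sigma> / pi * Xvar \<sigma> x powr vth \<sigma> * exp (Xvar \<sigma> x * cos (pi * \<sigma> / kap \<sigma>)) *
    (\<Sum>j<M. c j / (- Xvar \<sigma> x) ^ j *
      cos (Xvar \<sigma> x * sin (pi * \<sigma> / kap \<sigma>) + pi / kap \<sigma> * (vth \<sigma> - real j)))"

definition H_trunc :: "real \<Rightarrow> nat \<Rightarrow> real \<Rightarrow> real" where
  "H_trunc \<sigma> N x =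
    1 / \<sigma> * (\<Sum>k=1..<N. x powr (- (real k + \<sigma>) / \<sigma>) / fact k * rGamma (- (real k / \<sigma>)))"

end

theory Submission
  imports Defs "HOL-Complex_Analysis.Complex_Analysis" "HOL-Real_Asymp.Real_Asymp" "HOL-Probability.Distributions"
begin

text \<open>
  By the reflection formula for the gamma function, the series of \<open>M_wright \<sigma>\<close> at \<open>x\<close> is, up to the
  factor \<open>- 1 / (\<pi> \<sigma> x)\<close>, the imaginary part of the integral of
  \<open>exp (- t - x cis (\<pi> \<sigma>) t\<^sup>\<sigma>)\<close> over the positive half-line (\<open>M_wright_eq_wright_int\<close>). The asymptotics is
  found by moving this contour. After scaling, the saddle lies at \<open>1\<close>, the exponent is a multiple of
  \<open>phase \<sigma>\<close>, and the large parameter is \<open>X\<close>.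

  Near the saddle a holomorphic coordinate makes the exponent an exact negative square
  (\<open>phase_normal_form\<close>), and repeated integration by parts gives a Watson expansion whose coefficients do
  not depend on the direction in which the saddle is crossed (\<open>saddle_point_local\<close>,
  \<open>laplace_two_sided\<close>). Hence one contour suffices to compute them, and this is where the hypothesis on
  \<open>c\<close> enters. On the real axis the integral is \<open>wright_psi\<close>, the integral of \<open>exp (- t + y t\<^sup>\<sigma>)\<close>. If
  \<open>exp z\<close> is replaced in it by the integral of \<open>z\<^sup>r / \<Gamma>(r + 1)\<close> over \<open>r\<close>, which changes it only by a power
  of \<open>z\<close> (\<open>nu_from_asymp\<close>), the integration over \<open>t\<close> turns it into the integral of
  \<open>y\<^sup>r \<Gamma>(\<sigma> r + 1) / \<Gamma>(r + 1)\<close> over \<open>r\<close> (\<open>laplace_of_nu\<close>). The inverse factorial expansion of this quotient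
  can be integrated term by term, each term being again such an integral, and the result is an expansion of
  \<open>wright_psi\<close> with the coefficients \<open>c\<close> (\<open>wright_psi_expansion\<close>). By uniqueness of asymptotic expansions
  the saddle coefficients are the \<open>c j\<close>, up to a constant factor (\<open>saddle_expansion\<close>).

  For positive arguments the contour is moved to the vertical line through the saddle; its two halves are
  conjugate, and the first expansion follows (\<open>wright_int_vertical\<close>, \<open>recessive_expansion\<close>).

  For negative arguments there are three ranges, with \<open>\<beta> = \<pi> \<sigma> / \<kappa>\<close>. If \<open>\<sigma> < 1/3\<close>, then \<open>\<beta>\<close> is less than a
  right angle, the contour can be turned by \<open>\<beta>\<close> into the ray through the saddle, and the exponential
  expansion results; it grows, so the algebraic terms are absorbed by its error
  (\<open>exponential_expansion_below_third\<close>). If \<open>\<sigma> > 1/3\<close>, the contour can be turned so far that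
  the factor with \<open>x\<close> decays, and expanding the other factor in powers of \<open>t\<close> gives the algebraic expansion
  (\<open>algebraic_expansion\<close>); for \<open>\<sigma> < 1/2\<close> the exponential terms are then smaller than every power. If
  \<open>\<sigma> = 1/3\<close>, both kinds of rotation just fail. But then \<open>t = - v\<^sup>3\<close> gives the exponential of a cubic
  polynomial, which has straight descent paths (\<open>wright_int_third\<close>), and the algebraic terms are
  zero because \<open>1 / \<Gamma>\<close> vanishes at the negative integers.
\<close>

section \<open>Contour changes between rays\<close>

lemma powr_le_affine:
  fixes s c K :: real
  assumes "s < 1" "0 < c" "0 < s"
  obtains C where "C \<ge> 0" "\<And>r. r \<ge> 0 \<Longrightarrow> K * r powr s \<le> C + c * r"
proof -
  define k where "k = c / (\<bar>K\<bar> + 1)"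
  have k: "k > 0" using assms by (auto simp: k_def)
  have "\<forall>\<^sub>F r in at_top. r powr s \<le> k * r"
    using assms(1,3) k by real_asymp
  then obtain R where "\<And>r. r \<ge> R \<Longrightarrow> r powr s \<le> k * r"
    by (auto simp: eventually_at_top_linorder)
  then have R: "K * r powr s \<le> c * r" if "r \<ge> R" for r
  proof -
    have "K * r powr s \<le> (\<bar>K\<bar> + 1) * r powr s" by (intro mult_right_mono) auto
    also have "\<dots> \<le> (\<bar>K\<bar> + 1) * (k * r)"
      using \<open>\<And>r. r \<ge> R \<Longrightarrow> r powr s \<le> k * r\<close>[OF that] by (intro mult_left_mono) auto
    also have "\<dots> = c * r" by (simp add: k_def)
    finally show ?thesis .
  qed
  show thesis
  proof (rule that[of "\<bar>K\<bar> * \<bar>R\<bar> powr s"])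
    fix r :: real assume r: "r \<ge> 0"
    show "K * r powr s \<le> \<bar>K\<bar> * \<bar>R\<bar> powr s + c * r"
    proof (cases "r \<ge> R")
      case True
      have "0 \<le> \<bar>K\<bar> * \<bar>R\<bar> powr s" by simp
      with R[OF True] show ?thesis by linarith
    next
      case False
      have "K * r powr s \<le> \<bar>K\<bar> * \<bar>R\<bar> powr s"
        using False r assms by (intro mult_mono powr_mono2) auto
      moreover have "0 \<le> c * r" using r assms by simp
      ultimately show ?thesis by linarith
    qed
  qed simp
qed

lemma exp_powr_le_inverse_square:
  fixes s c :: real
  assumes "0 < c" "0 < s"
  obtains B where "B > 0" "\<And>r. r \<ge> 0 \<Longrightarrow> exp (- c * r powr s) \<le> B / (1 + r)\<^sup>2"
proof -
  have "\<forall>\<^sub>F r in at_top. exp (- c * r powr s) \<le> 1 / (1 + r)\<^sup>2"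
    using assms by real_asymp
  then obtain R where R: "\<And>r. r \<ge> R \<Longrightarrow> exp (- c * r powr s) \<le> 1 / (1 + r)\<^sup>2"
    by (auto simp: eventually_at_top_linorder)
  define B where "B = (1 + \<bar>R\<bar>)\<^sup>2"
  have B: "B \<ge> 1" by (auto simp: B_def)
  show thesis
  proof (rule that[of B])
    fix r :: real assume r: "r \<ge> 0"
    show "exp (- c * r powr s) \<le> B / (1 + r)\<^sup>2"
    proof (cases "r \<ge> R")
      case True
      have "1 / (1 + r)\<^sup>2 \<le> B / (1 + r)\<^sup>2"
        using B by (intro divide_right_mono) auto
      with R[OF True] show ?thesis by linarith
    next
      case False
      have "exp (- c * r powr s) \<le> 1" using assms by simp
      also have "1 \<le> B / (1 + r)\<^sup>2"
        using False r by (simp add: B_def power_mono)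
      finally show ?thesis .
    qed
  qed (use B in auto)
qed

lemma integrable_inverse_square: "(\<lambda>t::real. B / (1 + t)\<^sup>2) integrable_on {0..}"
proof -
  have "((\<lambda>t::real. 1 / (1 + t)\<^sup>2) has_integral 1) {0..}"
  proof (rule has_integral_to_inf)
    have *: "((\<lambda>t::real. 1 / (1 + t)\<^sup>2) has_integral (- 1 / (1 + y) - (- 1 / (1 + 0)))) {0..y}" if "y \<ge> 0" for y
      using that
      by (intro fundamental_theorem_of_calculus)
         (auto intro!: derivative_eq_intros simp: power2_eq_square
               simp flip: has_real_derivative_iff_has_vector_derivative)
    show "(\<lambda>t::real. 1 / (1 + t)\<^sup>2) integrable_on {0..y}" for y
      using *[of y] by (cases "y \<ge> 0") (auto simp: integrable_on_def)
    have "\<forall>\<^sub>F y in at_top. integral {0..y} (\<lambda>t::real. 1 / (1 + t)\<^sup>2) = - 1 / (1 + y) + 1"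
      using eventually_ge_at_top[of 0] by eventually_elim (use * integral_unique in fastforce)
    moreover have "((\<lambda>y::real. - 1 / (1 + y) + 1) \<longlongrightarrow> 1) at_top" by real_asymp
    ultimately show "((\<lambda>y. integral {0..y} (\<lambda>t::real. 1 / (1 + t)\<^sup>2)) \<longlongrightarrow> 1) at_top"
      by (simp add: filterlim_cong)
  qed auto
  then have "(\<lambda>t::real. B * (1 / (1 + t)\<^sup>2)) integrable_on {0..}"
    by (intro integrable_on_mult_right) (auto simp: integrable_on_def)
  then show ?thesis by simp
qed

lemma continuous_bounded_absolutely_integrable:
  fixes f :: "real \<Rightarrow> complex"
  assumes "continuous_on S f" "S \<in> sets lebesgue" "g integrable_on S" "\<And>t. t \<in> S \<Longrightarrow> norm (f t) \<le> g t"
  shows "f absolutely_integrable_on S"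
  by (rule measurable_bounded_by_integrable_imp_absolutely_integrable
      [OF continuous_imp_measurable_on_sets_lebesgue[OF assms(1,2)] assms(2-4)])

text \<open>
  The truncation points are an arbitrary sequence so that a change of variable, which distorts the
  truncation, can be carried out on bounded intervals first.
\<close>

lemma integral_atLeast_tendsto:
  fixes f :: "real \<Rightarrow> complex"
  assumes "f absolutely_integrable_on {a..}" and T: "filterlim T at_top sequentially"
  shows "(\<lambda>n. integral {a..a + T n} f) \<longlonglongrightarrow> integral {a..} f"
proof -
  have f: "f integrable_on {a..}" "(\<lambda>t. norm (f t)) integrable_on {a..}"
    using assms by (auto simp: absolutely_integrable_on_def)
  have i: "f integrable_on {a..a + T n}" for n
    by (rule integrable_on_subinterval[OF f(1)]) auto
  have e: "integral {a..a + T n} f = integral {a..} (\<lambda>t. if t \<in> {a..a + T n} then f t else 0)" for n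
    by (subst integral_restrict_Int) (auto simp: Int_absorb2 Int_absorb1)
  have "(\<lambda>n. integral {a..} (\<lambda>t. if t \<in> {a..a + T n} then f t else 0)) \<longlonglongrightarrow> integral {a..} f"
  proof (rule dominated_convergence(2)[OF _ f(2)])
    show "(\<lambda>t. if t \<in> {a..a + T n} then f t else 0) integrable_on {a..}" for n
      using i[of n] by (subst integrable_restrict_Int) (auto simp: Int_absorb1)
    show "norm (if x \<in> {a..a + T k} then f x else 0) \<le> norm (f x)" for k x by auto
    fix x assume x: "x \<in> {a..}"
    have "\<forall>\<^sub>F n in sequentially. x - a \<le> T n"
      using T by (simp add: filterlim_at_top)
    then have "\<forall>\<^sub>F n in sequentially. (if x \<in> {a..a + T n} then f x else 0) = f x"
      by eventually_elim (use x in auto)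
    then show "(\<lambda>n. if x \<in> {a..a + T n} then f x else 0) \<longlonglongrightarrow> f x"
      by (rule tendsto_eventually)
  qed
  then show ?thesis by (simp add: e)
qed

lemma integral_ray_segment:
  fixes f F :: "complex \<Rightarrow> complex"
  assumes F: "\<And>u. u \<in> S \<Longrightarrow> (F has_field_derivative f u) (at u within S)"
    and ray: "\<And>t. 0 \<le> t \<Longrightarrow> t \<le> T \<Longrightarrow> a + of_real t * d \<in> S" and T: "T \<ge> 0"
  shows "((\<lambda>t. f (a + of_real t * d) * d) has_integral (F (a + of_real T * d) - F a)) {0..T}"
proof -
  have "((\<lambda>t. F (a + of_real t * d)) has_vector_derivative f (a + of_real t * d) * d) (at t within {0..T})"
    if t: "t \<in> {0..T}" for t
  proof -
    have 1: "((\<lambda>t::real. a + of_real t * d) has_vector_derivative d) (at t within {0..T})"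
      by (auto intro!: derivative_eq_intros simp: has_vector_derivative_def scaleR_conv_of_real)
    have 2: "(F has_field_derivative f (a + of_real t * d))
        (at (a + of_real t * d) within (\<lambda>t. a + of_real t * d) ` {0..T})"
      by (rule DERIV_subset[OF F]) (use t ray in auto)
    show ?thesis
      using field_vector_diff_chain_within[OF 1 2] by (simp add: o_def mult.commute)
  qed
  from fundamental_theorem_of_calculus[OF T this] show ?thesis by simp
qed

lemma nonneg_if_norm_le_divide:
  assumes "norm z \<le> B / (1 + norm u)\<^sup>2"
  shows "B \<ge> 0"
proof -
  have "1 + norm u > 0" by (simp add: add_pos_nonneg)
  then have p: "(1 + norm u)\<^sup>2 > 0" by simp
  have "0 \<le> B / (1 + norm u)\<^sup>2" using assms norm_ge_zero order_trans by blast
  with p show ?thesis by (simp add: zero_le_divide_iff)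
qed

lemma absolutely_integrable_ray:
  fixes f :: "complex \<Rightarrow> complex"
  assumes "continuous_on S f"
    and decay: "\<And>u. u \<in> S \<Longrightarrow> norm (f u) \<le> B / (1 + norm u)\<^sup>2"
    and ray: "\<And>t. t \<ge> 0 \<Longrightarrow> a + of_real t * d \<in> S" and d: "norm d = 1"
  shows "(\<lambda>t. f (a + of_real t * d) * d) absolutely_integrable_on {0..}"
proof (rule continuous_bounded_absolutely_integrable)
  show "continuous_on {0..} (\<lambda>t. f (a + of_real t * d) * d)"
    by (intro continuous_intros continuous_on_compose2[OF assms(1)]) (use ray in auto)
  show "(\<lambda>t::real. (B * (1 + norm a)\<^sup>2) / (1 + t)\<^sup>2) integrable_on {0..}"
    by (rule integrable_inverse_square)
  fix t :: real assume t: "t \<in> {0..}"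
  let ?u = "a + of_real t * d"
  have B: "B \<ge> 0" using nonneg_if_norm_le_divide[OF decay[of ?u]] ray[of t] t by auto
  have "t = norm (of_real t * d)" using d t by (simp add: norm_mult)
  also have "\<dots> \<le> norm ?u + norm a"
    by (metis add.commute add_diff_cancel_left' norm_triangle_ineq4)
  finally have "t \<le> norm ?u + norm a" .
  moreover have "0 \<le> norm a * norm ?u" by simp
  moreover have "(1 + norm a) * (1 + norm ?u) = 1 + norm ?u + norm a + norm a * norm ?u"
    by (simp add: algebra_simps)
  ultimately have 1: "1 + t \<le> (1 + norm a) * (1 + norm ?u)" by linarith
  have "norm (f ?u * d) \<le> B / (1 + norm ?u)\<^sup>2"
    using decay[of ?u] ray[of t] t d by (simp add: norm_mult)
  also have "\<dots> \<le> B * (1 + norm a)\<^sup>2 / (1 + t)\<^sup>2"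
  proof -
    have "(1 + t)\<^sup>2 \<le> ((1 + norm a) * (1 + norm ?u))\<^sup>2" using 1 t by (intro power_mono) auto
    then have "B * (1 + t)\<^sup>2 \<le> B * ((1 + norm a)\<^sup>2 * (1 + norm ?u)\<^sup>2)" 
      using B by (intro mult_left_mono) (auto simp: power_mult_distrib)
    moreover have "0 < 1 + norm ?u" "0 < 1 + t"
      using t by (auto intro!: add_pos_nonneg)
    then have "0 < (1 + norm ?u)\<^sup>2" "0 < (1 + t)\<^sup>2" by simp_all
    ultimately show ?thesis by (simp add: divide_simps mult_ac)
  qed
  finally show "norm (f ?u * d) \<le> (B * (1 + norm a)\<^sup>2) / (1 + t)\<^sup>2" .
qed simp

text \<open>
  The chord joining two points far out on different rays stays away from the origin, because the
  midpoint of a chord of the unit circle is its point nearest to the centre.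
\<close>

lemma segment_of_rays_norm_ge:
  fixes a b d e :: complex
  assumes "norm d = 1" "norm e = 1" "n \<ge> 0" "u \<in> closed_segment (a + of_real n * d) (b + of_real n * e)"
  shows "norm u \<ge> n * (norm (d + e) / 2) - norm a - norm b"
proof -
  obtain s where s: "0 \<le> s" "s \<le> 1" "u = (1 - s) *\<^sub>R (a + of_real n * d) + s *\<^sub>R (b + of_real n * e)"
    using assms(4) by (auto simp: closed_segment_def)
  define v where "v = (1 - s) *\<^sub>R d + s *\<^sub>R e"
  have "(norm (d + e) / 2)\<^sup>2 \<le> (norm v)\<^sup>2"
  proof -
    have dd: "(Re d)\<^sup>2 + (Im d)\<^sup>2 = 1" "(Re e)\<^sup>2 + (Im e)\<^sup>2 = 1"
      using assms cmod_power2 by (metis one_power2)+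
    have id: "(norm v)\<^sup>2 - (norm (d + e) / 2)\<^sup>2 =
       (((1-s)\<^sup>2 - 1/4) * ((Re d)\<^sup>2 + (Im d)\<^sup>2) + (s\<^sup>2-1/4) * ((Re e)\<^sup>2 + (Im e)\<^sup>2)) + (2 * s * (1-s) - 1/2) * (Re d * Re e + Im d * Im e)"
      unfolding v_def by (simp add: cmod_power2 power_divide) (simp add: power2_eq_square algebra_simps add_divide_distrib)
    also have "\<dots> = (2 * (s - 1/2)\<^sup>2) * (1 - (Re d * Re e + Im d * Im e))"
      unfolding dd by (simp add: power2_eq_square algebra_simps)
    also have "\<dots> \<ge> 0"
    proof -
      have "2 * (Re d * Re e + Im d * Im e) \<le> ((Re d)\<^sup>2 + (Im d)\<^sup>2) + ((Re e)\<^sup>2 + (Im e)\<^sup>2)"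
        using sum_squares_bound[of "Re d" "Re e"] sum_squares_bound[of "Im d" "Im e"] by simp
      then show ?thesis unfolding dd by simp
    qed
    finally show ?thesis by simp
  qed
  then have v: "norm (d + e) / 2 \<le> norm v" by (rule power2_le_imp_le) simp
  have "u = of_real n * v + ((1 - s) *\<^sub>R a + s *\<^sub>R b)"
    unfolding s v_def by (simp add: scaleR_conv_of_real algebra_simps)
  then have "norm u \<ge> norm (of_real n * v) - norm ((1 - s) *\<^sub>R a + s *\<^sub>R b)"
    by (metis norm_diff_ineq)
  moreover have "norm ((1 - s) *\<^sub>R a + s *\<^sub>R b) \<le> norm a + norm b"
  proof -
    have "norm ((1 - s) *\<^sub>R a + s *\<^sub>R b) \<le> (1 - s) * norm a + s * norm b"
      using norm_triangle_ineq[of "(1 - s) *\<^sub>R a" "s *\<^sub>R b"] s by simp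
    also have "\<dots> \<le> 1 * norm a + 1 * norm b" using s by (intro add_mono mult_right_mono) auto
    finally show ?thesis by simp
  qed
  moreover have "norm (of_real n * v) \<ge> n * (norm (d + e) / 2)"
    using mult_left_mono[OF v assms(3)] assms(3) by (simp add: norm_mult)
  ultimately show ?thesis by linarith
qed

text \<open>
  Cauchy's theorem for two unbounded rays. The far ends are joined by a chord, whose length grows
  linearly while the integrand on it decays quadratically, so its contribution vanishes in the
  limit. Opposite directions are excluded because the chord could then pass near the origin. A
  primitive is used instead of holomorphy because the rays run along the boundary of the domain,
  where the powers are only continuous.
\<close>

lemma ray_change:
  fixes f F :: "complex \<Rightarrow> complex"
  assumes S: "convex S" and cont: "continuous_on S f"
    and F: "\<And>u. u \<in> S \<Longrightarrow> (F has_field_derivative f u) (at u within S)"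
    and decay: "\<And>u. u \<in> S \<Longrightarrow> norm (f u) \<le> B / (1 + norm u)\<^sup>2"
    and ra: "\<And>t. t \<ge> 0 \<Longrightarrow> a + of_real t * d \<in> S" and d: "norm d = 1"
    and rb: "\<And>t. t \<ge> 0 \<Longrightarrow> b + of_real t * e \<in> S" and e: "norm e = 1" and de: "d + e \<noteq> 0"
  shows "integral {0..} (\<lambda>t. f (a + of_real t * d) * d) + F a =
         integral {0..} (\<lambda>t. f (b + of_real t * e) * e) + F b"
proof -
  define p where "p = (\<lambda>n::nat. a + of_real (real n) * d)"
  define q where "q = (\<lambda>n::nat. b + of_real (real n) * e)"
  have ends: "(\<lambda>n. F (c + of_real (real n) * g) - F c) \<longlonglongrightarrow> integral {0..} (\<lambda>t. f (c + of_real t * g) * g)"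
    if r: "\<And>t. t \<ge> 0 \<Longrightarrow> c + of_real t * g \<in> S" and g: "norm g = 1" for c g
  proof -
    have "integral {0..real n} (\<lambda>t. f (c + of_real t * g) * g) = F (c + of_real (real n) * g) - F c" for n
      by (rule integral_unique, rule integral_ray_segment[OF F]) (use r in auto)
    with integral_atLeast_tendsto[OF absolutely_integrable_ray[OF cont decay r g] filterlim_real_sequentially] show ?thesis
      by simp
  qed
  have 1: "(\<lambda>n. F (p n) - F a) \<longlonglongrightarrow> integral {0..} (\<lambda>t. f (a + of_real t * d) * d)"
    unfolding p_def by (rule ends[OF ra d])
  have 2: "(\<lambda>n. F (q n) - F b) \<longlonglongrightarrow> integral {0..} (\<lambda>t. f (b + of_real t * e) * e)"
    unfolding q_def by (rule ends[OF rb e])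
  have pS: "p n \<in> S" "q n \<in> S" for n using ra[of "real n"] rb[of "real n"] by (auto simp: p_def q_def)
  define m where "m = norm (d + e) / 2"
  have m: "m > 0" using de by (simp add: m_def)
  have seg: "closed_segment (p n) (q n) \<subseteq> S" for n
    using pS S by (simp add: closed_segment_subset)
  have Bnn: "B \<ge> 0" using nonneg_if_norm_le_divide[OF decay[OF pS(1)[of 0]]] .
  have bound: "\<forall>\<^sub>F n in sequentially. norm (F (p n) - F (q n)) \<le>
      B / (1 + (real n * m - norm a - norm b))\<^sup>2 * (norm (a - b) + 2 * real n)"
  proof -
    have "\<forall>\<^sub>F n in sequentially. real n * m - (norm a + norm b) > 0"
      using m by real_asymp
    then have "\<forall>\<^sub>F n in sequentially. real n * m - norm a - norm b > 0"
      by (simp add: diff_diff_eq)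
    then show ?thesis
    proof eventually_elim
      case (elim n)
      have "norm (F (p n) - F (q n)) \<le> B / (1 + (real n * m - norm a - norm b))\<^sup>2 * norm (p n - q n)"
      proof (rule field_differentiable_bound[of "closed_segment (p n) (q n)" F f])
        show "(F has_field_derivative f u) (at u within closed_segment (p n) (q n))" 
          if "u \<in> closed_segment (p n) (q n)" for u
          by (rule DERIV_subset[OF F]) (use that seg[of n] in auto)
        show "norm (f u) \<le> B / (1 + (real n * m - norm a - norm b))\<^sup>2" if "u \<in> closed_segment (p n) (q n)" for u
        proof -
          have "real n * m - norm a - norm b \<le> norm u"
            using segment_of_rays_norm_ge[OF d e _ that[unfolded p_def q_def]] by (simp add: m_def)
          then have "B / (1 + norm u)\<^sup>2 \<le> B / (1 + (real n * m - norm a - norm b))\<^sup>2"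
            using elim Bnn by (intro divide_left_mono power_mono) (auto intro!: mult_pos_pos zero_less_power)
          with decay[of u] that seg[of n] show ?thesis by force
        qed
      qed auto
      also have "\<dots> \<le> B / (1 + (real n * m - norm a - norm b))\<^sup>2 * (norm (a - b) + 2 * real n)"
      proof (rule mult_left_mono)
        have "p n - q n = (a - b) + of_real (real n) * (d - e)" by (simp add: p_def q_def algebra_simps)
        then have "norm (p n - q n) \<le> norm (a - b) + real n * norm (d - e)"
          using norm_triangle_ineq[of "a - b" "of_real (real n) * (d - e)"] by (simp add: norm_mult)
        also have "\<dots> \<le> norm (a - b) + real n * 2"
          using norm_triangle_ineq4[of d e] d e by (intro add_left_mono mult_left_mono) auto
        finally show "norm (p n - q n) \<le> norm (a - b) + 2 * real n" by simp
      qed (use Bnn in auto)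
      finally show ?case .
    qed
  qed
  have "(\<lambda>n. F (p n) - F (q n)) \<longlonglongrightarrow> 0"
  proof (rule Lim_null_comparison[OF bound])
    define C where "C = norm a + norm b"
    have 1: "(\<lambda>n. 1 / (1 + (real n * m - C))\<^sup>2) \<longlonglongrightarrow> 0" "(\<lambda>n. real n / (1 + (real n * m - C))\<^sup>2) \<longlonglongrightarrow> 0"
      using m by real_asymp+
    have "(\<lambda>n. B * norm (a - b) * (1 / (1 + (real n * m - C))\<^sup>2) + 2 * B * (real n / (1 + (real n * m - C))\<^sup>2))
        \<longlonglongrightarrow> B * norm (a - b) * 0 + 2 * B * 0"
      by (intro tendsto_intros 1)
    then show "(\<lambda>n. B / (1 + (real n * m - norm a - norm b))\<^sup>2 * (norm (a - b) + 2 * real n)) \<longlonglongrightarrow> 0"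
      by (simp add: C_def algebra_simps add_divide_distrib)
  qed
  moreover have "(\<lambda>n. (F (p n) - F a) - (F (q n) - F b)) \<longlonglongrightarrow>
      integral {0..} (\<lambda>t. f (a + of_real t * d) * d) - integral {0..} (\<lambda>t. f (b + of_real t * e) * e)"
    using 1 2 by (rule tendsto_diff)
  then have "(\<lambda>n. ((F (p n) - F a) - (F (q n) - F b)) + F a - F b) \<longlonglongrightarrow>
      integral {0..} (\<lambda>t. f (a + of_real t * d) * d) - integral {0..} (\<lambda>t. f (b + of_real t * e) * e) + F a - F b"
    by (rule tendsto_diff[OF tendsto_add[OF _ tendsto_const] tendsto_const])
  then have "(\<lambda>n. F (p n) - F (q n)) \<longlonglongrightarrow>
      integral {0..} (\<lambda>t. f (a + of_real t * d) * d) - integral {0..} (\<lambda>t. f (b + of_real t * e) * e) + F a - F b"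
    by (simp add: algebra_simps)
  ultimately have "integral {0..} (\<lambda>t. f (a + of_real t * d) * d) - integral {0..} (\<lambda>t. f (b + of_real t * e) * e) + F a - F b = 0"
    using LIMSEQ_unique by blast
  then show ?thesis by (simp add: algebra_simps)
qed

section \<open>The phase and its normal form at the saddle\<close>

text \<open>
  The exponent \<open>-t + y t\<^sup>\<sigma>\<close> of all the integrals below, after the saddle
  point is scaled to \<open>1\<close> and the critical value to \<open>1\<close>; the large
  parameter is then \<open>X\<close>.
\<close>

definition phase :: "real \<Rightarrow> complex \<Rightarrow> complex" where
  "phase \<sigma> \<rho> = (\<rho> powr of_real \<sigma> - of_real \<sigma> * \<rho>) / of_real (kap \<sigma>)"

lemma phase_has_field_derivative:
  assumes "\<rho> \<notin> \<real>\<^sub>\<le>\<^sub>0"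
  shows "(phase \<sigma> has_field_derivative
           of_real \<sigma> * (\<rho> powr of_real (\<sigma> - 1) - 1) / of_real (kap \<sigma>)) (at \<rho> within A)"
proof -
  have "((\<lambda>z. z powr of_real \<sigma>) has_field_derivative of_real \<sigma> * \<rho> powr (of_real \<sigma> - 1)) (at \<rho>)"
    by (rule has_field_derivative_powr[OF assms])
  from DERIV_cdivide[OF DERIV_diff[OF this DERIV_cmult[OF DERIV_ident, of "of_real \<sigma>"]], of "of_real (kap \<sigma>)"]
  show ?thesis
    unfolding phase_def[abs_def]
    by (rule has_field_derivative_at_within[OF DERIV_cong]) (simp add: right_diff_distrib)
qed

lemma phase_1:
  assumes "\<sigma> < 1"
  shows "phase \<sigma> 1 = 1"
proof -
  have "complex_of_real (1 - \<sigma>) \<noteq> 0" using assms by (subst of_real_eq_0_iff) simp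
  then show ?thesis by (simp add: phase_def kap_def)
qed

lemma one_plus_notin_nonpos_Reals: "norm (w::complex) < 1 \<Longrightarrow> 1 + w \<notin> \<real>\<^sub>\<le>\<^sub>0"
proof
  assume w: "norm w < 1" and "1 + w \<in> \<real>\<^sub>\<le>\<^sub>0"
  then have "Re (1 + w) \<le> 0" by (simp add: complex_nonpos_Reals_iff)
  with w abs_Re_le_cmod[of w] show False by simp
qed

text \<open>
  The phase has a nondegenerate critical point at \<open>1\<close>, so \<open>1 - phase\<close> has
  a double zero there and the remaining factor, being nonzero, has a holomorphic square root.
\<close>

lemma phase_square_root:
  fixes \<sigma> :: real
  assumes "0 < \<sigma>" "\<sigma> < 1"
  obtains q r where "0 < r" "r \<le> 1" "q holomorphic_on ball 0 r"
    "\<And>w. w \<in> ball 0 r \<Longrightarrow> 1 - phase \<sigma> (1 + w) = (q w)\<^sup>2" "q 0 = 0" "deriv q 0 = of_real (sqrt (\<sigma> / 2))"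
proof -
  define f where "f = (\<lambda>w. 1 - phase \<sigma> (1 + w))"
  define f' where "f' = (\<lambda>w::complex. - (of_real \<sigma> * ((1 + w) powr of_real (\<sigma> - 1) - 1) / of_real (kap \<sigma>)))"
  have k: "kap \<sigma> \<noteq> 0" using assms by (simp add: kap_def)
  have df: "(f has_field_derivative f' w) (at w)" if "w \<in> ball 0 1" for w
  proof -
    have 1: "((\<lambda>w. 1 + w) has_field_derivative 1) (at w)" by (auto intro!: derivative_eq_intros)
    have "((\<lambda>w. phase \<sigma> (1 + w)) has_field_derivative (of_real \<sigma> * ((1+w) powr of_real (\<sigma> - 1) - 1) / of_real (kap \<sigma>)) * 1) (at w)"
      by (rule DERIV_chain'[OF 1 phase_has_field_derivative])
         (use that one_plus_notin_nonpos_Reals in auto)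
    from DERIV_diff[OF DERIV_const[of 1] this] show ?thesis by (simp add: f_def f'_def)
  qed
  have df2: "(f' has_field_derivative of_real \<sigma>) (at 0)"
  proof -
    have "((\<lambda>w::complex. (1 + w) powr of_real (\<sigma> - 1)) has_field_derivative of_real (\<sigma> - 1)) (at 0)"
      using DERIV_chain'[OF DERIV_add[OF DERIV_const DERIV_ident] has_field_derivative_powr, of 1 0 "of_real (\<sigma> - 1)"]
      by simp
    from DERIV_minus[OF DERIV_cdivide[OF DERIV_cmult[OF DERIV_diff[OF this DERIV_const[of 1]]]], of "of_real \<sigma>" "of_real (kap \<sigma>)"]
    have "(f' has_field_derivative - (of_real \<sigma> * of_real (\<sigma> - 1) / of_real (kap \<sigma>))) (at 0)"
      by (simp add: f'_def)
    moreover have "- (of_real \<sigma> * of_real (\<sigma> - 1) / of_real (kap \<sigma>)) = (of_real \<sigma> :: complex)"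
    proof -
      have "- (\<sigma> * (\<sigma> - 1) / kap \<sigma>) = \<sigma>" using k by (simp add: kap_def field_simps)
      from arg_cong[OF this, of complex_of_real] show ?thesis by simp
    qed
    ultimately show ?thesis by simp
  qed
  have holf: "f holomorphic_on ball 0 1" using df by (meson holomorphic_on_open open_ball)
  have d1: "deriv f w = f' w" if "w \<in> ball 0 1" for w using df[OF that] by (rule DERIV_imp_deriv)
  have d2: "deriv (deriv f) 0 = of_real \<sigma>"
  proof (rule DERIV_imp_deriv)
    show "(deriv f has_field_derivative of_real \<sigma>) (at 0)"
      by (rule has_field_derivative_transform_within_open[OF df2, of "ball 0 1"]) (auto simp: d1)
  qed
  have f0: "f 0 = 0" using phase_1[of \<sigma>] assms by (simp add: f_def)
  have d10: "deriv f 0 = 0" by (simp add: d1 f'_def)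
  obtain g r where g: "0 < r" "g holomorphic_on ball 0 r"
      "\<And>w. w \<in> ball 0 r \<Longrightarrow> f w - f 0 = ((w - 0) * g w)\<^sup>2" "\<And>w. w \<in> ball 0 r \<Longrightarrow> g w \<noteq> 0"
    by (rule holomorphic_factor_order_of_zero_strong[OF holf, of 0 2])
       (use d10 d2 assms in \<open>auto simp: numeral_2_eq_2 less_Suc_eq\<close>)
  define q0 where "q0 = (\<lambda>w. w * g w)"
  define r' where "r' = min r 1"
  have hol: "q0 holomorphic_on ball 0 r'"
    unfolding q0_def by (intro holomorphic_intros holomorphic_on_subset[OF g(2)]) (auto simp: r'_def)
  have q0: "f w = (q0 w)\<^sup>2" if "w \<in> ball 0 r'" for w
    using g(3)[of w] that f0 by (simp add: q0_def r'_def)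
  have r': "0 < r'" using g(1) by (simp add: r'_def)
  have dq: "(q0 has_field_derivative deriv q0 w) (at w)" if "w \<in> ball 0 r'" for w
    using hol that by (simp add: holomorphic_derivI)
  have dq2: "(deriv q0 has_field_derivative deriv (deriv q0) w) (at w)" if "w \<in> ball 0 r'" for w
    using holomorphic_deriv[OF hol] that by (simp add: holomorphic_derivI)
  have 1: "deriv f w = 2 * q0 w * deriv q0 w" if w: "w \<in> ball 0 r'" for w
  proof (rule DERIV_imp_deriv)
    have "((\<lambda>w. (q0 w)\<^sup>2) has_field_derivative 2 * q0 w * deriv q0 w) (at w)"
      using DERIV_power[OF dq[OF w], of 2] by (simp add: mult_ac)
    then show "(f has_field_derivative 2 * q0 w * deriv q0 w) (at w)"
      by (rule has_field_derivative_transform_within_open[of _ _ _ "ball 0 r'"]) (use w q0 in auto)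
  qed
  have "deriv (deriv f) 0 = 2 * (deriv q0 0)\<^sup>2"
  proof (rule DERIV_imp_deriv)
    have z: "0 \<in> ball 0 r'" using r' by simp
    have "((\<lambda>w. 2 * q0 w * deriv q0 w) has_field_derivative
         2 * q0 0 * deriv (deriv q0) 0 + 2 * deriv q0 0 * deriv q0 0) (at 0)"
      by (rule DERIV_mult'[OF DERIV_cmult[OF dq[OF z]] dq2[OF z]])
    then have "((\<lambda>w. 2 * q0 w * deriv q0 w) has_field_derivative 2 * (deriv q0 0)\<^sup>2) (at 0)"
      by (simp add: q0_def power2_eq_square mult.assoc)
    then show "(deriv f has_field_derivative 2 * (deriv q0 0)\<^sup>2) (at 0)"
      by (rule has_field_derivative_transform_within_open[of _ _ _ "ball 0 r'"]) (use r' 1 in auto)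
  qed
  then have sq: "(deriv q0 0)\<^sup>2 = (of_real (sqrt (\<sigma> / 2)))\<^sup>2"
    using assms d2 by (simp flip: of_real_power)
  define e :: complex where "e = (if deriv q0 0 = of_real (sqrt (\<sigma> / 2)) then 1 else -1)"
  have e2: "e\<^sup>2 = 1" by (simp add: e_def)
  have de: "e * deriv q0 0 = of_real (sqrt (\<sigma> / 2))"
    using sq by (auto simp: e_def power2_eq_iff)
  show thesis
  proof (rule that[of r' "\<lambda>w. e * q0 w"])
    show "0 < r'" "r' \<le> 1" using r' by (auto simp: r'_def)
    show "(\<lambda>w. e * q0 w) holomorphic_on ball 0 r'" by (intro holomorphic_intros hol)
    show "1 - phase \<sigma> (1 + w) = (e * q0 w)\<^sup>2" if "w \<in> ball 0 r'" for w
      using q0[OF that] e2 by (simp add: power_mult_distrib f_def)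
    show "e * q0 0 = 0" by (simp add: q0_def)
    show "deriv (\<lambda>w. e * q0 w) 0 = of_real (sqrt (\<sigma> / 2))"
      using DERIV_imp_deriv[OF DERIV_cmult[OF dq, of 0 e]] r' de by simp
  qed
qed

text \<open>
  The map \<open>q\<close> is a local coordinate in which the exponent is exactly \<open>- l *
  q\<^sup>2\<close>. Its derivative does not vanish at the saddle, so it has a local inverse
  \<open>W\<close>, whose derivative is the amplitude of the integral in the new coordinate.
\<close>

lemma phase_normal_form:
  fixes \<sigma> :: real
  assumes "0 < \<sigma>" "\<sigma> < 1"
  obtains q W r R where "0 < r" "r \<le> 1" "0 < R" "q holomorphic_on ball 0 r" "W holomorphic_on ball 0 R"
    "\<And>w. w \<in> ball 0 r \<Longrightarrow> 1 - phase \<sigma> (1 + w) = (q w)\<^sup>2"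
    "\<And>w. w \<in> ball 0 r \<Longrightarrow> q w \<in> ball 0 R"
    "\<And>w. w \<in> ball 0 r \<Longrightarrow> deriv q w * deriv W (q w) = 1"
    "q 0 = 0" "deriv q 0 = of_real (sqrt (\<sigma> / 2))"
proof -
  obtain q r0 where q: "0 < r0" "r0 \<le> 1" "q holomorphic_on ball 0 r0"
    "\<And>w. w \<in> ball 0 r0 \<Longrightarrow> 1 - phase \<sigma> (1 + w) = (q w)\<^sup>2" "q 0 = 0" "deriv q 0 = of_real (sqrt (\<sigma> / 2))"
    by (rule phase_square_root[OF assms]) (rule that)
  have dq0: "deriv q 0 \<noteq> 0" unfolding q(6) using assms(1) by simp
  have c0: "0 \<in> ball 0 r0" using q(1) by simp
  obtain r1 where r1: "r1 > 0" "ball (0::complex) r1 \<subseteq> ball 0 r0" "inj_on q (ball 0 r1)"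
    by (rule has_complex_derivative_locally_injective[OF q(3) c0 open_ball dq0]) (rule that)
  have hol1: "q holomorphic_on ball 0 r1" by (rule holomorphic_on_subset[OF q(3) r1(2)])
  obtain W where W: "W holomorphic_on (q ` ball 0 r1)"
     "\<And>z. z \<in> ball 0 r1 \<Longrightarrow> deriv q z * deriv W (q z) = 1"
    by (rule holomorphic_has_inverse[OF hol1 open_ball r1(3)]) (rule that)
  have op: "open (q ` ball 0 r1)" by (rule open_mapping_thm3[OF hol1 open_ball r1(3)])
  have z0: "0 \<in> q ` ball 0 r1" using q(5) r1(1) by (intro image_eqI[of _ _ 0]) auto
  obtain R where R: "R > 0" "ball 0 R \<subseteq> q ` ball 0 r1" by (rule openE[OF op z0]) (rule that)
  have "isCont q 0"
    using holomorphic_on_imp_continuous_on[OF hol1] r1(1) by (simp add: continuous_on_eq_continuous_at)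
  then have "\<exists>d>0. \<forall>w. dist w 0 < d \<longrightarrow> dist (q w) (q 0) < R"
    using R(1) unfolding continuous_at_eps_delta by blast
  then obtain d where d: "d > 0" "\<forall>w. norm w < d \<longrightarrow> norm (q w) < R"
    unfolding q(5) dist_0_norm dist_norm diff_zero by blast
  define r where "r = min d r1"
  have sub: "ball (0::complex) r \<subseteq> ball 0 r1" by (auto simp: r_def)
  have r01: "ball (0::complex) r \<subseteq> ball 0 r0" using sub r1(2) by blast
  have "r1 \<le> r0" using r1(1,2) by (simp add: ball_subset_ball_iff)
  show thesis
  proof (rule that[of r R q W])
    show "0 < r" "r \<le> 1" using d r1(1) \<open>r1 \<le> r0\<close> q(2) by (auto simp: r_def)
    show "q holomorphic_on ball 0 r" "W holomorphic_on ball 0 R"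
      using holomorphic_on_subset[OF hol1 sub] holomorphic_on_subset[OF W(1) R(2)] .
    show "1 - phase \<sigma> (1 + w) = (q w)\<^sup>2" if "w \<in> ball 0 r" for w
      by (rule q(4)) (use that r01 in blast)
    show "q w \<in> ball 0 R" if "w \<in> ball 0 r" for w
      using that d(2) by (simp add: r_def)
    show "deriv q w * deriv W (q w) = 1" if "w \<in> ball 0 r" for w
      by (rule W(2)) (use that sub in blast)
  qed (fact R(1) q(5,6))+
qed

section \<open>Gaussian integrals along rays\<close>

lemma integral_atLeast_split:
  fixes f :: "real \<Rightarrow> complex"
  assumes "f absolutely_integrable_on {a..}" "a \<le> T"
  shows "integral {a..} f = integral {a..T} f + integral {T..} f"
proof -
  have i: "f integrable_on {a..}" using assms by (simp add: absolutely_integrable_on_def)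
  have 1: "f integrable_on {a..T}" by (rule integrable_on_subinterval[OF i]) auto
  have "f absolutely_integrable_on {T..}" by (rule set_integrable_subset[OF assms(1)]) (use assms in auto)
  then have 2: "f integrable_on {T..}" by (simp add: absolutely_integrable_on_def)
  have "integral ({a..T} \<union> {T..}) f = integral {a..T} f + integral {T..} f"
    by (rule integral_Un[OF 1 2]) (rule negligible_subset[of "{T}"], auto)
  moreover have "{a..T} \<union> {T..} = {a..}" using assms(2) by auto
  ultimately show ?thesis by simp
qed

lemma integral_exp_minus_square: "integral {0..} (\<lambda>t::real. exp (- t\<^sup>2)) = sqrt pi / 2"
proof -
  have "set_integrable lborel {0..} (\<lambda>t::real. exp (- t\<^sup>2))" "(LINT t:{0..}|lborel. exp (- t\<^sup>2)) = sqrt pi / 2"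
    using gaussian_moment_0 by (auto simp: has_bochner_integral_iff set_integrable_def set_lebesgue_integral_def)
  then show ?thesis using set_borel_integral_eq_integral(2) by metis
qed

lemma exp_minus_square_sector_decay:
  assumes "k < 1" "0 \<le> k"
  obtains B where "\<And>u::complex. \<bar>Im u\<bar> \<le> k * Re u \<Longrightarrow> norm (exp (- u\<^sup>2)) \<le> B / (1 + norm u)\<^sup>2"
proof -
  define c where "c = (1 - k\<^sup>2) / (1 + k\<^sup>2)"
  have k2: "k\<^sup>2 < 1" using assms by (simp add: power_less_one_iff abs_square_less_1)
  have k3: "1 + k\<^sup>2 > 0" by (simp add: add_pos_nonneg)
  have c: "c > 0" using k2 k3 by (simp add: c_def)
  obtain B where B: "B > 0" "\<And>r. r \<ge> 0 \<Longrightarrow> exp (- c * r powr 2) \<le> B / (1 + r)\<^sup>2"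
    using exp_powr_le_inverse_square[OF c, of 2] by auto
  show thesis
  proof (rule that[of B])
    fix u :: complex assume u: "\<bar>Im u\<bar> \<le> k * Re u"
    have "\<bar>Im u\<bar>\<^sup>2 \<le> (k * Re u)\<^sup>2" using u by (intro power_mono) auto
    then have im: "(Im u)\<^sup>2 \<le> k\<^sup>2 * (Re u)\<^sup>2" by (simp add: power_mult_distrib)
    have "c * (norm u)\<^sup>2 \<le> c * ((1 + k\<^sup>2) * (Re u)\<^sup>2)"
      using im c by (intro mult_left_mono) (auto simp: cmod_power2 algebra_simps)
    also have "\<dots> = (1 - k\<^sup>2) * (Re u)\<^sup>2" using k3 by (simp add: c_def)
    also have "\<dots> \<le> (Re u)\<^sup>2 - (Im u)\<^sup>2" using im by (simp add: algebra_simps)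
    also have "\<dots> = Re (u\<^sup>2)" by (simp add: power2_eq_square)
    finally have "norm (exp (- u\<^sup>2)) \<le> exp (- c * (norm u)\<^sup>2)" by simp
    also have "\<dots> = exp (- c * norm u powr 2)" by (cases "u = 0") (auto simp: powr_realpow')
    also have "\<dots> \<le> B / (1 + norm u)\<^sup>2" using B(2)[of "norm u"] by simp
    finally show "norm (exp (- u\<^sup>2)) \<le> B / (1 + norm u)\<^sup>2" .
  qed
qed

lemma gaussian_ray_tail:
  assumes "c > 0" "T > 0"
  shows "(\<lambda>t::real. exp (- c * T * t)) integrable_on {T..}" 
    "integral {T..} (\<lambda>t. exp (- c * T * t)) = exp (- c * T\<^sup>2) / (c * T)"
proof -
  have "((\<lambda>x. exp (- (c * T) * x)) has_integral exp (- (c * T) * T) / (c * T)) {T..}"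
    by (rule has_integral_exp_minus_to_infinity) (use assms in simp)
  then have *: "((\<lambda>x. exp (- c * T * x)) has_integral exp (- c * T\<^sup>2) / (c * T)) {T..}"
    by (simp add: power2_eq_square mult.assoc)
  show "(\<lambda>t::real. exp (- c * T * t)) integrable_on {T..}" using * by (rule has_integral_integrable)
  show "integral {T..} (\<lambda>t. exp (- c * T * t)) = exp (- c * T\<^sup>2) / (c * T)"
    using * by (rule integral_unique)
qed

text \<open>
  In the sector around the real axis where \<open>exp (- u\<^sup>2)\<close> decays, the complete
  integral along the ray through \<open>z\<close> equals the one along the real axis. On the part
  beyond \<open>of_real (sqrt X) * z\<close> the square of the parameter is at least a multiple of
  the parameter, which leaves an explicit exponential integral.
\<close>

lemma gaussian_primitive_asymp:
  fixes F :: "complex \<Rightarrow> complex"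
  assumes F: "\<And>u. (F has_field_derivative exp (- u\<^sup>2)) (at u)"
    and z: "Re z > 0" "Re (z\<^sup>2) > 0"
  shows "(\<lambda>X. F (of_real (sqrt X) * z) - F 0 - of_real (sqrt pi / 2)) \<in> O[at_top](\<lambda>X. of_real (exp (- Re (z\<^sup>2) * X)))"
proof -
  define k where "k = \<bar>Im z\<bar> / Re z"
  have k: "0 \<le> k" "k < 1"
  proof -
    have "(Im z)\<^sup>2 < (Re z)\<^sup>2" using z(2) by (simp add: power2_eq_square)
    then have "\<bar>Im z\<bar> < \<bar>Re z\<bar>" by (metis abs_ge_zero power2_abs power_less_imp_less_base)
    then show "k < 1" using z(1) by (simp add: k_def)
  qed (use z in \<open>simp add: k_def\<close>)
  obtain B where B: "\<And>u::complex. \<bar>Im u\<bar> \<le> k * Re u \<Longrightarrow> norm (exp (- u\<^sup>2)) \<le> B / (1 + norm u)\<^sup>2"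
    using exp_minus_square_sector_decay[OF k(2,1)] by metis
  define S where "S = {u. \<bar>Im u\<bar> \<le> k * Re u}"
  define d where "d = z / of_real (norm z)"
  define c where "c = Re (d\<^sup>2)"
  have nz: "norm z > 0" using z(1) by auto
  have d: "norm d = 1" using nz by (simp add: d_def norm_divide)
  have c: "c > 0" "c * (norm z)\<^sup>2 = Re (z\<^sup>2)"
  proof -
    have "d\<^sup>2 = z\<^sup>2 / of_real ((norm z)\<^sup>2)" by (simp add: d_def power_divide)
    then have "c = Re (z\<^sup>2) / (norm z)\<^sup>2" by (simp add: c_def Re_divide_of_real del: of_real_power)
    then show "c > 0" "c * (norm z)\<^sup>2 = Re (z\<^sup>2)" using z nz by simp_all
  qed
  have conv: "convex S"
  proof -
    have "S = {u. Im u - k * Re u \<le> 0} \<inter> {u. - Im u - k * Re u \<le> 0}" by (auto simp: S_def)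
    moreover have "convex {u. Im u - k * Re u \<le> 0}" "convex {u. - Im u - k * Re u \<le> 0}"
      using convex_halfspace_le[of "Complex (-k) 1" 0] convex_halfspace_le[of "Complex (-k) (-1)" 0]
      by (simp_all add: inner_complex_def algebra_simps)
    ultimately show ?thesis by (simp add: convex_Int)
  qed
  have rd: "0 + of_real t * d \<in> S" if "t \<ge> 0" for t
  proof -
    have "\<bar>Im (of_real t * d)\<bar> = t / norm z * \<bar>Im z\<bar>" "Re (of_real t * d) = t / norm z * Re z"
      using that by (auto simp: d_def abs_mult)
    moreover have "\<bar>Im z\<bar> = k * Re z" using z by (simp add: k_def)
    ultimately show ?thesis by (simp add: S_def mult_ac)
  qed
  have r1: "0 + of_real t * 1 \<in> S" if "t \<ge> 0" for t using that k by (simp add: S_def)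
  have cont: "continuous_on S (\<lambda>u. exp (- u\<^sup>2))" by (intro continuous_intros)
  have FS: "(F has_field_derivative exp (- u\<^sup>2)) (at u within S)" for u using F by (rule has_field_derivative_at_within)
  have "Re d > 0" using z nz by (simp add: d_def)
  then have de: "d + 1 \<noteq> 0" by (auto simp: complex_eq_iff)
  define f where "f = (\<lambda>t. exp (- (0 + of_real t * d)\<^sup>2) * d)"
  have absf: "f absolutely_integrable_on {0..}"
    unfolding f_def by (rule absolutely_integrable_ray[OF cont _ rd d, where B=B]) (use B in \<open>auto simp: S_def\<close>)
  have "integral {0..} f = integral {0..} (\<lambda>t. exp (- (0 + of_real t * 1)\<^sup>2) * (1::complex))"
    using ray_change[OF conv cont FS _ rd d r1 _ de, of B] B unfolding f_def by (simp add: S_def)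
  also have "\<dots> = integral {0..} (\<lambda>t. complex_of_real (exp (- t\<^sup>2)))"
    by (simp add: exp_of_real flip: of_real_minus of_real_power)
  also have "\<dots> = of_real (sqrt pi / 2)"
  proof -
    have "((\<lambda>t::real. exp (- t\<^sup>2)) has_integral sqrt pi / 2) {0..}"
      using integral_exp_minus_square not_integrable_integral[of "\<lambda>t::real. exp (- t\<^sup>2)" "{0..}"]
      by (metis divide_eq_0_iff has_integral_integral pi_neq_zero real_sqrt_eq_zero_cancel_iff zero_neq_numeral)
    from has_integral_of_real[OF this] show ?thesis by (rule integral_unique)
  qed
  finally have If: "integral {0..} f = of_real (sqrt pi / 2)" .
  have tail: "norm (F (of_real T * d) - F 0 - of_real (sqrt pi / 2)) \<le> exp (- c * T\<^sup>2) / (c * T)" if T: "T > 0" for T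
  proof -
    have "integral {0..T} f = F (of_real T * d) - F 0"
      unfolding f_def using integral_unique[OF integral_ray_segment[OF FS, of T 0 d]] T rd by simp
    then have "F (of_real T * d) - F 0 - of_real (sqrt pi / 2) = - integral {T..} f"
      using integral_atLeast_split[OF absf, of T] T unfolding If[symmetric] by simp
    moreover have "norm (integral {T..} f) \<le> integral {T..} (\<lambda>t. exp (- c * T * t))"
    proof (rule integral_norm_bound_integral)
      have "f absolutely_integrable_on {T..}" by (rule set_integrable_subset[OF absf]) (use T in auto)
      then show "f integrable_on {T..}" by (simp add: absolutely_integrable_on_def)
      show "(\<lambda>t. exp (- c * T * t)) integrable_on {T..}" by (rule gaussian_ray_tail(1)[OF c(1) T])
      fix t assume t: "t \<in> {T..}"
      have "Re ((of_real t * d)\<^sup>2) = t\<^sup>2 * c" unfolding power_mult_distrib c_def by (simp flip: of_real_power)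
      moreover have "T * t * c \<le> t\<^sup>2 * c" using t c T by (intro mult_right_mono) (auto simp: power2_eq_square)
      ultimately show "norm (f t) \<le> exp (- c * T * t)" using d by (simp add: f_def norm_mult mult_ac)
    qed
    ultimately show ?thesis unfolding gaussian_ray_tail(2)[OF c(1) T] by (metis norm_minus_cancel)
  qed
  show ?thesis
  proof (rule bigoI[of _ 1])
    have "\<forall>\<^sub>F X in at_top. 1 \<le> c * (sqrt X * norm z)" using c(1) nz by real_asymp
    then show "\<forall>\<^sub>F X in at_top. norm (F (of_real (sqrt X) * z) - F 0 - of_real (sqrt pi / 2))
        \<le> 1 * norm (complex_of_real (exp (- Re (z\<^sup>2) * X)))"
      using eventually_gt_at_top[of 0]
    proof eventually_elim
      case (elim X)
      define T where "T = sqrt X * norm z"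
      have T: "T > 0" using elim nz by (simp add: T_def)
      have e: "c * T\<^sup>2 = Re (z\<^sup>2) * X" using c(2) elim by (simp add: T_def power_mult_distrib mult_ac)
      have "of_real (sqrt X) * z = of_real T * d" using nz by (simp add: T_def d_def)
      then have "norm (F (of_real (sqrt X) * z) - F 0 - of_real (sqrt pi / 2)) \<le> exp (- c * T\<^sup>2) / (c * T)"
        using tail[OF T] by simp
      also have "\<dots> \<le> exp (- c * T\<^sup>2) / 1"
        using elim(1) by (intro divide_left_mono) (auto simp: T_def)
      also have "\<dots> = exp (- Re (z\<^sup>2) * X)" using e by (simp flip: minus_mult_left)
      finally show ?case by simp
    qed
  qed
qed

section \<open>Gaussian integrals with an analytic amplitude\<close>

text \<open>
  The difference quotient of \<open>V\<close> at \<open>0\<close>, completed by the derivative to a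
  holomorphic function.
\<close>

definition slope0 :: "(complex \<Rightarrow> complex) \<Rightarrow> complex \<Rightarrow> complex" where
  "slope0 V p = (if p = 0 then deriv V 0 else (V p - V 0) / (p - 0))"

text \<open>
  One integration by parts replaces the amplitude \<open>V\<close> by the derivative of its
  difference quotient and gains a factor \<open>1 / (2 * l)\<close>, since \<open>exp (- l *
  q\<^sup>2) * q\<close> is a derivative. Iterating this map produces all the coefficients of
  Watson's lemma.
\<close>

definition watson_step :: "(complex \<Rightarrow> complex) \<Rightarrow> complex \<Rightarrow> complex" where
  "watson_step V = deriv (slope0 V)"

definition watson_coeff :: "(complex \<Rightarrow> complex) \<Rightarrow> nat \<Rightarrow> complex" where
  "watson_coeff V j = (watson_step ^^ j) V 0"

definition gauss_int :: "(complex \<Rightarrow> complex) \<Rightarrow> complex \<Rightarrow> complex \<Rightarrow> complex" where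
  "gauss_int V l p = contour_integral (linepath 0 p) (\<lambda>q. exp (- l * q\<^sup>2) * V q)"

lemma slope0_holomorphic:
  assumes "V holomorphic_on ball 0 R" "R > 0"
  shows "slope0 V holomorphic_on ball 0 R"
proof -
  have "(0::complex) \<in> interior (ball 0 R)" using assms(2) by (subst interior_open) auto
  from pole_lemma[OF assms(1) this] show ?thesis unfolding slope0_def[abs_def] .
qed

lemma watson_step_holomorphic:
  assumes "V holomorphic_on ball 0 R" "R > 0"
  shows "watson_step V holomorphic_on ball 0 R"
  unfolding watson_step_def by (rule holomorphic_deriv[OF slope0_holomorphic[OF assms] open_ball])

lemma watson_coeff_Suc: "watson_coeff V (Suc j) = watson_coeff (watson_step V) j"
  unfolding watson_coeff_def funpow_Suc_right o_def ..

lemma gauss_integrand_integrable: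
  assumes "V holomorphic_on ball 0 R" "p \<in> ball 0 R"
  shows "(\<lambda>q. exp (- l * q\<^sup>2) * V q) contour_integrable_on linepath 0 p"
proof (rule contour_integrable_continuous_linepath)
  have "(0::complex) \<in> ball 0 R" using assms(2) norm_ge_zero[of p] by (simp del: norm_ge_zero)
  then have seg: "closed_segment 0 p \<subseteq> ball 0 R"
    using assms(2) by (simp add: closed_segment_subset)
  show "continuous_on (closed_segment 0 p) (\<lambda>q. exp (- l * q\<^sup>2) * V q)"
    by (intro continuous_intros continuous_on_subset[OF holomorphic_on_imp_continuous_on[OF assms(1)] seg])
qed

text \<open>
  The boundary term at \<open>0\<close> does not depend on \<open>p\<close>. It cancels in the
  difference of two such integrals, so that on a path through the saddle only multiples of the pure
  Gaussian integral remain; the boundary term at \<open>p\<close> is exponentially small.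
\<close>

lemma gauss_int_step:
  assumes V: "V holomorphic_on ball 0 R" and p: "p \<in> ball 0 R" and l: "l \<noteq> 0"
  shows "gauss_int V l p = V 0 * gauss_int (\<lambda>_. 1) l p + gauss_int (watson_step V) l p / (2 * l)
            - (exp (- l * p\<^sup>2) * slope0 V p - slope0 V 0) / (2 * l)"
proof -
  have R: "R > 0" using p norm_ge_zero[of p] by (simp del: norm_ge_zero)
  have z: "(0::complex) \<in> ball 0 R" using R by simp
  have seg: "closed_segment 0 p \<subseteq> ball 0 R" using p z by (simp add: closed_segment_subset)
  note hs = slope0_holomorphic[OF V R] and hw = watson_step_holomorphic[OF V R]
  define G where "G = (\<lambda>q. exp (- l * q\<^sup>2) * slope0 V q)"
  define G' where "G' = (\<lambda>q. (- 2 * l * q) * (exp (- l * q\<^sup>2) * slope0 V q) + exp (- l * q\<^sup>2) * watson_step V q)"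
  have dG: "(G has_field_derivative G' q) (at q within ball 0 R)" if "q \<in> ball 0 R" for q
  proof -
    have 1: "((\<lambda>q. exp (- l * q\<^sup>2)) has_field_derivative (- 2 * l * q) * exp (- l * q\<^sup>2)) (at q)"
      by (auto intro!: derivative_eq_intros)
    have 2: "(slope0 V has_field_derivative watson_step V q) (at q)"
      unfolding watson_step_def using holomorphic_derivI[OF hs open_ball that] .
    show ?thesis
      using DERIV_mult'[OF 1 2] unfolding G_def G'_def
      by (rule has_field_derivative_at_within[OF DERIV_cong]) (simp only: mult_ac add_ac)
  qed
  have c1: "(G' has_contour_integral (G p - G 0)) (linepath 0 p)"
    using contour_integral_primitive[of "ball 0 R" G G' "linepath 0 p"] dG seg by simp
  have i1: "(\<lambda>q. exp (- l * q\<^sup>2) * 1) contour_integrable_on linepath 0 p"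
    by (rule gauss_integrand_integrable[OF holomorphic_on_const p])
  have i2: "(\<lambda>q. exp (- l * q\<^sup>2) * watson_step V q) contour_integrable_on linepath 0 p"
    by (rule gauss_integrand_integrable[OF hw p])
  note c2 = has_contour_integral_integral[OF i1] and c3 = has_contour_integral_integral[OF i2]
  have c: "((\<lambda>q. V 0 * (exp (- l * q\<^sup>2) * 1) + inverse (2 * l) * (exp (- l * q\<^sup>2) * watson_step V q)
             - inverse (2 * l) * G' q)
          has_contour_integral
            (V 0 * gauss_int (\<lambda>_. 1) l p + inverse (2 * l) * gauss_int (watson_step V) l p - inverse (2 * l) * (G p - G 0)))
          (linepath 0 p)"
    unfolding gauss_int_def
    by (intro has_contour_integral_diff has_contour_integral_add has_contour_integral_lmul c1 c2 c3)
  have "((\<lambda>q. exp (- l * q\<^sup>2) * V q) has_contour_integral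
            (V 0 * gauss_int (\<lambda>_. 1) l p + inverse (2 * l) * gauss_int (watson_step V) l p - inverse (2 * l) * (G p - G 0)))
          (linepath 0 p)"
  proof (rule has_contour_integral_eq[OF c])
    fix q assume "q \<in> path_image (linepath 0 p)"
    have "V q = V 0 + q * slope0 V q" by (simp add: slope0_def)
    moreover have "inverse (2 * l) * G' q = - (q * exp (- l * q\<^sup>2) * slope0 V q) + inverse (2 * l) * (exp (- l * q\<^sup>2) * watson_step V q)"
      using l by (simp add: G'_def field_simps)
    ultimately show "V 0 * (exp (- l * q\<^sup>2) * 1) + inverse (2 * l) * (exp (- l * q\<^sup>2) * watson_step V q)
             - inverse (2 * l) * G' q = exp (- l * q\<^sup>2) * V q"
      by (simp add: algebra_simps)
  qed
  then have "gauss_int V l p = V 0 * gauss_int (\<lambda>_. 1) l p + inverse (2 * l) * gauss_int (watson_step V) l p - inverse (2 * l) * (G p - G 0)"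
    unfolding gauss_int_def by (rule contour_integral_unique)
  then show ?thesis by (simp add: G_def field_simps)
qed

lemma integral_gaussian_unit_le:
  assumes "a > 0"
  shows "integral {0..1} (\<lambda>t::real. exp (- a * t\<^sup>2)) \<le> (pi / 2) / sqrt a"
proof -
  have i: "((\<lambda>t. 1 / (1 + a * t\<^sup>2)) has_integral (arctan (sqrt a * 1) / sqrt a - arctan (sqrt a * 0) / sqrt a)) {0..1}"
  proof (intro fundamental_theorem_of_calculus)
    fix t :: real
    have "((\<lambda>t. arctan (sqrt a * t) / sqrt a) has_real_derivative 1 / (1 + a * t\<^sup>2)) (at t within {0..1})"
      using assms by (auto intro!: derivative_eq_intros simp: mult.assoc power_mult_distrib inverse_eq_divide)
    then show "((\<lambda>t. arctan (sqrt a * t) / sqrt a) has_vector_derivative 1 / (1 + a * t\<^sup>2)) (at t within {0..1})"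
      by (simp only: has_real_derivative_iff_has_vector_derivative)
  qed simp
  have "integral {0..1} (\<lambda>t::real. exp (- a * t\<^sup>2)) \<le> integral {0..1} (\<lambda>t. 1 / (1 + a * t\<^sup>2))"
  proof (rule integral_le)
    show "(\<lambda>t::real. exp (- a * t\<^sup>2)) integrable_on {0..1}"
      by (intro integrable_continuous_real continuous_intros)
    show "(\<lambda>t. 1 / (1 + a * t\<^sup>2)) integrable_on {0..1}" using i by (rule has_integral_integrable)
    fix t :: real
    have "1 + a * t\<^sup>2 > 0" using assms by (simp add: add_pos_nonneg)
    moreover have "1 + a * t\<^sup>2 \<le> exp (a * t\<^sup>2)" by (rule exp_ge_add_one_self)
    ultimately have "inverse (exp (a * t\<^sup>2)) \<le> inverse (1 + a * t\<^sup>2)" by (intro le_imp_inverse_le)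
    then show "exp (- a * t\<^sup>2) \<le> 1 / (1 + a * t\<^sup>2)" by (simp add: exp_minus divide_inverse)
  qed
  also have "\<dots> = arctan (sqrt a) / sqrt a" using integral_unique[OF i] by simp
  also have "\<dots> \<le> (pi / 2) / sqrt a" using assms arctan_ubound[of "sqrt a"] by (intro divide_right_mono) auto
  finally show ?thesis .
qed

lemma Re_of_real_mult: "Re (of_real a * z) = a * Re z"
  by simp

text \<open>
  Near \<open>0\<close> the Gaussian has width of order \<open>X powr (-1/2)\<close> and the
  amplitude is bounded.
\<close>

lemma gauss_int_bound:
  assumes V: "V holomorphic_on ball 0 R" and p: "p \<in> ball 0 R" and c: "Re (w * p\<^sup>2) > 0"
  shows "(\<lambda>X. gauss_int V (of_real X * w) p) \<in> O[at_top](\<lambda>X. of_real (X powr (-1/2)))"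
proof -
  define c' where "c' = Re (w * p\<^sup>2)"
  have c': "c' > 0" using c by (simp add: c'_def)
  have z: "(0::complex) \<in> ball 0 R" using p norm_ge_zero[of p] by (simp del: norm_ge_zero)
  have seg: "closed_segment 0 p \<subseteq> ball 0 R" using p z by (simp add: closed_segment_subset)
  have "compact (V ` closed_segment 0 p)"
    by (intro compact_continuous_image continuous_on_subset[OF holomorphic_on_imp_continuous_on[OF V] seg]) simp
  then have "bounded (V ` closed_segment 0 p)" by (rule compact_imp_bounded)
  from this[unfolded bounded_iff] obtain B where "\<forall>v \<in> V ` closed_segment 0 p. norm v \<le> B" ..
  then have B: "\<And>q. q \<in> closed_segment 0 p \<Longrightarrow> norm (V q) \<le> B" by blast
  have B0: "B \<ge> 0" using order_trans[OF norm_ge_zero B[of 0]] by simp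
  show ?thesis
  proof (rule bigoI[of _ "B * norm p * ((pi / 2) / sqrt c')"])
    show "\<forall>\<^sub>F X in at_top. norm (gauss_int V (of_real X * w) p)
        \<le> B * norm p * ((pi / 2) / sqrt c') * norm (complex_of_real (X powr (-1/2)))"
      using eventually_gt_at_top[of 0]
    proof eventually_elim
      case (elim X)
      let ?f = "\<lambda>q. exp (- (of_real X * w) * q\<^sup>2) * V q"
      have "(?f has_contour_integral gauss_int V (of_real X * w) p) (linepath 0 p)"
        unfolding gauss_int_def by (rule has_contour_integral_integral[OF gauss_integrand_integrable[OF V p]])
      then have i: "((\<lambda>t. ?f (linepath 0 p t) * (p - 0)) has_integral gauss_int V (of_real X * w) p) {0..1}"
        by (simp add: has_contour_integral_linepath)
      have "norm (integral {0..1} (\<lambda>t. ?f (linepath 0 p t) * (p - 0))) \<le> integral {0..1} (\<lambda>t. (B * norm p) * exp (- (X * c') * t\<^sup>2))"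
      proof (rule integral_norm_bound_integral)
        show "(\<lambda>t. ?f (linepath 0 p t) * (p - 0)) integrable_on {0..1}" using i by (rule has_integral_integrable)
        show "(\<lambda>t. (B * norm p) * exp (- (X * c') * t\<^sup>2)) integrable_on {0..1}"
          by (intro integrable_continuous_real continuous_intros)
        fix t :: real assume t: "t \<in> {0..1}"
        have lp: "linepath 0 p t = of_real t * p" by (simp add: linepath_def scaleR_conv_of_real)
        have "linepath 0 p t \<in> closed_segment 0 p" using t by (metis imageI linepath_image_01)
        then have b: "norm (V (of_real t * p)) \<le> B" using B lp by metis
        have e: "- (of_real X * w) * (of_real t * p)\<^sup>2 = of_real (- X * t\<^sup>2) * (w * p\<^sup>2)"
          by (simp add: power_mult_distrib mult_ac)
        have "norm (exp (- (of_real X * w) * (of_real t * p)\<^sup>2)) = exp (- (X * c') * t\<^sup>2)"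
          unfolding e norm_exp_eq_Re c'_def Re_of_real_mult by (simp add: mult_ac)
        then show "norm (?f (linepath 0 p t) * (p - 0)) \<le> (B * norm p) * exp (- (X * c') * t\<^sup>2)"
          unfolding lp using mult_right_mono[OF b, of "norm p * exp (- (X * c') * t\<^sup>2)"] by (simp add: norm_mult mult_ac)
      qed
      then have "norm (gauss_int V (of_real X * w) p) \<le> (B * norm p) * integral {0..1} (\<lambda>t. exp (- (X * c') * t\<^sup>2))"
        using integral_unique[OF i] by simp
      also have "\<dots> \<le> (B * norm p) * ((pi / 2) / sqrt (X * c'))"
        using integral_gaussian_unit_le[of "X * c'"] B0 elim c' by (intro mult_left_mono) auto
      also have "\<dots> = B * norm p * ((pi / 2) / sqrt c') * norm (complex_of_real (X powr (-1/2)))"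
        using elim c' by (simp add: real_sqrt_mult powr_minus powr_half_sqrt norm_divide field_simps)
      finally show ?case .
    qed
  qed
qed

section \<open>Watson expansion of a two-sided Gaussian integral\<close>

lemma exp_decay_bigo_powr:
  fixes c e :: real
  assumes "c > 0"
  shows "(\<lambda>X. complex_of_real (exp (- c * X))) \<in> O[at_top](\<lambda>X. of_real (X powr e))"
proof (rule bigoI[of _ 1])
  have "\<forall>\<^sub>F X in at_top. exp (- c * X) \<le> X powr e" using assms by real_asymp
  then show "\<forall>\<^sub>F X in at_top. norm (complex_of_real (exp (- c * X))) \<le> 1 * norm (complex_of_real (X powr e))"
    by eventually_elim (simp flip: of_real_exp)
qed

lemma powr_mult_bigo:
  assumes "f \<in> O[at_top](\<lambda>X. complex_of_real (X powr a))" "g \<in> O[at_top](\<lambda>X. complex_of_real (X powr b))"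
  shows "(\<lambda>X::real. f X * g X) \<in> O[at_top](\<lambda>X. complex_of_real (X powr (a + b)))"
  using landau_o.big.mult[OF assms] by (simp add: powr_add)

lemma inverse_bigo_powr:
  fixes w :: complex
  assumes "w \<noteq> 0"
  shows "(\<lambda>X. 1 / (2 * (of_real X * w))) \<in> O[at_top](\<lambda>X. complex_of_real (X powr (-1)))"
proof (rule bigoI[of _ "1 / (2 * norm w)"])
  show "\<forall>\<^sub>F X in at_top. norm (1 / (2 * (of_real X * w))) \<le> 1 / (2 * norm w) * norm (complex_of_real (X powr (-1)))"
    using eventually_gt_at_top[of 0]
    by eventually_elim (simp add: norm_divide norm_mult powr_minus field_simps)
qed

text \<open>
  Each step of the induction gains one factor \<open>1 / X\<close> from
  \<open>gauss_int_step\<close>; the error of order \<open>X powr (-1/2)\<close> with which the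
  induction starts is the plain bound on the integral.
\<close>

lemma watson_expansion:
  assumes V: "V holomorphic_on ball 0 R" and p: "pa \<in> ball 0 R" "pb \<in> ball 0 R"
    and c: "Re (w * pa\<^sup>2) > 0" "Re (w * pb\<^sup>2) > 0"
  shows "(\<lambda>X. (gauss_int V (of_real X * w) pb - gauss_int V (of_real X * w) pa)
            - (gauss_int (\<lambda>_. 1) (of_real X * w) pb - gauss_int (\<lambda>_. 1) (of_real X * w) pa)
              * (\<Sum>j<M. watson_coeff V j / (2 * (of_real X * w)) ^ j))
         \<in> O[at_top](\<lambda>X. of_real (X powr (-1/2 - real M)))"
  using V
proof (induction M arbitrary: V)
  case 0
  have "(\<lambda>X. gauss_int V (of_real X * w) pb - gauss_int V (of_real X * w) pa) \<in> O[at_top](\<lambda>X. of_real (X powr (-1/2)))"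
    by (intro sum_in_bigo gauss_int_bound[OF 0] p c)
  then show ?case by simp
next
  case (Suc M)
  have R: "R > 0" using p(1) norm_ge_zero[of pa] by (simp del: norm_ge_zero)
  have w: "w \<noteq> 0" using c by auto
  define D where "D = (\<lambda>V X. gauss_int V (of_real X * w) pb - gauss_int V (of_real X * w) pa)"
  define L where "L = (\<lambda>X. 2 * (of_real X * w))"
  define V' where "V' = watson_step V"
  define bd where "bd = (\<lambda>X. exp (- (of_real X * w) * pb\<^sup>2) * slope0 V pb - exp (- (of_real X * w) * pa\<^sup>2) * slope0 V pa)"
  define err where "err = (\<lambda>X. D V' X - D (\<lambda>_. 1) X * (\<Sum>j<M. watson_coeff V' j / L X ^ j))"
  have IH: "err \<in> O[at_top](\<lambda>X. of_real (X powr (-1/2 - real M)))"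
    using Suc.IH[OF watson_step_holomorphic[OF Suc.prems R]] unfolding err_def D_def L_def V'_def .
  have bd: "bd \<in> O[at_top](\<lambda>X. of_real (X powr (-1/2 - real M)))"
  proof -
    have 1: "(\<lambda>X. exp (- (of_real X * w) * p\<^sup>2) * k) \<in> O[at_top](\<lambda>X. of_real (X powr (-1/2 - real M)))"
      if "Re (w * p\<^sup>2) > 0" for p k
    proof -
      have "(\<lambda>X. exp (- (of_real X * w) * p\<^sup>2)) \<in> O[at_top](\<lambda>X. complex_of_real (exp (- Re (w * p\<^sup>2) * X)))"
      proof (rule bigoI[of _ 1], rule always_eventually, rule allI)
        fix X :: real
        define r where "r = Re (w * p\<^sup>2)"
        have e: "- (of_real X * w) * p\<^sup>2 = of_real (- X) * (w * p\<^sup>2)" by (simp add: mult_ac)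
        have "norm (exp (- (of_real X * w) * p\<^sup>2)) = exp (- X * r)"
          unfolding e norm_exp_eq_Re Re_of_real_mult r_def ..
        then show "norm (exp (- (of_real X * w) * p\<^sup>2)) \<le> 1 * norm (complex_of_real (exp (- Re (w * p\<^sup>2) * X)))"
          unfolding r_def[symmetric] by (simp add: mult.commute)
      qed
      then have "(\<lambda>X. exp (- (of_real X * w) * p\<^sup>2)) \<in> O[at_top](\<lambda>X. of_real (X powr (-1/2 - real M)))"
        using exp_decay_bigo_powr[OF that] by (rule landau_o.big_trans)
      then show ?thesis by simp
    qed
    show ?thesis unfolding bd_def by (intro sum_in_bigo 1 c)
  qed
  have *: "\<forall>\<^sub>F X in at_top. D V X - D (\<lambda>_. 1) X * (\<Sum>j<Suc M. watson_coeff V j / L X ^ j)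
        = (1 / L X) * (err X - bd X)"
    using eventually_gt_at_top[of 0]
  proof eventually_elim
    case (elim X)
    have l: "of_real X * w \<noteq> 0" using elim w by simp
    have L: "L X \<noteq> 0" using l by (simp add: L_def)
    have s: "D V X = V 0 * D (\<lambda>_. 1) X + D V' X / L X - bd X / L X"
      unfolding D_def gauss_int_step[OF Suc.prems p(1) l] gauss_int_step[OF Suc.prems p(2) l] V'_def bd_def L_def
      by (simp add: diff_divide_distrib algebra_simps)
    have "(\<Sum>j<Suc M. watson_coeff V j / L X ^ j) = watson_coeff V 0 + (\<Sum>j<M. watson_coeff V (Suc j) / L X ^ Suc j)"
      by (subst sum.lessThan_Suc_shift) simp
    also have "\<dots> = V 0 + (\<Sum>j<M. watson_coeff V' j / L X ^ j) / L X"
      by (simp add: watson_coeff_Suc V'_def sum_divide_distrib mult.commute) (simp add: watson_coeff_def)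
    finally have e: "(\<Sum>j<Suc M. watson_coeff V j / L X ^ j) = V 0 + (\<Sum>j<M. watson_coeff V' j / L X ^ j) / L X" .
    show ?case unfolding s e err_def using L by (simp add: divide_simps) (simp add: algebra_simps)
  qed
  have "(\<lambda>X. (1 / L X) * (err X - bd X)) \<in> O[at_top](\<lambda>X. of_real (X powr (-1 + (-1/2 - real M))))"
    unfolding L_def by (rule powr_mult_bigo[OF inverse_bigo_powr[OF w]]) (rule sum_in_bigo[OF IH bd])
  also have "-1 + (-1/2 - real M) = -1/2 - real (Suc M)" by simp
  finally have "(\<lambda>X. D V X - D (\<lambda>_. 1) X * (\<Sum>j<Suc M. watson_coeff V j / L X ^ j)) \<in> O[at_top](\<lambda>X. of_real (X powr (-1/2 - real (Suc M))))"
    by (subst landau_o.big.in_cong[OF *])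
  then show ?case unfolding D_def L_def .
qed

text \<open>
  The two endpoints lie on opposite sides of the saddle in the direction \<open>\<mu>\<close>, so
  that together the two pieces make a complete Gaussian integral.
\<close>

lemma gauss_int_one_asymp:
  assumes \<mu>: "norm \<mu> = 1" and pb: "Re (\<mu> * pb) > 0" "Re ((\<mu> * pb)\<^sup>2) > 0"
    and pa: "Re (\<mu> * pa) < 0" "Re ((\<mu> * pa)\<^sup>2) > 0"
  obtains c where "c > 0"
    "(\<lambda>X. (gauss_int (\<lambda>_. 1) (of_real X * \<mu>\<^sup>2) pb - gauss_int (\<lambda>_. 1) (of_real X * \<mu>\<^sup>2) pa)
       - of_real (sqrt pi) / (\<mu> * of_real (sqrt X))) \<in> O[at_top](\<lambda>X. complex_of_real (exp (- c * X)))"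
proof -
  have hol: "(\<lambda>u::complex. exp (- u\<^sup>2)) holomorphic_on UNIV" by (intro holomorphic_intros)
  obtain F :: "complex \<Rightarrow> complex" where F: "\<And>u. (F has_field_derivative exp (- u\<^sup>2)) (at u)"
  proof (rule holomorphic_convex_primitive'[OF convex_UNIV open_UNIV hol])
    fix G :: "complex \<Rightarrow> complex"
    assume "\<And>u. u \<in> UNIV \<Longrightarrow> (G has_field_derivative exp (- u\<^sup>2)) (at u)"
    then show thesis by (intro that[of G]) simp
  qed
  have odd: "F (- u) - F 0 = - (F u - F 0)" for u
  proof -
    have "((\<lambda>u. F u + F (- u)) has_field_derivative 0) (at u within UNIV)" for u
    proof -
      have 1: "((\<lambda>u::complex. - u) has_field_derivative -1) (at u)" by (auto intro!: derivative_eq_intros)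
      show ?thesis using DERIV_add[OF F[of u] DERIV_chain'[OF 1 F[of "- u"]]] by simp
    qed
    then have "F u + F (- u) = F 0 + F (- 0)"
      using has_field_derivative_zero_constant[of UNIV "\<lambda>u. F u + F (- u)"] by (metis UNIV_I convex_UNIV)
    then show ?thesis by (simp add: algebra_simps)
  qed
  have \<mu>0: "\<mu> \<noteq> 0" using \<mu> by auto
  have gi: "gauss_int (\<lambda>_. 1) (of_real X * \<mu>\<^sup>2) p = (F (of_real (sqrt X) * (\<mu> * p)) - F 0) / (\<mu> * of_real (sqrt X))"
    if X: "X > 0" for X p
  proof -
    define m where "m = \<mu> * of_real (sqrt X)"
    have m: "m \<noteq> 0" using \<mu>0 X by (simp add: m_def)
    have m2: "m\<^sup>2 = of_real X * \<mu>\<^sup>2" using X by (simp add: m_def power_mult_distrib mult.commute flip: of_real_power)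
    have "((\<lambda>q. F (m * q) / m) has_field_derivative exp (- (of_real X * \<mu>\<^sup>2) * q\<^sup>2) * 1) (at q within UNIV)" for q
    proof -
      have 1: "((\<lambda>q. m * q) has_field_derivative m) (at q)" by (auto intro!: derivative_eq_intros)
      show ?thesis using DERIV_cdivide[OF DERIV_chain'[OF 1 F[of "m * q"]], of m] m
        by (simp add: power_mult_distrib m2)
    qed
    from contour_integral_primitive[OF this, of "linepath 0 p"]
    have "gauss_int (\<lambda>_. 1) (of_real X * \<mu>\<^sup>2) p = F (m * p) / m - F (m * 0) / m"
      unfolding gauss_int_def by (intro contour_integral_unique) auto
    then show ?thesis by (simp add: m_def diff_divide_distrib mult_ac)
  qed
  define z where "z = \<mu> * pb"
  define y where "y = - (\<mu> * pa)"
  define c where "c = min (Re (z\<^sup>2)) (Re (y\<^sup>2))"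
  have c: "c > 0" using pb pa by (simp add: c_def z_def y_def)
  have as: "(\<lambda>X. F (of_real (sqrt X) * u) - F 0 - of_real (sqrt pi / 2)) \<in> O[at_top](\<lambda>X. complex_of_real (exp (- c * X)))"
    if "Re u > 0" "c \<le> Re (u\<^sup>2)" for u
  proof -
    have "Re (u\<^sup>2) > 0" using that c by simp
    note gaussian_primitive_asymp[OF F that(1) this]
    also have "(\<lambda>X. complex_of_real (exp (- Re (u\<^sup>2) * X))) \<in> O[at_top](\<lambda>X. complex_of_real (exp (- c * X)))"
    proof (rule bigoI[of _ 1])
      show "\<forall>\<^sub>F X in at_top. norm (complex_of_real (exp (- Re (u\<^sup>2) * X))) \<le> 1 * norm (complex_of_real (exp (- c * X)))"
        using eventually_ge_at_top[of 0]
        by eventually_elim (use that in \<open>simp add: mult_right_mono del: of_real_exp\<close>)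
    qed
    finally show ?thesis .
  qed
  have main: "(\<lambda>X. (F (of_real (sqrt X) * z) - F 0 - of_real (sqrt pi / 2)) + (F (of_real (sqrt X) * y) - F 0 - of_real (sqrt pi / 2)))
      \<in> O[at_top](\<lambda>X. complex_of_real (exp (- c * X)))"
    by (intro sum_in_bigo as) (use pa pb in \<open>auto simp: z_def y_def c_def\<close>)
  have bdd: "(\<lambda>X. 1 / (\<mu> * of_real (sqrt X))) \<in> O[at_top](\<lambda>_. 1)"
  proof (rule bigoI[of _ 1])
    show "\<forall>\<^sub>F X in at_top. norm (1 / (\<mu> * of_real (sqrt X))) \<le> 1 * norm (1::complex)"
      using eventually_ge_at_top[of 1] by eventually_elim (simp add: norm_divide norm_mult \<mu>)
  qed
  have *: "\<forall>\<^sub>F X in at_top. (gauss_int (\<lambda>_. 1) (of_real X * \<mu>\<^sup>2) pb - gauss_int (\<lambda>_. 1) (of_real X * \<mu>\<^sup>2) pa)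
       - of_real (sqrt pi) / (\<mu> * of_real (sqrt X)) =
      (1 / (\<mu> * of_real (sqrt X))) * ((F (of_real (sqrt X) * z) - F 0 - of_real (sqrt pi / 2)) + (F (of_real (sqrt X) * y) - F 0 - of_real (sqrt pi / 2)))"
    using eventually_gt_at_top[of 0]
  proof eventually_elim
    case (elim X)
    have "F (of_real (sqrt X) * (\<mu> * pa)) - F 0 = - (F (of_real (sqrt X) * y) - F 0)"
      using odd[of "of_real (sqrt X) * y"] by (simp add: y_def)
    then have e: "F (of_real (sqrt X) * (\<mu> * pa)) = F 0 - (F (of_real (sqrt X) * y) - F 0)" by (simp add: algebra_simps)
    have "\<mu> * of_real (sqrt X) \<noteq> 0" using \<mu>0 elim by simp
    then show ?case unfolding gi[OF elim] e z_def[symmetric] by (simp add: divide_simps)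
  qed
  have "(\<lambda>X. (1 / (\<mu> * of_real (sqrt X))) * ((F (of_real (sqrt X) * z) - F 0 - of_real (sqrt pi / 2)) + (F (of_real (sqrt X) * y) - F 0 - of_real (sqrt pi / 2))))
       \<in> O[at_top](\<lambda>X. complex_of_real (exp (- c * X)))"
    using landau_o.big.mult[OF bdd main] by (simp only: mult_1_left)
  then have "(\<lambda>X. (gauss_int (\<lambda>_. 1) (of_real X * \<mu>\<^sup>2) pb - gauss_int (\<lambda>_. 1) (of_real X * \<mu>\<^sup>2) pa)
       - of_real (sqrt pi) / (\<mu> * of_real (sqrt X))) \<in> O[at_top](\<lambda>X. complex_of_real (exp (- c * X)))"
    by (subst landau_o.big.in_cong[OF *])
  with c show thesis by (rule that)
qed

section \<open>Steepest descent through the saddle\<close>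

lemma gauss_int_has_field_derivative:
  assumes V: "V holomorphic_on ball 0 R" and p: "p \<in> ball 0 R"
  shows "(gauss_int V l has_field_derivative exp (- l * p\<^sup>2) * V p) (at p)"
proof -
  have hol: "(\<lambda>q. exp (- l * q\<^sup>2) * V q) holomorphic_on ball 0 R" by (intro holomorphic_intros V)
  obtain G where G: "\<And>q. q \<in> ball 0 R \<Longrightarrow> (G has_field_derivative exp (- l * q\<^sup>2) * V q) (at q within ball 0 R)"
    by (rule holomorphic_convex_primitive'[OF convex_ball open_ball hol]) (rule that)
  have z: "(0::complex) \<in> ball 0 R" using p norm_ge_zero[of p] by (simp del: norm_ge_zero)
  have gi: "gauss_int V l p = G p - G 0" if p: "p \<in> ball 0 R" for p
  proof -
    have "closed_segment 0 p \<subseteq> ball 0 R" using p z by (simp add: closed_segment_subset)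
    then show ?thesis
      using contour_integral_primitive[OF G, of "linepath 0 p"]
      unfolding gauss_int_def by (intro contour_integral_unique) auto
  qed
  have "(G has_field_derivative exp (- l * p\<^sup>2) * V p) (at p)"
    using G[OF p] p by (simp add: at_within_open[of p "ball 0 R"])
  from DERIV_diff[OF this DERIV_const[of "G 0"]]
  have "((\<lambda>p. G p - G 0) has_field_derivative exp (- l * p\<^sup>2) * V p) (at p)" by simp
  then show ?thesis
    by (rule has_field_derivative_transform_within_open[of _ _ _ "ball 0 R"]) (use p gi in auto)
qed

text \<open>
  Here the normal form is hidden: \<open>P l\<close> is a primitive of the original integrand, and
  the expansion of its increments has coefficients \<open>v\<close> that depend neither on the
  direction \<open>\<mu>\<close> nor on the endpoints. This independence carries the whole
  development, because it allows the coefficients to be computed once, on the real axis.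
\<close>

lemma saddle_point_local:
  fixes \<sigma> :: real
  assumes "0 < \<sigma>" "\<sigma> < 1"
  obtains P q r v where "0 < r" 
    "\<And>l w. w \<in> ball 0 r \<Longrightarrow> (P l has_field_derivative exp (l * (phase \<sigma> (1 + w) - 1))) (at w)"
    "\<And>w. w \<in> ball 0 r \<Longrightarrow> 1 - phase \<sigma> (1 + w) = (q w)\<^sup>2"
    "q 0 = 0" "(q has_field_derivative of_real (sqrt (\<sigma> / 2))) (at 0)"
    "\<And>\<mu> wa wb M. \<lbrakk>norm \<mu> = 1; wa \<in> ball 0 r; wb \<in> ball 0 r; Re (\<mu> * q wb) > 0; Re ((\<mu> * q wb)\<^sup>2) > 0;
        Re (\<mu> * q wa) < 0; Re ((\<mu> * q wa)\<^sup>2) > 0\<rbrakk> \<Longrightarrow>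
        (\<lambda>X. P (of_real X * \<mu>\<^sup>2) wb - P (of_real X * \<mu>\<^sup>2) wa
           - of_real (sqrt pi) / (\<mu> * of_real (sqrt X)) * (\<Sum>j<M. v j / (2 * (of_real X * \<mu>\<^sup>2)) ^ j))
        \<in> O[at_top](\<lambda>X. complex_of_real (X powr (-1/2 - real M)))"
proof -
  obtain q W r R where N: "0 < r" "r \<le> 1" "0 < R" "q holomorphic_on ball 0 r" "W holomorphic_on ball 0 R"
    "\<And>w. w \<in> ball 0 r \<Longrightarrow> 1 - phase \<sigma> (1 + w) = (q w)\<^sup>2"
    "\<And>w. w \<in> ball 0 r \<Longrightarrow> q w \<in> ball 0 R"
    "\<And>w. w \<in> ball 0 r \<Longrightarrow> deriv q w * deriv W (q w) = 1"
    "q 0 = 0" "deriv q 0 = of_real (sqrt (\<sigma> / 2))"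
    by (rule phase_normal_form[OF assms]) (rule that)
  define V where "V = deriv W"
  have V: "V holomorphic_on ball 0 R" unfolding V_def by (rule holomorphic_deriv[OF N(5) open_ball])
  define P where "P = (\<lambda>l w. gauss_int V l (q w))"
  have dq: "(q has_field_derivative deriv q w) (at w)" if "w \<in> ball 0 r" for w
    by (rule holomorphic_derivI[OF N(4) open_ball that])
  have dP: "(P l has_field_derivative exp (l * (phase \<sigma> (1 + w) - 1))) (at w)" if w: "w \<in> ball 0 r" for l w
  proof -
    have 1: "(P l has_field_derivative (exp (- l * (q w)\<^sup>2) * V (q w)) * deriv q w) (at w)"
      unfolding P_def by (rule DERIV_chain'[OF dq[OF w] gauss_int_has_field_derivative[OF V N(7)[OF w]]])
    have 2: "V (q w) * deriv q w = 1" using N(8)[OF w] by (simp add: V_def mult.commute)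
    have 3: "- l * (q w)\<^sup>2 = l * (phase \<sigma> (1 + w) - 1)"
      unfolding N(6)[OF w, symmetric] by (simp add: algebra_simps)
    show ?thesis using 1 unfolding mult.assoc 2 3 by simp
  qed
  have asy: "(\<lambda>X. P (of_real X * \<mu>\<^sup>2) wb - P (of_real X * \<mu>\<^sup>2) wa
           - of_real (sqrt pi) / (\<mu> * of_real (sqrt X)) * (\<Sum>j<M. watson_coeff V j / (2 * (of_real X * \<mu>\<^sup>2)) ^ j))
        \<in> O[at_top](\<lambda>X. complex_of_real (X powr (-1/2 - real M)))"
    if h: "norm \<mu> = 1" "wa \<in> ball 0 r" "wb \<in> ball 0 r" "Re (\<mu> * q wb) > 0" "Re ((\<mu> * q wb)\<^sup>2) > 0"
        "Re (\<mu> * q wa) < 0" "Re ((\<mu> * q wa)\<^sup>2) > 0" for \<mu> wa wb M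
  proof -
    define D where "D = (\<lambda>V X. gauss_int V (of_real X * \<mu>\<^sup>2) (q wb) - gauss_int V (of_real X * \<mu>\<^sup>2) (q wa))"
    define S where "S = (\<lambda>X::real. \<Sum>j<M. watson_coeff V j / (2 * (of_real X * \<mu>\<^sup>2)) ^ j)"
    define g where "g = (\<lambda>X. of_real (sqrt pi) / (\<mu> * of_real (sqrt X)))"
    have 1: "(\<lambda>X. D V X - D (\<lambda>_. 1) X * S X) \<in> O[at_top](\<lambda>X. of_real (X powr (-1/2 - real M)))"
      unfolding D_def S_def
      by (rule watson_expansion[OF V N(7)[OF h(2)] N(7)[OF h(3)]]) (use h in \<open>simp_all only: power_mult_distrib\<close>)
    obtain c where c: "c > 0" "(\<lambda>X. D (\<lambda>_. 1) X - g X) \<in> O[at_top](\<lambda>X. complex_of_real (exp (- c * X)))"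
      by (rule gauss_int_one_asymp[OF h(1,4,5,6,7)]) (rule that, assumption, unfold D_def g_def, assumption)
    have 2: "(\<lambda>X. D (\<lambda>_. 1) X - g X) \<in> O[at_top](\<lambda>X. of_real (X powr (-1/2 - real M)))"
      using c(2) exp_decay_bigo_powr[OF c(1)] by (rule landau_o.big_trans)
    have 3: "S \<in> O[at_top](\<lambda>_. 1)"
      unfolding S_def
    proof (rule big_sum_in_bigo)
      fix j
      show "(\<lambda>X. watson_coeff V j / (2 * (of_real X * \<mu>\<^sup>2)) ^ j) \<in> O[at_top](\<lambda>_. 1)"
      proof (rule bigoI[of _ "norm (watson_coeff V j)"])
        show "\<forall>\<^sub>F X in at_top. norm (watson_coeff V j / (2 * (of_real X * \<mu>\<^sup>2)) ^ j) \<le> norm (watson_coeff V j) * norm (1::complex)"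
          using eventually_ge_at_top[of 1]
        proof eventually_elim
          case (elim X)
          have "(2 * X) ^ j \<ge> 1" using elim by (intro one_le_power) simp
          then have "norm (watson_coeff V j) / (2 * X) ^ j \<le> norm (watson_coeff V j) / 1"
            by (intro divide_left_mono) auto
          then show ?case using elim h(1) by (simp add: norm_divide norm_mult norm_power)
        qed
      qed
    qed
    have 4: "(\<lambda>X. (D (\<lambda>_. 1) X - g X) * S X) \<in> O[at_top](\<lambda>X. of_real (X powr (-1/2 - real M)))"
      using landau_o.big.mult[OF 2 3] by simp
    have "(\<lambda>X. (D V X - D (\<lambda>_. 1) X * S X) + (D (\<lambda>_. 1) X - g X) * S X) \<in> O[at_top](\<lambda>X. of_real (X powr (-1/2 - real M)))"
      by (rule sum_in_bigo(1)[OF 1 4])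
    also have "(\<lambda>X. (D V X - D (\<lambda>_. 1) X * S X) + (D (\<lambda>_. 1) X - g X) * S X) = (\<lambda>X. D V X - g X * S X)"
      by (simp add: algebra_simps)
    finally show ?thesis unfolding D_def P_def g_def S_def .
  qed
  have dq0: "(q has_field_derivative of_real (sqrt (\<sigma> / 2))) (at 0)" using dq[of 0] N(1,10) by simp
  show thesis by (rule that[OF N(1) dP N(6) N(9) dq0 asy])
qed

text \<open>
  One half of a contour that leaves the saddle, in the parametrisation in which its integral is
  given. Only near the parameter \<open>0\<close> must the exponent \<open>h\<close> and the
  amplitude \<open>a\<close> come from a curve \<open>1 + \<gamma> t\<close> in the plane of the
  phase; farther out it is enough that the real part of the exponent stays below a negative
  constant. This leaves room for parametrisations in which the global curve would cross the branch
  cut of the power.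
\<close>

definition descent_path ::
  "real \<Rightarrow> complex \<Rightarrow> real set \<Rightarrow> (real \<Rightarrow> complex) \<Rightarrow> (real \<Rightarrow> complex) \<Rightarrow> bool" where
  "descent_path \<sigma> \<omega> D h a \<longleftrightarrow>
     D \<in> sets lebesgue \<and> D \<subseteq> {0..} \<and> continuous_on D h \<and> continuous_on D a \<and>
     (\<lambda>t. exp (Re (h t)) * norm (a t)) integrable_on D \<and>
     (\<forall>e>0. \<exists>\<eta>>0. \<forall>t\<in>D. e \<le> t \<longrightarrow> Re (h t) \<le> - \<eta>) \<and>
     (\<exists>e>0. \<exists>\<gamma>. {0..e} \<subseteq> D \<and> \<gamma> 0 = 0 \<and>
        (\<forall>t\<in>{0..e}. (\<gamma> has_vector_derivative a t) (at t within {0..e}) \<and>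
                     h t = \<omega> * (phase \<sigma> (1 + \<gamma> t) - 1)))"

text \<open>
  The part of the path away from the saddle is exponentially small, because the exponent stays below
  a negative constant there. The part near it is an increment of the primitive \<open>P\<close>, and
  a short enough piece ends at a point where the Gaussian in the coordinate \<open>q\<close> decays.
\<close>

lemma laplace_half_path:
  assumes D: "descent_path \<sigma> (\<mu>\<^sup>2) D h a" and r: "0 < r" 
    and P: "\<And>l w. w \<in> ball 0 r \<Longrightarrow> (P l has_field_derivative exp (l * (phase \<sigma> (1 + w) - 1))) (at w)"
    and q2: "\<And>w. w \<in> ball 0 r \<Longrightarrow> 1 - phase \<sigma> (1 + w) = (q w)\<^sup>2"
    and q0: "q 0 = 0" and dq: "(q has_field_derivative of_real k) (at 0)" and k: "k > 0"
    and s: "s * Re (\<mu> * a 0) > 0"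
  obtains \<eta> w where "\<eta> > 0" "w \<in> ball 0 r" "Re ((\<mu> * q w)\<^sup>2) > 0" "s * Re (\<mu> * q w) > 0"
    "(\<lambda>X. integral D (\<lambda>t. exp (of_real X * h t) * a t) - (P (of_real X * \<mu>\<^sup>2) w - P (of_real X * \<mu>\<^sup>2) 0))
       \<in> O[at_top](\<lambda>X. complex_of_real (exp (- \<eta> * X)))"
proof -
  from D obtain e0 \<gamma> where
      D1: "D \<in> sets lebesgue" "D \<subseteq> {0..}" "continuous_on D h" "continuous_on D a"
        "(\<lambda>t. exp (Re (h t)) * norm (a t)) integrable_on D"
      and neg: "\<forall>e>0. \<exists>\<eta>>0. \<forall>t\<in>D. e \<le> t \<longrightarrow> Re (h t) \<le> - \<eta>"
      and e0: "e0 > 0" "{0..e0} \<subseteq> D" "\<gamma> 0 = 0"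
      and \<gamma>: "\<And>t. t \<in> {0..e0} \<Longrightarrow> (\<gamma> has_vector_derivative a t) (at t within {0..e0})"
      and h: "\<And>t. t \<in> {0..e0} \<Longrightarrow> h t = \<mu>\<^sup>2 * (phase \<sigma> (1 + \<gamma> t) - 1)"
    unfolding descent_path_def by blast
  have z: "(0::real) \<in> {0..e0}" using e0 by simp
  have contg: "continuous_on {0..e0} \<gamma>"
    using \<gamma> by (meson continuous_on_eq_continuous_within has_vector_derivative_continuous)
  obtain d1 where d1: "d1 > 0" "\<And>t. t \<in> {0..e0} \<Longrightarrow> t < d1 \<Longrightarrow> \<gamma> t \<in> ball 0 r"
  proof -
    from contg[unfolded continuous_on_iff, rule_format, OF z r]
    obtain d where d: "d > 0" "\<forall>t\<in>{0..e0}. dist t 0 < d \<longrightarrow> dist (\<gamma> t) (\<gamma> 0) < r" by blast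
    show thesis by (rule that[OF d(1)]) (use d(2) e0(3) in \<open>auto simp: dist_norm\<close>)
  qed
  have "((\<lambda>t. q (\<gamma> t)) has_vector_derivative a 0 * of_real k) (at 0 within {0..e0})"
    using field_vector_diff_chain_within[OF \<gamma>[OF z], of q "of_real k"] dq e0(3)
    by (simp add: o_def has_field_derivative_at_within)
  then have dv: "((\<lambda>t. s * Re (\<mu> * q (\<gamma> t))) has_real_derivative s * Re (\<mu> * (a 0 * of_real k))) (at 0 within {0..e0})"
    unfolding has_real_derivative_iff_has_vector_derivative
    by (intro bounded_linear.has_vector_derivative[OF bounded_linear_mult_right]
        bounded_linear.has_vector_derivative[OF bounded_linear_Re]
        bounded_linear.has_vector_derivative[OF bounded_linear_mult_right])
  have ks: "s * Re (\<mu> * (a 0 * of_real k)) = k * (s * Re (\<mu> * a 0))" by (simp add: algebra_simps)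
  have "0 < s * Re (\<mu> * (a 0 * of_real k))" unfolding ks by (rule mult_pos_pos[OF k s])
  then obtain d2 where d2: "d2 > 0" "\<forall>t>0. 0 + t \<in> {0..e0} \<longrightarrow> t < d2 \<longrightarrow> s * Re (\<mu> * q (\<gamma> 0)) < s * Re (\<mu> * q (\<gamma> (0 + t)))"
    using has_real_derivative_pos_inc_right[OF dv] by blast
  define e where "e = min e0 (min d1 d2 / 2)"
  have e: "e > 0" "e \<le> e0" "e < d1" "e < d2" using e0(1) d1(1) d2(1) by (auto simp: e_def)
  have eD: "{0..e} \<subseteq> D" using e e0 by auto
  obtain \<eta> where \<eta>: "\<eta> > 0" "\<And>t. t \<in> D \<Longrightarrow> e \<le> t \<Longrightarrow> Re (h t) \<le> - \<eta>" using neg e(1) by blast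
  define w where "w = \<gamma> e"
  have gb: "\<gamma> t \<in> ball 0 r" if "t \<in> {0..e}" for t using that e d1(2)[of t] by auto
  have w: "w \<in> ball 0 r" unfolding w_def using gb e by simp
  have re: "Re ((\<mu> * q w)\<^sup>2) > 0"
  proof -
    have "(\<mu> * q w)\<^sup>2 = - h e" unfolding power_mult_distrib q2[OF w, symmetric] using h[of e] e by (simp add: w_def algebra_simps)
    moreover have "e \<in> D" using eD e(1) by force
    then have "Re (h e) \<le> - \<eta>" using \<eta>(2)[of e] by simp
    ultimately show ?thesis using \<eta>(1) by simp
  qed
  have sg: "s * Re (\<mu> * q w) > 0" using d2(2)[rule_format, of e] e e0(3) q0 by (simp add: w_def)
  have hle: "Re (h t) \<le> 0" if "t \<in> D" for t
  proof (cases "t = 0")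
    case True
    have "phase \<sigma> 1 = 1" using q2[of 0] r q0 by simp
    then show ?thesis using h[OF z] e0(3) True by simp
  next
    case False
    then have "t > 0" using that D1(2) by force
    then show ?thesis using neg that by (smt (verit))
  qed
  define I where "I = integral D (\<lambda>t. exp (Re (h t)) * norm (a t))"
  have bound: "norm (integral D (\<lambda>t. exp (of_real X * h t) * a t) - (P (of_real X * \<mu>\<^sup>2) w - P (of_real X * \<mu>\<^sup>2) 0))
       \<le> exp (- \<eta> * (X - 1)) * I" if X: "X \<ge> 1" for X
  proof -
    define f where "f = (\<lambda>t. exp (of_real X * h t) * a t)"
    have nf: "norm (f t) = exp ((X - 1) * Re (h t)) * (exp (Re (h t)) * norm (a t))" for t
      by (simp add: f_def norm_mult algebra_simps flip: exp_add mult.assoc)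
    have af: "f absolutely_integrable_on D"
    proof (rule continuous_bounded_absolutely_integrable[OF _ D1(1) D1(5)])
      show "continuous_on D f" unfolding f_def by (intro continuous_intros D1)
      fix t assume t: "t \<in> D"
      have "exp ((X - 1) * Re (h t)) \<le> 1" using hle[OF t] X by (simp add: mult_nonneg_nonpos)
      then show "norm (f t) \<le> exp (Re (h t)) * norm (a t)" unfolding nf
        by (intro mult_left_le_one_le) auto
    qed
    have De: "D \<inter> {e..} \<in> sets lebesgue" using D1(1) by auto
    have af2: "f absolutely_integrable_on (D \<inter> {e..})" by (rule set_integrable_subset[OF af De]) auto
    have i1: "(f has_integral (P (of_real X * \<mu>\<^sup>2) w - P (of_real X * \<mu>\<^sup>2) 0)) {0..e}"
    proof -
      have "((\<lambda>t. P (of_real X * \<mu>\<^sup>2) (\<gamma> t)) has_vector_derivative f t) (at t within {0..e})" if t: "t \<in> {0..e}" for t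
      proof -
        have 1: "(\<gamma> has_vector_derivative a t) (at t within {0..e})"
          by (rule has_vector_derivative_within_subset[OF \<gamma>]) (use t e in auto)
        have eq: "of_real X * \<mu>\<^sup>2 * (phase \<sigma> (1 + \<gamma> t) - 1) = of_real X * h t" using h[of t] t e by simp
        have "(P (of_real X * \<mu>\<^sup>2) has_field_derivative exp (of_real X * h t)) (at (\<gamma> t) within \<gamma> ` {0..e})"
          using P[OF gb[OF t], of "of_real X * \<mu>\<^sup>2", unfolded eq] by (rule has_field_derivative_at_within)
        from field_vector_diff_chain_within[OF 1 this] show ?thesis by (simp add: f_def o_def mult.commute)
      qed
      from fundamental_theorem_of_calculus[OF _ this] e show ?thesis by (simp add: w_def e0(3))
    qed
    have "integral ({0..e} \<union> (D \<inter> {e..})) f = integral {0..e} f + integral (D \<inter> {e..}) f"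
      by (rule integral_Un) (use i1 af2 in \<open>auto simp: absolutely_integrable_on_def intro: negligible_subset[of "{e}"]\<close>)
    moreover have "{0..e} \<union> (D \<inter> {e..}) = D" using eD D1(2) by fastforce
    ultimately have eq: "integral D f - (P (of_real X * \<mu>\<^sup>2) w - P (of_real X * \<mu>\<^sup>2) 0) = integral (D \<inter> {e..}) f"
      using integral_unique[OF i1] by simp
    have i2: "(\<lambda>t. exp (Re (h t)) * norm (a t)) absolutely_integrable_on D"
      using D1(5) by (intro nonnegative_absolutely_integrable_1) auto
    have i3: "(\<lambda>t. exp (Re (h t)) * norm (a t)) integrable_on (D \<inter> {e..})"
      using set_integrable_subset[OF i2 De] by (simp add: absolutely_integrable_on_def)
    have "norm (integral (D \<inter> {e..}) f) \<le> integral (D \<inter> {e..}) (\<lambda>t. exp (- \<eta> * (X - 1)) * (exp (Re (h t)) * norm (a t)))"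
    proof (rule integral_norm_bound_integral)
      show "f integrable_on (D \<inter> {e..})" using af2 by (simp add: absolutely_integrable_on_def)
      show "(\<lambda>t. exp (- \<eta> * (X - 1)) * (exp (Re (h t)) * norm (a t))) integrable_on (D \<inter> {e..})"
        by (rule integrable_on_mult_right[OF i3])
      fix t assume "t \<in> D \<inter> {e..}"
      then have "Re (h t) \<le> - \<eta>" using \<eta>(2) by auto
      then have "(X - 1) * Re (h t) \<le> (X - 1) * (- \<eta>)" using X by (intro mult_left_mono) auto
      then have "exp ((X - 1) * Re (h t)) \<le> exp (- \<eta> * (X - 1))" by (simp add: mult.commute)
      then show "norm (f t) \<le> exp (- \<eta> * (X - 1)) * (exp (Re (h t)) * norm (a t))"
        unfolding nf by (intro mult_right_mono) auto
    qed
    also have "\<dots> = exp (- \<eta> * (X - 1)) * integral (D \<inter> {e..}) (\<lambda>t. exp (Re (h t)) * norm (a t))"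
      by (rule integral_mult_right)
    also have "\<dots> \<le> exp (- \<eta> * (X - 1)) * I"
      unfolding I_def by (intro mult_left_mono integral_subset_le i3 D1(5)) auto
    finally show ?thesis using eq unfolding f_def by simp
  qed
  show thesis
  proof (rule that[OF \<eta>(1) w re sg], rule bigoI[of _ "exp \<eta> * I"])
    show "\<forall>\<^sub>F X in at_top. norm (integral D (\<lambda>t. exp (of_real X * h t) * a t) - (P (of_real X * \<mu>\<^sup>2) w - P (of_real X * \<mu>\<^sup>2) 0))
       \<le> exp \<eta> * I * norm (complex_of_real (exp (- \<eta> * X)))"
      using eventually_ge_at_top[of 1]
    proof eventually_elim
      case (elim X)
      have x: "- \<eta> * (X - 1) = \<eta> + - \<eta> * X" by (simp add: algebra_simps)
      have eq: "exp (- \<eta> * (X - 1)) * I = exp \<eta> * I * norm (complex_of_real (exp (- \<eta> * X)))"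
        unfolding x exp_add norm_of_real abs_exp_cancel by (simp only: mult_ac)
      show ?case using bound[OF elim] unfolding eq .
    qed
  qed
qed

text \<open>
  Laplace's expansion for a contour made of two descent paths, with coefficients that are the same
  for every contour.
\<close>

lemma laplace_two_sided:
  fixes \<sigma> :: real
  assumes \<sigma>: "0 < \<sigma>" "\<sigma> < 1"
  obtains v :: "nat \<Rightarrow> complex" where
    "\<And>\<mu> Da ha aa Db hb ab M. \<lbrakk>norm \<mu> = 1; descent_path \<sigma> (\<mu>\<^sup>2) Db hb ab; Re (\<mu> * ab 0) > 0;
       descent_path \<sigma> (\<mu>\<^sup>2) Da ha aa; Re (\<mu> * aa 0) < 0\<rbrakk> \<Longrightarrow>
      (\<lambda>X. integral Db (\<lambda>t. exp (of_real X * hb t) * ab t) - integral Da (\<lambda>t. exp (of_real X * ha t) * aa t)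
           - of_real (sqrt pi) / (\<mu> * of_real (sqrt X)) * (\<Sum>j<M. v j / (of_real X * \<mu>\<^sup>2) ^ j))
        \<in> O[at_top](\<lambda>X. complex_of_real (X powr (-1/2 - real M)))"
proof -
  obtain P q r v where S: "0 < r" 
    "\<And>l w. w \<in> ball 0 r \<Longrightarrow> (P l has_field_derivative exp (l * (phase \<sigma> (1 + w) - 1))) (at w)"
    "\<And>w. w \<in> ball 0 r \<Longrightarrow> 1 - phase \<sigma> (1 + w) = (q w)\<^sup>2"
    "q 0 = 0" "(q has_field_derivative of_real (sqrt (\<sigma> / 2))) (at 0)"
    and asy: "\<And>\<mu> wa wb M. \<lbrakk>norm \<mu> = 1; wa \<in> ball 0 r; wb \<in> ball 0 r; Re (\<mu> * q wb) > 0; Re ((\<mu> * q wb)\<^sup>2) > 0;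
        Re (\<mu> * q wa) < 0; Re ((\<mu> * q wa)\<^sup>2) > 0\<rbrakk> \<Longrightarrow>
        (\<lambda>X. P (of_real X * \<mu>\<^sup>2) wb - P (of_real X * \<mu>\<^sup>2) wa
           - of_real (sqrt pi) / (\<mu> * of_real (sqrt X)) * (\<Sum>j<M. v j / (2 * (of_real X * \<mu>\<^sup>2)) ^ j))
        \<in> O[at_top](\<lambda>X. complex_of_real (X powr (-1/2 - real M)))"
    by (rule saddle_point_local[OF \<sigma>]) (rule that)
  have k: "sqrt (\<sigma> / 2) > 0" using \<sigma> by simp
  show thesis
  proof (rule that[of "\<lambda>j. v j / 2 ^ j"])
    fix \<mu> :: complex and Da ha aa Db hb ab and M :: nat
    assume \<mu>: "norm \<mu> = 1" and b: "descent_path \<sigma> (\<mu>\<^sup>2) Db hb ab" "Re (\<mu> * ab 0) > 0"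
      and a: "descent_path \<sigma> (\<mu>\<^sup>2) Da ha aa" "Re (\<mu> * aa 0) < 0"
    have b': "1 * Re (\<mu> * ab 0) > 0" and a': "(-1) * Re (\<mu> * aa 0) > 0" using a b by simp_all
    obtain \<eta>b wb where B: "\<eta>b > 0" "wb \<in> ball 0 r" "Re ((\<mu> * q wb)\<^sup>2) > 0" "1 * Re (\<mu> * q wb) > 0"
      "(\<lambda>X. integral Db (\<lambda>t. exp (of_real X * hb t) * ab t) - (P (of_real X * \<mu>\<^sup>2) wb - P (of_real X * \<mu>\<^sup>2) 0))
       \<in> O[at_top](\<lambda>X. complex_of_real (exp (- \<eta>b * X)))"
      by (rule laplace_half_path[OF b(1) S k b']) (assumption | rule that)+
    obtain \<eta>a wa where A: "\<eta>a > 0" "wa \<in> ball 0 r" "Re ((\<mu> * q wa)\<^sup>2) > 0" "(-1) * Re (\<mu> * q wa) > 0"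
      "(\<lambda>X. integral Da (\<lambda>t. exp (of_real X * ha t) * aa t) - (P (of_real X * \<mu>\<^sup>2) wa - P (of_real X * \<mu>\<^sup>2) 0))
       \<in> O[at_top](\<lambda>X. complex_of_real (exp (- \<eta>a * X)))"
      by (rule laplace_half_path[OF a(1) S k a']) (assumption | rule that)+
    have 1: "(\<lambda>X. integral Db (\<lambda>t. exp (of_real X * hb t) * ab t) - (P (of_real X * \<mu>\<^sup>2) wb - P (of_real X * \<mu>\<^sup>2) 0))
       \<in> O[at_top](\<lambda>X. complex_of_real (X powr (-1/2 - real M)))"
      using B(5) exp_decay_bigo_powr[OF B(1)] by (rule landau_o.big_trans)
    have 2: "(\<lambda>X. integral Da (\<lambda>t. exp (of_real X * ha t) * aa t) - (P (of_real X * \<mu>\<^sup>2) wa - P (of_real X * \<mu>\<^sup>2) 0))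
       \<in> O[at_top](\<lambda>X. complex_of_real (X powr (-1/2 - real M)))"
      using A(5) exp_decay_bigo_powr[OF A(1)] by (rule landau_o.big_trans)
    have 3: "(\<lambda>X. P (of_real X * \<mu>\<^sup>2) wb - P (of_real X * \<mu>\<^sup>2) wa
           - of_real (sqrt pi) / (\<mu> * of_real (sqrt X)) * (\<Sum>j<M. v j / (2 * (of_real X * \<mu>\<^sup>2)) ^ j))
        \<in> O[at_top](\<lambda>X. complex_of_real (X powr (-1/2 - real M)))"
      by (rule asy[OF \<mu> A(2) B(2)]) (use A B in simp_all)
    have e: "(\<Sum>j<M. v j / (2 * (of_real X * \<mu>\<^sup>2)) ^ j) = (\<Sum>j<M. v j / 2 ^ j / (of_real X * \<mu>\<^sup>2) ^ j)" for X
      by (simp add: power_mult_distrib)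
    from sum_in_bigo(1)[OF sum_in_bigo(2)[OF 1 2] 3, unfolded e]
    show "(\<lambda>X. integral Db (\<lambda>t. exp (of_real X * hb t) * ab t) - integral Da (\<lambda>t. exp (of_real X * ha t) * aa t)
           - of_real (sqrt pi) / (\<mu> * of_real (sqrt X)) * (\<Sum>j<M. v j / 2 ^ j / (of_real X * \<mu>\<^sup>2) ^ j))
        \<in> O[at_top](\<lambda>X. complex_of_real (X powr (-1/2 - real M)))"
      by (rule back_subst[of "\<lambda>f. f \<in> O[at_top](\<lambda>X. complex_of_real (X powr (-1/2 - real M)))"]) (auto simp: fun_eq_iff)
  qed
qed

section \<open>The Volterra integral of the reciprocal gamma function\<close>

lemma incomplete_gamma_step:
  fixes b z :: real
  assumes b: "b > 0" and z: "z \<ge> 0"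
  shows "(\<lambda>t. exp (- t) * t powr (b - 1)) integrable_on {0..z}"
    and "b * integral {0..z} (\<lambda>t. exp (- t) * t powr (b - 1)) =
         integral {0..z} (\<lambda>t. exp (- t) * t powr b) + exp (- z) * z powr b"
proof -
  have 1: "((\<lambda>t. exp (- t) * (b * t powr (b - 1)) - exp (- t) * t powr b) has_integral
            (exp (- z) * z powr b - exp (- 0) * 0 powr b)) {0..z}"
  proof (rule fundamental_theorem_of_calculus_interior[OF z])
    show "continuous_on {0..z} (\<lambda>t. exp (- t) * t powr b)"
      by (intro continuous_intros continuous_on_powr') (use b in auto)
    fix t :: real assume t: "t \<in> {0<..<z}"
    have "((\<lambda>t. exp (- t) * t powr b) has_real_derivative (exp (- t) * (b * t powr (b - 1)) - exp (- t) * t powr b)) (at t)"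
      using t by (auto intro!: derivative_eq_intros simp: field_simps)
    then show "((\<lambda>t. exp (- t) * t powr b) has_vector_derivative exp (- t) * (b * t powr (b - 1)) - exp (- t) * t powr b) (at t)"
      by (simp only: has_real_derivative_iff_has_vector_derivative)
  qed
  have "continuous_on {0..z} (\<lambda>t. exp (- t) * t powr b)"
    by (intro continuous_intros continuous_on_powr') (use b in auto)
  then have 2: "((\<lambda>t. exp (- t) * t powr b) has_integral integral {0..z} (\<lambda>t. exp (- t) * t powr b)) {0..z}"
    using integrable_continuous_real integrable_integral by blast
  have 3: "((\<lambda>t. b * (exp (- t) * t powr (b - 1))) has_integral
       (integral {0..z} (\<lambda>t. exp (- t) * t powr b) + exp (- z) * z powr b)) {0..z}"
    using has_integral_add[OF 2 1] b by (simp add: mult_ac)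
  from has_integral_mult_right[OF 3, of "1 / b"] b
  have 4: "((\<lambda>t. exp (- t) * t powr (b - 1)) has_integral
       (1 / b * (integral {0..z} (\<lambda>t. exp (- t) * t powr b) + exp (- z) * z powr b))) {0..z}" by simp
  show "(\<lambda>t. exp (- t) * t powr (b - 1)) integrable_on {0..z}" using 4 by (rule has_integral_integrable)
  show "b * integral {0..z} (\<lambda>t. exp (- t) * t powr (b - 1)) =
         integral {0..z} (\<lambda>t. exp (- t) * t powr b) + exp (- z) * z powr b"
    using integral_unique[OF 4] b by simp
qed

lemma rGamma_real_plus1: "rGamma (b::real) = b * rGamma (b + 1)"
  by (simp add: rGamma_plus1)

lemma rGamma_real_nonneg: "b \<ge> 0 \<Longrightarrow> rGamma (b::real) \<ge> 0"
  by (cases "b = 0") (simp_all add: rGamma_inverse_Gamma Gamma_real_pos order_less_imp_le)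

text \<open>
  Each integration by parts in the incomplete gamma integral splits off one term of the series.
\<close>

lemma lattice_sum_eq_incomplete_gamma:
  fixes a z :: real
  assumes a: "a > 0" and z: "z \<ge> 0"
  shows "(\<lambda>n. z powr (a + real n) * rGamma (a + real n + 1)) sums
           (exp z * (rGamma a * integral {0..z} (\<lambda>t. exp (- t) * t powr (a - 1))))"
proof -
  define L where "L = (\<lambda>b. integral {0..z} (\<lambda>t. exp (- t) * t powr (b - 1)))"
  define Q where "Q = (\<lambda>n::nat. rGamma (a + real n) * L (a + real n))"
  define T where "T = (\<lambda>n::nat. exp (- z) * (z powr (a + real n) * rGamma (a + real n + 1)))"
  have step: "Q n = Q (Suc n) + T n" for n
  proof -
    have b: "a + real n > 0" using a by simp
    have "Q n = rGamma (a + real n + 1) * ((a + real n) * L (a + real n))"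
      by (subst Q_def, subst rGamma_real_plus1) (simp add: mult_ac)
    also have "(a + real n) * L (a + real n) = L (a + real n + 1) + exp (- z) * z powr (a + real n)"
      using incomplete_gamma_step(2)[OF b z] by (simp add: L_def)
    finally show ?thesis by (simp add: Q_def T_def algebra_simps)
  qed
  have Lnn: "L b \<ge> 0" if "b > 0" for b
    unfolding L_def by (rule integral_nonneg[OF incomplete_gamma_step(1)[OF that z]]) auto
  have Qnn: "Q n \<ge> 0" for n using Lnn[of "a + real n"] a by (simp add: Q_def rGamma_real_nonneg)
  have Tnn: "T n \<ge> 0" for n using a by (simp add: T_def rGamma_real_nonneg)
  have sum: "(\<Sum>k<n. T k) = Q 0 - Q n" for n
  proof (induction n)
    case (Suc n)
    then show ?case using step[of n] unfolding sum.lessThan_Suc by linarith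
  qed simp
  have summ: "summable T"
  proof (rule summableI_nonneg_bounded[OF Tnn])
    show "(\<Sum>k<n. T k) \<le> Q 0" for n using Qnn[of n] by (simp add: sum)
  qed
  have "Q n \<le> exp z * T n" for n
  proof -
    have b: "a + real n > 0" using a by simp
    have "((\<lambda>t. t powr (a + real n - 1)) has_integral (z powr (a + real n) / (a + real n))) {0..z}"
      using has_integral_powr_from_0[of "a + real n - 1" z] b z by simp
    then have "L (a + real n) \<le> z powr (a + real n) / (a + real n)"
      unfolding L_def by (rule has_integral_le[OF integrable_integral[OF incomplete_gamma_step(1)[OF b z]]])
        (auto simp: mult_left_le_one_le)
    then have "Q n \<le> rGamma (a + real n) * (z powr (a + real n) / (a + real n))"
      unfolding Q_def using b by (intro mult_left_mono rGamma_real_nonneg) auto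
    also have "\<dots> = z powr (a + real n) * rGamma (a + real n + 1)"
      using b by (subst rGamma_real_plus1) simp
    also have "\<dots> = exp z * T n" by (simp add: T_def exp_minus)
    finally show ?thesis .
  qed
  moreover have "(\<lambda>n. exp z * T n) \<longlonglongrightarrow> exp z * 0"
    by (intro tendsto_intros summable_LIMSEQ_zero[OF summ])
  ultimately have Q0: "Q \<longlonglongrightarrow> 0"
    by (intro tendsto_sandwich[OF _ _ tendsto_const, of 0 Q sequentially "\<lambda>n. exp z * T n"]) (use Qnn in auto)
  have "(\<lambda>n. Q 0 - Q n) \<longlonglongrightarrow> Q 0 - 0" by (intro tendsto_intros Q0)
  then have "T sums Q 0" unfolding sums_def sum by simp
  from sums_mult[OF this, of "exp z"] have "(\<lambda>n. exp z * T n) sums (exp z * Q 0)" .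
  moreover have "exp z * T n = z powr (a + real n) * rGamma (a + real n + 1)" for n
    by (simp add: T_def flip: mult.assoc exp_add)
  ultimately show ?thesis by (simp add: Q_def L_def)
qed

text \<open>
  For integral \<open>a\<close> the sum is an exponential series. For the other \<open>a\<close> it
  is \<open>exp z\<close> times a normalised incomplete gamma integral, whose defect is bounded by a
  multiple of \<open>exp (- z)\<close>.
\<close>

lemma lattice_sum_close_to_exp:
  obtains C :: real where "C \<ge> 0"
    "\<And>a z. 0 < a \<Longrightarrow> a \<le> 1 \<Longrightarrow> 0 \<le> z \<Longrightarrow>
       (\<lambda>n. z powr (a + real n) * rGamma (a + real n + 1)) sums (\<Sum>n. z powr (a + real n) * rGamma (a + real n + 1)) \<and>
       \<bar>(\<Sum>n. z powr (a + real n) * rGamma (a + real n + 1)) - exp z\<bar> \<le> C"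
proof -
  have "compact (rGamma ` {0..1::real})"
    by (intro compact_continuous_image continuous_intros) auto
  then have "bounded (rGamma ` {0..1::real})" by (rule compact_imp_bounded)
  from this[unfolded bounded_iff] obtain B where "\<forall>x\<in>rGamma ` {0..1::real}. norm x \<le> B" ..
  then have B: "\<And>a. a \<in> {0..1::real} \<Longrightarrow> \<bar>rGamma a\<bar> \<le> B" by simp
  have B0: "B \<ge> 0" using B[of 0] by simp
  show thesis
  proof (rule that[of "max B (exp 1)"])
    show "max B (exp 1) \<ge> 0" using B0 by simp
    fix a z :: real assume a: "0 < a" "a \<le> 1" and z: "0 \<le> z"
    let ?f = "\<lambda>t. exp (- t) * t powr (a - 1)"
    define P where "P = rGamma a * integral {0..z} ?f"
    have s: "(\<lambda>n. z powr (a + real n) * rGamma (a + real n + 1)) sums (exp z * P)"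
      unfolding P_def by (rule lattice_sum_eq_incomplete_gamma[OF a(1) z])
    have GI: "(?f has_integral Gamma a) {0..}"
      using Gamma_integral_real[OF a(1)] by (simp add: exp_minus field_simps)
    have rG: "rGamma a * Gamma a = 1"
      using Gamma_real_pos[OF a(1)] by (simp add: rGamma_inverse_Gamma)
    have i0: "?f integrable_on {0..z}" by (rule incomplete_gamma_step(1)[OF a(1) z])
    have ge0: "integral {0..z} ?f \<le> Gamma a"
      using integral_subset_le[OF _ i0 has_integral_integrable[OF GI]] integral_unique[OF GI] by auto
    have P1: "P \<le> 1" using mult_left_mono[OF ge0 rGamma_real_nonneg[of a]] a rG by (simp add: P_def)
    have P0: "P \<ge> 0" unfolding P_def
      by (intro mult_nonneg_nonneg rGamma_real_nonneg integral_nonneg i0) (use a in auto)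
    have "\<bar>exp z * P - exp z\<bar> \<le> max B (exp 1)"
    proof (cases "z \<ge> 1")
      case False
      have "\<bar>exp z * P - exp z\<bar> = exp z * (1 - P)" using P1 by (simp add: algebra_simps abs_if mult_left_le)
      also have "\<dots> \<le> exp 1 * 1" using P0 P1 False by (intro mult_mono) auto
      finally show ?thesis by simp
    next
      case True
      have i2: "((\<lambda>t. exp (- 1 * t)) has_integral exp (- 1 * z) / 1) {z..}"
        by (rule has_integral_exp_minus_to_infinity) simp
      have nn: "?f absolutely_integrable_on {0..}"
        using has_integral_integrable[OF GI] by (intro nonnegative_absolutely_integrable_1) auto
      have i1: "?f integrable_on {z..}"
        using set_integrable_subset[OF nn, of "{z..}"] z by (simp add: absolutely_integrable_on_def)
      have "integral ({0..z} \<union> {z..}) ?f = integral {0..z} ?f + integral {z..} ?f"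
        by (rule integral_Un[OF i0 i1]) (rule negligible_subset[of "{z}"], auto)
      moreover have "{0..z} \<union> {z..} = {0..}" using z by auto
      ultimately have split: "Gamma a = integral {0..z} ?f + integral {z..} ?f" using integral_unique[OF GI] by simp
      have "integral {z..} ?f \<le> exp (- 1 * z) / 1"
      proof (rule has_integral_le[OF integrable_integral[OF i1] i2])
        fix t assume "t \<in> {z..}"
        then have "t powr (a - 1) \<le> t powr 0" using True a by (intro powr_mono) auto
        then show "?f t \<le> exp (- 1 * t)" using \<open>t \<in> {z..}\<close> True by (simp add: mult_left_le)
      qed
      then have le: "exp z * integral {z..} ?f \<le> 1"
        using mult_left_mono[of "integral {z..} ?f" "exp (- z)" "exp z"] by (simp add: exp_minus)
      have "1 - P = rGamma a * Gamma a - rGamma a * integral {0..z} ?f" unfolding rG P_def ..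
      also have "\<dots> = rGamma a * integral {z..} ?f" unfolding split by (simp add: algebra_simps)
      finally have "1 - P = rGamma a * integral {z..} ?f" .
      then have "exp z * (1 - P) = rGamma a * (exp z * integral {z..} ?f)" by simp
      also have "\<dots> \<le> rGamma a * 1" using le a by (intro mult_left_mono rGamma_real_nonneg) auto
      also have "\<dots> \<le> B" using B[of a] a by simp
      finally have "exp z * (1 - P) \<le> B" .
      moreover have "\<bar>exp z * P - exp z\<bar> = exp z * (1 - P)" using P1 by (simp add: algebra_simps abs_if mult_left_le)
      ultimately show ?thesis by simp
    qed
    then show "(\<lambda>n. z powr (a + real n) * rGamma (a + real n + 1)) sums (\<Sum>n. z powr (a + real n) * rGamma (a + real n + 1)) \<and>
       \<bar>(\<Sum>n. z powr (a + real n) * rGamma (a + real n + 1)) - exp z\<bar> \<le> max B (exp 1)"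
      using s sums_unique[OF s] by simp
  qed
qed

lemma rGamma_borel_measurable [measurable]: "(rGamma :: real \<Rightarrow> real) \<in> borel_measurable borel"
  by (intro borel_measurable_continuous_onI continuous_intros)

text \<open>
  The half-line is cut into translates of the unit interval; on each lattice the sum is close to
  \<open>exp z\<close>, uniformly.
\<close>

lemma nn_integral_powr_rGamma_bounds:
  obtains C :: real where "C \<ge> 0"
    "\<And>z. 0 \<le> z \<Longrightarrow> (\<integral>\<^sup>+a. ennreal (z powr a * rGamma (a + 1)) * indicator {0<..} a \<partial>lborel) \<le> ennreal (exp z + C)"
    "\<And>z. 0 \<le> z \<Longrightarrow> ennreal (exp z - C) \<le> (\<integral>\<^sup>+a. ennreal (z powr a * rGamma (a + 1)) * indicator {0<..} a \<partial>lborel)"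
proof -
  obtain C :: real where C: "C \<ge> 0" and
    L: "\<And>a z. 0 < a \<Longrightarrow> a \<le> 1 \<Longrightarrow> 0 \<le> z \<Longrightarrow>
       (\<lambda>n. z powr (a + real n) * rGamma (a + real n + 1)) sums (\<Sum>n. z powr (a + real n) * rGamma (a + real n + 1)) \<and>
       \<bar>(\<Sum>n. z powr (a + real n) * rGamma (a + real n + 1)) - exp z\<bar> \<le> C"
    by (rule lattice_sum_close_to_exp) (rule that)
  have key: "(\<integral>\<^sup>+a. ennreal (z powr a * rGamma (a + 1)) * indicator {0<..} a \<partial>lborel) =
     (\<integral>\<^sup>+a. ennreal (\<Sum>n. z powr (a + real n) * rGamma (a + real n + 1)) * indicator {0<..1} a \<partial>lborel)"
    if z: "0 \<le> z" for z
  proof -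
    define g where "g = (\<lambda>a. ennreal (z powr a * rGamma (a + 1)))"
    have [measurable]: "g \<in> borel_measurable borel" unfolding g_def by measurable
    have ind: "(indicator {0<..} a :: ennreal) = (\<Sum>n. indicator {real n<..real n + 1} a)" for a :: real
    proof -
      have disj: "disjoint_family (\<lambda>n. {real n<..real n + 1})"
        unfolding disjoint_family_on_def
      proof (intro ballI impI)
        fix m n :: nat assume "m \<noteq> n"
        then have "real m + 1 \<le> real n \<or> real n + 1 \<le> real m" by linarith
        then show "{real m<..real m + 1} \<inter> {real n<..real n + 1} = {}" by auto
      qed
      have "(\<Union>n. {real n<..real n + 1}) = {0<..}"
      proof (intro equalityI subsetI)
        fix x :: real assume x: "x \<in> {0<..}"
        define n where "n = nat (\<lceil>x\<rceil> - 1)"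
        have "\<lceil>x\<rceil> \<ge> 1" using x by simp
        then have "real n = of_int \<lceil>x\<rceil> - 1" by (simp add: n_def)
        then have "x \<in> {real n<..real n + 1}" using ceiling_correct[of x] by auto
        then show "x \<in> (\<Union>n. {real n<..real n + 1})" by blast
      qed auto
      then show ?thesis using suminf_indicator[OF disj, of a] by simp
    qed
    have "(\<integral>\<^sup>+a. g a * indicator {0<..} a \<partial>lborel) = (\<integral>\<^sup>+a. (\<Sum>n. g a * indicator {real n<..real n + 1} a) \<partial>lborel)"
      unfolding ind by (simp add: ennreal_suminf_cmult)
    also have "\<dots> = (\<Sum>n. \<integral>\<^sup>+a. g a * indicator {real n<..real n + 1} a \<partial>lborel)"
      by (rule nn_integral_suminf) measurable
    also have "\<dots> = (\<Sum>n. \<integral>\<^sup>+a. g (a + real n) * indicator {0<..1} a \<partial>lborel)"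
    proof (rule suminf_cong)
      fix n :: nat
      have "(\<integral>\<^sup>+a. g a * indicator {real n<..real n + 1} a \<partial>lborel) =
         ennreal \<bar>1\<bar> * (\<integral>\<^sup>+a. g (real n + 1 * a) * indicator {real n<..real n + 1} (real n + 1 * a) \<partial>lborel)"
        by (rule nn_integral_real_affine) auto
      also have "\<dots> = (\<integral>\<^sup>+a. g (a + real n) * indicator {0<..1} a \<partial>lborel)"
        by (auto intro!: nn_integral_cong simp: indicator_def add.commute)
      finally show "(\<integral>\<^sup>+a. g a * indicator {real n<..real n + 1} a \<partial>lborel) = (\<integral>\<^sup>+a. g (a + real n) * indicator {0<..1} a \<partial>lborel)" .
    qed
    also have "\<dots> = (\<integral>\<^sup>+a. (\<Sum>n. g (a + real n) * indicator {0<..1} a) \<partial>lborel)"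
      by (rule nn_integral_suminf[symmetric]) measurable
    also have "\<dots> = (\<integral>\<^sup>+a. ennreal (\<Sum>n. z powr (a + real n) * rGamma (a + real n + 1)) * indicator {0<..1} a \<partial>lborel)"
    proof (intro nn_integral_cong)
      fix a :: real
      show "(\<Sum>n. g (a + real n) * indicator {0<..1} a) = ennreal (\<Sum>n. z powr (a + real n) * rGamma (a + real n + 1)) * indicator {0<..1} a"
      proof (cases "a \<in> {0<..1}")
        case True
        have "(\<Sum>n. ennreal (z powr (a + real n) * rGamma (a + real n + 1))) = ennreal (\<Sum>n. z powr (a + real n) * rGamma (a + real n + 1))"
          by (rule suminf_ennreal2) (use L[of a z] True z in \<open>auto simp: sums_iff rGamma_real_nonneg\<close>)
        then show ?thesis using True by (simp add: g_def)
      qed simp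
    qed
    finally show ?thesis unfolding g_def .
  qed
  have c: "(\<integral>\<^sup>+a. ennreal k * indicator {0<..1::real} a \<partial>lborel) = ennreal k" for k
    by (subst nn_integral_cmult_indicator) auto
  show thesis
  proof (rule that[OF C])
    fix z :: real assume z: "0 \<le> z"
    have "(\<integral>\<^sup>+a. ennreal (\<Sum>n. z powr (a + real n) * rGamma (a + real n + 1)) * indicator {0<..1} a \<partial>lborel)
        \<le> (\<integral>\<^sup>+a. ennreal (exp z + C) * indicator {0<..1::real} a \<partial>lborel)"
      by (intro nn_integral_mono) (use L[OF _ _ z] in \<open>force simp: indicator_def intro!: ennreal_leI\<close>)
    then show "(\<integral>\<^sup>+a. ennreal (z powr a * rGamma (a + 1)) * indicator {0<..} a \<partial>lborel) \<le> ennreal (exp z + C)"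
      unfolding key[OF z] c .
    have "(\<integral>\<^sup>+a. ennreal (exp z - C) * indicator {0<..1::real} a \<partial>lborel) \<le>
       (\<integral>\<^sup>+a. ennreal (\<Sum>n. z powr (a + real n) * rGamma (a + real n + 1)) * indicator {0<..1} a \<partial>lborel)"
      by (intro nn_integral_mono) (use L[OF _ _ z] in \<open>force simp: indicator_def intro!: ennreal_leI\<close>)
    then show "ennreal (exp z - C) \<le> (\<integral>\<^sup>+a. ennreal (z powr a * rGamma (a + 1)) * indicator {0<..} a \<partial>lborel)"
      unfolding key[OF z] c .
  qed
qed

text \<open>
  Volterra's function \<open>\<nu>\<close>, with the lower limit of integration as a parameter so
  that the hypothesis, which speaks of large arguments only, can be integrated.
\<close>

definition nu_from :: "real \<Rightarrow> real \<Rightarrow> real" where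
  "nu_from b z = (\<integral>a. z powr a * rGamma (a + 1) * indicator {b<..} a \<partial>lborel)"

text \<open>
  This is the continuous analogue of the exponential series: replacing the sum over \<open>n\<close>
  by an integral over \<open>a\<close> changes \<open>exp z\<close> only by a power of
  \<open>z\<close>.
\<close>

lemma nu_from_asymp:
  assumes b: "b \<ge> 0"
  obtains K where "K \<ge> 0"
    "\<And>z. 0 \<le> z \<Longrightarrow> integrable lborel (\<lambda>a. z powr a * rGamma (a + 1) * indicator {b<..} a)"
    "\<And>z. 0 \<le> z \<Longrightarrow> \<bar>nu_from b z - exp z\<bar> \<le> K * (1 + z powr b)"
proof -
  obtain C :: real where C: "C \<ge> 0"
    "\<And>z. 0 \<le> z \<Longrightarrow> (\<integral>\<^sup>+a. ennreal (z powr a * rGamma (a + 1)) * indicator {0<..} a \<partial>lborel) \<le> ennreal (exp z + C)"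
    "\<And>z. 0 \<le> z \<Longrightarrow> ennreal (exp z - C) \<le> (\<integral>\<^sup>+a. ennreal (z powr a * rGamma (a + 1)) * indicator {0<..} a \<partial>lborel)"
    by (rule nn_integral_powr_rGamma_bounds) (rule that)
  have "compact ((\<lambda>a. rGamma (a + 1)) ` {0..b})"
    by (intro compact_continuous_image continuous_on_compose2[OF continuous_on_rGamma[of UNIV]] continuous_intros) auto
  then have "bounded ((\<lambda>a. rGamma (a + 1)) ` {0..b})" by (rule compact_imp_bounded)
  from this[unfolded bounded_iff] obtain B where "\<forall>x\<in>(\<lambda>a. rGamma (a + 1)) ` {0..b}. norm x \<le> B" ..
  then have B: "\<And>a. a \<in> {0..b} \<Longrightarrow> \<bar>rGamma (a + 1)\<bar> \<le> B" by simp
  have B0: "B \<ge> 0" using B[of 0] b by simp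
  have main: "integrable lborel (\<lambda>a. z powr a * rGamma (a + 1) * indicator {b<..} a) \<and> \<bar>nu_from b z - exp z\<bar> \<le> (C + B * b) * (1 + z powr b)"
    if z: "0 \<le> z" for z
  proof -
    define G where "G = (\<lambda>c a. z powr a * rGamma (a + 1) * indicator {c<..} a)"
    have Gnn: "G c a \<ge> 0" if "c \<ge> 0" for c a using that by (auto simp: G_def indicator_def rGamma_real_nonneg)
    have [measurable]: "G c \<in> borel_measurable borel" for c unfolding G_def by measurable
    have nn: "(\<integral>\<^sup>+a. ennreal (G 0 a) \<partial>lborel) = (\<integral>\<^sup>+a. ennreal (z powr a * rGamma (a + 1)) * indicator {0<..} a \<partial>lborel)"
      by (intro nn_integral_cong) (auto simp: G_def indicator_def)
    have fin: "(\<integral>\<^sup>+a. ennreal (G 0 a) \<partial>lborel) \<le> ennreal (exp z + C)" using C(2)[OF z] nn by simp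
    have i0: "integrable lborel (G 0)"
      by (rule integrableI_nonneg) (use Gnn fin in \<open>auto simp: le_less_trans[OF _ ennreal_less_top]\<close>)
    have e0: "ennreal (integral\<^sup>L lborel (G 0)) = (\<integral>\<^sup>+a. ennreal (G 0 a) \<partial>lborel)"
      by (rule nn_integral_eq_integral[symmetric, OF i0]) (use Gnn in auto)
    have I0: "integral\<^sup>L lborel (G 0) \<ge> 0" by (rule integral_nonneg_AE) (use Gnn in auto)
    have up: "integral\<^sup>L lborel (G 0) \<le> exp z + C"
      using fin C(1) unfolding e0[symmetric] by (subst (asm) ennreal_le_iff) (auto intro: add_nonneg_nonneg)
    have lo: "exp z - C \<le> integral\<^sup>L lborel (G 0)"
    proof (cases "exp z - C \<ge> 0")
      case True
      have "ennreal (exp z - C) \<le> ennreal (integral\<^sup>L lborel (G 0))" using C(3)[OF z] nn e0 by simp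
      then show ?thesis using I0 by (simp add: ennreal_le_iff)
    qed (use I0 in simp)
    have ib: "integrable lborel (G b)"
    proof (rule Bochner_Integration.integrable_bound[OF i0])
      show "AE a in lborel. norm (G b a) \<le> norm (G 0 a)" using b by (auto simp: G_def indicator_def)
    qed simp
    have d1: "integral\<^sup>L lborel (G 0) - integral\<^sup>L lborel (G b) = (\<integral>a. G 0 a - G b a \<partial>lborel)"
      using i0 ib by simp
    have id: "integrable lborel (\<lambda>a. B * (1 + z powr b) * indicator {0..b} a)"
      by (intro integrable_mult_right integrable_real_indicator) (use b in \<open>auto simp: emeasure_lborel_Icc\<close>)
    have "(\<integral>a. G 0 a - G b a \<partial>lborel) \<le> (\<integral>a. B * (1 + z powr b) * indicator {0..b} a \<partial>lborel)"
    proof (rule integral_mono[OF Bochner_Integration.integrable_diff[OF i0 ib] id])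
      fix a :: real
      show "G 0 a - G b a \<le> B * (1 + z powr b) * indicator {0..b} a"
      proof (cases "0 < a \<and> a \<le> b")
        case True
        have "z powr a \<le> 1 + z powr b"
        proof (cases "z \<le> 1")
          case True
          have "z powr a \<le> 1" using True z \<open>0 < a \<and> a \<le> b\<close> by (intro powr_le1) auto
          then show ?thesis by (smt (verit) powr_ge_zero)
        next
          case False
          then have "z powr a \<le> z powr b" using \<open>0 < a \<and> a \<le> b\<close> by (intro powr_mono) auto
          then show ?thesis by simp
        qed
        then have "z powr a * rGamma (a + 1) \<le> (1 + z powr b) * B"
          using B[of a] True by (intro mult_mono) (auto simp: rGamma_real_nonneg add_nonneg_nonneg)
        then show ?thesis using True by (simp add: G_def mult.commute)
      qed (use b B0 in \<open>auto simp: G_def indicator_def add_nonneg_nonneg\<close>)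
    qed
    also have "\<dots> = B * (1 + z powr b) * b" using b by simp
    finally have d2: "integral\<^sup>L lborel (G 0) - integral\<^sup>L lborel (G b) \<le> B * b * (1 + z powr b)"
      using d1 by (simp add: mult_ac)
    have d3: "integral\<^sup>L lborel (G b) \<le> integral\<^sup>L lborel (G 0)"
      by (rule integral_mono[OF ib i0]) (use b in \<open>auto simp: G_def indicator_def rGamma_real_nonneg\<close>)
    have "C \<le> C * (1 + z powr b)" using C(1) by (simp add: mult_left_le algebra_simps)
    moreover have "0 \<le> B * b * (1 + z powr b)" using B0 b by (intro mult_nonneg_nonneg add_nonneg_nonneg) auto
    ultimately have "\<bar>integral\<^sup>L lborel (G b) - exp z\<bar> \<le> C * (1 + z powr b) + B * b * (1 + z powr b)"
      using up lo d2 d3 by linarith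
    then show ?thesis using ib by (simp add: nu_from_def G_def[abs_def] distrib_right)
  qed
  show thesis by (rule that[of "C + B * b"]) (use main C(1) B0 b in auto)
qed

section \<open>The inverse factorial expansion on the real axis\<close>

lemma eventually_sector_at_infinity:
  assumes "eventually P (sector_at_infinity \<epsilon>)"
  obtains B where "\<And>s. norm s \<ge> B \<Longrightarrow> \<bar>Arg s\<bar> \<le> pi - \<epsilon> \<Longrightarrow> P s"
  using assms unfolding sector_at_infinity_def eventually_inf_principal eventually_at_infinity by auto

lemma positive_parameters:
  assumes "0 < \<sigma>" "\<sigma> < 1"
  shows "kap \<sigma> > 0" "hpar \<sigma> > 0" "Apar \<sigma> > 0" "hpar \<sigma> * kap \<sigma> powr kap \<sigma> > 0"
  using assms by (auto simp: kap_def hpar_def Apar_def)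

text \<open>
  The hypothesis for real \<open>s = r - 1\<close>. With this shift \<open>\<sigma> s + \<sigma> =
  \<sigma> r\<close> and \<open>\<kappa> s + \<vartheta>' = \<kappa> r + 1/2\<close>, and the
  quotient of the rising factorial by \<open>\<Gamma>(\<kappa> r + 1/2)\<close> becomes a reciprocal
  gamma function.
\<close>

lemma gamma_ratio_real_expansion:
  assumes \<sigma>: "0 < \<sigma>" "\<sigma> < 1" and ifc: "inverse_factorial_coeffs \<sigma> c" and M: "M \<ge> 1"
  defines "H \<equiv> hpar \<sigma> * kap \<sigma> powr kap \<sigma>"
  defines "K \<equiv> \<sigma> * kap \<sigma> * Apar \<sigma> / H"
  obtains C r0 where "C \<ge> 0" "\<And>r. r \<ge> r0 \<Longrightarrow>
    \<bar>Gamma (\<sigma> * r + 1) * rGamma (r + 1) - K * H powr r * (\<Sum>j<M. c j * rGamma (kap \<sigma> * r + 1/2 + real j))\<bar>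
      \<le> C * H powr r * rGamma (kap \<sigma> * r + 1/2 + real M)"
proof -
  note pos = positive_parameters[OF \<sigma>, folded H_def]
  define lhs where "lhs = (\<lambda>s::complex.
          Gamma (of_real \<sigma> * s + of_real \<sigma>) * Gamma (of_real (kap \<sigma>) * s + of_real (1 - vth \<sigma>))
            / Gamma (1 + s)
            / (of_real (kap \<sigma> * Apar \<sigma>) * of_real H powr s)
          - (\<Sum>j<M. of_real (c j) / pochhammer (of_real (kap \<sigma>) * s + of_real (1 - vth \<sigma>)) j))"
  define rhs where "rhs = (\<lambda>s::complex. 1 / pochhammer (of_real (kap \<sigma>) * s + of_real (1 - vth \<sigma>)) M)"
  have "lhs \<in> O[sector_at_infinity (pi/2)](rhs)"
    using ifc M pi_gt_zero unfolding inverse_factorial_coeffs_def lhs_def rhs_def H_def by simp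
  then obtain C where C: "C > 0" "eventually (\<lambda>s. norm (lhs s) \<le> C * norm (rhs s)) (sector_at_infinity (pi/2))"
    by (rule landau_o.bigE)
  obtain B where B: "\<And>s. norm s \<ge> B \<Longrightarrow> \<bar>Arg s\<bar> \<le> pi - pi/2 \<Longrightarrow> norm (lhs s) \<le> C * norm (rhs s)"
    by (rule eventually_sector_at_infinity[OF C(2)]) (rule that)
  show thesis
  proof (rule that[of "\<sigma> * kap \<sigma> * Apar \<sigma> / H * C" "max (B + 1) 2"])
    show "\<sigma> * kap \<sigma> * Apar \<sigma> / H * C \<ge> 0" using pos \<sigma> C by simp
    fix r :: real assume r: "r \<ge> max (B + 1) 2"
    define x where "x = r - 1"
    define z where "z = kap \<sigma> * r + 1/2"
    have x: "x \<ge> B" "x \<ge> 1" using r by (auto simp: x_def)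
    have z: "z > 0" using pos(1) r by (simp add: z_def add_pos_pos)
    have z1: "kap \<sigma> * x + (1 - vth \<sigma>) = z" by (simp add: x_def z_def vth_def kap_def algebra_simps)
    have z2: "of_real (kap \<sigma>) * of_real x + of_real (1 - vth \<sigma>) = complex_of_real z"
      unfolding z1[symmetric] by simp
    have z3: "of_real \<sigma> * of_real x + of_real \<sigma> = complex_of_real (\<sigma> * r)"
      by (simp add: x_def algebra_simps)
    have z4: "1 + of_real x = complex_of_real r" by (simp add: x_def)
    define l where "l = Gamma (\<sigma> * r) * Gamma z / Gamma r / (kap \<sigma> * Apar \<sigma> * H powr x) - (\<Sum>j<M. c j / pochhammer z j)"
    have "lhs (of_real x) = of_real l"
      unfolding lhs_def z2 z3 z4 l_def Gamma_complex_of_real pochhammer_of_real powr_of_real[OF less_imp_le[OF pos(4)]] by simp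
    moreover have "rhs (of_real x) = of_real (1 / pochhammer z M)"
      unfolding rhs_def z2 by (simp add: pochhammer_of_real)
    moreover have "norm (lhs (of_real x)) \<le> C * norm (rhs (of_real x))"
      by (rule B) (use x in \<open>auto simp: Arg_of_real\<close>)
    moreover have pM: "pochhammer z j > 0" for j using z by (rule pochhammer_pos)
    ultimately have l: "\<bar>l\<bar> \<le> C * (1 / pochhammer z M)" by (simp add: norm_divide abs_of_pos)
    have rz: "rGamma (z + real j) = rGamma z / pochhammer z j" for j
      using pochhammer_rGamma[of z j] pM[of j] by (simp add: field_simps)
    have rGz: "rGamma z * Gamma z = 1" using Gamma_real_pos[OF z] by (simp add: rGamma_inverse_Gamma)
    have rGnn: "rGamma z \<ge> 0" using z by (simp add: rGamma_real_nonneg)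
    have Hx: "H powr x = H powr r / H" using pos(4) by (simp add: x_def powr_diff)
    have G1: "Gamma (\<sigma> * r + 1) * rGamma (r + 1) = \<sigma> * (Gamma (\<sigma> * r) / Gamma r)"
    proof -
      have g1: "Gamma (\<sigma> * r + 1) = \<sigma> * r * Gamma (\<sigma> * r)"
      proof (rule Gamma_plus1)
        have "\<sigma> * r > 0" using \<sigma> r by simp
        then show "\<sigma> * r \<notin> \<int>\<^sub>\<le>\<^sub>0" by (auto elim!: nonpos_Ints_cases)
      qed
      have "Gamma (\<sigma> * r + 1) * rGamma (r + 1) = \<sigma> * (Gamma (\<sigma> * r) * (r * rGamma (r + 1)))"
        unfolding g1 by (simp only: mult_ac)
      also have "r * rGamma (r + 1) = inverse (Gamma r)"
        using rGamma_real_plus1[of r] by (simp add: rGamma_inverse_Gamma)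
      finally show ?thesis by (simp add: divide_inverse)
    qed
    define W where "W = \<sigma> * kap \<sigma> * Apar \<sigma> * H powr x * rGamma z"
    have W: "W \<ge> 0" using \<sigma> pos rGnn by (simp add: W_def)
    have "W * (Gamma (\<sigma> * r) * Gamma z / Gamma r / (kap \<sigma> * Apar \<sigma> * H powr x)) = \<sigma> * (Gamma (\<sigma> * r) / Gamma r) * (rGamma z * Gamma z)"
      unfolding W_def using pos by (simp add: field_simps)
    then have W1: "W * (Gamma (\<sigma> * r) * Gamma z / Gamma r / (kap \<sigma> * Apar \<sigma> * H powr x)) = Gamma (\<sigma> * r + 1) * rGamma (r + 1)"
      unfolding rGz G1 by simp
    have W2: "W * (\<Sum>j<M. c j / pochhammer z j) = K * H powr r * (\<Sum>j<M. c j * rGamma (z + real j))"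
      unfolding W_def K_def Hx rz sum_distrib_left by (intro sum.cong) (auto simp: field_simps)
    have "\<bar>W * l\<bar> \<le> W * (C * (1 / pochhammer z M))" unfolding abs_mult abs_of_nonneg[OF W] by (rule mult_left_mono[OF l W])
    also have "\<dots> = \<sigma> * kap \<sigma> * Apar \<sigma> / H * C * H powr r * rGamma (z + real M)"
      unfolding W_def Hx rz by (simp add: field_simps)
    finally show "\<bar>Gamma (\<sigma> * r + 1) * rGamma (r + 1) - K * H powr r * (\<Sum>j<M. c j * rGamma (kap \<sigma> * r + 1/2 + real j))\<bar>
      \<le> \<sigma> * kap \<sigma> * Apar \<sigma> / H * C * H powr r * rGamma (kap \<sigma> * r + 1/2 + real M)"
      unfolding l_def right_diff_distrib W1 W2 unfolding z_def .
  qed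
qed

text \<open>
  The real integral whose saddle lies on the path of integration. It links the coefficients of the
  hypothesis with those of the saddle point.
\<close>

definition wright_psi :: "real \<Rightarrow> real \<Rightarrow> real" where
  "wright_psi \<sigma> y = (\<integral>t. exp (- t + y * t powr \<sigma>) * indicator {0<..} t \<partial>lborel)"

lemma integrable_exp_decay:
  fixes f :: "real \<Rightarrow> real"
  assumes f: "f \<in> borel_measurable borel" and le: "\<And>t. t > 0 \<Longrightarrow> \<bar>f t\<bar> \<le> B * exp (- c * t)" and c: "c > 0"
  shows "integrable lborel (\<lambda>t. f t * indicator {0<..} t)"
proof -
  have "((\<lambda>t. exp (- c * t)) has_integral exp (- c * 0) / c) {0..}"
    by (rule has_integral_exp_minus_to_infinity[OF c])
  then have "(\<lambda>t. exp (- c * t)) absolutely_integrable_on {0..}"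
    by (intro nonnegative_absolutely_integrable_1) (auto dest: has_integral_integrable)
  then have "integrable lebesgue (\<lambda>t. indicator {0..} t *\<^sub>R exp (- c * t))" by (simp add: set_integrable_def)
  then have "integrable lborel (\<lambda>t. indicator {0..} t *\<^sub>R exp (- c * t))"
    by (subst (asm) integrable_completion) auto
  then have i: "integrable lborel (\<lambda>t. B * (indicator {0..} t *\<^sub>R exp (- c * t)))" by simp
  show ?thesis
  proof (rule Bochner_Integration.integrable_bound[OF i])
    show "(\<lambda>t. f t * indicator {0<..} t) \<in> borel_measurable lborel" using f by measurable
    show "AE t in lborel. norm (f t * indicator {0<..} t) \<le> norm (B * (indicator {0..} t *\<^sub>R exp (- c * t)))"
    proof (intro AE_I2)
      fix t :: real
      show "norm (f t * indicator {0<..} t) \<le> norm (B * (indicator {0..} t *\<^sub>R exp (- c * t)))"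
        using order_trans[OF le[of t] mult_right_mono[OF abs_ge_self[of B], of "exp (- c * t)"]]
        by (cases "t > 0") (auto simp: abs_mult)
    qed
  qed
qed

lemma integrable_wright_psi:
  fixes \<sigma> y :: real
  assumes "0 < \<sigma>" "\<sigma> < 1"
  shows "integrable lborel (\<lambda>t::real. exp (- t + y * t powr \<sigma>) * indicator {0<..} t)"
proof -
  have half: "0 < (1/2::real)" by simp
  obtain C where C: "\<And>t::real. t \<ge> 0 \<Longrightarrow> y * t powr \<sigma> \<le> C + (1/2) * t"
    by (rule powr_le_affine[OF assms(2) half assms(1), of y]) (rule that)
  show ?thesis
  proof (rule integrable_exp_decay[where B="exp C" and c="1/2"])
    fix t :: real assume "t > 0"
    then have "- t + y * t powr \<sigma> \<le> C + (- (1/2) * t)" using C[of t] by simp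
    then have "exp (- t + y * t powr \<sigma>) \<le> exp (C + (- (1/2) * t))" by (simp only: exp_le_cancel_iff)
    then show "\<bar>exp (- t + y * t powr \<sigma>)\<bar> \<le> exp C * exp (- (1/2) * t)" unfolding abs_exp_cancel exp_add[symmetric] .
  qed auto
qed

lemma integral_Gamma_lborel:
  assumes a: "a > (0::real)"
  shows "integrable lborel (\<lambda>t. exp (- t) * t powr (a - 1) * indicator {0<..} t)"
    and "(\<integral>t. exp (- t) * t powr (a - 1) * indicator {0<..} t \<partial>lborel) = Gamma a"
    and "(\<integral>\<^sup>+t. ennreal (exp (- t) * t powr (a - 1) * indicator {0<..} t) \<partial>lborel) = ennreal (Gamma a)"
proof -
  have e: "(\<integral>\<^sup>+t. ennreal (exp (- t) * t powr (a - 1) * indicator {0<..} t) \<partial>lborel) = ennreal (Gamma a)"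
    unfolding Gamma_conv_nn_integral_real[OF a]
    by (intro nn_integral_cong) (auto simp: indicator_def exp_minus field_simps powr_def)
  show i: "integrable lborel (\<lambda>t. exp (- t) * t powr (a - 1) * indicator {0<..} t)"
    by (rule integrableI_nonneg) (auto simp: e)
  show "(\<integral>t. exp (- t) * t powr (a - 1) * indicator {0<..} t \<partial>lborel) = Gamma a"
    using nn_integral_eq_integral[OF i] e Gamma_real_pos[OF a]
    by (subst integral_eq_nn_integral) (auto simp: e)
  show "(\<integral>\<^sup>+t. ennreal (exp (- t) * t powr (a - 1) * indicator {0<..} t) \<partial>lborel) = ennreal (Gamma a)" by (rule e)
qed

lemma nu_from_measurable [measurable]: "nu_from b \<in> borel_measurable borel"
  unfolding nu_from_def[abs_def] by measurable

lemma nu_from_nonneg: "b \<ge> 0 \<Longrightarrow> nu_from b z \<ge> 0"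
  unfolding nu_from_def by (intro integral_nonneg_AE AE_I2) (auto simp: indicator_def rGamma_real_nonneg)

lemma abs_lborel_integral_le:
  fixes f g :: "real \<Rightarrow> real"
  assumes f: "integrable lborel f" and g: "integrable lborel g" and le: "\<And>x. \<bar>f x\<bar> \<le> g x"
  shows "\<bar>integral\<^sup>L lborel f\<bar> \<le> integral\<^sup>L lborel g"
proof -
  have "integral\<^sup>L lborel f \<le> integral\<^sup>L lborel g"
    by (rule integral_mono[OF f g]) (use le in \<open>simp add: abs_le_iff\<close>)
  moreover have "(\<integral>x. - f x \<partial>lborel) \<le> integral\<^sup>L lborel g"
    by (rule integral_mono[OF Bochner_Integration.integrable_minus[OF f] g]) (use le in \<open>simp add: abs_le_iff\<close>)
  ultimately show ?thesis by simp
qed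

text \<open>
  Writing \<open>Gamma (\<sigma> * r + 1)\<close> as Euler's integral and exchanging the
  integrations turns the integral over \<open>r\<close> into that of \<open>exp (- t) * nu_from b (y
  * t powr \<sigma>)\<close> over \<open>t\<close>, where \<open>nu_from b\<close> may be replaced
  by the exponential function.
\<close>

lemma laplace_of_nu:
  assumes \<sigma>: "0 < \<sigma>" "\<sigma> < 1" and b: "b \<ge> 0" 
  obtains K where "K \<ge> 0"
   "\<And>y. y > 0 \<Longrightarrow> integrable lborel (\<lambda>r. y powr r * (Gamma (\<sigma> * r + 1) * rGamma (r + 1)) * indicator {b<..} r)"
   "\<And>y. y > 0 \<Longrightarrow> \<bar>(\<integral>r. y powr r * (Gamma (\<sigma> * r + 1) * rGamma (r + 1)) * indicator {b<..} r \<partial>lborel) - wright_psi \<sigma> y\<bar>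
       \<le> K * (1 + y powr b)"
proof -
  obtain K where K: "K \<ge> 0"
    "\<And>z. 0 \<le> z \<Longrightarrow> integrable lborel (\<lambda>a. z powr a * rGamma (a + 1) * indicator {b<..} a)"
    "\<And>z. 0 \<le> z \<Longrightarrow> \<bar>nu_from b z - exp z\<bar> \<le> K * (1 + z powr b)"
    by (rule nu_from_asymp[OF b]) (rule that)
  define K' where "K' = K * (1 + Gamma (\<sigma> * b + 1))"
  have sb: "\<sigma> * b + 1 > 0" using \<sigma> b by (simp add: add_nonneg_pos)
  have K': "K' \<ge> 0" using K(1) Gamma_real_pos[OF sb] by (simp add: K'_def)
  have main: "integrable lborel (\<lambda>r. y powr r * (Gamma (\<sigma> * r + 1) * rGamma (r + 1)) * indicator {b<..} r) \<and>
     \<bar>(\<integral>r. y powr r * (Gamma (\<sigma> * r + 1) * rGamma (r + 1)) * indicator {b<..} r \<partial>lborel) - wright_psi \<sigma> y\<bar> \<le> K' * (1 + y powr b)"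
    if y: "y > 0" for y
  proof -
    define f where "f = (\<lambda>r t. (y powr r * rGamma (r + 1) * indicator {b<..} r) * (exp (- t) * t powr (\<sigma> * r) * indicator {0<..} t))"
    have [measurable]: "(\<lambda>(r, t). ennreal (f r t)) \<in> borel_measurable (lborel \<Otimes>\<^sub>M lborel)"
      unfolding f_def by measurable
    define g where "g = (\<lambda>r. y powr r * (Gamma (\<sigma> * r + 1) * rGamma (r + 1)) * indicator {b<..} r)"
    define k where "k = (\<lambda>t. exp (- t) * nu_from b (y * t powr \<sigma>) * indicator {0<..} t)"
    have inner_t: "(\<integral>\<^sup>+t. ennreal (f r t) \<partial>lborel) = ennreal (g r)" for r
    proof (cases "r > b")
      case True
      have a: "\<sigma> * r + 1 > 0" using True b \<sigma> by (intro add_nonneg_pos mult_nonneg_nonneg) auto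
      have nn: "y powr r * rGamma (r + 1) \<ge> 0" using True b by (simp add: rGamma_real_nonneg)
      have "(\<integral>\<^sup>+t. ennreal (f r t) \<partial>lborel) =
         (\<integral>\<^sup>+t. ennreal (y powr r * rGamma (r + 1)) * ennreal (exp (- t) * t powr ((\<sigma> * r + 1) - 1) * indicator {0<..} t) \<partial>lborel)"
      proof (intro nn_integral_cong)
        fix t :: real
        have "f r t = y powr r * rGamma (r + 1) * (exp (- t) * t powr ((\<sigma> * r + 1) - 1) * indicator {0<..} t)"
          using True by (simp add: f_def)
        then show "ennreal (f r t) = ennreal (y powr r * rGamma (r + 1)) * ennreal (exp (- t) * t powr ((\<sigma> * r + 1) - 1) * indicator {0<..} t)"
          by (simp only: ennreal_mult'[OF nn])
      qed
      also have "\<dots> = ennreal (y powr r * rGamma (r + 1)) *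
          (\<integral>\<^sup>+t. ennreal (exp (- t) * t powr ((\<sigma> * r + 1) - 1) * indicator {0<..} t) \<partial>lborel)"
        by (rule nn_integral_cmult) measurable
      also have "(\<integral>\<^sup>+t. ennreal (exp (- t) * t powr ((\<sigma> * r + 1) - 1) * indicator {0<..} t) \<partial>lborel) = ennreal (Gamma (\<sigma> * r + 1))"
        by (rule integral_Gamma_lborel(3)[OF a])
      also have "ennreal (y powr r * rGamma (r + 1)) * ennreal (Gamma (\<sigma> * r + 1)) = ennreal (g r)" unfolding ennreal_mult'[OF nn, symmetric] using True by (simp add: g_def mult_ac)
      finally show ?thesis .
    qed (simp add: f_def g_def)
    have inner_r: "(\<integral>\<^sup>+r. ennreal (f r t) \<partial>lborel) = ennreal (k t)" for t
    proof (cases "t > 0")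
      case True
      define z where "z = y * t powr \<sigma>"
      have z: "z \<ge> 0" using y True by (simp add: z_def)
      have e: "f r t = exp (- t) * (z powr r * rGamma (r + 1) * indicator {b<..} r)" for r
        using True y by (simp add: f_def z_def powr_mult powr_powr)
      have "(\<integral>\<^sup>+r. ennreal (f r t) \<partial>lborel) = (\<integral>\<^sup>+r. ennreal (exp (- t)) * ennreal (z powr r * rGamma (r + 1) * indicator {b<..} r) \<partial>lborel)"
        unfolding e by (intro nn_integral_cong) (simp add: ennreal_mult')
      also have "\<dots> = ennreal (exp (- t)) * (\<integral>\<^sup>+r. ennreal (z powr r * rGamma (r + 1) * indicator {b<..} r) \<partial>lborel)"
        by (rule nn_integral_cmult) measurable
      also have "(\<integral>\<^sup>+r. ennreal (z powr r * rGamma (r + 1) * indicator {b<..} r) \<partial>lborel) = ennreal (nu_from b z)"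
        unfolding nu_from_def by (rule nn_integral_eq_integral[OF K(2)[OF z]])
           (use b in \<open>auto simp: indicator_def rGamma_real_nonneg\<close>)
      finally show ?thesis using True by (simp add: k_def z_def ennreal_mult')
    qed (simp add: f_def k_def)
    have fub: "(\<integral>\<^sup>+t. (\<integral>\<^sup>+r. ennreal (f r t) \<partial>lborel) \<partial>lborel) = (\<integral>\<^sup>+r. (\<integral>\<^sup>+t. ennreal (f r t) \<partial>lborel) \<partial>lborel)"
      by (rule lborel_pair.Fubini') measurable
    have gnn: "g r \<ge> 0" for r
    proof (cases "r > b")
      case True
      then have "\<sigma> * r + 1 > 0" using b \<sigma> by (intro add_nonneg_pos mult_nonneg_nonneg) auto
      then show ?thesis using True b Gamma_real_pos by (simp add: g_def rGamma_real_nonneg less_imp_le)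
    qed (simp add: g_def)
    have knn: "k t \<ge> 0" for t using b by (simp add: k_def nu_from_nonneg)
    have [measurable]: "k \<in> borel_measurable borel" unfolding k_def by measurable
    have gm: "g \<in> borel_measurable lborel"
    proof -
      have "(\<lambda>r. enn2real (\<integral>\<^sup>+t. ennreal (f r t) \<partial>lborel)) \<in> borel_measurable lborel" by measurable
      then show ?thesis unfolding inner_t using gnn by simp
    qed
    have ipsi: "integrable lborel (\<lambda>t. exp (- t + y * t powr \<sigma>) * indicator {0<..} t)"
      by (rule integrable_wright_psi[OF \<sigma>])
    define m where "m = (\<lambda>t. K * (exp (- t) * t powr (1 - 1) * indicator {0<..} t) + K * y powr b * (exp (- t) * t powr ((\<sigma> * b + 1) - 1) * indicator {0<..} t))"
    have im: "integrable lborel m" unfolding m_def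
      by (intro Bochner_Integration.integrable_add integrable_mult_right integral_Gamma_lborel(1) sb) auto
    have Im: "integral\<^sup>L lborel m = K * Gamma 1 + K * y powr b * Gamma (\<sigma> * b + 1)"
      unfolding m_def using integral_Gamma_lborel(1,2)[OF sb] integral_Gamma_lborel(1,2)[of 1]
      by (subst Bochner_Integration.integral_add) auto
    have km: "\<bar>k t - exp (- t + y * t powr \<sigma>) * indicator {0<..} t\<bar> \<le> m t" for t
    proof (cases "t > 0")
      case True
      define z where "z = y * t powr \<sigma>"
      have z: "z \<ge> 0" using y True by (simp add: z_def)
      have "k t - exp (- t + y * t powr \<sigma>) * indicator {0<..} t = exp (- t) * (nu_from b z - exp z)"
      proof -
        have "exp (- t + y * t powr \<sigma>) = exp (- t) * exp z" by (simp only: exp_add z_def)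
        then show ?thesis using True by (simp add: k_def z_def right_diff_distrib)
      qed
      then have "\<bar>k t - exp (- t + y * t powr \<sigma>) * indicator {0<..} t\<bar> = exp (- t) * \<bar>nu_from b z - exp z\<bar>" by (simp add: abs_mult)
      also have "\<dots> \<le> exp (- t) * (K * (1 + z powr b))" by (intro mult_left_mono K(3) z) simp
      also have "\<dots> = m t" using True y by (simp add: m_def z_def powr_mult powr_powr algebra_simps)
      finally show ?thesis .
    qed (simp add: k_def m_def)
    have ik: "integrable lborel k"
    proof (rule Bochner_Integration.integrable_bound[OF Bochner_Integration.integrable_add[OF ipsi im]])
      show "AE t in lborel. norm (k t) \<le> norm (exp (- t + y * t powr \<sigma>) * indicator {0<..} t + m t)"
      proof (rule AE_I2)
        fix t :: real
        have "0 \<le> exp (- t + y * t powr \<sigma>) * indicator {0<..} t" by simp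
        then show "norm (k t) \<le> norm (exp (- t + y * t powr \<sigma>) * indicator {0<..} t + m t)"
          using km[of t] knn[of t] unfolding real_norm_def by linarith
      qed
    qed simp
    have eq: "(\<integral>\<^sup>+r. ennreal (g r) \<partial>lborel) = (\<integral>\<^sup>+t. ennreal (k t) \<partial>lborel)"
      using fub unfolding inner_t inner_r by simp
    have kf: "(\<integral>\<^sup>+t. ennreal (k t) \<partial>lborel) = ennreal (integral\<^sup>L lborel k)"
      by (rule nn_integral_eq_integral[OF ik]) (use knn in auto)
    have ig: "integrable lborel g"
      by (rule integrableI_nonneg[OF gm]) (use gnn eq kf in auto)
    have "integral\<^sup>L lborel g = integral\<^sup>L lborel k"
      by (subst (1 2) integral_eq_nn_integral) (use gm gnn knn eq in auto)
    then have "integral\<^sup>L lborel g - wright_psi \<sigma> y = (\<integral>t. k t - exp (- t + y * t powr \<sigma>) * indicator {0<..} t \<partial>lborel)"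
      unfolding wright_psi_def using ik ipsi by simp
    also have "\<bar>\<dots>\<bar> \<le> integral\<^sup>L lborel m"
      by (rule abs_lborel_integral_le[OF Bochner_Integration.integrable_diff[OF ik ipsi] im km])
    also have "\<dots> \<le> K' * (1 + y powr b)"
    proof -
      have "K * y powr b * Gamma (\<sigma> * b + 1) + K \<le> K' * (1 + y powr b)"
        using K(1) Gamma_real_pos[OF sb] by (simp add: K'_def algebra_simps)
      then show ?thesis unfolding Im by simp
    qed
    finally show ?thesis using ig unfolding g_def by simp
  qed
  show thesis by (rule that[OF K']) (use main in auto)
qed

section \<open>Expansion of the real Wright integral\<close>

lemma integral_powr_rGamma_affine:
  fixes k :: real
  assumes k: "k > 0" and b: "k * b + p \<ge> 0" 
  obtains K where "K \<ge> 0"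
    "\<And>x. x > 0 \<Longrightarrow> integrable lborel (\<lambda>r. x powr (k * r) * rGamma (k * r + p + 1) * indicator {b<..} r)"
    "\<And>x. x > 0 \<Longrightarrow> \<bar>(\<integral>r. x powr (k * r) * rGamma (k * r + p + 1) * indicator {b<..} r \<partial>lborel) - x powr (- p) * exp x / k\<bar>
        \<le> x powr (- p) / k * (K * (1 + x powr (k * b + p)))"
proof -
  obtain K where K: "K \<ge> 0"
    "\<And>z. 0 \<le> z \<Longrightarrow> integrable lborel (\<lambda>a. z powr a * rGamma (a + 1) * indicator {k * b + p<..} a)"
    "\<And>z. 0 \<le> z \<Longrightarrow> \<bar>nu_from (k * b + p) z - exp z\<bar> \<le> K * (1 + z powr (k * b + p))"
    by (rule nu_from_asymp[OF b]) (rule that)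
  have e: "x powr (k * r) * rGamma (k * r + p + 1) * indicator {b<..} r =
      x powr (- p) * (x powr (p + k * r) * rGamma ((p + k * r) + 1) * indicator {k * b + p<..} (p + k * r))"
    if "x > 0" for x r
  proof -
    have "(p + k * r \<in> {k * b + p<..}) = (r \<in> {b<..})" using k by simp
    moreover have "x powr (- p) * x powr (p + k * r) = x powr (k * r)" using that by (simp flip: powr_add)
    ultimately show ?thesis by (simp add: indicator_def add_ac flip: mult.assoc)
  qed
  have k0: "k \<noteq> 0" using k by simp
  have i: "integrable lborel (\<lambda>r. x powr (k * r) * rGamma (k * r + p + 1) * indicator {b<..} r)" if x: "x > 0" for x
    unfolding e[OF x] by (intro integrable_mult_right lborel_integrable_real_affine[OF K(2) k0]) (use x in simp)
  have v: "(\<integral>r. x powr (k * r) * rGamma (k * r + p + 1) * indicator {b<..} r \<partial>lborel) = x powr (- p) * (nu_from (k * b + p) x / k)"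
    if x: "x > 0" for x
  proof -
    have "nu_from (k * b + p) x = k * (\<integral>r. x powr (p + k * r) * rGamma ((p + k * r) + 1) * indicator {k * b + p<..} (p + k * r) \<partial>lborel)"
      unfolding nu_from_def using lborel_integral_real_affine[OF k0, of "\<lambda>a. x powr a * rGamma (a + 1) * indicator {k * b + p<..} a" p] k
      by simp
    then show ?thesis unfolding e[OF x] using k by simp
  qed
  show thesis
  proof (rule that[OF K(1) i])
    fix x :: real assume x: "x > 0"
    have "\<bar>x powr (- p) * (nu_from (k * b + p) x / k) - x powr (- p) * exp x / k\<bar> = x powr (- p) / k * \<bar>nu_from (k * b + p) x - exp x\<bar>"
    proof -
      have "x powr (- p) * (nu_from (k * b + p) x / k) - x powr (- p) * exp x / k = x powr (- p) / k * (nu_from (k * b + p) x - exp x)"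
        by (simp add: right_diff_distrib diff_divide_distrib)
      then show ?thesis using k by (simp add: abs_mult)
    qed
    also have "\<dots> \<le> x powr (- p) / k * (K * (1 + x powr (k * b + p)))"
      using k x K(3)[of x] by (intro mult_left_mono) auto
    finally show "\<bar>(\<integral>r. x powr (k * r) * rGamma (k * r + p + 1) * indicator {b<..} r \<partial>lborel) - x powr (- p) * exp x / k\<bar>
        \<le> x powr (- p) / k * (K * (1 + x powr (k * b + p)))" unfolding v[OF x] .
  qed
qed

text \<open>
  The integral of \<open>y powr r\<close> against the gamma quotient is \<open>wright_psi\<close> up
  to a power of \<open>y\<close>. Inserting the inverse factorial expansion instead and integrating
  term by term gives, again by the asymptotics of \<open>nu_from\<close>, one power of
  \<open>X\<close> times \<open>exp X\<close> for each coefficient.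
\<close>

lemma wright_psi_expansion:
  assumes \<sigma>: "0 < \<sigma>" "\<sigma> < 1" and ifc: "inverse_factorial_coeffs \<sigma> c" and M: "M \<ge> 1"
  defines "H \<equiv> hpar \<sigma> * kap \<sigma> powr kap \<sigma>"
  defines "K \<equiv> \<sigma> * Apar \<sigma> / H"
  shows "(\<lambda>X. exp (- X) * wright_psi \<sigma> (X powr kap \<sigma> / H) - K * (\<Sum>j<M. c j * X powr (1/2 - real j)))
           \<in> O[at_top](\<lambda>X. X powr (1/2 - real M))"
proof -
  note pos = positive_parameters[OF \<sigma>, folded H_def]
  define k where "k = kap \<sigma>"
  have k: "k > 0" using pos by (simp add: k_def)
  obtain C r0 where C: "C \<ge> 0" and r0: "\<And>r. r \<ge> r0 \<Longrightarrow>
    \<bar>Gamma (\<sigma> * r + 1) * rGamma (r + 1) - \<sigma> * kap \<sigma> * Apar \<sigma> / H * H powr r * (\<Sum>j<M. c j * rGamma (kap \<sigma> * r + 1/2 + real j))\<bar>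
      \<le> C * H powr r * rGamma (kap \<sigma> * r + 1/2 + real M)"
    by (rule gamma_ratio_real_expansion[OF \<sigma> ifc M, folded H_def]) (rule that)
  define b where "b = max r0 (1 / k)"
  have b: "b > 0" "b \<ge> r0" "k * b \<ge> 1"
  proof -
    have le: "1 / k \<le> b" "r0 \<le> b" by (auto simp: b_def)
    show "b > 0" using le(1) k by (meson divide_pos_pos less_le_trans zero_less_one)
    show "b \<ge> r0" by (rule le)
    show "k * b \<ge> 1" using mult_left_mono[OF le(1), of k] k by simp
  qed
  define LR where "LR = (\<lambda>y. \<integral>r. y powr r * (Gamma (\<sigma> * r + 1) * rGamma (r + 1)) * indicator {b<..} r \<partial>lborel)"
  define f where "f = (\<lambda>j x r. x powr (k * r) * rGamma (k * r + (real j - 1/2) + 1) * indicator {b<..} r :: real)"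
  define I where "I = (\<lambda>j x. \<integral>r. f j x r \<partial>lborel)"
  obtain K1 where K1': "K1 \<ge> 0"
   "\<And>y. y > 0 \<Longrightarrow> integrable lborel (\<lambda>r. y powr r * (Gamma (\<sigma> * r + 1) * rGamma (r + 1)) * indicator {b<..} r)"
   "\<And>y. y > 0 \<Longrightarrow> \<bar>(\<integral>r. y powr r * (Gamma (\<sigma> * r + 1) * rGamma (r + 1)) * indicator {b<..} r \<partial>lborel) - wright_psi \<sigma> y\<bar>
       \<le> K1 * (1 + y powr b)"
    by (rule laplace_of_nu[OF \<sigma> less_imp_le[OF b(1)]]) (rule that)
  have K1: "\<bar>LR y - wright_psi \<sigma> y\<bar> \<le> K1 * (1 + y powr b)" if "y > 0" for y
    unfolding LR_def by (rule K1'(3)[OF that])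
  have If: "integrable lborel (f j x)" if x: "x > 0" for j x
  proof -
    have bb: "k * b + (real j - 1/2) \<ge> 0" using b(3) by simp
    show ?thesis
      by (rule integral_powr_rGamma_affine[OF k bb]) (use x in \<open>simp only: f_def\<close>)
  qed
  have Iasy: "(\<lambda>X. exp (- X) * I j X - X powr (1/2 - real j) / k) \<in> O[at_top](\<lambda>X. X powr (1/2 - real M))" for j
  proof -
    have bb: "k * b + (real j - 1/2) \<ge> 0" using b(3) by simp
    obtain Kj where Kj': "Kj \<ge> 0"
      "\<And>x. x > 0 \<Longrightarrow> integrable lborel (\<lambda>r. x powr (k * r) * rGamma (k * r + (real j - 1/2) + 1) * indicator {b<..} r)"
      "\<And>x. x > 0 \<Longrightarrow> \<bar>(\<integral>r. x powr (k * r) * rGamma (k * r + (real j - 1/2) + 1) * indicator {b<..} r \<partial>lborel)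
          - x powr (- (real j - 1/2)) * exp x / k\<bar>
        \<le> x powr (- (real j - 1/2)) / k * (Kj * (1 + x powr (k * b + (real j - 1/2))))"
      by (rule integral_powr_rGamma_affine[OF k bb]) (rule that)
    have Kj: "\<bar>I j x - x powr (- (real j - 1/2)) * exp x / k\<bar>
        \<le> x powr (- (real j - 1/2)) / k * (Kj * (1 + x powr (k * b + (real j - 1/2))))" if "x > 0" for x
      unfolding I_def f_def by (rule Kj'(3)[OF that])
    have "(\<lambda>X. exp (- X) * I j X - X powr (1/2 - real j) / k) \<in>
        O[at_top](\<lambda>X. exp (- X) * (X powr (- (real j - 1/2)) * (1 + X powr (k * b + (real j - 1/2)))))"
    proof (rule bigoI[of _ "Kj / k"])
      show "\<forall>\<^sub>F X in at_top. norm (exp (- X) * I j X - X powr (1/2 - real j) / k) \<le>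
          Kj / k * norm (exp (- X) * (X powr (- (real j - 1/2)) * (1 + X powr (k * b + (real j - 1/2)))))"
        using eventually_gt_at_top[of 0]
      proof eventually_elim
        case (elim X)
        have "exp (- X) * I j X - X powr (1/2 - real j) / k = exp (- X) * (I j X - X powr (- (real j - 1/2)) * exp X / k)"
          by (simp add: right_diff_distrib flip: exp_add)
        then have "norm (exp (- X) * I j X - X powr (1/2 - real j) / k) = exp (- X) * \<bar>I j X - X powr (- (real j - 1/2)) * exp X / k\<bar>"
          by (simp add: abs_mult)
        also have "\<dots> \<le> exp (- X) * (X powr (- (real j - 1/2)) / k * (Kj * (1 + X powr (k * b + (real j - 1/2)))))"
          by (intro mult_left_mono Kj elim) simp
        also have "\<dots> = Kj / k * (exp (- X) * (X powr (- (real j - 1/2)) * (1 + X powr (k * b + (real j - 1/2)))))"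
          by (simp add: field_simps)
        also have "\<dots> = Kj / k * norm (exp (- X) * (X powr (- (real j - 1/2)) * (1 + X powr (k * b + (real j - 1/2)))))"
          by (simp add: abs_mult)
        finally show ?case .
      qed
    qed
    also have "(\<lambda>X. exp (- X) * (X powr (- (real j - 1/2)) * (1 + X powr (k * b + (real j - 1/2))))) \<in> O[at_top](\<lambda>X. X powr (1/2 - real M))"
    proof -
      define u v w where "u = - (real j - 1/2)" and "v = k * b + (real j - 1/2)" and "w = 1/2 - real M"
      have v: "v > 0" using b(3) by (simp add: v_def)
      have "(\<lambda>X::real. exp (- X) * (X powr u * (1 + X powr v))) \<in> O[at_top](\<lambda>X. X powr w)"
        using v by real_asymp
      then show ?thesis unfolding u_def v_def w_def .
    qed
    finally show ?thesis .
  qed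
  define y where "y = (\<lambda>X. X powr k / H)"
  have yr: "y X powr r * H powr r = X powr (k * r)" if "X > 0" for X r
    using that pos(4) by (simp add: y_def powr_divide powr_powr)
  have A: "(\<lambda>X. exp (- X) * (wright_psi \<sigma> (y X) - LR (y X))) \<in> O[at_top](\<lambda>X. X powr (1/2 - real M))"
  proof -
    have "(\<lambda>X. exp (- X) * (wright_psi \<sigma> (y X) - LR (y X))) \<in> O[at_top](\<lambda>X. exp (- X) * (1 + y X powr b))"
    proof (rule bigoI[of _ K1])
      show "\<forall>\<^sub>F X in at_top. norm (exp (- X) * (wright_psi \<sigma> (y X) - LR (y X))) \<le> K1 * norm (exp (- X) * (1 + y X powr b))"
        using eventually_gt_at_top[of 0]
      proof eventually_elim
        case (elim X)
        have "y X > 0" using elim pos(4) by (simp add: y_def)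
        have "norm (exp (- X) * (wright_psi \<sigma> (y X) - LR (y X))) = exp (- X) * \<bar>LR (y X) - wright_psi \<sigma> (y X)\<bar>"
          by (simp add: abs_mult abs_minus_commute)
        also have "\<dots> \<le> exp (- X) * (K1 * (1 + y X powr b))"
          by (intro mult_left_mono K1 \<open>y X > 0\<close>) simp
        also have "\<dots> = K1 * norm (exp (- X) * (1 + y X powr b))" by (simp add: abs_mult)
        finally show ?case .
      qed
    qed
    also have "(\<lambda>X. exp (- X) * (1 + y X powr b)) \<in> O[at_top](\<lambda>X. X powr (1/2 - real M))"
    proof -
      define w where "w = 1/2 - real M"
      have b0: "b > 0" by (rule b(1))
      have "(\<lambda>X. exp (- X) * (1 + (X powr k / H) powr b)) \<in> O[at_top](\<lambda>X. X powr w)"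
        using pos(4) k b0 by real_asymp
      then show ?thesis unfolding w_def y_def .
    qed
    finally show ?thesis .
  qed
  define K0 where "K0 = \<sigma> * kap \<sigma> * Apar \<sigma> / H"
  have B: "(\<lambda>X. exp (- X) * (LR (y X) - K0 * (\<Sum>j<M. c j * I j X))) \<in> O[at_top](\<lambda>X. X powr (1/2 - real M))"
  proof -
    have "(\<lambda>X. exp (- X) * (LR (y X) - K0 * (\<Sum>j<M. c j * I j X))) \<in> O[at_top](\<lambda>X. exp (- X) * I M X)"
    proof (rule bigoI[of _ C])
      show "\<forall>\<^sub>F X in at_top. norm (exp (- X) * (LR (y X) - K0 * (\<Sum>j<M. c j * I j X))) \<le> C * norm (exp (- X) * I M X)"
        using eventually_gt_at_top[of 0]
      proof eventually_elim
        case (elim X)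
        have yX: "y X > 0" using elim pos(4) by (simp add: y_def)
        define g where "g = (\<lambda>r. y X powr r * (Gamma (\<sigma> * r + 1) * rGamma (r + 1)) * indicator {b<..} r)"
        have ig: "integrable lborel g" unfolding g_def by (rule K1'(2)[OF yX])
        have isum: "integrable lborel (\<lambda>r. K0 * (\<Sum>j<M. c j * f j X r))"
          by (intro integrable_mult_right Bochner_Integration.integrable_sum If elim)
        have "LR (y X) - K0 * (\<Sum>j<M. c j * I j X) = (\<integral>r. g r - K0 * (\<Sum>j<M. c j * f j X r) \<partial>lborel)"
          unfolding Bochner_Integration.integral_diff[OF ig isum] unfolding LR_def g_def[symmetric] I_def
          by (simp add: Bochner_Integration.integral_sum If elim)
        also have "\<bar>\<dots>\<bar> \<le> (\<integral>r. C * f M X r \<partial>lborel)"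
        proof -
          have "\<bar>g r - K0 * (\<Sum>j<M. c j * f j X r)\<bar> \<le> C * f M X r" for r
          proof (cases "r > b")
            case True
            have "g r - K0 * (\<Sum>j<M. c j * f j X r) = y X powr r * (Gamma (\<sigma> * r + 1) * rGamma (r + 1) - K0 * H powr r * (\<Sum>j<M. c j * rGamma (kap \<sigma> * r + 1/2 + real j)))"
            proof -
              have "(\<Sum>j<M. c j * f j X r) = X powr (k * r) * (\<Sum>j<M. c j * rGamma (kap \<sigma> * r + 1/2 + real j))"
                unfolding sum_distrib_left using True
                by (intro sum.cong) (auto simp: f_def k_def algebra_simps)
              then show ?thesis using True unfolding yr[OF elim, symmetric] by (simp add: g_def algebra_simps)
            qed
            then have "\<bar>g r - K0 * (\<Sum>j<M. c j * f j X r)\<bar> \<le> y X powr r * (C * H powr r * rGamma (kap \<sigma> * r + 1/2 + real M))"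
              using r0[of r] True b(2) unfolding K0_def by (simp add: abs_mult mult_left_mono)
            also have "\<dots> = C * (X powr (k * r) * rGamma (kap \<sigma> * r + 1/2 + real M))"
              unfolding yr[OF elim, symmetric] by (simp add: mult_ac)
            also have "\<dots> = C * f M X r" using True by (simp add: f_def k_def algebra_simps)
            finally show ?thesis .
          qed (simp add: g_def f_def)
          then show ?thesis
            by (intro abs_lborel_integral_le Bochner_Integration.integrable_diff ig isum integrable_mult_right If elim)
        qed
        also have "\<dots> = C * I M X" by (simp add: I_def)
        finally have le: "\<bar>LR (y X) - K0 * (\<Sum>j<M. c j * I j X)\<bar> \<le> C * I M X" .
        have "norm (exp (- X) * (LR (y X) - K0 * (\<Sum>j<M. c j * I j X))) = exp (- X) * \<bar>LR (y X) - K0 * (\<Sum>j<M. c j * I j X)\<bar>"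
          by (simp add: abs_mult)
        also have "\<dots> \<le> exp (- X) * (C * I M X)" using le by (intro mult_left_mono) auto
        also have "\<dots> \<le> C * norm (exp (- X) * I M X)"
          using mult_left_mono[OF abs_ge_self[of "I M X"], of "C * exp (- X)"] C by (simp add: abs_mult mult_ac)
        finally show ?case .
      qed
    qed
    also have "(\<lambda>X. exp (- X) * I M X) \<in> O[at_top](\<lambda>X. X powr (1/2 - real M))"
    proof -
      have 1: "(\<lambda>X. X powr (1/2 - real M) / k) \<in> O[at_top](\<lambda>X. X powr (1/2 - real M))" using k by simp
      show ?thesis using sum_in_bigo(1)[OF Iasy[of M] 1] by simp
    qed
    finally show ?thesis .
  qed
  have D: "(\<lambda>X. K0 * (\<Sum>j<M. c j * (exp (- X) * I j X - X powr (1/2 - real j) / k))) \<in> O[at_top](\<lambda>X. X powr (1/2 - real M))"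
  proof -
    have "(\<lambda>X. \<Sum>j<M. c j * (exp (- X) * I j X - X powr (1/2 - real j) / k)) \<in> O[at_top](\<lambda>X. X powr (1/2 - real M))"
    proof (rule big_sum_in_bigo)
      fix j show "(\<lambda>X. c j * (exp (- X) * I j X - X powr (1/2 - real j) / k)) \<in> O[at_top](\<lambda>X. X powr (1/2 - real M))"
        using landau_o.big.mult[OF bigo_const[of "c j"] Iasy[of j]] by simp
    qed
    from landau_o.big.mult[OF bigo_const[of K0] this] show ?thesis by simp
  qed
  from sum_in_bigo(1)[OF sum_in_bigo(1)[OF A B] D]
  have "(\<lambda>X. exp (- X) * (wright_psi \<sigma> (y X) - LR (y X)) + exp (- X) * (LR (y X) - K0 * (\<Sum>j<M. c j * I j X))
       + K0 * (\<Sum>j<M. c j * (exp (- X) * I j X - X powr (1/2 - real j) / k))) \<in> O[at_top](\<lambda>X. X powr (1/2 - real M))" .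
  also have "(\<lambda>X. exp (- X) * (wright_psi \<sigma> (y X) - LR (y X)) + exp (- X) * (LR (y X) - K0 * (\<Sum>j<M. c j * I j X))
       + K0 * (\<Sum>j<M. c j * (exp (- X) * I j X - X powr (1/2 - real j) / k)))
      = (\<lambda>X. exp (- X) * wright_psi \<sigma> (y X) - K * (\<Sum>j<M. c j * X powr (1/2 - real j)))"
  proof
    fix X
    have 1: "K0 * (\<Sum>j<M. c j * (exp (- X) * I j X - X powr (1/2 - real j) / k)) =
        exp (- X) * (K0 * (\<Sum>j<M. c j * I j X)) - K0 / k * (\<Sum>j<M. c j * X powr (1/2 - real j))"
      by (simp add: right_diff_distrib sum_subtractf sum_distrib_left mult_ac sum_divide_distrib)
    have "K0 / k = K" using k by (simp add: K0_def K_def k_def)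
    then show "exp (- X) * (wright_psi \<sigma> (y X) - LR (y X)) + exp (- X) * (LR (y X) - K0 * (\<Sum>j<M. c j * I j X))
       + K0 * (\<Sum>j<M. c j * (exp (- X) * I j X - X powr (1/2 - real j) / k))
      = exp (- X) * wright_psi \<sigma> (y X) - K * (\<Sum>j<M. c j * X powr (1/2 - real j))"
      unfolding 1 by (simp add: algebra_simps)
  qed
  finally show ?thesis unfolding y_def k_def .
qed

section \<open>Identification of the saddle coefficients\<close>

lemma integral_affine_atLeast:
  fixes f :: "real \<Rightarrow> complex"
  assumes m: "m > 0" and f: "f absolutely_integrable_on {c..}"
    and g: "(\<lambda>t. f (c + m * t)) absolutely_integrable_on {0..}"
  shows "integral {c..} f = of_real m * integral {0..} (\<lambda>t. f (c + m * t))"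
proof -
  have fi: "f integrable_on {c..}" using f by (simp add: absolutely_integrable_on_def)
  have e: "integral {c..c + m * real n} f = of_real m * integral {0..0 + real n} (\<lambda>t. f (c + m * t))" for n
  proof -
    have "f integrable_on cbox c (c + m * real n)"
      unfolding interval_cbox[symmetric] by (rule integrable_on_subinterval[OF fi]) auto
    then have "(f has_integral integral {c..c + m * real n} f) (cbox c (c + m * real n))"
      by (simp add: integrable_integral)
    from iffD2[OF has_integral_affinity_iff[OF m, where c=c] this]
    have "((\<lambda>t. f (c + m * t)) has_integral (integral {c..c + m * real n} f /\<^sub>R m)) {0..real n}"
      using m by (simp add: add.commute flip: mult.assoc)
    from integral_unique[OF this] m show ?thesis by (simp add: scaleR_conv_of_real)
  qed
  have T: "filterlim (\<lambda>n. m * real n) at_top sequentially"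
    using m by (intro filterlim_tendsto_pos_mult_at_top[OF tendsto_const] filterlim_real_sequentially)
  have "(\<lambda>n. of_real m * integral {0..0 + real n} (\<lambda>t. f (c + m * t))) \<longlonglongrightarrow> integral {c..} f"
    using integral_atLeast_tendsto[OF f T] unfolding e .
  moreover have "(\<lambda>n. of_real m * integral {0..0 + real n} (\<lambda>t. f (c + m * t))) \<longlonglongrightarrow> of_real m * integral {0..} (\<lambda>t. f (c + m * t))"
    by (intro tendsto_mult_left integral_atLeast_tendsto g filterlim_real_sequentially)
  ultimately show ?thesis by (rule LIMSEQ_unique)
qed

definition rphase :: "real \<Rightarrow> real \<Rightarrow> real" where
  "rphase \<sigma> \<rho> = (\<rho> powr \<sigma> - \<sigma> * \<rho>) / kap \<sigma>"

lemma phase_of_real: "\<rho> \<ge> 0 \<Longrightarrow> phase \<sigma> (of_real \<rho>) = of_real (rphase \<sigma> \<rho>)"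
  by (simp add: phase_def rphase_def powr_of_real)

lemma continuous_on_rphase: "\<sigma> > 0 \<Longrightarrow> continuous_on {0..} (rphase \<sigma>)"
  unfolding rphase_def[abs_def] divide_inverse by (intro continuous_intros continuous_on_powr') auto

lemma rphase_has_derivative:
  "\<rho> > 0 \<Longrightarrow> (rphase \<sigma> has_real_derivative (\<sigma> * (\<rho> powr (\<sigma> - 1) - 1) / kap \<sigma>)) (at \<rho>)"
proof -
  assume "\<rho> > 0"
  then have "((\<lambda>\<rho>. \<rho> powr \<sigma> - \<sigma> * \<rho>) has_real_derivative \<sigma> * (\<rho> powr (\<sigma> - 1) - 1)) (at \<rho>)"
    by (auto intro!: derivative_eq_intros simp: right_diff_distrib)
  then show ?thesis unfolding rphase_def[abs_def] by (rule DERIV_cdivide)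
qed

lemma rphase_strict_decreasing:
  assumes \<sigma>: "0 < \<sigma>" "\<sigma> < 1" and ab: "1 \<le> a" "a < b"
  shows "rphase \<sigma> b < rphase \<sigma> a"
proof -
  have "\<exists>z>a. z < b \<and> rphase \<sigma> b - rphase \<sigma> a = (b - a) * (\<sigma> * (z powr (\<sigma> - 1) - 1) / kap \<sigma>)"
    by (rule MVT2[OF ab(2)]) (use ab in \<open>auto intro!: rphase_has_derivative\<close>)
  then obtain z where z: "z > a" "rphase \<sigma> b - rphase \<sigma> a = (b - a) * (\<sigma> * (z powr (\<sigma> - 1) - 1) / kap \<sigma>)" by blast
  have "z powr (\<sigma> - 1) < z powr 0" using z ab \<sigma> by (intro powr_less_mono) auto
  then have "\<sigma> * (z powr (\<sigma> - 1) - 1) < 0" using z ab \<sigma> by (simp add: mult_pos_neg)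
  then have "(b - a) * (\<sigma> * (z powr (\<sigma> - 1) - 1) / kap \<sigma>) < 0"
    using ab positive_parameters(1)[OF \<sigma>] by (simp add: mult_pos_neg divide_neg_pos)
  then show ?thesis using z(2) by simp
qed

lemma rphase_strict_increasing:
  assumes \<sigma>: "0 < \<sigma>" "\<sigma> < 1" and ab: "0 < a" "a < b" "b \<le> 1"
  shows "rphase \<sigma> a < rphase \<sigma> b"
proof -
  have "\<exists>z>a. z < b \<and> rphase \<sigma> b - rphase \<sigma> a = (b - a) * (\<sigma> * (z powr (\<sigma> - 1) - 1) / kap \<sigma>)"
    by (rule MVT2[OF ab(2)]) (use ab in \<open>auto intro!: rphase_has_derivative\<close>)
  then obtain z where z: "z > a" "z < b" "rphase \<sigma> b - rphase \<sigma> a = (b - a) * (\<sigma> * (z powr (\<sigma> - 1) - 1) / kap \<sigma>)" by blast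
  have "z powr 0 < z powr (\<sigma> - 1)"
    using powr_less_mono'[of z "\<sigma> - 1" 0] z ab \<sigma> by auto
  then have "0 < (b - a) * (\<sigma> * (z powr (\<sigma> - 1) - 1) / kap \<sigma>)" 
    using ab \<sigma> z positive_parameters(1)[OF \<sigma>] by simp
  then show ?thesis using z(3) by simp
qed

lemma rphase_1: "\<sigma> < 1 \<Longrightarrow> rphase \<sigma> 1 = 1"
  by (simp add: rphase_def kap_def)

text \<open>
  The phase increases on the left of the saddle and decreases on its right.
\<close>

lemma rphase_away_from_1:
  assumes \<sigma>: "0 < \<sigma>" "\<sigma> < 1" and e: "0 < e"
  obtains \<eta> where "\<eta> > 0" "\<And>t. e \<le> t \<Longrightarrow> rphase \<sigma> (1 + t) \<le> 1 - \<eta>"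
    "\<And>t. e \<le> t \<Longrightarrow> t \<le> 1 \<Longrightarrow> rphase \<sigma> (1 - t) \<le> 1 - \<eta>"
proof -
  define d where "d = min e (1/2)"
  have d: "0 < d" "d < 1" "d \<le> e" using e by (auto simp: d_def)
  define \<eta> where "\<eta> = min (1 - rphase \<sigma> (1 + d)) (1 - rphase \<sigma> (1 - d))"
  have 1: "rphase \<sigma> (1 + d) < 1" using rphase_strict_decreasing[OF \<sigma>, of 1 "1 + d"] d rphase_1[OF \<sigma>(2)] by simp
  have 2: "rphase \<sigma> (1 - d) < 1" using rphase_strict_increasing[OF \<sigma>, of "1 - d" 1] d rphase_1[OF \<sigma>(2)] by simp
  have 3: "rphase \<sigma> (1 - d) \<ge> 0"
  proof -
    have "\<sigma> * (1 - d) \<le> 1 * (1 - d)" using \<sigma> d by (intro mult_right_mono) auto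
    also have "1 * (1 - d) = (1 - d) powr 1" using d by simp
    also have "\<dots> \<le> (1 - d) powr \<sigma>" using \<sigma> d by (intro powr_mono') auto
    finally show ?thesis using positive_parameters(1)[OF \<sigma>] by (simp add: rphase_def)
  qed
  show thesis
  proof (rule that[of \<eta>])
    show "\<eta> > 0" using 1 2 by (simp add: \<eta>_def)
    fix t assume t: "e \<le> t"
    have "rphase \<sigma> (1 + t) \<le> rphase \<sigma> (1 + d)"
      using rphase_strict_decreasing[OF \<sigma>, of "1 + d" "1 + t"] t d by (cases "d = t") auto
    then show "rphase \<sigma> (1 + t) \<le> 1 - \<eta>" by (simp add: \<eta>_def)
    assume t1: "t \<le> 1"
    have "rphase \<sigma> (1 - t) \<le> rphase \<sigma> (1 - d)"
    proof (cases "t = 1")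
      case True then show ?thesis using 3 \<sigma> by (simp add: rphase_def)
    next
      case False
      then show ?thesis using rphase_strict_increasing[OF \<sigma>, of "1 - t" "1 - d"] t t1 d by (cases "d = t") auto
    qed
    then show "rphase \<sigma> (1 - t) \<le> 1 - \<eta>" by (simp add: \<eta>_def)
  qed
qed

lemma rphase_le_affine:
  assumes \<sigma>: "0 < \<sigma>" "\<sigma> < 1"
  obtains C c where "c > 0" "\<And>\<rho>. \<rho> \<ge> 0 \<Longrightarrow> rphase \<sigma> \<rho> \<le> C - c * \<rho>"
proof -
  have h: "\<sigma> / 2 > 0" using \<sigma> by simp
  obtain C where C: "\<And>\<rho>::real. \<rho> \<ge> 0 \<Longrightarrow> 1 * \<rho> powr \<sigma> \<le> C + (\<sigma> / 2) * \<rho>"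
    by (rule powr_le_affine[OF \<sigma>(2) h \<sigma>(1), of 1]) (rule that)
  have k: "kap \<sigma> > 0" by (rule positive_parameters(1)[OF \<sigma>])
  show thesis
  proof (rule that[of "\<sigma> / 2 / kap \<sigma>" "C / kap \<sigma>"])
    show "\<sigma> / 2 / kap \<sigma> > 0" using h k by simp
    fix \<rho> :: real assume "\<rho> \<ge> 0"
    then have "\<rho> powr \<sigma> - \<sigma> * \<rho> \<le> C - \<sigma> / 2 * \<rho>" using C[of \<rho>] by simp
    then have "rphase \<sigma> \<rho> \<le> (C - \<sigma> / 2 * \<rho>) / kap \<sigma>" unfolding rphase_def using k by (intro divide_right_mono) auto
    then show "rphase \<sigma> \<rho> \<le> C / kap \<sigma> - \<sigma> / 2 / kap \<sigma> * \<rho>" by (simp add: diff_divide_distrib)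
  qed
qed

lemma exp_rphase_absolutely_integrable:
  assumes \<sigma>: "0 < \<sigma>" "\<sigma> < 1" and w: "Re w > 0" and a: "a \<ge> 0"
  shows "(\<lambda>t. exp (w * (of_real (rphase \<sigma> (a + t)) - 1))) absolutely_integrable_on {0..}"
proof -
  obtain C c where C: "c > 0" "\<And>\<rho>. \<rho> \<ge> 0 \<Longrightarrow> rphase \<sigma> \<rho> \<le> C - c * \<rho>"
    using rphase_le_affine[OF \<sigma>] by metis
  show ?thesis
  proof (rule continuous_bounded_absolutely_integrable)
    show "continuous_on {0..} (\<lambda>t. exp (w * (of_real (rphase \<sigma> (a + t)) - 1)))"
      by (intro continuous_intros continuous_on_compose2[OF continuous_on_rphase[OF \<sigma>(1)]]) (use a in auto)
    have "(\<lambda>t. exp (Re w * (C - 1)) * exp (- (Re w * c) * t)) integrable_on {0..}"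
      by (intro integrable_on_mult_right integrable_on_exp_minus_to_infinity) (use w C in simp)
    then show "(\<lambda>t. exp (Re w * (C - 1)) * exp (- (Re w * c) * t)) integrable_on {0..}" .
    fix t :: real assume t: "t \<in> {0..}"
    have "c * t \<le> c * (a + t)" using C(1) a by simp
    then have "rphase \<sigma> (a + t) - 1 \<le> (C - 1) - c * t" using C(2)[of "a + t"] t a by simp
    then have "Re w * (rphase \<sigma> (a + t) - 1) \<le> Re w * ((C - 1) - c * t)" using w by (intro mult_left_mono) auto
    then have "Re w * (rphase \<sigma> (a + t) - 1) \<le> Re w * (C - 1) + - (Re w * c) * t" by (simp add: right_diff_distrib mult.assoc)
    then have "exp (Re w * (rphase \<sigma> (a + t) - 1)) \<le> exp (Re w * (C - 1)) * exp (- (Re w * c) * t)"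
      by (simp only: exp_le_cancel_iff flip: exp_add)
    then show "norm (exp (w * (of_real (rphase \<sigma> (a + t)) - 1))) \<le> exp (Re w * (C - 1)) * exp (- (Re w * c) * t)"
      by simp
  qed simp
qed

lemma descent_real_right:
  assumes \<sigma>: "0 < \<sigma>" "\<sigma> < 1" and w: "Re w > 0"
  shows "descent_path \<sigma> w {0..} (\<lambda>t. w * (of_real (rphase \<sigma> (1 + t)) - 1)) (\<lambda>_. 1)"
  unfolding descent_path_def
proof (intro conjI)
  show "continuous_on {0..} (\<lambda>t. w * (of_real (rphase \<sigma> (1 + t)) - 1))"
    by (intro continuous_intros continuous_on_compose2[OF continuous_on_rphase[OF \<sigma>(1)]]) auto
  show "(\<lambda>t. exp (Re (w * (of_real (rphase \<sigma> (1 + t)) - 1))) * norm (1::complex)) integrable_on {0..}"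
    using exp_rphase_absolutely_integrable[OF \<sigma> w, of 1] by (simp add: absolutely_integrable_on_def)
  show "\<forall>e>0. \<exists>\<eta>>0. \<forall>t\<in>{0..}. e \<le> t \<longrightarrow> Re (w * (of_real (rphase \<sigma> (1 + t)) - 1)) \<le> - \<eta>"
  proof (intro allI impI)
    fix e :: real assume "e > 0"
    then obtain \<eta> where \<eta>: "\<eta> > 0" "\<And>t. e \<le> t \<Longrightarrow> rphase \<sigma> (1 + t) \<le> 1 - \<eta>"
      using rphase_away_from_1[OF \<sigma>] by metis
    show "\<exists>\<eta>>0. \<forall>t\<in>{0..}. e \<le> t \<longrightarrow> Re (w * (of_real (rphase \<sigma> (1 + t)) - 1)) \<le> - \<eta>"
    proof (intro exI[of _ "Re w * \<eta>"] conjI ballI impI)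
      fix t assume "e \<le> t"
      then have "Re w * (rphase \<sigma> (1 + t) - 1) \<le> Re w * (- \<eta>)" using \<eta>(2)[of t] w by (intro mult_left_mono) auto
      then show "Re (w * (of_real (rphase \<sigma> (1 + t)) - 1)) \<le> - (Re w * \<eta>)" by simp
    qed (use w \<eta> in simp)
  qed
  have "((\<lambda>t::real. complex_of_real t) has_vector_derivative 1) (at t within {0..1})" for t
    by (auto intro!: derivative_eq_intros simp: has_vector_derivative_def scaleR_conv_of_real)
  moreover have "phase \<sigma> (1 + of_real t) = of_real (rphase \<sigma> (1 + t))" if "t \<ge> 0" for t
    using phase_of_real[of "1 + t" \<sigma>] that by simp
  ultimately show "\<exists>e>0. \<exists>\<gamma>. {0..e} \<subseteq> {0..} \<and> \<gamma> 0 = 0 \<and>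
        (\<forall>t\<in>{0..e}. (\<gamma> has_vector_derivative 1) (at t within {0..e}) \<and>
                     w * (of_real (rphase \<sigma> (1 + t)) - 1) = w * (phase \<sigma> (1 + \<gamma> t) - 1))"
    by (intro exI[of _ 1] conjI exI[of _ "\<lambda>t. complex_of_real t"]) auto
qed auto

lemma descent_real_left:
  assumes \<sigma>: "0 < \<sigma>" "\<sigma> < 1" and w: "Re w > 0"
  shows "descent_path \<sigma> w {0..1} (\<lambda>t. w * (of_real (rphase \<sigma> (1 - t)) - 1)) (\<lambda>_. - 1)"
  unfolding descent_path_def
proof (intro conjI)
  show ct: "continuous_on {0..1} (\<lambda>t. w * (of_real (rphase \<sigma> (1 - t)) - 1))"
    by (intro continuous_intros continuous_on_compose2[OF continuous_on_rphase[OF \<sigma>(1)]]) auto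
  show "(\<lambda>t. exp (Re (w * (of_real (rphase \<sigma> (1 - t)) - 1))) * norm (- 1::complex)) integrable_on {0..1}"
    by (intro integrable_continuous_real continuous_intros ct)
  show "\<forall>e>0. \<exists>\<eta>>0. \<forall>t\<in>{0..1}. e \<le> t \<longrightarrow> Re (w * (of_real (rphase \<sigma> (1 - t)) - 1)) \<le> - \<eta>"
  proof (intro allI impI)
    fix e :: real assume "e > 0"
    then obtain \<eta> where \<eta>: "\<eta> > 0" "\<And>t. e \<le> t \<Longrightarrow> t \<le> 1 \<Longrightarrow> rphase \<sigma> (1 - t) \<le> 1 - \<eta>"
      using rphase_away_from_1[OF \<sigma>] by metis
    show "\<exists>\<eta>>0. \<forall>t\<in>{0..1}. e \<le> t \<longrightarrow> Re (w * (of_real (rphase \<sigma> (1 - t)) - 1)) \<le> - \<eta>"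
    proof (intro exI[of _ "Re w * \<eta>"] conjI ballI impI)
      fix t assume "t \<in> {0..1}" "e \<le> t"
      then have "Re w * (rphase \<sigma> (1 - t) - 1) \<le> Re w * (- \<eta>)" using \<eta>(2)[of t] w by (intro mult_left_mono) auto
      then show "Re (w * (of_real (rphase \<sigma> (1 - t)) - 1)) \<le> - (Re w * \<eta>)" by simp
    qed (use w \<eta> in simp)
  qed
  have "((\<lambda>t::real. - complex_of_real t) has_vector_derivative - 1) (at t within {0..1})" for t
    by (auto intro!: derivative_eq_intros simp: has_vector_derivative_def scaleR_conv_of_real)
  moreover have "phase \<sigma> (1 + - of_real t) = of_real (rphase \<sigma> (1 - t))" if "t \<le> 1" for t
    using phase_of_real[of "1 - t" \<sigma>] that by simp
  ultimately show "\<exists>e>0. \<exists>\<gamma>. {0..e} \<subseteq> {0..1} \<and> \<gamma> 0 = 0 \<and>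
        (\<forall>t\<in>{0..e}. (\<gamma> has_vector_derivative - 1) (at t within {0..e}) \<and>
                     w * (of_real (rphase \<sigma> (1 - t)) - 1) = w * (phase \<sigma> (1 + \<gamma> t) - 1))"
    by (intro exI[of _ 1] conjI exI[of _ "\<lambda>t. - complex_of_real t"]) auto
qed auto

lemma real_axis_integral_split:
  assumes \<sigma>: "0 < \<sigma>" "\<sigma> < 1" and w: "Re w > 0"
  shows "integral {0..} (\<lambda>t. exp (w * (of_real (rphase \<sigma> (1 + t)) - 1)) * 1)
       - integral {0..1} (\<lambda>t. exp (w * (of_real (rphase \<sigma> (1 - t)) - 1)) * (- 1))
       = integral {0..} (\<lambda>\<rho>. exp (w * (of_real (rphase \<sigma> \<rho>) - 1)))"
proof -
  define f where "f = (\<lambda>\<rho>. exp (w * (complex_of_real (rphase \<sigma> \<rho>) - 1)))"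
  have a0: "f absolutely_integrable_on {0..}" using exp_rphase_absolutely_integrable[OF \<sigma> w, of 0] by (simp add: f_def)
  have a1: "f absolutely_integrable_on {1..}" by (rule set_integrable_subset[OF a0]) auto
  have a2: "(\<lambda>t. f (1 + 1 * t)) absolutely_integrable_on {0..}"
    using exp_rphase_absolutely_integrable[OF \<sigma> w, of 1] by (simp add: f_def)
  have 1: "integral {0..} (\<lambda>t. f (1 + t)) = integral {1..} f"
    using integral_affine_atLeast[OF _ a1 a2] by simp
  have 2: "integral {0..1} (\<lambda>t. f (1 - t)) = integral {0..1} f"
  proof -
    have "f integrable_on {0..1}" using a0 by (intro integrable_on_subinterval[of f "{0..}"]) (auto simp: absolutely_integrable_on_def)
    then have "(f has_integral integral {0..1} f) (cbox 0 1)" by (simp add: integrable_integral)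
    from has_integral_affinity[OF this, of "- 1" 1]
    have "((\<lambda>t. f (1 - t)) has_integral integral {0..1} f) {0..1}"
      by (simp add: image_affinity_atLeastAtMost)
    then show ?thesis by (rule integral_unique)
  qed
  have "integral {0..} f = integral {0..1} f + integral {1..} f" by (rule integral_atLeast_split[OF a0]) simp
  then show ?thesis using 1 2 by (simp add: f_def)
qed

lemma wright_psi_scaled:
  assumes \<sigma>: "0 < \<sigma>" "\<sigma> < 1" and X: "X > 0"
  shows "of_real (exp (- X) * wright_psi \<sigma> (X powr kap \<sigma> / (hpar \<sigma> * kap \<sigma> powr kap \<sigma>))) =
     of_real (\<sigma> * X / kap \<sigma>) * integral {0..} (\<lambda>\<rho>. exp (of_real X * (complex_of_real (rphase \<sigma> \<rho>) - 1)))"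
proof -
  note pos = positive_parameters[OF \<sigma>]
  define y where "y = X powr kap \<sigma> / (hpar \<sigma> * kap \<sigma> powr kap \<sigma>)"
  define m where "m = \<sigma> * X / kap \<sigma>"
  have m: "m > 0" using \<sigma> X pos by (simp add: m_def)
  define g where "g = (\<lambda>t::real. exp (- t + y * t powr \<sigma>))"
  have y: "y * m powr \<sigma> = X / kap \<sigma>"
  proof -
    have "m powr \<sigma> = \<sigma> powr \<sigma> * X powr \<sigma> / kap \<sigma> powr \<sigma>" using \<sigma> X pos by (simp add: m_def powr_mult powr_divide)
    then have "y * m powr \<sigma> = (X powr kap \<sigma> * X powr \<sigma>) / (kap \<sigma> powr kap \<sigma> * kap \<sigma> powr \<sigma>)"
      using \<sigma> by (simp add: y_def hpar_def field_simps)
    also have "\<dots> = X / kap \<sigma>" using X pos by (simp add: kap_def flip: powr_add)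
    finally show ?thesis .
  qed
  have gm: "g (0 + m * \<rho>) = exp (X * rphase \<sigma> \<rho>)" if "\<rho> \<ge> 0" for \<rho>
  proof -
    have "y * (m * \<rho>) powr \<sigma> = X / kap \<sigma> * \<rho> powr \<sigma>"
      using m that by (simp add: powr_mult flip: y)
    moreover have "- (m * \<rho>) + X / kap \<sigma> * \<rho> powr \<sigma> = X * rphase \<sigma> \<rho>"
      using pos(1) by (simp add: m_def rphase_def field_simps)
    ultimately show ?thesis by (simp add: g_def)
  qed
  have si: "set_integrable lborel {0<..} g"
    unfolding set_integrable_def using integrable_wright_psi[OF \<sigma>, of y] by (simp add: g_def mult.commute)
  have psi: "wright_psi \<sigma> y = integral {0<..} g"
    using set_borel_integral_eq_integral(2)[OF si]
    by (simp add: wright_psi_def set_lebesgue_integral_def g_def mult.commute)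
  have gi: "g integrable_on {0<..}" using set_borel_integral_eq_integral(1)[OF si] .
  have h0: "(g has_integral wright_psi \<sigma> y) {0..}"
  proof -
    have n: "negligible {x \<in> {0..} - {0<..}. g x \<noteq> 0}" "negligible {x \<in> {0<..} - {0..}. g x \<noteq> 0}"
      by (rule negligible_subset[of "{0::real}"], simp, force)+
    show ?thesis unfolding has_integral_spike_set_eq[OF n] psi by (rule integrable_integral[OF gi])
  qed
  have ac: "(\<lambda>t. complex_of_real (g t)) absolutely_integrable_on {0..}"
  proof (rule continuous_bounded_absolutely_integrable)
    show "continuous_on {0..} (\<lambda>t. complex_of_real (g t))"
      unfolding g_def by (intro continuous_intros continuous_on_powr') (use \<sigma> in auto)
    show "g integrable_on {0..}" using h0 by (rule has_integral_integrable)
  qed (auto simp: g_def)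
  have ac2: "(\<lambda>\<rho>. complex_of_real (g (0 + m * \<rho>))) absolutely_integrable_on {0..}"
  proof -
    have "(\<lambda>\<rho>. of_real (exp X) * exp (of_real X * (complex_of_real (rphase \<sigma> (0 + \<rho>)) - 1))) absolutely_integrable_on {0..}"
      by (intro set_integrable_mult_right exp_rphase_absolutely_integrable \<sigma>) (use X in auto)
    then show ?thesis
    proof (rule absolutely_integrable_spike[of _ _ "{}"])
      fix \<rho> :: real assume "\<rho> \<in> {0..} - {}"
      then show "complex_of_real (g (0 + m * \<rho>)) = of_real (exp X) * exp (of_real X * (complex_of_real (rphase \<sigma> (0 + \<rho>)) - 1))"
        unfolding exp_of_real[symmetric] exp_add[symmetric] using gm[of \<rho>] by (simp add: algebra_simps flip: exp_of_real)
    qed simp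
  qed
  have "complex_of_real (wright_psi \<sigma> y) = integral {0..} (\<lambda>t. complex_of_real (g t))"
    using has_integral_of_real[OF h0, where 'b=complex] integral_unique by metis
  also have "\<dots> = of_real m * integral {0..} (\<lambda>\<rho>. complex_of_real (g (0 + m * \<rho>)))"
    by (rule integral_affine_atLeast[OF m ac ac2])
  also have "integral {0..} (\<lambda>\<rho>. complex_of_real (g (0 + m * \<rho>))) =
      integral {0..} (\<lambda>\<rho>. of_real (exp X) * exp (of_real X * (complex_of_real (rphase \<sigma> \<rho>) - 1)))"
  proof (rule integral_cong)
    fix \<rho> :: real assume "\<rho> \<in> {0..}"
    then show "complex_of_real (g (0 + m * \<rho>)) = of_real (exp X) * exp (of_real X * (complex_of_real (rphase \<sigma> \<rho>) - 1))"
      unfolding exp_of_real[symmetric] exp_add[symmetric] using gm[of \<rho>] by (simp add: algebra_simps flip: exp_of_real)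
  qed
  also have "\<dots> = of_real (exp X) * integral {0..} (\<lambda>\<rho>. exp (of_real X * (complex_of_real (rphase \<sigma> \<rho>) - 1)))"
    by (rule integral_mult_right)
  finally have *: "complex_of_real (wright_psi \<sigma> y) = of_real m * (of_real (exp X) * integral {0..} (\<lambda>\<rho>. exp (of_real X * (complex_of_real (rphase \<sigma> \<rho>) - 1))))" .
  have "complex_of_real (exp (- X)) * of_real (exp X) = 1" by (simp flip: of_real_mult exp_add)
  then show ?thesis unfolding y_def[symmetric] m_def[symmetric] of_real_mult * 
    by (metis (no_types, lifting) mult.commute mult.left_commute mult_1)
qed

text \<open>
  Two expansions of the same function in powers of \<open>1 / X\<close> have the same coefficients;
  this compares the saddle point expansion with the one derived from the hypothesis.
\<close>

lemma asymptotic_coefficients_unique: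
  fixes d :: "nat \<Rightarrow> complex"
  assumes "\<And>M. M \<ge> 1 \<Longrightarrow> (\<lambda>X. \<Sum>j<M. d j * of_real (X powr (- real j))) \<in> O[at_top](\<lambda>X. complex_of_real (X powr (- real M)))"
  shows "d j = 0"
proof (induction j rule: less_induct)
  case (less j)
  have "(\<lambda>X. \<Sum>i<Suc j. d i * of_real (X powr (- real i))) = (\<lambda>X. d j * of_real (X powr (- real j)))"
    using less.IH by (intro ext) (simp add: sum.lessThan_Suc)
  with assms[of "Suc j"] have "(\<lambda>X. d j * of_real (X powr (- real j))) \<in> O[at_top](\<lambda>X. complex_of_real (X powr (- real (Suc j))))"
    by simp
  then obtain C where "C > 0" and C: "\<forall>\<^sub>F X in at_top. norm (d j * of_real (X powr (- real j))) \<le> C * norm (complex_of_real (X powr (- real (Suc j))))"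
    by (rule landau_o.bigE)
  have "\<forall>\<^sub>F X in at_top. norm (d j) \<le> C / X"
    using C eventually_gt_at_top[of 0]
  proof eventually_elim
    case (elim X)
    have p: "X powr (- real j) > 0" using elim by simp
    have "X powr (- real (Suc j)) = X powr (- real j) * (1 / X)"
      using elim by (simp add: powr_diff powr_minus field_simps)
    then have "norm (d j) * X powr (- real j) \<le> (C / X) * X powr (- real j)"
      using elim by (simp add: norm_mult norm_divide mult_ac)
    with p show ?case by (simp only: mult_le_cancel_right_pos)
  qed
  moreover have "((\<lambda>X. C / X) \<longlongrightarrow> 0) at_top" by real_asymp
  ultimately have "norm (d j) \<le> 0"
    by (intro tendsto_le[OF _ _ tendsto_const, of at_top "\<lambda>X. C / X"]) auto
  then show ?case by simp
qed

text \<open>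
  The coefficients of the two-sided Laplace expansion are universal, so they can be read off from
  one contour. On the real axis, with \<open>\<mu> = 1\<close>, the integral is
  \<open>wright_psi\<close>, and its expansion in terms of the \<open>c j\<close> is known from the
  hypothesis.
\<close>

lemma saddle_expansion:
  fixes \<sigma> :: real
  assumes \<sigma>: "0 < \<sigma>" "\<sigma> < 1" and ifc: "inverse_factorial_coeffs \<sigma> c"
    and \<mu>: "norm \<mu> = 1" and b: "descent_path \<sigma> (\<mu>\<^sup>2) Db hb ab" "Re (\<mu> * ab 0) > 0"
    and a: "descent_path \<sigma> (\<mu>\<^sup>2) Da ha aa" "Re (\<mu> * aa 0) < 0"
  shows "(\<lambda>X. integral Db (\<lambda>t. exp (of_real X * hb t) * ab t) - integral Da (\<lambda>t. exp (of_real X * ha t) * aa t)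
           - of_real (sqrt (2 * pi / \<sigma>)) / (\<mu> * of_real (sqrt X)) * (\<Sum>j<M. of_real (c j) / (of_real X * \<mu>\<^sup>2) ^ j))
        \<in> O[at_top](\<lambda>X. complex_of_real (X powr (-1/2 - real M)))"
proof -
  note pos = positive_parameters[OF \<sigma>]
  obtain v :: "nat \<Rightarrow> complex" where v:
    "\<And>\<mu> Da ha aa Db hb ab M. \<lbrakk>norm \<mu> = 1; descent_path \<sigma> (\<mu>\<^sup>2) Db hb ab; Re (\<mu> * ab 0) > 0;
       descent_path \<sigma> (\<mu>\<^sup>2) Da ha aa; Re (\<mu> * aa 0) < 0\<rbrakk> \<Longrightarrow>
      (\<lambda>X. integral Db (\<lambda>t. exp (of_real X * hb t) * ab t) - integral Da (\<lambda>t. exp (of_real X * ha t) * aa t)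
           - of_real (sqrt pi) / (\<mu> * of_real (sqrt X)) * (\<Sum>j<M. v j / (of_real X * \<mu>\<^sup>2) ^ j))
        \<in> O[at_top](\<lambda>X. complex_of_real (X powr (-1/2 - real M)))"
    by (rule laplace_two_sided[OF \<sigma>]) (rule that)
  define J where "J = (\<lambda>X. integral {0..} (\<lambda>\<rho>. exp (of_real X * (complex_of_real (rphase \<sigma> \<rho>) - 1))))"
  define k where "k = \<sigma> / kap \<sigma>"
  have k: "k > 0" using \<sigma> pos by (simp add: k_def)
  define H where "H = hpar \<sigma> * kap \<sigma> powr kap \<sigma>"
  have K: "\<sigma> * Apar \<sigma> / H = k * sqrt (2 * pi / \<sigma>)"
  proof -
    have "(\<sigma> / kap \<sigma>) powr \<sigma> = hpar \<sigma> / kap \<sigma> powr \<sigma>" using \<sigma> pos by (simp add: hpar_def powr_divide)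
    then have "\<sigma> * Apar \<sigma> / H = \<sigma> * sqrt (2 * pi / \<sigma>) / (kap \<sigma> powr \<sigma> * kap \<sigma> powr kap \<sigma>)"
      using pos by (simp add: Apar_def H_def)
    also have "kap \<sigma> powr \<sigma> * kap \<sigma> powr kap \<sigma> = kap \<sigma>" using pos by (simp add: kap_def flip: powr_add)
    finally show ?thesis by (simp add: k_def)
  qed
  have 1: "(\<lambda>X. J X - of_real (sqrt pi) / of_real (sqrt X) * (\<Sum>j<M. v j / of_real X ^ j))
        \<in> O[at_top](\<lambda>X. complex_of_real (X powr (-1/2 - real M)))" for M
  proof -
    have "descent_path \<sigma> (1\<^sup>2) {0..} (\<lambda>t. 1 * (of_real (rphase \<sigma> (1 + t)) - 1)) (\<lambda>_. 1)"
      "descent_path \<sigma> (1\<^sup>2) {0..1} (\<lambda>t. 1 * (of_real (rphase \<sigma> (1 - t)) - 1)) (\<lambda>_. - 1)"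
      using descent_real_right[OF \<sigma>, of 1] descent_real_left[OF \<sigma>, of 1] by simp_all
    from v[OF _ this(1) _ this(2), of M]
    have "(\<lambda>X. integral {0..} (\<lambda>t. exp (of_real X * (1 * (of_real (rphase \<sigma> (1 + t)) - 1))) * 1)
         - integral {0..1} (\<lambda>t. exp (of_real X * (1 * (of_real (rphase \<sigma> (1 - t)) - 1))) * (- 1))
           - of_real (sqrt pi) / (1 * of_real (sqrt X)) * (\<Sum>j<M. v j / (of_real X * 1\<^sup>2) ^ j))
        \<in> O[at_top](\<lambda>X. complex_of_real (X powr (-1/2 - real M)))" by simp
    also have "?this \<longleftrightarrow> ?thesis"
    proof (rule landau_o.big.in_cong)
      show "\<forall>\<^sub>F X in at_top. integral {0..} (\<lambda>t. exp (of_real X * (1 * (of_real (rphase \<sigma> (1 + t)) - 1))) * 1)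
         - integral {0..1} (\<lambda>t. exp (of_real X * (1 * (of_real (rphase \<sigma> (1 - t)) - 1))) * (- 1))
           - of_real (sqrt pi) / (1 * of_real (sqrt X)) * (\<Sum>j<M. v j / (of_real X * 1\<^sup>2) ^ j)
         = J X - of_real (sqrt pi) / of_real (sqrt X) * (\<Sum>j<M. v j / of_real X ^ j)"
        using eventually_gt_at_top[of 0]
      proof eventually_elim
        case (elim X)
        then show ?case using real_axis_integral_split[OF \<sigma>, of "of_real X"] by (simp add: J_def)
      qed
    qed
    finally show ?thesis .
  qed
  define d where "d = (\<lambda>j. of_real k * of_real (sqrt pi) * v j - of_real (k * sqrt (2 * pi / \<sigma>) * c j))"
  have "d j = 0" for j
  proof (rule asymptotic_coefficients_unique)
    fix M :: nat assume M: "M \<ge> 1"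
    have 2: "(\<lambda>X. exp (- X) * wright_psi \<sigma> (X powr kap \<sigma> / H) - k * sqrt (2 * pi / \<sigma>) * (\<Sum>j<M. c j * X powr (1/2 - real j)))
           \<in> O[at_top](\<lambda>X. X powr (1/2 - real M))"
      using wright_psi_expansion[OF \<sigma> ifc M] unfolding H_def[symmetric] K .
    then obtain C where C: "\<forall>\<^sub>F X in at_top. norm (exp (- X) * wright_psi \<sigma> (X powr kap \<sigma> / H) - k * sqrt (2 * pi / \<sigma>) * (\<Sum>j<M. c j * X powr (1/2 - real j)))
        \<le> C * norm (X powr (1/2 - real M))" by (rule landau_o.bigE)
    have 3: "(\<lambda>X. complex_of_real (exp (- X) * wright_psi \<sigma> (X powr kap \<sigma> / H) - k * sqrt (2 * pi / \<sigma>) * (\<Sum>j<M. c j * X powr (1/2 - real j))))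
           \<in> O[at_top](\<lambda>X. complex_of_real (X powr (1/2 - real M)))"
      by (rule bigoI[of _ C]) (use C in \<open>simp only: norm_of_real real_norm_def\<close>)
    have p1: "(\<lambda>X. complex_of_real (k * X)) \<in> O[at_top](\<lambda>X. complex_of_real (X powr 1))"
      by (rule bigoI[of _ "k"], rule eventually_mono[OF eventually_gt_at_top[of 0]]) (use k in \<open>simp add: norm_mult\<close>)
    have 4: "(\<lambda>X. complex_of_real (k * X) * (J X - of_real (sqrt pi) / of_real (sqrt X) * (\<Sum>j<M. v j / of_real X ^ j)))
        \<in> O[at_top](\<lambda>X. complex_of_real (X powr (1/2 - real M)))"
      using powr_mult_bigo[OF p1 1[of M]] by (simp add: algebra_simps)
    have 5: "(\<lambda>X. complex_of_real (X powr (-1/2))) \<in> O[at_top](\<lambda>X. complex_of_real (X powr (-1/2)))" by simp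
    from powr_mult_bigo[OF 5 sum_in_bigo(2)[OF 3 4]]
    have "(\<lambda>X. complex_of_real (X powr (-1/2)) * (complex_of_real (exp (- X) * wright_psi \<sigma> (X powr kap \<sigma> / H) - k * sqrt (2 * pi / \<sigma>) * (\<Sum>j<M. c j * X powr (1/2 - real j)))
        - complex_of_real (k * X) * (J X - of_real (sqrt pi) / of_real (sqrt X) * (\<Sum>j<M. v j / of_real X ^ j))))
        \<in> O[at_top](\<lambda>X. complex_of_real (X powr (- real M)))" by simp
    also have "?this \<longleftrightarrow> ((\<lambda>X. \<Sum>j<M. d j * of_real (X powr (- real j))) \<in> O[at_top](\<lambda>X. complex_of_real (X powr (- real M))))"
    proof (rule landau_o.big.in_cong)
      show "\<forall>\<^sub>F X in at_top. complex_of_real (X powr (-1/2)) * (complex_of_real (exp (- X) * wright_psi \<sigma> (X powr kap \<sigma> / H) - k * sqrt (2 * pi / \<sigma>) * (\<Sum>j<M. c j * X powr (1/2 - real j)))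
        - complex_of_real (k * X) * (J X - of_real (sqrt pi) / of_real (sqrt X) * (\<Sum>j<M. v j / of_real X ^ j)))
         = (\<Sum>j<M. d j * of_real (X powr (- real j)))"
        using eventually_gt_at_top[of 0]
      proof eventually_elim
        case (elim X)
        define S V where "S = (\<Sum>j<M. c j * X powr (- real j))" and "V = (\<Sum>j<M. v j * of_real (X powr (- real j)))"
        define h where "h = X powr (1/2)"
        have h: "h > 0" "h * h = X" "sqrt X = h" "X powr (-1/2) = 1 / h"
        proof -
          have "h = sqrt X" using elim by (simp add: h_def powr_half_sqrt)
          then show "h > 0" "h * h = X" "sqrt X = h" using elim by simp_all
          show "X powr (-1/2) = 1 / h" using powr_minus_divide[of X "1/2"] by (simp add: h_def)
        qed
        have s1: "(\<Sum>j<M. c j * X powr (1/2 - real j)) = h * S"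
          unfolding S_def h_def sum_distrib_left
        proof (intro sum.cong refl)
          fix j
          have "X powr (1/2 - real j) = X powr (1/2) * X powr (- real j)" by (simp flip: powr_add)
          then show "c j * X powr (1/2 - real j) = X powr (1/2) * (c j * X powr (- real j))" by simp
        qed
        have s2: "(\<Sum>j<M. v j / of_real X ^ j) = V"
          unfolding V_def
        proof (intro sum.cong refl)
          fix j
          have "X powr (- real j) = 1 / X ^ j" using elim by (simp add: powr_minus_divide powr_realpow)
          then show "v j / of_real X ^ j = v j * of_real (X powr (- real j))" by simp
        qed
        have s3: "complex_of_real (exp (- X) * wright_psi \<sigma> (X powr kap \<sigma> / H)) = of_real (k * X) * J X"
          using wright_psi_scaled[OF \<sigma> elim] by (simp add: H_def J_def k_def)
        have s4: "(\<Sum>j<M. d j * of_real (X powr (- real j))) = of_real k * of_real (sqrt pi) * V - of_real (k * sqrt (2 * pi / \<sigma>)) * of_real S"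
          unfolding d_def V_def S_def of_real_sum sum_distrib_left sum_subtractf[symmetric]
          by (intro sum.cong refl) (simp add: algebra_simps)
        have hx: "complex_of_real X = of_real h * of_real h" using h(2) by (metis of_real_mult)
        have h0: "complex_of_real h \<noteq> 0" using h(1) by simp
        have alg: "1 / h * (k * (h * h) * J - k * s * (h * S) - k * (h * h) * (J - P / h * V)) = k * P * V - k * s * S"
          if "h \<noteq> 0" for h k J s S P V :: complex
        proof -
          have "h * (P / h * V) = P * V" using that by simp
          then have "k * (h * h) * J - k * s * (h * S) - k * (h * h) * (J - P / h * V) = h * (k * P * V - k * s * S)"
            by algebra
          then show ?thesis using that by simp
        qed
        show ?case unfolding s1 s2 s4 of_real_diff s3
          unfolding h(3,4) of_real_mult hx of_real_divide of_real_1
          by (rule alg[OF h0])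
      qed
    qed
    finally show "(\<lambda>X. \<Sum>j<M. d j * of_real (X powr (- real j))) \<in> O[at_top](\<lambda>X. complex_of_real (X powr (- real M)))" .
  qed
  then have vc: "of_real (sqrt pi) * v j = of_real (sqrt (2 * pi / \<sigma>)) * of_real (c j)" for j
    using k by (simp add: d_def algebra_simps)
  have e: "of_real (sqrt pi) / (\<mu> * of_real (sqrt X)) * (\<Sum>j<M. v j / (of_real X * \<mu>\<^sup>2) ^ j) =
     of_real (sqrt (2 * pi / \<sigma>)) / (\<mu> * of_real (sqrt X)) * (\<Sum>j<M. of_real (c j) / (of_real X * \<mu>\<^sup>2) ^ j)" for X
  proof -
    have "of_real (sqrt pi) * (\<Sum>j<M. v j / (of_real X * \<mu>\<^sup>2) ^ j) = of_real (sqrt (2 * pi / \<sigma>)) * (\<Sum>j<M. of_real (c j) / (of_real X * \<mu>\<^sup>2) ^ j)"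
      unfolding sum_distrib_left times_divide_eq_right vc ..
    then show ?thesis unfolding times_divide_eq_left by (rule arg_cong)
  qed
  show ?thesis using v[OF \<mu> b a, of M] unfolding e .
qed

section \<open>Integral representation of the series\<close>

lemma has_integral_atLeast_0_iff:
  fixes f :: "real \<Rightarrow> 'a::banach"
  shows "(f has_integral I) {0..} \<longleftrightarrow> (f has_integral I) {0<..}"
proof (rule has_integral_spike_set_eq)
  show "negligible {x \<in> {0..} - {0<..}. f x \<noteq> 0}" "negligible {x \<in> {0<..} - {0..}. f x \<noteq> 0}"
    by (rule negligible_subset[of "{0::real}"], simp, force)+
qed

text \<open>
  Expanding the second exponential and integrating term by term gives a series with
  \<open>\<Gamma>(\<sigma> n + 1)\<close> in place of the reciprocal gamma function; the factor
  \<open>cis (pi * \<sigma>)\<close> supplies the sine of the reflection formula.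
\<close>

definition wright_int :: "real \<Rightarrow> real \<Rightarrow> complex" where
  "wright_int \<sigma> x = integral {0..} (\<lambda>t. exp (- of_real t - of_real x * cis (pi * \<sigma>) * of_real (t powr \<sigma>)))"

lemma exp_powr_dominating:
  fixes \<sigma> y :: real
  assumes "0 < \<sigma>" "\<sigma> < 1"
  shows "(\<lambda>t. exp (- t + y * t powr \<sigma>)) integrable_on {0<..}"
proof -
  have si: "set_integrable lborel {0<..} (\<lambda>t. exp (- t + y * t powr \<sigma>))"
    unfolding set_integrable_def using integrable_wright_psi[OF assms, of y] by (simp add: mult.commute)
  show ?thesis using set_borel_integral_eq_integral(1)[OF si] .
qed

lemma wright_int_sums:
  assumes \<sigma>: "0 < \<sigma>" "\<sigma> < 1"
  shows "(\<lambda>n. (- of_real x * cis (pi * \<sigma>)) ^ n / fact n * of_real (Gamma (\<sigma> * real n + 1))) sums wright_int \<sigma> x"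
proof -
  define z where "z = - of_real x * cis (pi * \<sigma>)"
  define f where "f = (\<lambda>t. exp (- of_real t - of_real x * cis (pi * \<sigma>) * of_real (t powr \<sigma>)))"
  define s where "s = (\<lambda>N t. \<Sum>n<N. z ^ n / fact n * of_real (t powr (\<sigma> * real n) / exp t))"
  have nz: "norm z = \<bar>x\<bar>" by (simp add: z_def norm_mult)
  have pw: "(z * of_real (t powr \<sigma>)) ^ n /\<^sub>R fact n * exp (- of_real t) = z ^ n / fact n * of_real (t powr (\<sigma> * real n) / exp t)"
    if "t > 0" for t n
  proof -
    have "(t powr \<sigma>) ^ n = t powr (\<sigma> * real n)" using that by (simp add: powr_powr flip: powr_realpow)
    then have "(complex_of_real (t powr \<sigma>)) ^ n = of_real (t powr (\<sigma> * real n))" by (metis of_real_power)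
    then show ?thesis by (simp add: power_mult_distrib exp_minus scaleR_conv_of_real exp_of_real divide_inverse mult_ac)
  qed
  have int: "(s N has_integral (\<Sum>n<N. z ^ n / fact n * of_real (Gamma (\<sigma> * real n + 1)))) {0<..}" for N
    unfolding s_def
  proof (intro has_integral_sum has_integral_mult_right)
    fix n assume "n \<in> {..<N}"
    have "\<sigma> * real n + 1 > 0" using \<sigma> by (simp add: add_nonneg_pos)
    from Gamma_integral_real[OF this]
    have "((\<lambda>t. t powr (\<sigma> * real n) / exp t) has_integral Gamma (\<sigma> * real n + 1)) {0<..}"
      by (simp add: has_integral_atLeast_0_iff)
    from has_integral_of_real[OF this]
    show "((\<lambda>t. complex_of_real (t powr (\<sigma> * real n) / exp t)) has_integral of_real (Gamma (\<sigma> * real n + 1))) {0<..}" .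
  qed simp
  have dom: "norm (s N t) \<le> exp (- t + \<bar>x\<bar> * t powr \<sigma>)" if t: "t \<in> {0<..}" for N t
  proof -
    have "norm (s N t) \<le> (\<Sum>n<N. norm (z ^ n / fact n * of_real (t powr (\<sigma> * real n) / exp t)))"
      unfolding s_def by (rule norm_sum)
    also have "\<dots> = (\<Sum>n<N. (\<bar>x\<bar> * t powr \<sigma>) ^ n /\<^sub>R fact n) * exp (- t)"
      unfolding sum_distrib_right
    proof (rule sum.cong)
      fix n
      have "(t powr \<sigma>) ^ n = t powr (\<sigma> * real n)" using t by (simp add: powr_powr flip: powr_realpow)
      then show "norm (z ^ n / fact n * of_real (t powr (\<sigma> * real n) / exp t)) = (\<bar>x\<bar> * t powr \<sigma>) ^ n /\<^sub>R fact n * exp (- t)"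
        by (simp add: norm_mult norm_divide norm_inverse norm_power nz power_mult_distrib exp_minus divide_inverse)
    qed simp
    also have "\<dots> \<le> exp (\<bar>x\<bar> * t powr \<sigma>) * exp (- t)"
    proof (rule mult_right_mono)
      show "(\<Sum>n<N. (\<bar>x\<bar> * t powr \<sigma>) ^ n /\<^sub>R fact n) \<le> exp (\<bar>x\<bar> * t powr \<sigma>)"
        unfolding exp_def by (intro sum_le_suminf summable_exp_generic) auto
    qed simp
    finally show ?thesis unfolding exp_add by (simp only: mult.commute)
  qed
  have conv: "(\<lambda>N. s N t) \<longlonglongrightarrow> f t" if t: "t \<in> {0<..}" for t
  proof -
    have t0: "t > 0" using t by simp
    have "exp (z * of_real (t powr \<sigma>)) * exp (- of_real t) = f t"
      unfolding f_def z_def mult_exp_exp by (rule arg_cong[of _ _ exp]) simp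
    moreover have "(\<lambda>n. (z * of_real (t powr \<sigma>)) ^ n /\<^sub>R fact n * exp (- of_real t)) sums (exp (z * of_real (t powr \<sigma>)) * exp (- of_real t))"
      by (intro sums_mult2 exp_converges)
    ultimately show ?thesis unfolding pw[OF t0] s_def sums_def by metis
  qed
  have "(\<lambda>N. integral {0<..} (s N)) \<longlonglongrightarrow> integral {0<..} f"
    by (rule dominated_convergence(2)[OF has_integral_integrable[OF int] exp_powr_dominating[OF \<sigma>, of "\<bar>x\<bar>"] dom conv])
  moreover have "integral {0<..} f = wright_int \<sigma> x"
  proof -
    have "f integrable_on {0<..}"
      by (rule dominated_convergence(1)[OF has_integral_integrable[OF int] exp_powr_dominating[OF \<sigma>, of "\<bar>x\<bar>"] dom conv])
    then have "(f has_integral integral {0<..} f) {0..}" by (simp add: has_integral_atLeast_0_iff integrable_integral)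
    then show ?thesis unfolding wright_int_def f_def by (simp add: integral_unique)
  qed
  ultimately show ?thesis unfolding sums_def integral_unique[OF int] z_def by simp
qed

lemma Im_of_real_mult: "Im (of_real a * z) = a * Im z"
  by simp

lemma rGamma_reflect_real:
  fixes a :: real
  assumes "a > 0"
  shows "rGamma (1 - a) = Gamma a * sin (pi * a) / pi"
proof -
  have "complex_of_real (rGamma a * rGamma (1 - a)) = of_real (sin (pi * a) / pi)"
  proof -
    have 1: "1 - of_real a = complex_of_real (1 - a)" by simp
    have 2: "sin (of_real pi * of_real a) = complex_of_real (sin (pi * a))" by (metis of_real_mult sin_of_real)
    show ?thesis
      using rGamma_reflection_complex[of "of_real a"] unfolding 1 2 rGamma_complex_of_real of_real_mult of_real_divide .
  qed
  then have "rGamma a * rGamma (1 - a) = sin (pi * a) / pi" by (simp only: of_real_eq_iff)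
  then have "Gamma a * (rGamma a * rGamma (1 - a)) = Gamma a * (sin (pi * a) / pi)" by (rule arg_cong)
  then have "(Gamma a * rGamma a) * rGamma (1 - a) = Gamma a * sin (pi * a) / pi"
    unfolding mult.assoc times_divide_eq_right .
  moreover have "Gamma a * rGamma a = 1" using Gamma_real_pos[OF assms] by (simp add: rGamma_inverse_Gamma)
  ultimately show ?thesis by simp
qed

text \<open>
  By the reflection formula \<open>1 / \<Gamma>(1 - a) = \<Gamma>(a) sin(\<pi> a) / \<pi>\<close>
  with \<open>a = (n + 1) \<sigma>\<close>. The sine is the imaginary part of the power of
  \<open>cis (pi * \<sigma>)\<close>, and the real term of index \<open>0\<close> in the integral
  drops out, which explains the shift of the index and the factor \<open>x\<close>.
\<close>

lemma M_wright_eq_wright_int: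
  assumes \<sigma>: "0 < \<sigma>" "\<sigma> < 1" and x: "x \<noteq> 0"
  shows "pi * \<sigma> * x * M_wright \<sigma> x = - Im (wright_int \<sigma> x)"
proof -
  define c where "c = (\<lambda>n. (- of_real x * cis (pi * \<sigma>)) ^ n / fact n * complex_of_real (Gamma (\<sigma> * real n + 1)))"
  define T where "T = (\<lambda>n. (- x) ^ n / fact n * rGamma (- (real n * \<sigma>) + 1 - \<sigma>))"
  have "(\<lambda>n. Im (c n)) sums Im (wright_int \<sigma> x)"
    unfolding c_def by (intro sums_Im wright_int_sums \<sigma>)
  moreover have "Im (c 0) = 0" by (simp add: c_def)
  ultimately have s: "(\<lambda>n. Im (c (Suc n))) sums Im (wright_int \<sigma> x)"
    using sums_Suc_iff[of "\<lambda>n. Im (c n)" "Im (wright_int \<sigma> x)"] by simp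
  have e: "Im (c (Suc n)) = (- (pi * \<sigma> * x)) * T n" for n
  proof -
    define a where "a = \<sigma> * real (Suc n)"
    have a: "a > 0" using \<sigma> by (simp add: a_def)
    have "(- complex_of_real x * cis (pi * \<sigma>)) ^ Suc n = of_real ((- x) ^ Suc n) * cis (pi * a)"
    proof -
      have "cis (pi * \<sigma>) ^ Suc n = cis (pi * a)"
        using Complex.DeMoivre[of "pi * \<sigma>" "Suc n"] by (simp only: a_def mult_ac)
      then show ?thesis unfolding power_mult_distrib by (simp only: of_real_power of_real_minus)
    qed
    then have "c (Suc n) = of_real ((- x) ^ Suc n / fact (Suc n) * Gamma (a + 1)) * cis (pi * a)"
      unfolding c_def a_def[symmetric] by (simp only: of_real_mult of_real_divide of_real_fact) (simp add: mult_ac)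
    then have "Im (c (Suc n)) = (- x) ^ Suc n / fact (Suc n) * Gamma (a + 1) * sin (pi * a)"
      by (simp only: Im_of_real_mult cis.sel)
    also have "Gamma (a + 1) = a * Gamma a" by (rule Gamma_plus1) (use a in \<open>auto elim!: nonpos_Ints_cases\<close>)
    also have "(- x) ^ Suc n / fact (Suc n) * (a * Gamma a) * sin (pi * a) = (- (pi * \<sigma> * x)) * ((- x) ^ n / fact n * (Gamma a * sin (pi * a) / pi))"
      by (simp add: a_def field_simps del: of_nat_Suc)
    also have "Gamma a * sin (pi * a) / pi = rGamma (1 - a)" by (rule rGamma_reflect_real[OF a, symmetric])
    also have "1 - a = - (real n * \<sigma>) + 1 - \<sigma>" by (simp add: a_def algebra_simps)
    finally show ?thesis by (simp add: T_def)
  qed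
  have nz: "- (pi * \<sigma> * x) \<noteq> 0" using \<sigma> x by simp
  have "T sums (Im (wright_int \<sigma> x) / (- (pi * \<sigma> * x)))"
    using s unfolding e by (rule sums_mult_D[OF _ nz])
  then have "M_wright \<sigma> x = Im (wright_int \<sigma> x) / (- (pi * \<sigma> * x))"
    unfolding M_wright_def T_def by (rule sums_unique[symmetric])
  then show ?thesis using \<sigma> x by (simp add: field_simps)
qed

lemma powr_polar:
  assumes "r \<ge> 0" "- pi < \<phi>" "\<phi> \<le> pi" "s > 0"
  shows "(of_real r * cis \<phi>) powr of_real s = of_real (r powr s) * cis (s * \<phi>)"
proof (cases "r = 0")
  case False
  then have r: "r > 0" using assms by simp
  have e: "of_real r * cis \<phi> = exp (Complex (ln r) \<phi>)"
    unfolding exp_eq_polar using r by simp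
  have "Ln (exp (Complex (ln r) \<phi>)) = Complex (ln r) \<phi>" using assms by (intro Ln_exp) auto
  then have "(of_real r * cis \<phi>) powr of_real s = exp (of_real s * Complex (ln r) \<phi>)"
    unfolding e powr_def by simp
  also have "of_real s * Complex (ln r) \<phi> = Complex (s * ln r) (s * \<phi>)" by (simp add: complex_eq_iff)
  also have "exp (Complex (s * ln r) (s * \<phi>)) = of_real (r powr s) * cis (s * \<phi>)"
    unfolding exp_eq_polar using r by (simp add: powr_def)
  finally show ?thesis .
qed (use assms in simp)

text \<open>
  The critical point of \<open>- t + x * t powr \<sigma>\<close> is \<open>t = m\<close>, and
  \<open>X\<close> is the critical value.
\<close>

lemma saddle_scaling:
  assumes \<sigma>: "0 < \<sigma>" "\<sigma> < 1" and x: "x > 0"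
  defines "m \<equiv> \<sigma> * Xvar \<sigma> x / kap \<sigma>"
  shows "Xvar \<sigma> x > 0" "m > 0" "x * m powr \<sigma> = Xvar \<sigma> x / kap \<sigma>"
    "m / (pi * \<sigma> * x) = Apar \<sigma> / pi * Xvar \<sigma> x powr vth \<sigma> * (sqrt (Xvar \<sigma> x) / sqrt (2 * pi / \<sigma>))"
proof -
  note pos = positive_parameters[OF \<sigma>]
  define X where "X = Xvar \<sigma> x"
  show X: "Xvar \<sigma> x > 0" using pos x by (simp add: Xvar_def)
  show m: "m > 0" using X pos \<sigma> by (simp add: m_def)
  have Xk: "X powr kap \<sigma> = kap \<sigma> powr kap \<sigma> * (hpar \<sigma> * x)"
    using pos x by (simp add: X_def Xvar_def powr_mult powr_powr)
  have Xs: "X = X powr kap \<sigma> * X powr \<sigma>" "kap \<sigma> = kap \<sigma> powr kap \<sigma> * kap \<sigma> powr \<sigma>"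
    using X pos by (simp_all add: X_def kap_def flip: powr_add)
  have mp: "m powr \<sigma> = hpar \<sigma> * X powr \<sigma> / kap \<sigma> powr \<sigma>"
    using \<sigma> X pos by (simp add: m_def X_def hpar_def powr_mult powr_divide)
  have "X / kap \<sigma> = (kap \<sigma> powr kap \<sigma> * (hpar \<sigma> * x) * X powr \<sigma>) / (kap \<sigma> powr kap \<sigma> * kap \<sigma> powr \<sigma>)"
    using Xs Xk by simp
  also have "\<dots> = x * m powr \<sigma>" unfolding mp using pos by simp
  finally show xm: "x * m powr \<sigma> = Xvar \<sigma> x / kap \<sigma>" by (simp add: X_def)
  have xm2: "1 / x = kap \<sigma> * m powr \<sigma> / X" using xm x X pos by (simp add: X_def field_simps)
  have A: "Apar \<sigma> = sqrt (2 * pi / \<sigma>) * (hpar \<sigma> / kap \<sigma> powr \<sigma>)"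
    using \<sigma> pos by (simp add: Apar_def hpar_def powr_divide)
  define s where "s = sqrt (2 * pi / \<sigma>)"
  have s: "s > 0" using \<sigma> by (simp add: s_def)
  have Xv: "X powr vth \<sigma> * sqrt X = X powr \<sigma>"
    using X by (simp add: X_def vth_def flip: powr_half_sqrt powr_add)
  have "m / (pi * \<sigma> * x) = m / (pi * \<sigma>) * (1 / x)" by simp
  also have "\<dots> = m powr \<sigma> / pi" unfolding xm2 using \<sigma> X pos by (simp add: m_def X_def)
  also have "\<dots> = hpar \<sigma> / kap \<sigma> powr \<sigma> * (X powr vth \<sigma> * sqrt X) / pi" unfolding mp Xv by simp
  also have "\<dots> = Apar \<sigma> / pi * X powr vth \<sigma> * (sqrt X / sqrt (2 * pi / \<sigma>))"
    unfolding A s_def[symmetric] using s by simp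
  finally show "m / (pi * \<sigma> * x) = Apar \<sigma> / pi * Xvar \<sigma> x powr vth \<sigma> * (sqrt (Xvar \<sigma> x) / sqrt (2 * pi / \<sigma>))"
    by (simp add: X_def)
qed

text \<open>
  The bound \<open>c * norm u \<le> Re u\<close> describes a closed sector around the positive real
  axis inside the right half-plane. At its vertex the integrand only has to be continuous.
\<close>

lemma sector_rotate:
  fixes f :: "complex \<Rightarrow> complex"
  assumes c: "0 < c" and cont: "continuous_on {u. c * norm u \<le> Re u} f"
    and diff: "\<And>u. Re u > 0 \<Longrightarrow> f field_differentiable at u"
    and decay: "\<And>u. c * norm u \<le> Re u \<Longrightarrow> norm (f u) \<le> B / (1 + norm u)\<^sup>2"
    and d: "norm d = 1" "c \<le> Re d"
  shows "integral {0..} (\<lambda>t. f (of_real t * d) * d) = integral {0..} (\<lambda>t. f (of_real t))"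
    and "(\<lambda>t. f (of_real t * d) * d) absolutely_integrable_on {0..}"
proof -
  define S where "S = {u. c * norm u \<le> Re u}"
  have conv: "convex S"
    unfolding S_def convex_def
  proof (clarsimp simp: algebra_simps)
    fix x y :: complex and u v :: real
    assume h: "c * norm x \<le> Re x" "c * norm y \<le> Re y" "0 \<le> u" "0 \<le> v" "u + v = 1"
    have "c * norm (u *\<^sub>R x + v *\<^sub>R y) \<le> c * (u * norm x + v * norm y)"
      using norm_triangle_ineq[of "u *\<^sub>R x" "v *\<^sub>R y"] c h by (intro mult_left_mono) auto
    also have "\<dots> = u * (c * norm x) + v * (c * norm y)" by (simp add: algebra_simps)
    also have "\<dots> \<le> u * Re x + v * Re y" using h by (intro add_mono mult_left_mono) auto
    finally show "c * norm (u *\<^sub>R x + v *\<^sub>R y) \<le> u * Re x + v * Re y" .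
  qed
  have cS: "continuous_on S f" using cont by (simp add: S_def)
  have "\<exists>F. \<forall>u\<in>S. (F has_field_derivative f u) (at u within S)"
  proof (rule holomorphic_convex_primitive[OF conv _ cS, of "{0}"])
    fix u assume u: "u \<in> interior S - {0}"
    then have "u \<in> S" using interior_subset by blast
    then have "Re u \<ge> c * norm u" by (simp add: S_def)
    moreover have "c * norm u > 0" using u c by simp
    ultimately show "f field_differentiable at u" by (intro diff) linarith
  next
    fix g assume "\<And>x. x \<in> S \<Longrightarrow> (g has_field_derivative f x) (at x within S)"
    then show ?thesis by blast
  qed simp
  then obtain F where F: "\<And>u. u \<in> S \<Longrightarrow> (F has_field_derivative f u) (at u within S)" by blast
  have dec: "norm (f u) \<le> B / (1 + norm u)\<^sup>2" if "u \<in> S" for u using decay that by (simp add: S_def)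
  have Red: "Re d > 0" using c d by linarith
  have r1: "0 + of_real t * d \<in> S" if "t \<ge> 0" for t
    using that d mult_left_mono[OF d(2) that] by (simp add: S_def norm_mult mult_ac)
  have "c \<le> 1" using d abs_Re_le_cmod[of d] by linarith
  then have r2: "0 + of_real t * 1 \<in> S" if "t \<ge> 0" for t
    using that mult_right_mono[of c 1 t] by (simp add: S_def)
  have "d + 1 \<noteq> 0" using Red by (auto simp: complex_eq_iff)
  from ray_change[OF conv cS F dec r1 d(1) r2 _ this]
  show "integral {0..} (\<lambda>t. f (of_real t * d) * d) = integral {0..} (\<lambda>t. f (of_real t))" by simp
  show "(\<lambda>t. f (of_real t * d) * d) absolutely_integrable_on {0..}"
    using absolutely_integrable_ray[OF cS dec r1 d(1)] by simp
qed

section \<open>The vertical descent path\<close>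

lemma vertical_polar:
  obtains R \<theta> where "R \<ge> \<bar>t\<bar>" "R \<ge> 0" "\<bar>\<theta>\<bar> < pi / 2" "1 + \<i> * of_real t = of_real R * cis \<theta>" "t > 0 \<Longrightarrow> \<theta> > 0"
proof -
  define u where "u = 1 + \<i> * complex_of_real t"
  have u: "u \<noteq> 0" "Re u > 0" "Im u = t" by (auto simp: u_def complex_eq_iff)
  have e: "u = of_real (norm u) * cis (Arg u)" using Arg_eq[OF u(1)] by (simp add: cis_conv_exp)
  have b: "\<bar>Arg u\<bar> < pi / 2" using Arg_Re_pos[of u] u by blast
  show thesis
  proof (rule that[of "norm u" "Arg u"])
    show "\<bar>t\<bar> \<le> norm u" using abs_Im_le_cmod[of u] u by simp
    show "1 + \<i> * of_real t = of_real (norm u) * cis (Arg u)" using e by (simp add: u_def)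
    assume "t > 0"
    show "Arg u > 0"
    proof (rule ccontr)
      assume "\<not> Arg u > 0"
      then have "sin (Arg u) \<le> 0" using b sin_ge_zero[of "- Arg u"] by simp
      moreover have "Im u = norm u * sin (Arg u)" by (subst e) simp
      ultimately have "Im u \<le> 0" using mult_nonneg_nonpos[OF norm_ge_zero[of u]] by metis
      then show False using u \<open>t > 0\<close> by simp
    qed
  qed (use b in auto)
qed

lemma vertical_notin_nonpos_Reals: "1 + \<i> * complex_of_real t \<notin> \<real>\<^sub>\<le>\<^sub>0"
  by (auto simp: complex_nonpos_Reals_iff)

lemma vertical_powr_derivative:
  "((\<lambda>t. (1 + \<i> * of_real t) powr of_real s) has_vector_derivative
      \<i> * (of_real s * (1 + \<i> * of_real t) powr (of_real s - 1))) (at t within A)"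
proof -
  have 1: "((\<lambda>t::real. 1 + \<i> * of_real t) has_vector_derivative \<i>) (at t within A)"
    by (auto intro!: derivative_eq_intros simp: has_vector_derivative_def scaleR_conv_of_real)
  have 2: "((\<lambda>z. z powr of_real s) has_field_derivative of_real s * (1 + \<i> * of_real t) powr (of_real s - 1))
     (at (1 + \<i> * of_real t) within (\<lambda>t. 1 + \<i> * of_real t) ` A)"
    by (rule has_field_derivative_at_within[OF has_field_derivative_powr[OF vertical_notin_nonpos_Reals]])
  show ?thesis using field_vector_diff_chain_within[OF 1 2] by (simp add: o_def)
qed

text \<open>
  On the vertical line through the saddle the linear part of the phase has constant real part, and
  the real part of the power increases with the distance from the saddle; so the negative of the
  phase descends.
\<close>

lemma Re_vertical_powr_strict_mono:
  assumes \<sigma>: "0 < \<sigma>" "\<sigma> < 1" and ab: "0 \<le> a" "a < b"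
  shows "Re ((1 + \<i> * of_real a) powr of_real \<sigma>) < Re ((1 + \<i> * of_real b) powr of_real \<sigma>)"
proof -
  have d: "((\<lambda>t. Re ((1 + \<i> * of_real t) powr of_real \<sigma>)) has_real_derivative
      Re (\<i> * (of_real \<sigma> * (1 + \<i> * of_real t) powr (of_real \<sigma> - 1)))) (at t)" for t
    unfolding has_real_derivative_iff_has_vector_derivative
    by (rule bounded_linear.has_vector_derivative[OF bounded_linear_Re vertical_powr_derivative])
  have "\<exists>z>a. z < b \<and> Re ((1 + \<i> * of_real b) powr of_real \<sigma>) - Re ((1 + \<i> * of_real a) powr of_real \<sigma>) =
      (b - a) * Re (\<i> * (of_real \<sigma> * (1 + \<i> * of_real z) powr (of_real \<sigma> - 1)))"
    by (rule MVT2[OF ab(2)]) (rule d)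
  then obtain z where z: "z > a" "Re ((1 + \<i> * of_real b) powr of_real \<sigma>) - Re ((1 + \<i> * of_real a) powr of_real \<sigma>) =
      (b - a) * Re (\<i> * (of_real \<sigma> * (1 + \<i> * of_real z) powr (of_real \<sigma> - 1)))" by blast
  obtain R \<theta> where R: "R \<ge> \<bar>z\<bar>" "R \<ge> 0" "\<bar>\<theta>\<bar> < pi / 2" "1 + \<i> * of_real z = of_real R * cis \<theta>" "z > 0 \<Longrightarrow> \<theta> > 0"
    by (rule vertical_polar[of z]) (rule that)
  have z0: "z > 0" using z ab by simp
  have R0: "R > 0" using R(1) z0 by simp
  have th: "\<theta> > 0" using R(5) z0 by simp
  have u0: "1 + \<i> * of_real z \<noteq> 0" using vertical_notin_nonpos_Reals[of z] by auto
  have "(1 + \<i> * of_real z) powr (of_real \<sigma> - 1) = (of_real R * cis \<theta>) powr of_real \<sigma> / (1 + \<i> * of_real z)"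
    using u0 R(4) by (simp add: powr_diff)
  also have "\<dots> = of_real (R powr \<sigma>) * cis (\<sigma> * \<theta>) / (of_real R * cis \<theta>)"
    using powr_polar[OF R(2), of \<theta> \<sigma>] R(3,4) \<sigma> pi_gt_zero by (simp add: abs_less_iff)
  also have "\<dots> = of_real (R powr \<sigma> / R) * cis (\<sigma> * \<theta> - \<theta>)" by (simp add: cis_divide[symmetric])
  finally have e: "(1 + \<i> * of_real z) powr (of_real \<sigma> - 1) = of_real (R powr \<sigma> / R) * cis (- ((1 - \<sigma>) * \<theta>))" by (simp add: algebra_simps)
  have "Re (\<i> * (of_real \<sigma> * (1 + \<i> * of_real z) powr (of_real \<sigma> - 1))) = \<sigma> * (R powr \<sigma> / R) * sin ((1 - \<sigma>) * \<theta>)"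
    unfolding e by simp
  moreover have "sin ((1 - \<sigma>) * \<theta>) > 0"
  proof (rule sin_gt_zero)
    show "0 < (1 - \<sigma>) * \<theta>" using \<sigma> th by simp
    have "(1 - \<sigma>) * \<theta> \<le> 1 * \<theta>" using \<sigma> th by (intro mult_right_mono) auto
    then show "(1 - \<sigma>) * \<theta> < pi" using R(3) pi_gt_zero by linarith
  qed
  ultimately have "Re (\<i> * (of_real \<sigma> * (1 + \<i> * of_real z) powr (of_real \<sigma> - 1))) > 0" using \<sigma> R0 by simp
  then show ?thesis using z(2) ab by (smt (verit) mult_pos_pos)
qed

lemma Re_vertical_powr_ge:
  assumes \<sigma>: "0 < \<sigma>" "\<sigma> < 1"
  shows "Re ((1 + \<i> * of_real t) powr of_real \<sigma>) \<ge> cos (\<sigma> * (pi / 2)) * \<bar>t\<bar> powr \<sigma>" 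
proof -
  obtain R \<theta> where R: "R \<ge> \<bar>t\<bar>" "R \<ge> 0" "\<bar>\<theta>\<bar> < pi / 2" "1 + \<i> * of_real t = of_real R * cis \<theta>"
    by (rule vertical_polar[of t]) (rule that)
  have e: "Re ((1 + \<i> * of_real t) powr of_real \<sigma>) = R powr \<sigma> * cos (\<sigma> * \<theta>)"
    unfolding R(4) using powr_polar[OF R(2), of \<theta> \<sigma>] R(3) \<sigma> pi_gt_zero by (simp add: abs_less_iff)
  have sp: "\<sigma> * (pi / 2) < pi / 2" using \<sigma> by simp
  have "cos (\<sigma> * (pi / 2)) \<le> cos \<bar>\<sigma> * \<theta>\<bar>"
  proof (rule cos_monotone_0_pi_le)
    show "\<bar>\<sigma> * \<theta>\<bar> \<le> \<sigma> * (pi / 2)" using R(3) \<sigma> by (simp add: abs_mult)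
    show "\<sigma> * (pi / 2) \<le> pi" using sp pi_gt_zero by linarith
  qed simp
  then have c: "cos (\<sigma> * (pi / 2)) \<le> cos (\<sigma> * \<theta>)" by simp
  have sp0: "0 < \<sigma> * (pi / 2)" using \<sigma> by simp
  have c0: "cos (\<sigma> * (pi / 2)) \<ge> 0" by (rule cos_ge_zero) (use sp sp0 in linarith)+
  have "cos (\<sigma> * (pi / 2)) * \<bar>t\<bar> powr \<sigma> \<le> cos (\<sigma> * \<theta>) * R powr \<sigma>"
    using c c0 R \<sigma> by (intro mult_mono powr_mono2) auto
  then show ?thesis unfolding e by (simp add: mult.commute)
qed

lemma phase_vertical:
  assumes "\<sigma> < 1"
  shows "Re (- (phase \<sigma> (1 + \<i> * of_real t) - 1)) = - (Re ((1 + \<i> * of_real t) powr of_real \<sigma>) - 1) / kap \<sigma>"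
proof -
  have k: "kap \<sigma> \<noteq> 0" using assms by (simp add: kap_def)
  have "Re (phase \<sigma> (1 + \<i> * of_real t)) = (Re ((1 + \<i> * of_real t) powr of_real \<sigma>) - \<sigma>) / kap \<sigma>"
    by (simp add: phase_def)
  then show ?thesis using k by (simp add: kap_def field_simps)
qed

lemma vertical_powr_cnj: "(1 - \<i> * of_real t) powr of_real \<sigma> = cnj ((1 + \<i> * of_real t) powr of_real \<sigma>)"
  by (subst cnj_powr) auto

lemma phase_vertical_cnj: "phase \<sigma> (1 - \<i> * of_real t) = cnj (phase \<sigma> (1 + \<i> * of_real t))"
  by (simp add: phase_def vertical_powr_cnj)

lemma phase_vertical_integrable:
  assumes \<sigma>: "0 < \<sigma>" "\<sigma> < 1" and X: "X > 0"
  shows "(\<lambda>t. exp (of_real X * - (phase \<sigma> (1 + \<i> * of_real t) - 1))) absolutely_integrable_on {0..}"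
proof -
  define c where "c = X * cos (\<sigma> * (pi / 2)) / kap \<sigma>"
  have k: "kap \<sigma> > 0" by (rule positive_parameters(1)[OF \<sigma>])
  have "cos (\<sigma> * (pi / 2)) > 0" using \<sigma> by (intro cos_gt_zero_pi) (auto simp: pi_gt_zero, smt (verit) mult_pos_pos pi_gt_zero)
  then have c: "c > 0" using X k by (simp add: c_def)
  obtain B where B: "B > 0" "\<And>r. r \<ge> 0 \<Longrightarrow> exp (- c * r powr \<sigma>) \<le> B / (1 + r)\<^sup>2"
    using exp_powr_le_inverse_square[OF c \<sigma>(1)] by metis
  show ?thesis
  proof (rule continuous_bounded_absolutely_integrable)
    show "continuous_on {0..} (\<lambda>t. exp (of_real X * - (phase \<sigma> (1 + \<i> * of_real t) - 1)))"
      unfolding phase_def divide_inverse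
      by (intro continuous_intros continuous_on_powr_complex) (use \<sigma> in auto)
    show "(\<lambda>t. (exp (X / kap \<sigma>) * B) / (1 + t)\<^sup>2) integrable_on {0..}" by (rule integrable_inverse_square)
    fix t :: real assume t: "t \<in> {0..}"
    have "Re (- (phase \<sigma> (1 + \<i> * of_real t) - 1)) \<le> (1 - cos (\<sigma> * (pi / 2)) * t powr \<sigma>) / kap \<sigma>"
      unfolding phase_vertical[OF \<sigma>(2)] using Re_vertical_powr_ge[OF \<sigma>, of t] t k by (intro divide_right_mono) auto
    then have "X * Re (- (phase \<sigma> (1 + \<i> * of_real t) - 1)) \<le> X * ((1 - cos (\<sigma> * (pi / 2)) * t powr \<sigma>) / kap \<sigma>)"
      using X by (intro mult_left_mono) auto
    also have "\<dots> = X / kap \<sigma> + - c * t powr \<sigma>" by (simp add: c_def right_diff_distrib diff_divide_distrib)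
    finally have "exp (X * Re (- (phase \<sigma> (1 + \<i> * of_real t) - 1))) \<le> exp (X / kap \<sigma>) * exp (- c * t powr \<sigma>)"
      by (simp only: exp_le_cancel_iff flip: exp_add)
    also have "\<dots> \<le> exp (X / kap \<sigma>) * (B / (1 + t)\<^sup>2)" using B(2)[of t] t by (intro mult_left_mono) auto
    finally show "norm (exp (of_real X * - (phase \<sigma> (1 + \<i> * of_real t) - 1))) \<le> (exp (X / kap \<sigma>) * B) / (1 + t)\<^sup>2"
      unfolding norm_exp_eq_Re Re_of_real_mult by simp
  qed simp
qed

lemma descent_vertical:
  assumes \<sigma>: "0 < \<sigma>" "\<sigma> < 1"
  shows "descent_path \<sigma> (- 1) {0..} (\<lambda>t. - (phase \<sigma> (1 + \<i> * of_real t) - 1)) (\<lambda>_. \<i>)"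
    and "descent_path \<sigma> (- 1) {0..} (\<lambda>t. - (phase \<sigma> (1 - \<i> * of_real t) - 1)) (\<lambda>_. - \<i>)"
proof -
  have k: "kap \<sigma> > 0" by (rule positive_parameters(1)[OF \<sigma>])
  have tail: "\<forall>e>0. \<exists>\<eta>>0. \<forall>t\<in>{0..}. e \<le> t \<longrightarrow> Re (- (phase \<sigma> (1 + \<i> * of_real t) - 1)) \<le> - \<eta>"
  proof (intro allI impI)
    fix e :: real assume e: "e > 0"
    define \<eta> where "\<eta> = (Re ((1 + \<i> * of_real e) powr of_real \<sigma>) - 1) / kap \<sigma>"
    have \<eta>: "\<eta> > 0" using Re_vertical_powr_strict_mono[OF \<sigma>, of 0 e] e k by (simp add: \<eta>_def)
    have "Re (- (phase \<sigma> (1 + \<i> * of_real t) - 1)) \<le> - \<eta>" if t: "e \<le> t" for t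
    proof -
      have "Re ((1 + \<i> * of_real e) powr of_real \<sigma>) \<le> Re ((1 + \<i> * of_real t) powr of_real \<sigma>)"
        using Re_vertical_powr_strict_mono[OF \<sigma>, of e t] e t by (cases "e = t") auto
      then show ?thesis unfolding phase_vertical[OF \<sigma>(2)] \<eta>_def minus_divide_left[symmetric] neg_le_iff_le
        using k by (intro divide_right_mono) auto
    qed
    with \<eta> show "\<exists>\<eta>>0. \<forall>t\<in>{0..}. e \<le> t \<longrightarrow> Re (- (phase \<sigma> (1 + \<i> * of_real t) - 1)) \<le> - \<eta>" by blast
  qed
  have int: "(\<lambda>t. exp (Re (- (phase \<sigma> (1 + \<i> * of_real t) - 1)))) integrable_on {0..}"
    using phase_vertical_integrable[OF \<sigma>, of 1] by (simp add: absolutely_integrable_on_def)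
  have reE: "Re (- (phase \<sigma> (1 - \<i> * of_real t) - 1)) = Re (- (phase \<sigma> (1 + \<i> * of_real t) - 1))" for t
    unfolding phase_vertical_cnj by simp
  have cont: "continuous_on {0..} (\<lambda>t. - (phase \<sigma> (1 + \<i> * of_real t) - 1))"
    "continuous_on {0..} (\<lambda>t. - (phase \<sigma> (1 - \<i> * of_real t) - 1))"
    unfolding phase_def divide_inverse
    by (intro continuous_intros continuous_on_powr_complex; use \<sigma> in \<open>auto simp: complex_eq_iff\<close>)+
  have d1: "((\<lambda>t::real. \<i> * of_real t) has_vector_derivative \<i>) (at t within {0..1})" for t
    by (auto intro!: derivative_eq_intros simp: has_vector_derivative_def scaleR_conv_of_real)
  have d2: "((\<lambda>t::real. - (\<i> * of_real t)) has_vector_derivative - \<i>) (at t within {0..1})" for t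
    by (auto intro!: derivative_eq_intros simp: has_vector_derivative_def scaleR_conv_of_real)
  show "descent_path \<sigma> (- 1) {0..} (\<lambda>t. - (phase \<sigma> (1 + \<i> * of_real t) - 1)) (\<lambda>_. \<i>)"
    unfolding descent_path_def
  proof (intro conjI)
    show "\<exists>e>0. \<exists>\<gamma>. {0..e} \<subseteq> {0..} \<and> \<gamma> 0 = 0 \<and>
        (\<forall>t\<in>{0..e}. (\<gamma> has_vector_derivative \<i>) (at t within {0..e}) \<and>
                     - (phase \<sigma> (1 + \<i> * of_real t) - 1) = - 1 * (phase \<sigma> (1 + \<gamma> t) - 1))"
      by (intro exI[of _ 1] conjI exI[of _ "\<lambda>t. \<i> * complex_of_real t"]) (auto intro: d1)
  qed (use tail int cont in auto)
  show "descent_path \<sigma> (- 1) {0..} (\<lambda>t. - (phase \<sigma> (1 - \<i> * of_real t) - 1)) (\<lambda>_. - \<i>)"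
    unfolding descent_path_def reE
  proof (intro conjI)
    show "\<exists>e>0. \<exists>\<gamma>. {0..e} \<subseteq> {0..} \<and> \<gamma> 0 = 0 \<and>
        (\<forall>t\<in>{0..e}. (\<gamma> has_vector_derivative - \<i>) (at t within {0..e}) \<and>
                     - (phase \<sigma> (1 - \<i> * of_real t) - 1) = - 1 * (phase \<sigma> (1 + \<gamma> t) - 1))"
      by (intro exI[of _ 1] conjI exI[of _ "\<lambda>t. - (\<i> * complex_of_real t)"]) (auto intro: d2)
  qed (use tail int cont in auto)
qed

text \<open>
  The power with its cut along the negative imaginary axis, hence continuous on the closed upper
  half-plane, where the contour is moved.
\<close>

definition upper_powr :: "real \<Rightarrow> complex \<Rightarrow> complex" where
  "upper_powr s u = cis (pi / 2 * s) * (- \<i> * u) powr of_real s"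

lemma upper_powr_polar:
  assumes "r \<ge> 0" "0 \<le> \<theta>" "\<theta> \<le> pi" "s > 0"
  shows "upper_powr s (of_real r * cis \<theta>) = of_real (r powr s) * cis (s * \<theta>)"
proof -
  have "- \<i> * (of_real r * cis \<theta>) = of_real r * cis (\<theta> - pi / 2)"
  proof -
    have "cis (\<theta> - pi / 2) = - \<i> * cis \<theta>" by (simp add: complex_eq_iff cos_diff sin_diff)
    then show ?thesis by simp
  qed
  then have "upper_powr s (of_real r * cis \<theta>) = cis (pi / 2 * s) * (of_real (r powr s) * cis (s * (\<theta> - pi / 2)))"
    unfolding upper_powr_def using powr_polar[of r "\<theta> - pi / 2" s] assms pi_gt_zero by simp
  also have "\<dots> = of_real (r powr s) * (cis (pi / 2 * s) * cis (s * (\<theta> - pi / 2)))" by (simp add: mult_ac)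
  also have "cis (pi / 2 * s) * cis (s * (\<theta> - pi / 2)) = cis (s * \<theta>)" by (simp add: cis_mult algebra_simps)
  finally show ?thesis .
qed

lemma upper_half_plane_polar:
  assumes "Im u \<ge> 0"
  obtains \<theta> where "0 \<le> \<theta>" "\<theta> \<le> pi" "u = of_real (norm u) * cis \<theta>"
proof (cases "u = 0")
  case True then show thesis using that[of 0] by simp
next
  case False
  have e: "u = of_real (norm u) * cis (Arg u)" using Arg_eq[OF False] by (simp add: cis_conv_exp)
  have "Arg u \<ge> 0"
  proof (rule ccontr)
    assume "\<not> Arg u \<ge> 0"
    then have "sin (- Arg u) > 0" using Arg_bounded[of u] by (intro sin_gt_zero) auto
    moreover have "Im u = norm u * sin (Arg u)" by (subst e) simp
    ultimately show False using assms False by (simp add: zero_le_mult_iff)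
  qed
  with e Arg_bounded[of u] show thesis by (intro that[of "Arg u"]) auto
qed

text \<open>
  Near the imaginary axis the power has a positive real part, of the order of its modulus, while the
  linear term is bounded above. Farther to the left the linear term is negative and dominates the
  power.
\<close>

lemma upper_region_decay:
  assumes \<sigma>: "0 < \<sigma>" "\<sigma> < 1"
  obtains C c where "c > 0" "\<And>u. Im u \<ge> 0 \<Longrightarrow> Re u \<le> 1 \<Longrightarrow> Re (of_real \<sigma> * u - upper_powr \<sigma> u) \<le> C - c * norm u powr \<sigma>"
proof -
  \<comment> \<open>an angle beyond the imaginary axis at which \<open>u powr \<sigma>\<close> still has positive real part: \<open>\<sigma> * (2 - \<sigma>) < 1\<close>\<close>
  define \<theta>0 where "\<theta>0 = pi / 2 * (2 - \<sigma>)"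
  have t0: "pi / 2 < \<theta>0" "\<theta>0 < pi" using \<sigma> by (auto simp: \<theta>0_def)
  have "\<sigma> * (2 - \<sigma>) < 1"
  proof -
    have "0 < (1 - \<sigma>)\<^sup>2" using \<sigma> by simp
    then show ?thesis by (simp add: power2_eq_square algebra_simps)
  qed
  then have s0: "\<sigma> * \<theta>0 < pi / 2" using mult_strict_left_mono[of "\<sigma> * (2 - \<sigma>)" 1 "pi / 2"] by (simp add: \<theta>0_def mult_ac)
  define c1 where "c1 = cos (\<sigma> * \<theta>0)"
  have sp: "0 < \<sigma> * \<theta>0" using \<sigma> t0 pi_gt_zero by simp
  have c1: "c1 > 0" unfolding c1_def using s0 sp by (intro cos_gt_zero) auto
  define c2 where "c2 = - \<sigma> * cos \<theta>0"
  have "cos \<theta>0 < cos (pi / 2)" using t0 by (intro cos_monotone_0_pi) auto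
  then have c2: "c2 > 0" using \<sigma> by (simp add: c2_def mult_pos_neg)
  obtain C where C: "C \<ge> 0" "\<And>r::real. r \<ge> 0 \<Longrightarrow> 2 * r powr \<sigma> \<le> C + c2 * r"
    by (rule powr_le_affine[OF \<sigma>(2) c2 \<sigma>(1), of 2]) (rule that)
  show thesis
  proof (rule that[of "min c1 1" "max \<sigma> C"])
    show "min c1 1 > 0" using c1 by simp
    fix u assume u: "Im u \<ge> 0" "Re u \<le> 1"
    obtain \<theta> where th: "0 \<le> \<theta>" "\<theta> \<le> pi" "u = of_real (norm u) * cis \<theta>" by (rule upper_half_plane_polar[OF u(1)]) (rule that)
    define r where "r = norm u"
    have r: "r \<ge> 0" by (simp add: r_def)
    have up: "Re (upper_powr \<sigma> u) = r powr \<sigma> * cos (\<sigma> * \<theta>)"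
      by (subst th(3)) (simp add: upper_powr_polar th(1,2) \<sigma> r_def)
    have reu: "Re u = r * cos \<theta>" by (subst th(3)) (simp add: r_def)
    have rp: "r powr \<sigma> \<ge> 0" by simp
    have "\<sigma> * Re u - r powr \<sigma> * cos (\<sigma> * \<theta>) \<le> max \<sigma> C - min c1 1 * r powr \<sigma>"
    proof (cases "\<theta> \<le> \<theta>0")
      case True
      have "c1 \<le> cos (\<sigma> * \<theta>)" unfolding c1_def
        using True th \<sigma> s0 pi_gt_zero by (intro cos_monotone_0_pi_le) auto
      then have "min c1 1 * r powr \<sigma> \<le> cos (\<sigma> * \<theta>) * r powr \<sigma>" by (intro mult_right_mono) auto
      moreover have "\<sigma> * Re u \<le> \<sigma> * 1" using u \<sigma> by (intro mult_left_mono) auto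
      ultimately show ?thesis by (simp add: mult.commute)
    next
      case False
      have "cos \<theta> \<le> cos \<theta>0" using False th t0 by (intro cos_monotone_0_pi_le) auto
      then have "\<sigma> * Re u \<le> - c2 * r" unfolding reu c2_def using r \<sigma> mult_left_mono[of "cos \<theta>" "cos \<theta>0" "\<sigma> * r"] by (simp add: mult_ac)
      moreover have "- (r powr \<sigma> * cos (\<sigma> * \<theta>)) \<le> r powr \<sigma>"
        using mult_left_mono[of "- cos (\<sigma> * \<theta>)" 1 "r powr \<sigma>"] cos_ge_minus_one[of "\<sigma> * \<theta>"] by simp
      moreover have "min c1 1 * r powr \<sigma> \<le> 1 * r powr \<sigma>" by (intro mult_right_mono) auto
      ultimately show ?thesis using C(2)[OF r] by linarith
    qed
    then show "Re (of_real \<sigma> * u - upper_powr \<sigma> u) \<le> max \<sigma> C - min c1 1 * norm u powr \<sigma>"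
      using up by (simp add: r_def)
  qed
qed

text \<open>
  For positive \<open>x\<close> the defining ray corresponds to the negative real axis of the scaled
  variable, approached from above. It is turned clockwise, through the upper half-plane, to the
  vertical half-line that leaves the saddle. The segment of the real axis between the vertex and the
  saddle contributes a real number, which the imaginary part removes.
\<close>

lemma wright_int_vertical:
  assumes \<sigma>: "0 < \<sigma>" "\<sigma> < 1" and x: "x > 0"
  defines "X \<equiv> Xvar \<sigma> x" and "m \<equiv> \<sigma> * Xvar \<sigma> x / kap \<sigma>"
  shows "- Im (wright_int \<sigma> x) = m * exp (- X) * Im (integral {0..} (\<lambda>t. exp (of_real X * - (phase \<sigma> (1 + \<i> * of_real t) - 1)) * \<i>))"
proof -
  note sc = saddle_scaling[OF \<sigma> x, folded X_def m_def]
  have k: "kap \<sigma> > 0" by (rule positive_parameters(1)[OF \<sigma>])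
  define f where "f = (\<lambda>u. exp (of_real (X / kap \<sigma>) * (of_real \<sigma> * u - upper_powr \<sigma> u)))"
  define S where "S = {u. Im u \<ge> 0} \<inter> {u. Re u \<le> 1}"
  have conv: "convex S" unfolding S_def
    by (intro convex_Int convex_halfspace_Im_ge convex_halfspace_Re_le)
  have cont: "continuous_on S f"
    unfolding f_def upper_powr_def S_def
    by (intro continuous_intros continuous_on_powr_complex) (use \<sigma> in auto)
  have fd: "f field_differentiable at u" if "Im u > 0" for u
  proof -
    have n: "- \<i> * u \<notin> \<real>\<^sub>\<le>\<^sub>0" using that by (auto simp: complex_nonpos_Reals_iff)
    note p = DERIV_chain'[OF DERIV_cmult[OF DERIV_ident, of "- \<i>"] has_field_derivative_powr[OF n, of "of_real \<sigma>"]]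
    note DERIV_chain'[OF DERIV_cmult[OF DERIV_diff[OF DERIV_cmult[OF DERIV_ident, of "of_real \<sigma>"] DERIV_cmult[OF p, of "cis (pi / 2 * \<sigma>)"]],
        of "of_real (X / kap \<sigma>)"] DERIV_exp]
    then show ?thesis unfolding field_differentiable_def f_def upper_powr_def by blast
  qed
  have "\<exists>F. \<forall>u\<in>S. (F has_field_derivative f u) (at u within S)"
  proof (rule holomorphic_convex_primitive[OF conv _ cont, of "{}"])
    fix u assume u: "u \<in> interior S - {}"
    then obtain e where e: "e > 0" "ball u e \<subseteq> S" by (auto simp: mem_interior)
    have "u - \<i> * of_real (e / 2) \<in> ball u e" using e(1) by (simp add: dist_norm norm_mult)
    then have "Im (u - \<i> * of_real (e / 2)) \<ge> 0" using e(2) unfolding S_def by blast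
    then have "Im u > 0" using e(1) by simp
    then show "f field_differentiable at u" by (rule fd)
  next
    fix g assume "\<And>x. x \<in> S \<Longrightarrow> (g has_field_derivative f x) (at x within S)"
    then show ?thesis by blast
  qed simp
  then obtain F where F: "\<And>u. u \<in> S \<Longrightarrow> (F has_field_derivative f u) (at u within S)" by blast
  obtain C c where C: "c > 0" "\<And>u. Im u \<ge> 0 \<Longrightarrow> Re u \<le> 1 \<Longrightarrow> Re (of_real \<sigma> * u - upper_powr \<sigma> u) \<le> C - c * norm u powr \<sigma>"
    by (rule upper_region_decay[OF \<sigma>]) (rule that)
  have Xk: "X / kap \<sigma> > 0" using sc(1) k by simp
  have "X / kap \<sigma> * c > 0" using Xk C(1) by (rule mult_pos_pos)
  then obtain B0 where B0: "B0 > 0" "\<And>r. r \<ge> 0 \<Longrightarrow> exp (- (X / kap \<sigma> * c) * r powr \<sigma>) \<le> B0 / (1 + r)\<^sup>2"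
    using exp_powr_le_inverse_square[OF _ \<sigma>(1)] by metis
  define B where "B = exp (X / kap \<sigma> * C) * B0"
  have decay: "norm (f u) \<le> B / (1 + norm u)\<^sup>2" if "u \<in> S" for u
  proof -
    have "X / kap \<sigma> * Re (of_real \<sigma> * u - upper_powr \<sigma> u) \<le> X / kap \<sigma> * (C - c * norm u powr \<sigma>)"
      using C(2)[of u] that Xk by (intro mult_left_mono) (auto simp: S_def)
    also have "\<dots> = X / kap \<sigma> * C + - (X / kap \<sigma> * c) * norm u powr \<sigma>" by (simp add: right_diff_distrib mult.assoc)
    finally have "exp (X / kap \<sigma> * Re (of_real \<sigma> * u - upper_powr \<sigma> u)) \<le> exp (X / kap \<sigma> * C) * exp (- (X / kap \<sigma> * c) * norm u powr \<sigma>)"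
      by (simp only: exp_le_cancel_iff flip: exp_add)
    also have "\<dots> \<le> exp (X / kap \<sigma> * C) * (B0 / (1 + norm u)\<^sup>2)" using B0(2)[of "norm u"] by (intro mult_left_mono) auto
    finally show ?thesis unfolding f_def norm_exp_eq_Re Re_of_real_mult B_def by simp
  qed
  have ra: "0 + of_real t * (- 1) \<in> S" if "t \<ge> 0" for t using that by (simp add: S_def)
  have rb: "1 + of_real t * \<i> \<in> S" if "t \<ge> 0" for t using that by (simp add: S_def)
  have ne: "- 1 + \<i> \<noteq> 0" by (simp add: complex_eq_iff)
  have rc: "integral {0..} (\<lambda>t. f (0 + of_real t * (- 1)) * (- 1)) + F 0 = integral {0..} (\<lambda>t. f (1 + of_real t * \<i>) * \<i>) + F 1"
    by (rule ray_change[OF conv cont F decay ra _ rb _ ne]) auto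
  have absa: "(\<lambda>t. f (0 + of_real t * (- 1)) * (- 1)) absolutely_integrable_on {0..}"
    by (rule absolutely_integrable_ray[OF cont decay ra]) auto
  have f1: "f (of_real t) = of_real (exp (X / kap \<sigma> * (\<sigma> * t - t powr \<sigma>)))" if "t \<ge> 0" for t
  proof -
    have "upper_powr \<sigma> (of_real t) = of_real (t powr \<sigma>)" using upper_powr_polar[of t 0 \<sigma>] that \<sigma> by simp
    then show ?thesis by (simp add: f_def exp_of_real[symmetric])
  qed
  have "((\<lambda>t. f (0 + of_real t * 1) * 1) has_integral (F (0 + of_real 1 * 1) - F 0)) {0..1}"
    by (rule integral_ray_segment[OF F]) (auto simp: S_def)
  then have "((\<lambda>t. f (of_real t)) has_integral (F 1 - F 0)) {0..1}" by simp
  from has_integral_linear[OF this bounded_linear_Im]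
  have "((\<lambda>t. Im (f (of_real t))) has_integral Im (F 1 - F 0)) {0..1}" by (simp only: o_def)
  moreover have "((\<lambda>t. Im (f (of_real t))) has_integral 0) {0..1}"
    by (rule has_integral_is_0) (simp add: f1)
  ultimately have "Im (F 1 - F 0) = 0" by (rule has_integral_unique)
  then have F01: "Im (F 1) = Im (F 0)" by simp
  define g where "g = (\<lambda>t. exp (- of_real t - of_real x * cis (pi * \<sigma>) * of_real (t powr \<sigma>)))"
  have gm: "g (0 + m * t) = f (0 + of_real t * (- 1))" if "t \<ge> 0" for t
  proof -
    have "upper_powr \<sigma> (of_real t * cis pi) = of_real (t powr \<sigma>) * cis (\<sigma> * pi)" using upper_powr_polar[of t pi \<sigma>] that \<sigma> by simp
    then have 1: "upper_powr \<sigma> (- of_real t) = of_real (t powr \<sigma>) * cis (pi * \<sigma>)" by (simp add: mult.commute)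
    have "x * (m * t) powr \<sigma> = (x * m powr \<sigma>) * t powr \<sigma>" using sc(2) that by (simp add: powr_mult mult.assoc)
    then have xm: "x * (m * t) powr \<sigma> = X / kap \<sigma> * t powr \<sigma>" unfolding sc(3) .
    then have 2: "of_real x * of_real ((m * t) powr \<sigma>) = complex_of_real (X / kap \<sigma> * t powr \<sigma>)" by (simp only: of_real_mult[symmetric])
    have 3: "complex_of_real (m * t) = of_real (X / kap \<sigma>) * (of_real \<sigma> * of_real t)" by (simp add: m_def X_def)
    have "- of_real (m * t) - of_real x * cis (pi * \<sigma>) * of_real ((m * t) powr \<sigma>) = of_real (X / kap \<sigma>) * (of_real \<sigma> * (- of_real t) - of_real (t powr \<sigma>) * cis (pi * \<sigma>))"
    proof -
      have "of_real x * cis (pi * \<sigma>) * of_real ((m * t) powr \<sigma>) = (of_real x * of_real ((m * t) powr \<sigma>)) * cis (pi * \<sigma>)" by (simp only: mult_ac)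
      also have "\<dots> = of_real (X / kap \<sigma>) * (of_real (t powr \<sigma>) * cis (pi * \<sigma>))" unfolding 2 of_real_mult mult.assoc ..
      finally show ?thesis unfolding 3 by (simp only: right_diff_distrib mult_minus_right)
    qed
    then show ?thesis unfolding g_def f_def using 1 by simp
  qed
  have gi: "g absolutely_integrable_on {0..}"
  proof (rule continuous_bounded_absolutely_integrable)
    show "continuous_on {0..} g" unfolding g_def by (intro continuous_intros continuous_on_powr') (use \<sigma> in auto)
    show "(\<lambda>t. exp (- t + x * t powr \<sigma>)) integrable_on {0..}"
      using exp_powr_dominating[OF \<sigma>, of x] by (simp add: integrable_on_def has_integral_atLeast_0_iff)
    fix t :: real assume "t \<in> {0..}"
    have "x * t powr \<sigma> * (- cos (pi * \<sigma>)) \<le> x * t powr \<sigma> * 1"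
      using x cos_ge_minus_one[of "pi * \<sigma>"] by (intro mult_left_mono) auto
    then show "norm (g t) \<le> exp (- t + x * t powr \<sigma>)" unfolding g_def norm_exp_eq_Re by (simp add: mult_ac)
  qed simp
  have fi: "(\<lambda>t. f (0 + of_real t * (- 1))) absolutely_integrable_on {0..}"
    using set_integrable_mult_right[OF absa, of "- 1"] by simp
  have "(\<lambda>t. g (0 + m * t)) absolutely_integrable_on {0..}"
    by (rule absolutely_integrable_spike[OF fi, of "{}"]) (use gm in auto)
  from integral_affine_atLeast[OF sc(2) gi this]
  have "wright_int \<sigma> x = of_real m * integral {0..} (\<lambda>t. g (0 + m * t))"
    unfolding wright_int_def g_def .
  also have "integral {0..} (\<lambda>t. g (0 + m * t)) = integral {0..} (\<lambda>t. f (0 + of_real t * (- 1)))"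
    by (rule integral_cong) (use gm in auto)
  also have "\<dots> = - integral {0..} (\<lambda>t. f (0 + of_real t * (- 1)) * (- 1))" by simp
  finally have "Im (wright_int \<sigma> x) = - (m * Im (integral {0..} (\<lambda>t. f (0 + of_real t * (- 1)) * (- 1))))" by simp
  also have "Im (integral {0..} (\<lambda>t. f (0 + of_real t * (- 1)) * (- 1))) = Im (integral {0..} (\<lambda>t. f (1 + of_real t * \<i>) * \<i>))"
    using arg_cong[OF rc, of Im] F01 by simp
  also have "integral {0..} (\<lambda>t. f (1 + of_real t * \<i>) * \<i>) =
      integral {0..} (\<lambda>t. of_real (exp (- X)) * (exp (of_real X * - (phase \<sigma> (1 + \<i> * of_real t) - 1)) * \<i>))"
  proof (rule integral_cong)
    fix t :: real assume t: "t \<in> {0..}"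
    obtain R \<theta> where R: "R \<ge> 0" "\<bar>\<theta>\<bar> < pi / 2" "1 + \<i> * of_real t = of_real R * cis \<theta>" "t > 0 \<Longrightarrow> \<theta> > 0"
      by (rule vertical_polar[of t]) (rule that)
    have "upper_powr \<sigma> (1 + \<i> * of_real t) = (1 + \<i> * of_real t) powr of_real \<sigma>"
    proof (cases "t = 0")
      case True then show ?thesis using upper_powr_polar[of 1 0 \<sigma>] \<sigma> by simp
    next
      case False
      then have "\<theta> > 0" using R(4) t by simp
      then show ?thesis unfolding R(3)
        using upper_powr_polar[OF R(1), of \<theta> \<sigma>] powr_polar[OF R(1), of \<theta> \<sigma>] R(2) \<sigma> pi_gt_zero by (simp add: abs_less_iff)
    qed
    moreover have "y / r * (s - p) = - y + y * - ((p - s) / r - 1)" for y r s p :: complex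
      by (simp add: algebra_simps diff_divide_distrib)
    ultimately have "f (1 + of_real t * \<i>) = exp (of_real (- X) + of_real X * - (phase \<sigma> (1 + \<i> * of_real t) - 1))"
      unfolding f_def phase_def of_real_divide of_real_minus by (simp only: mult.commute[of "of_real t" \<i>])
    then show "f (1 + of_real t * \<i>) * \<i> = of_real (exp (- X)) * (exp (of_real X * - (phase \<sigma> (1 + \<i> * of_real t) - 1)) * \<i>)"
      unfolding exp_add exp_of_real by simp
  qed
  also have "\<dots> = of_real (exp (- X)) * integral {0..} (\<lambda>t. exp (of_real X * - (phase \<sigma> (1 + \<i> * of_real t) - 1)) * \<i>)"
    by (rule integral_mult_right)
  finally show ?thesis by (simp only: Im_of_real_mult minus_minus mult.assoc)
qed

section \<open>Rotation of the contour and the exponential expansion\<close>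

lemma norm_powr_of_real:
  fixes u :: complex
  assumes "s > 0"
  shows "norm (u powr of_real s) = norm u powr s"
  using assms by (cases "u = 0") (simp_all add: powr_def norm_exp_eq_Re)

lemma of_real_powr_nonneg: "t \<ge> 0 \<Longrightarrow> complex_of_real t powr of_real s = of_real (t powr s)"
  by (simp add: powr_of_real)

text \<open>
  For negative arguments the ray may be turned by any angle below a right angle in either direction,
  because \<open>exp (- u)\<close> dominates the power there.
\<close>

lemma wright_int_rotate:
  assumes \<sigma>: "0 < \<sigma>" "\<sigma> < 1" and x: "x > 0" and phi: "\<bar>\<phi>\<bar> < pi / 2"
  defines "g \<equiv> \<lambda>t. exp (- (of_real t * cis \<phi>) + of_real x * cis (\<sigma> * (pi + \<phi>)) * of_real (t powr \<sigma>)) * cis \<phi>"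
  shows "wright_int \<sigma> (- x) = integral {0..} g" "g absolutely_integrable_on {0..}"
proof -
  define c where "c = cos \<phi>"
  have c: "c > 0" unfolding c_def using phi by (intro cos_gt_zero_pi) auto
  define f where "f = (\<lambda>u. exp (- u + of_real x * cis (pi * \<sigma>) * u powr of_real \<sigma>))"
  have c2: "c / 2 > 0" using c by simp
  obtain C where C: "\<And>r::real. r \<ge> 0 \<Longrightarrow> x * r powr \<sigma> \<le> C + (c / 2) * r"
    by (rule powr_le_affine[OF \<sigma>(2) c2 \<sigma>(1), of x]) (rule that)
  obtain B0 where B0: "B0 > 0" "\<And>r. r \<ge> 0 \<Longrightarrow> exp (- (c / 2) * r powr 1) \<le> B0 / (1 + r)\<^sup>2"
    by (rule exp_powr_le_inverse_square[OF c2, of 1]) (simp, rule that)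
  have decay: "norm (f u) \<le> (exp C * B0) / (1 + norm u)\<^sup>2" if u: "c * norm u \<le> Re u" for u
  proof -
    have "Re (of_real x * (cis (pi * \<sigma>) * u powr of_real \<sigma>)) \<le> norm (of_real x * (cis (pi * \<sigma>) * u powr of_real \<sigma>))"
      by (rule complex_Re_le_cmod)
    also have "\<dots> = x * norm u powr \<sigma>" using x \<sigma> by (simp add: norm_mult norm_powr_of_real)
    also have "\<dots> \<le> C + (c / 2) * norm u" by (rule C) simp
    finally have "Re (- u + of_real x * cis (pi * \<sigma>) * u powr of_real \<sigma>) \<le> C + - (c / 2) * norm u"
      using u by (simp add: mult.assoc)
    then have "norm (f u) \<le> exp (C + - (c / 2) * norm u)" unfolding f_def norm_exp_eq_Re by (simp only: exp_le_cancel_iff)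
    also have "\<dots> = exp C * exp (- (c / 2) * norm u powr 1)" unfolding exp_add by simp
    also have "\<dots> \<le> exp C * (B0 / (1 + norm u)\<^sup>2)" by (intro mult_left_mono B0) auto
    finally show ?thesis by simp
  qed
  have sub: "Re u \<ge> 0" if "c * norm u \<le> Re u" for u :: complex
    using that mult_nonneg_nonneg[OF less_imp_le[OF c] norm_ge_zero[of u]] by linarith
  have cont: "continuous_on {u. c * norm u \<le> Re u} f"
    unfolding f_def by (intro continuous_intros continuous_on_powr_complex) (use \<sigma> sub in auto)
  have fd: "f field_differentiable at u" if "Re u > 0" for u
  proof -
    have n: "u \<notin> \<real>\<^sub>\<le>\<^sub>0" using that by (auto simp: complex_nonpos_Reals_iff)
    note DERIV_chain'[OF DERIV_add[OF DERIV_minus[OF DERIV_ident] DERIV_cmult[OF has_field_derivative_powr[OF n, of "of_real \<sigma>"], of "of_real x * cis (pi * \<sigma>)"]] DERIV_exp]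
    then show ?thesis unfolding field_differentiable_def f_def by blast
  qed
  have fg: "f (of_real t * cis \<phi>) * cis \<phi> = g t" if "t \<ge> 0" for t
  proof -
    have "(of_real t * cis \<phi>) powr of_real \<sigma> = of_real (t powr \<sigma>) * cis (\<sigma> * \<phi>)"
      by (rule powr_polar) (use that phi \<sigma> pi_gt_zero in auto)
    moreover have "cis (pi * \<sigma>) * cis (\<sigma> * \<phi>) = cis (\<sigma> * (pi + \<phi>))" by (simp add: cis_mult algebra_simps)
    ultimately have E: "of_real x * cis (pi * \<sigma>) * (of_real t * cis \<phi>) powr of_real \<sigma> = of_real x * cis (\<sigma> * (pi + \<phi>)) * of_real (t powr \<sigma>)"
      by (metis (no_types, lifting) mult.assoc mult.commute)
    show ?thesis unfolding f_def g_def E ..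
  qed
  have d: "norm (cis \<phi>) = 1" "c \<le> Re (cis \<phi>)" by (auto simp: c_def)
  have "wright_int \<sigma> (- x) = integral {0..} (\<lambda>t. f (of_real t))"
    unfolding wright_int_def f_def by (rule integral_cong) (simp add: of_real_powr_nonneg mult.assoc)
  also have "\<dots> = integral {0..} (\<lambda>t. f (of_real t * cis \<phi>) * cis \<phi>)"
    by (rule sector_rotate(1)[OF c cont fd decay d, symmetric])
  also have "\<dots> = integral {0..} g" by (rule integral_cong) (use fg in auto)
  finally show "wright_int \<sigma> (- x) = integral {0..} g" .
  show "g absolutely_integrable_on {0..}"
    by (rule absolutely_integrable_spike[OF sector_rotate(2)[OF c cont fd decay d], of "{}"]) (use fg in auto)
qed

text \<open>
  Turned by the angle \<open>\<beta>\<close>, the ray passes through the saddle, and on it both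
  terms of the exponent have the same argument \<open>\<beta>\<close>: the integrand is the real one
  with a complex large parameter. The bound on \<open>\<sigma>\<close> says that
  \<open>\<beta>\<close> is less than a right angle.
\<close>

lemma wright_int_real_axis:
  assumes \<sigma>: "0 < \<sigma>" "\<sigma> < 1/3" and x: "x > 0"
  defines "\<beta> \<equiv> pi * \<sigma> / kap \<sigma>" and "X \<equiv> Xvar \<sigma> x" and "m \<equiv> \<sigma> * Xvar \<sigma> x / kap \<sigma>"
  shows "wright_int \<sigma> (- x) = cis \<beta> * of_real m * exp (of_real X * cis \<beta>) *
     (integral {0..} (\<lambda>t. exp (of_real X * (cis \<beta> * (of_real (rphase \<sigma> (1 + t)) - 1))) * 1)
       - integral {0..1} (\<lambda>t. exp (of_real X * (cis \<beta> * (of_real (rphase \<sigma> (1 - t)) - 1))) * (- 1)))"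
proof -
  have s1: "\<sigma> < 1" using \<sigma> by simp
  note sc = saddle_scaling[OF \<sigma>(1) s1 x, folded X_def m_def]
  have k: "kap \<sigma> > 0" by (rule positive_parameters(1)[OF \<sigma>(1) s1])
  have "\<sigma> / kap \<sigma> < 1/2" using \<sigma> by (simp add: kap_def field_simps)
  from mult_strict_left_mono[OF this pi_gt_zero] have b: "0 < \<beta>" "\<beta> < pi / 2"
    using \<sigma> k by (simp_all add: \<beta>_def)
  have cb: "cos \<beta> > 0" using b by (intro cos_gt_zero) auto
  have ab: "\<sigma> * (pi + \<beta>) = \<beta>"
  proof -
    have "\<beta> * kap \<sigma> = pi * \<sigma>" using k by (simp add: \<beta>_def)
    then show ?thesis by (simp add: kap_def algebra_simps)
  qed
  have b': "\<bar>\<beta>\<bar> < pi / 2" using b by simp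
  note rot = wright_int_rotate[OF \<sigma>(1) s1 x b', unfolded ab]
  define f where "f = (\<lambda>t. exp (- (of_real t * cis \<beta>) + of_real x * cis \<beta> * of_real (t powr \<sigma>)))"
  have fi: "f absolutely_integrable_on {0..}"
  proof -
    have "(\<lambda>t. cis (- \<beta>) * (f t * cis \<beta>)) absolutely_integrable_on {0..}"
      using set_integrable_mult_right[OF rot(2), of "cis (- \<beta>)"] by (simp add: f_def)
    moreover have "cis (- \<beta>) * (f t * cis \<beta>) = f t" for t
      by (simp add: mult.left_commute cis_mult)
    ultimately show ?thesis by simp
  qed
  define w where "w = of_real X * cis \<beta>"
  have w: "Re w > 0" using sc(1) cb by (simp add: w_def)
  have fm: "f (0 + m * t) = exp w * exp (w * (of_real (rphase \<sigma> (0 + t)) - 1))" if "t \<ge> 0" for t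
  proof -
    have "x * (m * t) powr \<sigma> = (x * m powr \<sigma>) * t powr \<sigma>" using sc(2) that by (simp add: powr_mult mult.assoc)
    then have xm: "x * (m * t) powr \<sigma> = X / kap \<sigma> * t powr \<sigma>" unfolding sc(3) .
    have "- (m * t) + x * (m * t) powr \<sigma> = X * rphase \<sigma> t"
      unfolding xm unfolding rphase_def m_def X_def using k by (simp add: field_simps)
    then have "of_real (- (m * t) + x * (m * t) powr \<sigma>) * cis \<beta> = w * of_real (rphase \<sigma> t)" by (simp add: w_def mult_ac)
    then have "- (of_real (m * t) * cis \<beta>) + of_real x * cis \<beta> * of_real ((m * t) powr \<sigma>) = w + w * (of_real (rphase \<sigma> t) - 1)"
      by (simp add: algebra_simps)
    then show ?thesis unfolding f_def by (simp add: exp_add)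
  qed
  have ei: "(\<lambda>t. exp w * exp (w * (of_real (rphase \<sigma> (0 + t)) - 1))) absolutely_integrable_on {0..}"
    by (intro set_integrable_mult_right exp_rphase_absolutely_integrable \<sigma>(1) s1 w) simp
  have ci: "(\<lambda>t. f (0 + m * t)) absolutely_integrable_on {0..}"
    by (rule absolutely_integrable_spike[OF ei, of "{}"]) (use fm in auto)
  have "wright_int \<sigma> (- x) = integral {0..} (\<lambda>t. cis \<beta> * f t)" unfolding rot(1) f_def by (simp add: mult.commute)
  also have "\<dots> = cis \<beta> * integral {0..} f" by (rule integral_mult_right)
  also have "integral {0..} f = of_real m * integral {0..} (\<lambda>t. f (0 + m * t))"
    by (rule integral_affine_atLeast[OF sc(2) fi ci])
  also have "integral {0..} (\<lambda>t. f (0 + m * t)) = integral {0..} (\<lambda>t. exp w * exp (w * (of_real (rphase \<sigma> t) - 1)))"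
    by (rule integral_cong) (use fm in auto)
  also have "\<dots> = exp w * integral {0..} (\<lambda>t. exp (w * (of_real (rphase \<sigma> t) - 1)))" by (rule integral_mult_right)
  also have "integral {0..} (\<lambda>t. exp (w * (of_real (rphase \<sigma> t) - 1))) = 
      integral {0..} (\<lambda>t. exp (w * (of_real (rphase \<sigma> (1 + t)) - 1)) * 1)
       - integral {0..1} (\<lambda>t. exp (w * (of_real (rphase \<sigma> (1 - t)) - 1)) * (- 1))"
    by (rule real_axis_integral_split[OF \<sigma>(1) s1 w, symmetric])
  finally show ?thesis unfolding w_def by (simp only: mult.assoc)
qed

text \<open>
  The phases in the cosines are those of the powers of \<open>of_real X * cis \<beta>\<close>,
  because \<open>pi / kap \<sigma> = pi + \<beta>\<close>.
\<close>

lemma E_trunc_as_Im: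
  assumes \<sigma>: "0 < \<sigma>" "\<sigma> < 1" and X: "Xvar \<sigma> x > 0"
  defines "\<beta> \<equiv> pi * \<sigma> / kap \<sigma>" and "X \<equiv> Xvar \<sigma> x"
  shows "E_trunc \<sigma> c M x = Apar \<sigma> / pi * X powr vth \<sigma> *
     Im (cis (\<beta> / 2) * exp (of_real X * cis \<beta>) * (\<Sum>j<M. of_real (c j) / (of_real X * cis \<beta>) ^ j))"
proof -
  have k: "kap \<sigma> > 0" by (rule positive_parameters(1)[OF \<sigma>])
  have bk: "\<beta> * kap \<sigma> = pi * \<sigma>" using k by (simp add: \<beta>_def)
  have pk0: "(pi + \<beta>) * kap \<sigma> = pi" unfolding distrib_right bk by (simp add: kap_def right_diff_distrib)
  have pk: "pi / kap \<sigma> = pi + \<beta>" using k pk0 by (metis less_irrefl nonzero_divide_eq_eq)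
  have "\<beta> * 1 - \<beta> * \<sigma> = pi * \<sigma>" using bk unfolding kap_def right_diff_distrib .
  then have bs: "\<beta> * \<sigma> = \<beta> - pi * \<sigma>" by linarith
  have e: "exp (of_real X * cis \<beta>) = of_real (exp (X * cos \<beta>)) * cis (X * sin \<beta>)" by (simp add: exp_eq_polar)
  have t: "Im (cis (\<beta> / 2) * exp (of_real X * cis \<beta>) * (of_real (c j) / (of_real X * cis \<beta>) ^ j)) =
     exp (X * cos \<beta>) * (c j / (- X) ^ j * cos (X * sin \<beta> + pi / kap \<sigma> * (vth \<sigma> - real j)))" for j
  proof -
    have d: "of_real (c j) / (of_real X * cis \<beta>) ^ j = of_real (c j / X ^ j) * cis (- (real j * \<beta>))"
      by (simp add: power_mult_distrib Complex.DeMoivre divide_inverse mult_ac)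
    have "cis (\<beta> / 2) * exp (of_real X * cis \<beta>) * (of_real (c j) / (of_real X * cis \<beta>) ^ j) =
       of_real (exp (X * cos \<beta>) * (c j / X ^ j)) * (cis (\<beta> / 2) * cis (X * sin \<beta>) * cis (- (real j * \<beta>)))"
      unfolding d e by (simp add: mult_ac)
    also have "cis (\<beta> / 2) * cis (X * sin \<beta>) * cis (- (real j * \<beta>)) = cis (X * sin \<beta> + \<beta> / 2 - real j * \<beta>)"
      unfolding cis_mult by (rule arg_cong[of _ _ cis]) linarith
    finally have "Im (cis (\<beta> / 2) * exp (of_real X * cis \<beta>) * (of_real (c j) / (of_real X * cis \<beta>) ^ j)) =
       exp (X * cos \<beta>) * (c j / X ^ j) * sin (X * sin \<beta> + \<beta> / 2 - real j * \<beta>)"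
      by (simp only: Im_of_real_mult cis.sel)
    moreover have "cos (X * sin \<beta> + pi / kap \<sigma> * (vth \<sigma> - real j)) = (- 1) ^ j * sin (X * sin \<beta> + \<beta> / 2 - real j * \<beta>)"
    proof -
      define y where "y = X * sin \<beta> + \<beta> / 2 - real j * \<beta>"
      have "(pi + \<beta>) * (\<sigma> - 1 / 2 - real j) = pi * \<sigma> + \<beta> * \<sigma> - pi / 2 - \<beta> / 2 - real j * pi - real j * \<beta>"
        by (simp add: algebra_simps)
      then have "pi / kap \<sigma> * (vth \<sigma> - real j) = \<beta> / 2 - pi / 2 - real j * \<beta> - real j * pi"
        unfolding pk vth_def bs by linarith
      then have "X * sin \<beta> + pi / kap \<sigma> * (vth \<sigma> - real j) = (y - pi / 2) - real j * pi" unfolding y_def by linarith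
      then have "cos (X * sin \<beta> + pi / kap \<sigma> * (vth \<sigma> - real j)) = cos ((y - pi / 2) - real j * pi)" by (simp only:)
      also have "\<dots> = cos (y - pi / 2) * (- 1) ^ j" unfolding cos_diff[of "y - pi / 2"] cos_npi sin_npi by simp
      also have "cos (y - pi / 2) = sin y" by (simp add: cos_diff)
      finally show ?thesis by (simp add: y_def)
    qed
    moreover have "(- X) ^ j = (- 1) ^ j * X ^ j" by (rule power_minus)
    moreover have "a * (d / p) * y = a * (d / (s * p) * (s * y))" if "s \<noteq> 0" for a d p s y :: real
      using that by simp
    ultimately show ?thesis by (metis power_not_zero zero_neq_neg_one)
  qed
  show ?thesis unfolding E_trunc_def sum_distrib_left Im_sum t X_def[symmetric] \<beta>_def[symmetric]
    by (simp add: mult_ac)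
qed

lemma filterlim_Xvar:
  assumes \<sigma>: "0 < \<sigma>" "\<sigma> < 1"
  shows "filterlim (Xvar \<sigma>) at_top at_top"
proof -
  note pos = positive_parameters[OF \<sigma>]
  have "filterlim (\<lambda>x. k * (h * x) powr (1 / k)) at_top at_top" if "k > 0" "h > 0" for k h :: real
    using that by real_asymp
  from this[OF pos(1), of "hpar \<sigma>"] show ?thesis unfolding Xvar_def[abs_def] using pos by simp
qed

text \<open>
  The scaling of the saddle turns the expansion of the two-sided integral \<open>D\<close> into the
  formal exponential expansion. The integral representation is an eventual one because the bound on
  the Airy integrand is uniform for \<open>X \<ge> 1\<close> only.
\<close>

lemma exponential_expansion:
  fixes D :: "real \<Rightarrow> complex"
  assumes \<sigma>: "0 < \<sigma>" "\<sigma> < 1"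
  defines "\<beta> \<equiv> pi * \<sigma> / kap \<sigma>"
  assumes rep: "\<forall>\<^sub>F x in at_top. Im (wright_int \<sigma> (- x)) =
      Im (cis \<beta> * of_real (\<sigma> * Xvar \<sigma> x / kap \<sigma>) * exp (of_real (Xvar \<sigma> x) * cis \<beta>) * D (Xvar \<sigma> x))"
    and D: "(\<lambda>X. D X - of_real (sqrt (2 * pi / \<sigma>)) / (cis (\<beta> / 2) * of_real (sqrt X)) * (\<Sum>j<M. of_real (c j) / (of_real X * cis \<beta>) ^ j))
        \<in> O[at_top](\<lambda>X. complex_of_real (X powr (-1/2 - real M)))"
  shows "(\<lambda>x. M_wright \<sigma> (- x) - E_trunc \<sigma> c M x) \<in> O[at_top](\<lambda>x. Xvar \<sigma> x powr (vth \<sigma> - real M) * exp (Xvar \<sigma> x * cos \<beta>))"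
proof -
  note pos = positive_parameters[OF \<sigma>]
  define q where "q = sqrt (2 * pi / \<sigma>)"
  have q: "q > 0" using \<sigma> by (simp add: q_def)
  define S where "S = (\<lambda>X. \<Sum>j<M. of_real (c j) / (of_real X * cis \<beta>) ^ j)"
  define err where "err = (\<lambda>X. D X - of_real q / (cis (\<beta> / 2) * of_real (sqrt X)) * S X)"
  note Xlim = filterlim_Xvar[OF \<sigma>]
  have "err \<in> O[at_top](\<lambda>X. complex_of_real (X powr (-1/2 - real M)))" using D unfolding err_def S_def q_def .
  then obtain C where C: "C > 0" "\<forall>\<^sub>F X in at_top. norm (err X) \<le> C * norm (complex_of_real (X powr (-1/2 - real M)))"
    by (rule landau_o.bigE)
  have C': "\<forall>\<^sub>F x in at_top. norm (err (Xvar \<sigma> x)) \<le> C * Xvar \<sigma> x powr (-1/2 - real M)"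
    using eventually_compose_filterlim[OF C(2) Xlim] by simp
  show ?thesis
  proof (rule bigoI[of _ "Apar \<sigma> / pi / q * C"])
    show "\<forall>\<^sub>F x in at_top. norm (M_wright \<sigma> (- x) - E_trunc \<sigma> c M x)
       \<le> Apar \<sigma> / pi / q * C * norm (Xvar \<sigma> x powr (vth \<sigma> - real M) * exp (Xvar \<sigma> x * cos \<beta>))"
      using C' rep eventually_gt_at_top[of 0]
    proof eventually_elim
      case (elim x)
      define X where "X = Xvar \<sigma> x"
      define m where "m = \<sigma> * Xvar \<sigma> x / kap \<sigma>"
      note sc = saddle_scaling[OF \<sigma> elim(3), folded X_def m_def q_def]
      have X: "X > 0" "sqrt X > 0" using sc(1) by simp_all
      define P where "P = Apar \<sigma> / pi * X powr vth \<sigma>"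
      have P: "P \<ge> 0" using pos by (simp add: P_def)
      define Q where "Q = cis \<beta> * exp (of_real X * cis \<beta>)"
      have nQ: "norm Q = exp (X * cos \<beta>)" by (simp add: Q_def norm_mult norm_exp_eq_Re)
      have "pi * \<sigma> * x * M_wright \<sigma> (- x) = Im (wright_int \<sigma> (- x))"
        using M_wright_eq_wright_int[OF \<sigma>, of "- x"] elim(3) by simp
      also have "\<dots> = Im (of_real m * (Q * D X))" unfolding elim(2) Q_def X_def m_def by (simp only: mult_ac)
      also have "\<dots> = m * Im (Q * D X)" by (rule Im_of_real_mult)
      finally have "pi * \<sigma> * x * M_wright \<sigma> (- x) = m * Im (Q * D X)" .
      moreover have "pi * \<sigma> * x \<noteq> 0" using elim(3) \<sigma> by simp
      ultimately have "M_wright \<sigma> (- x) = m / (pi * \<sigma> * x) * Im (Q * D X)"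
        by (metis nonzero_mult_div_cancel_left times_divide_eq_left)
      then have 1: "M_wright \<sigma> (- x) = P * (sqrt X / q) * Im (Q * D X)" unfolding sc(4) P_def .
      have cc: "cis \<beta> / cis (\<beta> / 2) = cis (\<beta> / 2)" by (simp add: cis_divide)
      have alg: "(b * e) * (k / (d * r) * y) = (k / r) * ((b / d) * e * y)" for b e k d r y :: complex
        by (simp add: divide_inverse mult_ac)
      have Qe: "Q * (of_real q / (cis (\<beta> / 2) * of_real (sqrt X)) * S X) = of_real (q / sqrt X) * (cis (\<beta> / 2) * exp (of_real X * cis \<beta>) * S X)"
        unfolding Q_def of_real_divide by (subst alg) (simp only: cc)
      have "E_trunc \<sigma> c M x = P * Im (cis (\<beta> / 2) * exp (of_real X * cis \<beta>) * S X)"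
        using E_trunc_as_Im[OF \<sigma>, of x c M] sc(1) unfolding P_def S_def X_def \<beta>_def by simp
      also have "\<dots> = P * (sqrt X / q) * Im (Q * (of_real q / (cis (\<beta> / 2) * of_real (sqrt X)) * S X))"
        unfolding Qe Im_of_real_mult using X q by simp
      finally have 2: "E_trunc \<sigma> c M x = P * (sqrt X / q) * Im (Q * (of_real q / (cis (\<beta> / 2) * of_real (sqrt X)) * S X))" .
      have lin: "p * Im (u * d) - p * Im (u * z) = p * Im (u * (d - z))" for p :: real and u d z :: complex
        by (simp only: right_diff_distrib minus_complex.sel)
      have 3: "err X = D X - of_real q / (cis (\<beta> / 2) * of_real (sqrt X)) * S X" by (simp only: err_def)
      have "M_wright \<sigma> (- x) - E_trunc \<sigma> c M x = P * (sqrt X / q) * Im (Q * err X)"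
        unfolding 1 2 3 by (rule lin)
      then have "norm (M_wright \<sigma> (- x) - E_trunc \<sigma> c M x) = P * (sqrt X / q) * \<bar>Im (Q * err X)\<bar>"
        using P X q by (simp add: abs_mult)
      also have "\<dots> \<le> P * (sqrt X / q) * (exp (X * cos \<beta>) * (C * X powr (-1/2 - real M)))"
      proof (rule mult_left_mono)
        have "\<bar>Im (Q * err X)\<bar> \<le> norm Q * norm (err X)" using abs_Im_le_cmod[of "Q * err X"] by (simp add: norm_mult)
        also have "\<dots> \<le> exp (X * cos \<beta>) * (C * X powr (-1/2 - real M))"
          unfolding nQ using elim(1) by (intro mult_left_mono) (auto simp: X_def)
        finally show "\<bar>Im (Q * err X)\<bar> \<le> exp (X * cos \<beta>) * (C * X powr (-1/2 - real M))" .
      qed (use P X q in auto)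
      also have "\<dots> = Apar \<sigma> / pi / q * C * (X powr vth \<sigma> * sqrt X * X powr (-1/2 - real M)) * exp (X * cos \<beta>)"
        by (simp add: P_def)
      also have "X powr vth \<sigma> * sqrt X * X powr (-1/2 - real M) = X powr (vth \<sigma> - real M)"
        using X by (simp flip: powr_half_sqrt powr_add)
      finally show ?case using X by (simp add: X_def abs_mult mult.assoc)
    qed
  qed
qed

section \<open>The Airy case\<close>

text \<open>
  For \<open>\<sigma> = 1/3\<close> the substitution \<open>t = - v ^ 3\<close> makes the integrand
  entire. The exponent is then a cubic polynomial, written here along a ray from the saddle in the
  direction \<open>e\<close>.
\<close>

definition airy_exponent :: "complex \<Rightarrow> real \<Rightarrow> complex" where
  "airy_exponent e t = \<i> * (- (3 / 2) * (of_real t * e)\<^sup>2 - (of_real t * e) ^ 3 / 2)"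

definition airy_amplitude :: "complex \<Rightarrow> real \<Rightarrow> complex" where
  "airy_amplitude e t = 3 * (1 + of_real t * e)\<^sup>2 * e"

lemma cube_root_of_cube_near_1:
  assumes "norm (w::complex) \<le> 1 / 4"
  shows "((1 + w) ^ 3) powr of_real (1 / 3) = 1 + w"
proof -
  have nz: "1 + w \<noteq> 0"
  proof
    assume "1 + w = 0"
    then have "w = - 1" by (simp add: eq_neg_iff_add_eq_0 add.commute)
    with assms show False by simp
  qed
  have "norm (Ln (1 + w)) \<le> 2 * norm w" by (rule norm_Ln_le) (use assms in simp)
  then have im: "\<bar>Im (Ln (1 + w))\<bar> \<le> 1 / 2" using abs_Im_le_cmod[of "Ln (1 + w)"] assms by linarith
  have e: "(1 + w) ^ 3 = exp (3 * Ln (1 + w))" using nz exp_of_nat_mult[of 3 "Ln (1 + w)"] by simp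
  have "Ln (exp (3 * Ln (1 + w))) = 3 * Ln (1 + w)"
    by (rule Ln_exp) (use im pi_gt3 in \<open>simp_all add: abs_le_iff\<close>)
  then show ?thesis unfolding e powr_def using nz by simp
qed

text \<open>
  Both the quadratic and the cubic term descend in the directions that satisfy the two hypotheses.
\<close>

lemma Re_airy_exponent_le:
  assumes e: "norm e = 1" "2 / 3 \<le> Re (\<i> * e\<^sup>2)" "0 \<le> Re (\<i> * e ^ 3)" and t: "t \<ge> 0"
  shows "Re (airy_exponent e t) \<le> - t\<^sup>2"
proof -
  have "airy_exponent e t = of_real (- (3 / 2) * t\<^sup>2) * (\<i> * e\<^sup>2) + of_real (- (t ^ 3 / 2)) * (\<i> * e ^ 3)"
    by (simp add: airy_exponent_def power_mult_distrib algebra_simps)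
  then have "Re (airy_exponent e t) = - (3 / 2) * t\<^sup>2 * Re (\<i> * e\<^sup>2) + - (t ^ 3 / 2 * Re (\<i> * e ^ 3))"
    by (simp only: plus_complex.sel Re_of_real_mult mult_minus_left)
  moreover have "t ^ 3 / 2 * Re (\<i> * e ^ 3) \<ge> 0" by (rule mult_nonneg_nonneg[OF _ e(3)]) (use t in simp)
  moreover have "(3 / 2 * t\<^sup>2) * (2 / 3) \<le> (3 / 2 * t\<^sup>2) * Re (\<i> * e\<^sup>2)" using e(2) by (intro mult_left_mono) auto
  ultimately show ?thesis by simp
qed

lemma airy_integrand_bound:
  assumes e: "norm e = 1" "2 / 3 \<le> Re (\<i> * e\<^sup>2)" "0 \<le> Re (\<i> * e ^ 3)"
  obtains B where "\<And>X t. X \<ge> 1 \<Longrightarrow> t \<ge> 0 \<Longrightarrow> exp (X * Re (airy_exponent e t)) * norm (airy_amplitude e t) \<le> B / (1 + t)\<^sup>2"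
proof -
  have "\<forall>\<^sub>F t in at_top. (1 + t) ^ 4 * exp (- t\<^sup>2) \<le> (1::real)" by real_asymp
  then obtain R where R: "\<And>t. t \<ge> R \<Longrightarrow> (1 + t) ^ 4 * exp (- t\<^sup>2) \<le> (1::real)" by (auto simp: eventually_at_top_linorder)
  define B where "B = 3 * max 1 ((1 + \<bar>R\<bar>) ^ 4)"
  have pb: "(1 + t) ^ 4 * exp (- t\<^sup>2) \<le> max 1 ((1 + \<bar>R\<bar>) ^ 4)" if t: "t \<ge> 0" for t :: real
  proof (cases "t \<ge> R")
    case False
    have "(1 + t) ^ 4 * exp (- t\<^sup>2) \<le> (1 + \<bar>R\<bar>) ^ 4 * 1" using False t by (intro mult_mono power_mono) auto
    then show ?thesis by simp
  next
    case True
    show ?thesis by (rule max.coboundedI1[OF R[OF True]])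
  qed
  show thesis
  proof (rule that[of B])
    fix X t :: real assume X: "X \<ge> 1" and t: "t \<ge> 0"
    have "norm (1 + of_real t * e) \<le> 1 + t" using norm_triangle_ineq[of 1 "of_real t * e"] e t by (simp add: norm_mult)
    then have a: "norm (airy_amplitude e t) \<le> 3 * (1 + t)\<^sup>2"
      unfolding airy_amplitude_def using e(1) by (simp add: norm_mult norm_power power_mono)
    have "X * Re (airy_exponent e t) \<le> X * (- t\<^sup>2)" using Re_airy_exponent_le[OF e t] X by (intro mult_left_mono) auto
    also have "\<dots> \<le> 1 * (- t\<^sup>2)" using X by (intro mult_right_mono_neg) auto
    finally have "exp (X * Re (airy_exponent e t)) \<le> exp (- t\<^sup>2)" by simp
    then have "exp (X * Re (airy_exponent e t)) * norm (airy_amplitude e t) \<le> exp (- t\<^sup>2) * (3 * (1 + t)\<^sup>2)"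
      using a by (intro mult_mono) auto
    also have "\<dots> = 3 * ((1 + t) ^ 4 * exp (- t\<^sup>2)) / (1 + t)\<^sup>2"
    proof -
      have "(1 + t) ^ 4 = (1 + t)\<^sup>2 * (1 + t)\<^sup>2" by (simp flip: power_add)
      then show ?thesis using t by (simp add: field_simps)
    qed
    also have "\<dots> \<le> B / (1 + t)\<^sup>2" unfolding B_def using pb[OF t] by (intro divide_right_mono mult_left_mono) auto
    finally show "exp (X * Re (airy_exponent e t)) * norm (airy_amplitude e t) \<le> B / (1 + t)\<^sup>2" .
  qed
qed

lemma continuous_on_airy [continuous_intros]:
  "continuous_on A (airy_exponent e)" "continuous_on A (airy_amplitude e)"
  unfolding airy_exponent_def[abs_def] airy_amplitude_def[abs_def] by (auto intro!: continuous_intros)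

lemma airy_absolutely_integrable:
  assumes e: "norm e = 1" "2 / 3 \<le> Re (\<i> * e\<^sup>2)" "0 \<le> Re (\<i> * e ^ 3)" and X: "X \<ge> 1"
  shows "(\<lambda>t. exp (of_real X * airy_exponent e t) * airy_amplitude e t) absolutely_integrable_on {0..}"
proof -
  obtain B where B: "\<And>X t. X \<ge> 1 \<Longrightarrow> t \<ge> 0 \<Longrightarrow> exp (X * Re (airy_exponent e t)) * norm (airy_amplitude e t) \<le> B / (1 + t)\<^sup>2"
    by (rule airy_integrand_bound[OF e]) (rule that)
  show ?thesis
  proof (rule continuous_bounded_absolutely_integrable[OF _ _ integrable_inverse_square])
    show "continuous_on {0..} (\<lambda>t. exp (of_real X * airy_exponent e t) * airy_amplitude e t)" by (intro continuous_intros)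
    fix t :: real assume "t \<in> {0..}"
    then show "norm (exp (of_real X * airy_exponent e t) * airy_amplitude e t) \<le> B / (1 + t)\<^sup>2"
      using B[OF X, of t] unfolding norm_mult norm_exp_eq_Re Re_of_real_mult by simp
  qed simp
qed

text \<open>
  The curve in the plane of the phase is \<open>(1 + t * e) ^ 3\<close>. Only near the saddle is its
  principal cube root \<open>1 + t * e\<close>, which is all that a descent path asks for.
\<close>

lemma descent_airy:
  assumes e: "norm e = 1" "2 / 3 \<le> Re (\<i> * e\<^sup>2)" "0 \<le> Re (\<i> * e ^ 3)" and D: "D = {0..} \<or> D = {0..2}"
  shows "descent_path (1 / 3) \<i> D (airy_exponent e) (airy_amplitude e)"
  unfolding descent_path_def
proof (intro conjI)
  show "D \<in> sets lebesgue" using D by auto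
  show D0: "D \<subseteq> {0..}" using D by auto
  show "continuous_on D (airy_exponent e)" "continuous_on D (airy_amplitude e)" by (intro continuous_intros)+
  have "(\<lambda>t. exp (of_real 1 * airy_exponent e t) * airy_amplitude e t) absolutely_integrable_on D"
    by (rule set_integrable_subset[OF airy_absolutely_integrable[OF e]]) (use D in auto)
  then show "(\<lambda>t. exp (Re (airy_exponent e t)) * norm (airy_amplitude e t)) integrable_on D"
    by (simp add: absolutely_integrable_on_def norm_mult)
  show "\<forall>\<epsilon>>0. \<exists>\<eta>>0. \<forall>t\<in>D. \<epsilon> \<le> t \<longrightarrow> Re (airy_exponent e t) \<le> - \<eta>"
  proof (intro allI impI)
    fix \<epsilon> :: real assume p: "\<epsilon> > 0"
    show "\<exists>\<eta>>0. \<forall>t\<in>D. \<epsilon> \<le> t \<longrightarrow> Re (airy_exponent e t) \<le> - \<eta>"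
    proof (intro exI[of _ "\<epsilon>\<^sup>2"] conjI ballI impI)
      fix t assume t: "t \<in> D" "\<epsilon> \<le> t"
      have "\<epsilon>\<^sup>2 \<le> t\<^sup>2" using t p by (intro power_mono) auto
      moreover have "t \<ge> 0" using t p by simp
      from Re_airy_exponent_le[OF e this] have "Re (airy_exponent e t) \<le> - t\<^sup>2" .
      ultimately show "Re (airy_exponent e t) \<le> - \<epsilon>\<^sup>2" by linarith
    qed (use p in simp)
  qed
  define \<gamma> where "\<gamma> = (\<lambda>t. (1 + of_real t * e) ^ 3 - 1)"
  have d: "(\<gamma> has_vector_derivative airy_amplitude e t) (at t within A)" for t A
  proof -
    have 1: "((\<lambda>t::real. 1 + of_real t * e) has_vector_derivative e) (at t within A)"
      by (auto intro!: derivative_eq_intros simp: has_vector_derivative_def scaleR_conv_of_real)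
    have 2: "((\<lambda>z. z ^ 3 - 1) has_field_derivative 3 * (1 + of_real t * e)\<^sup>2) (at (1 + of_real t * e) within (\<lambda>t. 1 + of_real t * e) ` A)"
      by (auto intro!: derivative_eq_intros)
    show ?thesis using field_vector_diff_chain_within[OF 1 2] by (simp add: o_def \<gamma>_def airy_amplitude_def mult.commute)
  qed
  have h: "airy_exponent e t = \<i> * (phase (1 / 3) (1 + \<gamma> t) - 1)" if "t \<in> {0..1/4}" for t
  proof -
    have "norm (of_real t * e) \<le> 1 / 4" using that e(1) by (simp add: norm_mult)
    from cube_root_of_cube_near_1[OF this]
    have r: "(1 + \<gamma> t) powr of_real (1 / 3) = 1 + of_real t * e" by (simp add: \<gamma>_def)
    define w where "w = of_real t * e"
    have k: "complex_of_real (kap (1 / 3)) = 2 / 3" by (simp add: kap_def)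
    have "phase (1 / 3) (1 + \<gamma> t) - 1 = ((1 + w) - (1 / 3) * (1 + w) ^ 3) / (2 / 3) - 1"
      unfolding phase_def r k by (simp add: \<gamma>_def w_def)
    also have "\<dots> = - (3 / 2) * w\<^sup>2 - w ^ 3 / 2" by (simp add: power2_eq_square power3_eq_cube field_simps)
    finally show ?thesis unfolding airy_exponent_def w_def by simp
  qed
  show "\<exists>\<epsilon>>0. \<exists>\<gamma>. {0..\<epsilon>} \<subseteq> D \<and> \<gamma> 0 = 0 \<and>
        (\<forall>t\<in>{0..\<epsilon>}. (\<gamma> has_vector_derivative airy_amplitude e t) (at t within {0..\<epsilon>}) \<and>
                     airy_exponent e t = \<i> * (phase (1 / 3) (1 + \<gamma> t) - 1))"
    by (intro exI[of _ "1 / 4"] conjI exI[of _ \<gamma>] ballI d h) (use D in \<open>auto simp: \<gamma>_def\<close>)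
qed

text \<open>
  The first direction leads from the saddle to the valley of the defining ray, the second to the
  negative real axis.
\<close>

lemma airy_directions:
  "norm (cis (- (pi / 6))) = 1" "2 / 3 \<le> Re (\<i> * (cis (- (pi / 6)))\<^sup>2)" "0 \<le> Re (\<i> * (cis (- (pi / 6))) ^ 3)"
  "norm (cis (2 * pi / 3)) = 1" "2 / 3 \<le> Re (\<i> * (cis (2 * pi / 3))\<^sup>2)" "0 \<le> Re (\<i> * (cis (2 * pi / 3)) ^ 3)"
proof -
  have s3: "4 / 3 \<le> sqrt 3" by (rule real_le_rsqrt) (simp add: power2_eq_square)
  have p1: "(cis (- (pi / 6)))\<^sup>2 = cis (- (pi / 3))" "(cis (- (pi / 6))) ^ 3 = cis (- (pi / 2))"
    using Complex.DeMoivre[of "- (pi / 6)" 2] Complex.DeMoivre[of "- (pi / 6)" 3] by simp_all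
  have p2: "(cis (2 * pi / 3))\<^sup>2 = cis (4 * pi / 3)" "(cis (2 * pi / 3)) ^ 3 = cis (2 * pi)"
    using Complex.DeMoivre[of "2 * pi / 3" 2] Complex.DeMoivre[of "2 * pi / 3" 3] by simp_all
  have s4: "sin (4 * pi / 3) = - (sqrt 3 / 2)"
  proof -
    have "4 * pi / 3 = pi / 3 + pi" by simp
    then have "sin (4 * pi / 3) = - sin (pi / 3)" using sin_periodic_pi[of "pi / 3"] by simp
    then show ?thesis by (simp add: sin_60)
  qed
  show "2 / 3 \<le> Re (\<i> * (cis (- (pi / 6)))\<^sup>2)" unfolding p1 using s3 by (simp add: sin_60)
  show "0 \<le> Re (\<i> * (cis (- (pi / 6))) ^ 3)" unfolding p1 by simp
  show "2 / 3 \<le> Re (\<i> * (cis (2 * pi / 3))\<^sup>2)" unfolding p2 using s3 by (simp add: s4)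
  show "0 \<le> Re (\<i> * (cis (2 * pi / 3)) ^ 3)" unfolding p2 by simp
qed auto

text \<open>
  At this value of \<open>\<sigma>\<close> the ray through the saddle would have to be turned by a
  right angle, where absolute convergence fails. In the variable \<open>v\<close> the integrand has
  an entire primitive \<open>G\<close>, and the defining ray is parallel to the first descent path,
  so that the values of \<open>G\<close> far out on the two differ by a null sequence. The second
  path ends on the real axis, where the integrand is real: the integral from there to
  \<open>0\<close> does not contribute to the imaginary part.
\<close>

lemma wright_int_third:
  assumes x: "x > 0" and X1: "Xvar (1 / 3) x \<ge> 1"
  defines "X \<equiv> Xvar (1 / 3) x" and "m \<equiv> (1 / 3) * Xvar (1 / 3) x / kap (1 / 3)"
  shows "Im (wright_int (1 / 3) (- x)) = Im (\<i> * of_real m * exp (of_real X * \<i>) *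
     (integral {0..} (\<lambda>t. exp (of_real X * airy_exponent (cis (- (pi / 6))) t) * airy_amplitude (cis (- (pi / 6))) t)
       - integral {0..2} (\<lambda>t. exp (of_real X * airy_exponent (cis (2 * pi / 3)) t) * airy_amplitude (cis (2 * pi / 3)) t)))"
proof -
  have \<sigma>: "0 < (1/3::real)" "(1/3::real) < 1" by simp_all
  note sc = saddle_scaling[OF \<sigma> x, folded X_def m_def]
  define a where "a = m powr (1 / 3)"
  have a: "a > 0" using sc(2) by (simp add: a_def)
  have mX: "m = X / 2" by (simp add: m_def X_def kap_def)
  have a3: "a ^ 3 = m" using sc(2) by (simp add: a_def powr_powr flip: powr_realpow)
  have xa: "x * a = 3 * X / 2" using sc(3) by (simp add: a_def kap_def)
  define g where "g = (\<lambda>v::complex. 3 * v\<^sup>2 * exp (v ^ 3 + of_real x * v))"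
  have "g holomorphic_on UNIV" unfolding g_def by (intro holomorphic_intros)
  then obtain G :: "complex \<Rightarrow> complex" where G: "\<And>v. (G has_field_derivative g v) (at v within A)" for A
  proof -
    assume hol: "g holomorphic_on UNIV"
    show thesis
    proof (rule holomorphic_convex_primitive'[OF convex_UNIV open_UNIV hol])
      fix G :: "complex \<Rightarrow> complex"
      assume "\<And>v. v \<in> UNIV \<Longrightarrow> (G has_field_derivative g v) (at v)"
      then show thesis by (intro that[of G]) (auto intro: has_field_derivative_at_within)
    qed
  qed
  define c where "c = cis (pi / 3)"
  have c3: "c ^ 3 = - 1" using Complex.DeMoivre[of "pi / 3" 3] by (simp add: c_def)
  \<comment> \<open>the ray of the defining integral, in the variable v with v^3 = -t\<close>
  define F where "F = (\<lambda>t. exp (- of_real t - of_real (- x) * cis (pi * (1 / 3)) * of_real (t powr (1 / 3))))"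
  define V where "V = (\<lambda>t. c * of_real (t powr (1 / 3)))"
  have Fint: "(F has_integral (G 0 - G (V R))) {0..R}" if R: "R \<ge> 0" for R
  proof -
    have "((\<lambda>t. - G (V t)) has_vector_derivative F t) (at t)" if t: "t \<in> {0<..<R}" for t
    proof -
      have t0: "t > 0" using t by simp
      define s where "s = t powr (1 / 3)"
      have s: "s > 0" "s ^ 3 = t" using t0 by (auto simp: s_def powr_powr simp flip: powr_realpow)
      have dp: "((\<lambda>t. t powr (1 / 3)) has_real_derivative 1 / (3 * s\<^sup>2)) (at t)"
      proof -
        have 0: "((\<lambda>t. t powr (1 / 3)) has_real_derivative (1 / 3) * t powr (1 / 3 - 1)) (at t)" by (rule has_real_derivative_powr[OF t0])
        have "t powr (1 / 3 - 1) = 1 / s\<^sup>2"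
        proof -
          have "t powr (1 / 3 - 1) = t powr (1 / 3) / t powr 1" by (rule powr_diff)
          also have "\<dots> = s / t" using t0 by (simp add: s_def)
          also have "\<dots> = 1 / s\<^sup>2" unfolding s(2)[symmetric] using s(1) by (simp add: power2_eq_square power3_eq_cube)
          finally show ?thesis .
        qed
        then have "(1 / 3) * t powr (1 / 3 - 1) = 1 / (3 * s\<^sup>2)" by (simp only: times_divide_times_eq mult_1)
        with 0 show ?thesis by (simp only:)
      qed
      have 1: "(V has_vector_derivative c * of_real (1 / (3 * s\<^sup>2))) (at t)"
        unfolding V_def
        by (intro bounded_linear.has_vector_derivative[OF bounded_linear_mult_right]
            bounded_linear.has_vector_derivative[OF bounded_linear_of_real])
           (use dp in \<open>simp only: has_real_derivative_iff_has_vector_derivative\<close>)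
      have "((\<lambda>t. G (V t)) has_vector_derivative c * of_real (1 / (3 * s\<^sup>2)) * g (V t)) (at t)"
        using field_vector_diff_chain_within[OF 1 G] by (simp add: o_def)
      moreover have "c * of_real (1 / (3 * s\<^sup>2)) * g (V t) = - F t"
      proof -
        have v: "V t = c * of_real s" by (simp add: V_def s_def)
        have "(V t) ^ 3 = c ^ 3 * of_real (s ^ 3)" unfolding v power_mult_distrib of_real_power ..
        then have v3: "(V t) ^ 3 = - of_real t" unfolding c3 s(2) by simp
        have "c * of_real (1 / (3 * s\<^sup>2)) * (3 * (V t)\<^sup>2) = c ^ 3"
          unfolding v using s(1) by (simp add: power_mult_distrib power2_eq_square power3_eq_cube field_simps)
        then have "c * of_real (1 / (3 * s\<^sup>2)) * g (V t) = - exp ((V t) ^ 3 + of_real x * V t)"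
          unfolding g_def c3 by (simp flip: mult.assoc)
        also have "(V t) ^ 3 + of_real x * V t = - of_real t - of_real (- x) * cis (pi * (1 / 3)) * of_real (t powr (1 / 3))"
          unfolding v3 by (simp add: V_def c_def mult.assoc)
        finally show ?thesis by (simp only: F_def)
      qed
      ultimately have "((\<lambda>t. G (V t)) has_vector_derivative - F t) (at t)" by (simp only:)
      from has_vector_derivative_minus[OF this] show ?thesis by (simp only: minus_minus)
    qed
    moreover have "continuous_on {0..R} (\<lambda>t. - G (V t))"
    proof -
      have "continuous_on UNIV G" using G by (meson DERIV_continuous_on)
      moreover have "continuous_on {0..R} V" unfolding V_def by (intro continuous_intros continuous_on_powr') auto
      ultimately show ?thesis by (intro continuous_on_minus continuous_on_compose2[of UNIV G "{0..R}" V]) auto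
    qed
    ultimately have "(F has_integral (- G (V R) - (- G (V 0)))) {0..R}"
      by (intro fundamental_theorem_of_calculus_interior R) auto
    then show ?thesis by (simp add: V_def)
  qed
  have Fabs: "F absolutely_integrable_on {0..}"
  proof -
    have p: "\<bar>0\<bar> < pi / 2" by simp
    from wright_int_rotate(2)[OF \<sigma> x p]
    show ?thesis by (rule absolutely_integrable_spike[where S = "{}"]) (auto simp: F_def mult.commute)
  qed
  define T where "T = (\<lambda>n. (a * real n) ^ 3)"
  have Tlim: "filterlim T at_top sequentially" unfolding T_def using a by real_asymp
  have VT: "V (T n) = c * of_real (a * real n)" for n
  proof -
    have "T n powr (1 / 3) = a * real n"
    proof (cases "n = 0")
      case False
      then have an: "a * real n > 0" using a by simp
      have "T n powr (1 / 3) = ((a * real n) powr 3) powr (1 / 3)" unfolding T_def by (subst powr_numeral[OF less_imp_le[OF an]]) (rule refl)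
      also have "\<dots> = (a * real n) powr (3 * (1 / 3))" by (rule powr_powr)
      also have "\<dots> = a * real n" using an by simp
      finally show ?thesis .
    qed (simp add: T_def)
    then show ?thesis by (simp add: V_def)
  qed
  have "(\<lambda>n. integral {0..0 + T n} F) \<longlonglongrightarrow> integral {0..} F" by (rule integral_atLeast_tendsto[OF Fabs Tlim])
  moreover have "integral {0..0 + T n} F = G 0 - G (c * of_real (a * real n))" for n
    using integral_unique[OF Fint[of "T n"]] a unfolding VT by (simp add: T_def)
  ultimately have lim1: "(\<lambda>n. G 0 - G (c * of_real (a * real n))) \<longlonglongrightarrow> wright_int (1 / 3) (- x)"
    unfolding wright_int_def F_def by simp
  \<comment> \<open>both descent paths leave the saddle, which is at i a in this variable\<close>
  define P where "P = - \<i> * of_real m * exp (of_real X * \<i>)"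
  have gd: "g (\<i> * of_real a + of_real t * (\<i> * of_real a * e)) * (\<i> * of_real a * e) = P * (exp (of_real X * airy_exponent e t) * airy_amplitude e t)" for t e
  proof -
    define w where "w = of_real t * e"
    have v: "\<i> * of_real a + of_real t * (\<i> * of_real a * e) = \<i> * of_real a * (1 + w)" by (simp add: w_def algebra_simps)
    have i3: "(\<i> * of_real a) ^ 3 = - \<i> * of_real m" unfolding power_mult_distrib a3[symmetric] by (simp add: power3_eq_cube)
    have "(\<i> * of_real a * (1 + w)) ^ 3 + of_real x * (\<i> * of_real a * (1 + w)) = - \<i> * of_real m * (1 + w) ^ 3 + \<i> * of_real (x * a) * (1 + w)"
      unfolding power_mult_distrib[of "\<i> * of_real a"] i3 by (simp add: mult_ac)
    also have "\<dots> = of_real X * \<i> + of_real X * (\<i> * (- (3 / 2) * w\<^sup>2 - w ^ 3 / 2))"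
      unfolding xa mX by (simp add: power2_eq_square power3_eq_cube algebra_simps)
    finally have ex: "exp ((\<i> * of_real a * (1 + w)) ^ 3 + of_real x * (\<i> * of_real a * (1 + w))) = exp (of_real X * \<i>) * exp (of_real X * airy_exponent e t)"
      unfolding airy_exponent_def w_def by (simp only: exp_add)
    have "3 * (\<i> * of_real a * (1 + w))\<^sup>2 * (\<i> * of_real a * e) = (\<i> * of_real a) ^ 3 * (3 * (1 + w)\<^sup>2 * e)"
      by (simp add: power2_eq_square power3_eq_cube mult_ac)
    then have am: "3 * (\<i> * of_real a * (1 + w))\<^sup>2 * (\<i> * of_real a * e) = - \<i> * of_real m * airy_amplitude e t"
      unfolding i3 airy_amplitude_def w_def .
    have "g (\<i> * of_real a * (1 + w)) * (\<i> * of_real a * e) = (3 * (\<i> * of_real a * (1 + w))\<^sup>2 * (\<i> * of_real a * e)) * exp ((\<i> * of_real a * (1 + w)) ^ 3 + of_real x * (\<i> * of_real a * (1 + w)))"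
      unfolding g_def by (simp only: mult_ac)
    then show ?thesis unfolding v am ex P_def by (simp only: mult_ac)
  qed
  define I where "I = (\<lambda>e D. integral D (\<lambda>t. exp (of_real X * airy_exponent e t) * airy_amplitude e t))"
  have seg: "P * I e {0..R} = G (\<i> * of_real a + of_real R * (\<i> * of_real a * e)) - G (\<i> * of_real a)" if "R \<ge> 0" for R e
  proof -
    have "((\<lambda>t. P * (exp (of_real X * airy_exponent e t) * airy_amplitude e t)) has_integral
        (G (\<i> * of_real a + of_real R * (\<i> * of_real a * e)) - G (\<i> * of_real a))) {0..R}"
      using integral_ray_segment[of UNIV G g R "\<i> * of_real a" "\<i> * of_real a * e"] G that unfolding gd by simp
    from integral_unique[OF this] show ?thesis unfolding I_def by (simp only: integral_mult_right)
  qed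
  define e1 where "e1 = cis (- (pi / 6))"
  define e2 where "e2 = cis (2 * pi / 3)"
  have ie1: "\<i> * e1 = c" unfolding e1_def c_def by (simp add: complex_eq_iff sin_30 cos_30 sin_60 cos_60)
  have lim2: "(\<lambda>n. G (\<i> * of_real a + of_real (real n) * (\<i> * of_real a * e1)) - G (\<i> * of_real a)) \<longlonglongrightarrow> P * I e1 {0..}"
  proof -
    have "(\<lambda>n. P * I e1 {0..0 + real n}) \<longlonglongrightarrow> P * I e1 {0..}"
      unfolding I_def e1_def
      by (intro tendsto_mult_left integral_atLeast_tendsto airy_absolutely_integrable airy_directions filterlim_real_sequentially)
         (use X1 in \<open>simp add: X_def\<close>)
    then show ?thesis by (simp add: seg)
  qed
  have close: "(\<lambda>n. G (\<i> * of_real a + of_real (real n) * (\<i> * of_real a * e1)) - G (c * of_real (a * real n))) \<longlonglongrightarrow> 0"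
  proof (rule Lim_null_comparison)
    show "\<forall>\<^sub>F n in sequentially. norm (G (\<i> * of_real a + of_real (real n) * (\<i> * of_real a * e1)) - G (c * of_real (a * real n)))
       \<le> 3 * (a * real n + a)\<^sup>2 * exp (- ((a * real n) ^ 3) + x * (a * real n / 2)) * a"
    proof (rule always_eventually, rule allI)
      fix n :: nat
      define t where "t = a * real n"
      have t: "t \<ge> 0" using a by (simp add: t_def)
      have pt: "\<i> * of_real a + of_real (real n) * (\<i> * of_real a * e1) = c * of_real t + \<i> * of_real a"
        unfolding ie1[symmetric] by (simp add: t_def mult_ac)
      have "norm (G (c * of_real t + \<i> * of_real a) - G (c * of_real t)) \<le> 3 * (t + a)\<^sup>2 * exp (- (t ^ 3) + x * (t / 2)) * norm ((c * of_real t + \<i> * of_real a) - c * of_real t)"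
      proof (rule field_differentiable_bound[of "closed_segment (c * of_real t + \<i> * of_real a) (c * of_real t)" G g])
        fix v assume "v \<in> closed_segment (c * of_real t + \<i> * of_real a) (c * of_real t)"
        then obtain u where u: "0 \<le> u" "u \<le> 1" "v = (1 - u) *\<^sub>R (c * of_real t + \<i> * of_real a) + u *\<^sub>R (c * of_real t)"
          by (auto simp: closed_segment_def)
        define y where "y = (1 - u) * a"
        have y: "0 \<le> y" "y \<le> a" using u a by (auto simp: y_def mult_left_le_one_le)
        have v: "v = c * of_real t + \<i> * of_real y" unfolding u y_def by (simp add: scaleR_conv_of_real algebra_simps)
        have rev: "Re v = t / 2" "Im v = sqrt 3 / 2 * t + y" unfolding v c_def by (simp_all add: cos_60 sin_60)
        have nv: "norm v \<le> t + a" using norm_triangle_ineq[of "c * of_real t" "\<i> * of_real y"] y t unfolding v by (simp add: norm_mult c_def)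
        have "Re (v ^ 3) = (Re v) ^ 3 - 3 * Re v * (Im v)\<^sup>2" by (simp add: power2_eq_square power3_eq_cube algebra_simps)
        also have "\<dots> \<le> (t / 2) ^ 3 - 3 * (t / 2) * (sqrt 3 / 2 * t)\<^sup>2"
          unfolding rev using t y by (intro diff_left_mono mult_left_mono power_mono) auto
        also have "(sqrt 3 / 2 * t)\<^sup>2 = 3 / 4 * t\<^sup>2" by (simp add: power_mult_distrib power_divide)
        also have "(t / 2) ^ 3 - 3 * (t / 2) * (3 / 4 * t\<^sup>2) = - (t ^ 3)" by (simp add: power2_eq_square power3_eq_cube)
        finally have "Re (v ^ 3 + of_real x * v) \<le> - (t ^ 3) + x * (t / 2)"
          unfolding plus_complex.sel Re_of_real_mult rev(1) by linarith
        then have "norm (exp (v ^ 3 + of_real x * v)) \<le> exp (- (t ^ 3) + x * (t / 2))" unfolding norm_exp_eq_Re by (simp only: exp_le_cancel_iff)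
        moreover have "norm (3 * v\<^sup>2) \<le> 3 * (t + a)\<^sup>2" using nv by (simp add: norm_mult norm_power power_mono)
        ultimately show "norm (g v) \<le> 3 * (t + a)\<^sup>2 * exp (- (t ^ 3) + x * (t / 2))"
          unfolding g_def norm_mult[of "3 * v\<^sup>2"] by (intro mult_mono) auto
      qed (use G in auto)
      then show "norm (G (\<i> * of_real a + of_real (real n) * (\<i> * of_real a * e1)) - G (c * of_real (a * real n)))
         \<le> 3 * (a * real n + a)\<^sup>2 * exp (- ((a * real n) ^ 3) + x * (a * real n / 2)) * a"
        unfolding pt using a by (simp add: t_def norm_mult)
    qed
    show "(\<lambda>n. 3 * (a * real n + a)\<^sup>2 * exp (- ((a * real n) ^ 3) + x * (a * real n / 2)) * a) \<longlonglongrightarrow> 0"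
      using a x by real_asymp
  qed
  have "(\<lambda>n. (G 0 - G (c * of_real (a * real n)))
        + (G (\<i> * of_real a + of_real (real n) * (\<i> * of_real a * e1)) - G (\<i> * of_real a))
        - (G (\<i> * of_real a + of_real (real n) * (\<i> * of_real a * e1)) - G (c * of_real (a * real n))))
      \<longlonglongrightarrow> wright_int (1 / 3) (- x) + P * I e1 {0..} - 0"
    by (intro tendsto_diff tendsto_add lim1 lim2 close)
  then have "(\<lambda>n::nat. G 0 - G (\<i> * of_real a)) \<longlonglongrightarrow> wright_int (1 / 3) (- x) + P * I e1 {0..}" by simp
  then have W: "wright_int (1 / 3) (- x) = G 0 - G (\<i> * of_real a) - P * I e1 {0..}"
    using LIMSEQ_unique[OF tendsto_const] by (metis add_diff_cancel_right')
  \<comment> \<open>the other path ends on the negative real axis\<close>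
  define y where "y = sqrt 3 * a"
  have end2: "\<i> * of_real a + of_real 2 * (\<i> * of_real a * e2) = - of_real y"
    unfolding e2_def y_def by (simp add: complex_eq_iff cos_120 sin_120)
  have 2: "P * I e2 {0..2} = G (- of_real y) - G (\<i> * of_real a)" using seg[of 2 e2] unfolding end2 by simp
  have "((\<lambda>t. g (0 + of_real t * (- 1)) * (- 1)) has_integral (G (0 + of_real y * (- 1)) - G 0)) {0..y}"
    by (rule integral_ray_segment[of UNIV]) (use G a in \<open>auto simp: y_def\<close>)
  from has_integral_linear[OF this bounded_linear_Im]
  have "((\<lambda>t. Im (g (0 + of_real t * (- 1)) * (- 1))) has_integral Im (G (- of_real y) - G 0)) {0..y}" by (simp add: o_def)
  moreover have "((\<lambda>t. Im (g (0 + of_real t * (- 1)) * (- 1))) has_integral 0) {0..y}"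
  proof (rule has_integral_is_0)
    fix t :: real
    have "g (of_real (- t)) = of_real (3 * t\<^sup>2 * exp ((- t) ^ 3 + x * (- t)))" unfolding g_def by (simp flip: exp_of_real)
    then have "Im (g (of_real (- t))) = 0" by (simp only: Im_complex_of_real)
    then show "Im (g (0 + of_real t * (- 1)) * (- 1)) = 0" by simp
  qed
  ultimately have "Im (G (- of_real y) - G 0) = 0" by (rule has_integral_unique)
  then have im0: "Im (G (- of_real y)) = Im (G 0)" by simp
  have "wright_int (1 / 3) (- x) = (G 0 - G (- of_real y)) + (- P) * (I e1 {0..} - I e2 {0..2})"
    unfolding W using 2 by (simp add: algebra_simps)
  then have "Im (wright_int (1 / 3) (- x)) = Im ((- P) * (I e1 {0..} - I e2 {0..2}))" using im0 by simp
  then show ?thesis unfolding P_def I_def e1_def e2_def by simp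
qed

section \<open>The algebraic expansion\<close>

text \<open>
  Taylor's formula in the half-plane in which all derivatives of \<open>exp (- u)\<close> are
  bounded by \<open>1\<close>.
\<close>

lemma exp_minus_taylor_bound:
  fixes u :: complex
  assumes u: "Re u \<ge> 0"
  shows "norm (exp (- u) - (\<Sum>k<n. (- u) ^ k / fact k)) \<le> norm u ^ n"
proof (cases n)
  case 0
  then show ?thesis using u by simp
next
  case (Suc m)
  have "norm (exp (- u) - (\<Sum>k\<le>m. exp 0 * (- u - 0) ^ k / fact k)) \<le> 1 * norm (- u - 0) ^ Suc m / fact m"
  proof (rule complex_Taylor[of "{v. Re v \<le> 0}" m "\<lambda>_. exp"])
    show "convex {v. Re v \<le> 0}" by (rule convex_halfspace_Re_le)
  qed (use u in \<open>auto intro!: derivative_eq_intros\<close>)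
  also have "\<dots> \<le> norm u ^ Suc m / 1"
    unfolding mult_1 by (intro frac_le) (auto simp: fact_ge_1)
  finally show ?thesis unfolding Suc lessThan_Suc_atMost by simp
qed

lemma power_exp_powr_decay:
  fixes p b s :: real
  assumes "p \<ge> 0" "b > 0" "s > 0"
  obtains B where "\<And>r. r \<ge> 0 \<Longrightarrow> (1 + r) powr p * exp (- b * r powr s) \<le> B / (1 + r)\<^sup>2"
proof -
  have "\<forall>\<^sub>F r in at_top. (1 + r) powr (p + 2) * exp (- b * r powr s) \<le> 1"
    using assms by real_asymp
  then obtain R where R: "\<And>r. r \<ge> R \<Longrightarrow> (1 + r) powr (p + 2) * exp (- b * r powr s) \<le> 1"
    by (auto simp: eventually_at_top_linorder)
  define B where "B = max 1 ((1 + \<bar>R\<bar>) powr (p + 2))"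
  show thesis
  proof (rule that[of B])
    fix r :: real assume r: "r \<ge> 0"
    have "(1 + r) powr (p + 2) * exp (- b * r powr s) \<le> B"
    proof (cases "r \<ge> R")
      case False
      have "(1 + r) powr (p + 2) * exp (- b * r powr s) \<le> (1 + \<bar>R\<bar>) powr (p + 2) * 1"
        using False r assms by (intro mult_mono powr_mono2) auto
      then show ?thesis by (simp add: B_def)
    next
      case True
      show ?thesis unfolding B_def by (rule max.coboundedI1[OF R[OF True]])
    qed
    moreover have "(1 + r) powr (p + 2) = (1 + r) powr p * (1 + r)\<^sup>2"
      using r by (simp add: powr_add powr_numeral)
    ultimately show "(1 + r) powr p * exp (- b * r powr s) \<le> B / (1 + r)\<^sup>2"
      using r by (simp add: field_simps)
  qed
qed

text \<open>
  Euler's integral for the gamma function along a rotated ray.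
\<close>

lemma gamma_integral_rotated:
  assumes a: "a > (1::real)" and r: "r > 0" and th: "\<bar>\<theta>\<bar> < pi / 2"
  defines "H \<equiv> \<lambda>y. of_real (y powr (a - 1)) * exp (- (of_real r * cis \<theta>) * of_real y)"
  shows "H absolutely_integrable_on {0..}" "integral {0..} H = of_real (Gamma a * r powr (- a)) * cis (- (a * \<theta>))"
proof -
  define c where "c = cos \<theta>"
  have c: "c > 0" unfolding c_def using th by (intro cos_gt_zero_pi) auto
  have a1: "a - 1 > 0" using a by simp
  define f where "f = (\<lambda>u::complex. u powr of_real (a - 1) * exp (- u))"
  obtain B where B: "\<And>r::real. r \<ge> 0 \<Longrightarrow> (1 + r) powr (a - 1) * exp (- c * r powr 1) \<le> B / (1 + r)\<^sup>2"
    by (rule power_exp_powr_decay[of "a - 1" c 1]) (use a in simp, use c in simp, simp, rule that)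
  have decay: "norm (f u) \<le> B / (1 + norm u)\<^sup>2" if u: "c * norm u \<le> Re u" for u
  proof -
    have "norm (f u) \<le> (1 + norm u) powr (a - 1) * exp (- c * norm u powr 1)"
      unfolding f_def norm_mult norm_powr_of_real[OF a1] norm_exp_eq_Re
      using u a by (intro mult_mono powr_mono2) auto
    also have "\<dots> \<le> B / (1 + norm u)\<^sup>2" by (rule B) simp
    finally show ?thesis .
  qed
  have sub: "Re u \<ge> 0" if "c * norm u \<le> Re u" for u :: complex
    using that mult_nonneg_nonneg[OF less_imp_le[OF c] norm_ge_zero[of u]] by linarith
  have cont: "continuous_on {u. c * norm u \<le> Re u} f"
    unfolding f_def by (intro continuous_intros continuous_on_powr_complex) (use a sub in auto)
  have fd: "f field_differentiable at u" if "Re u > 0" for u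
  proof -
    have n: "u \<notin> \<real>\<^sub>\<le>\<^sub>0" using that by (auto simp: complex_nonpos_Reals_iff)
    note DERIV_mult'[OF has_field_derivative_powr[OF n, of "of_real (a - 1)"] DERIV_chain'[OF DERIV_minus[OF DERIV_ident] DERIV_exp]]
    then show ?thesis unfolding field_differentiable_def f_def by blast
  qed
  have d: "norm (cis \<theta>) = 1" "c \<le> Re (cis \<theta>)" by (auto simp: c_def)
  have G: "integral {0..} (\<lambda>t. f (of_real t)) = of_real (Gamma a)"
  proof -
    have "((\<lambda>t. t powr (a - 1) / exp t) has_integral Gamma a) {0..}" by (rule Gamma_integral_real) (use a in simp)
    from integral_unique[OF has_integral_of_real[OF this]]
    have "integral {0..} (\<lambda>t. complex_of_real (t powr (a - 1) / exp t)) = of_real (Gamma a)" .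
    moreover have "integral {0..} (\<lambda>t. f (of_real t)) = integral {0..} (\<lambda>t. complex_of_real (t powr (a - 1) / exp t))"
      by (rule integral_cong) (simp add: f_def of_real_powr_nonneg[of _ "a - 1", simplified] exp_minus divide_inverse exp_of_real)
    ultimately show ?thesis by simp
  qed
  define g where "g = (\<lambda>t. f (of_real t * cis \<theta>) * cis \<theta>)"
  note gabs = sector_rotate(2)[OF c cont fd decay d, folded g_def]
  have gint: "integral {0..} g = of_real (Gamma a)"
    using sector_rotate(1)[OF c cont fd decay d] G by (simp add: g_def)
  have gH: "g (0 + r * y) = (of_real (r powr (a - 1)) * cis (a * \<theta>)) * H y" if y: "y \<ge> 0" for y
  proof -
    have "(of_real (r * y) * cis \<theta>) powr of_real (a - 1) = of_real ((r * y) powr (a - 1)) * cis ((a - 1) * \<theta>)"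
      by (rule powr_polar) (use y r th a pi_gt_zero in auto)
    moreover have "(r * y) powr (a - 1) = r powr (a - 1) * y powr (a - 1)" using r y by (simp add: powr_mult)
    moreover have "cis ((a - 1) * \<theta>) * cis \<theta> = cis (a * \<theta>)" by (simp add: cis_mult algebra_simps)
    ultimately show ?thesis unfolding g_def f_def H_def by (simp add: mult_ac)
  qed
  obtain B2 where B2: "\<And>y::real. y \<ge> 0 \<Longrightarrow> (1 + y) powr (a - 1) * exp (- (r * c) * y powr 1) \<le> B2 / (1 + y)\<^sup>2"
    by (rule power_exp_powr_decay[of "a - 1" "r * c" 1]) (use a in simp, use c r in simp, simp, rule that)
  show Habs: "H absolutely_integrable_on {0..}"
  proof (rule continuous_bounded_absolutely_integrable[OF _ _ integrable_inverse_square[of B2]])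
    show "continuous_on {0..} H" unfolding H_def by (intro continuous_intros continuous_on_powr') (use a in auto)
    fix y :: real assume y: "y \<in> {0..}"
    have "norm (H y) = y powr (a - 1) * exp (- (r * c) * y powr 1)"
      using y by (simp add: H_def norm_mult norm_exp_eq_Re c_def)
    also have "\<dots> \<le> (1 + y) powr (a - 1) * exp (- (r * c) * y powr 1)" using y a by (intro mult_right_mono powr_mono2) auto
    finally show "norm (H y) \<le> B2 / (1 + y)\<^sup>2" using B2[of y] y by simp
  qed simp
  have "(\<lambda>y. (of_real (r powr (a - 1)) * cis (a * \<theta>)) * H y) absolutely_integrable_on {0..}"
    by (rule set_integrable_mult_right) (rule Habs)
  then have gr: "(\<lambda>y. g (0 + r * y)) absolutely_integrable_on {0..}"
    by (rule absolutely_integrable_spike[where S = "{}"]) (use gH in auto)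
  have "of_real (Gamma a) = of_real r * integral {0..} (\<lambda>y. g (0 + r * y))"
    using integral_affine_atLeast[OF r gabs gr] gint by simp
  also have "integral {0..} (\<lambda>y. g (0 + r * y)) = integral {0..} (\<lambda>y. (of_real (r powr (a - 1)) * cis (a * \<theta>)) * H y)"
    by (rule integral_cong) (use gH in auto)
  also have "\<dots> = (of_real (r powr (a - 1)) * cis (a * \<theta>)) * integral {0..} H" by (rule integral_mult_right)
  also have "of_real r * (of_real (r powr (a - 1)) * cis (a * \<theta>) * integral {0..} H) = (of_real (r * r powr (a - 1)) * cis (a * \<theta>)) * integral {0..} H"
    by (simp add: mult_ac)
  also have "r * r powr (a - 1) = r powr a" using r by (simp add: powr_diff)
  finally have fe: "of_real (r powr (- a)) * cis (- (a * \<theta>)) * of_real (Gamma a) =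
      (of_real (r powr (- a) * r powr a) * (cis (- (a * \<theta>)) * cis (a * \<theta>))) * integral {0..} H"
    by (simp add: mult_ac)
  have p1: "r powr (- a) * r powr a = 1" using r by (simp flip: powr_add)
  have c1: "cis (- (a * \<theta>)) * cis (a * \<theta>) = 1" by (simp add: cis_mult)
  have "integral {0..} H = of_real (r powr (- a)) * cis (- (a * \<theta>)) * of_real (Gamma a)"
    using fe unfolding p1 c1 of_real_1 mult_1_left by (rule sym)
  then show "integral {0..} H = of_real (Gamma a * r powr (- a)) * cis (- (a * \<theta>))"
    by (simp only: of_real_mult mult_ac)
qed

lemma power_exp_powr_integral:
  fixes k :: nat
  assumes \<sigma>: "0 < \<sigma>" "\<sigma> < 1" and r: "r > 0" and th: "\<bar>\<theta>\<bar> < pi / 2"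
  defines "f \<equiv> \<lambda>t. of_real (t ^ k) * exp (- (of_real r * cis \<theta>) * of_real (t powr \<sigma>))"
    and "a \<equiv> real (k + 1) / \<sigma>"
  shows "f absolutely_integrable_on {0..}" "integral {0..} f = of_real (Gamma a / \<sigma> * r powr (- a)) * cis (- (a * \<theta>))"
proof -
  define c where "c = cos \<theta>"
  have c: "c > 0" unfolding c_def using th by (intro cos_gt_zero_pi) auto
  have a1: "a > 1" using \<sigma> by (simp add: a_def field_simps)
  obtain B where B: "\<And>t::real. t \<ge> 0 \<Longrightarrow> (1 + t) powr real k * exp (- (r * c) * t powr \<sigma>) \<le> B / (1 + t)\<^sup>2"
    by (rule power_exp_powr_decay[of "real k" "r * c" \<sigma>]) (simp, use c r in simp, use \<sigma> in simp, rule that)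
  have contf: "continuous_on {0..} f" unfolding f_def by (intro continuous_intros continuous_on_powr') (use \<sigma> in auto)
  show fabs: "f absolutely_integrable_on {0..}"
  proof (rule continuous_bounded_absolutely_integrable[OF contf _ integrable_inverse_square[of B]])
    fix t :: real assume t: "t \<in> {0..}"
    have "norm (f t) = t ^ k * exp (- (r * c) * t powr \<sigma>)"
      using t by (simp add: f_def norm_mult norm_power norm_exp_eq_Re c_def)
    also have "\<dots> \<le> (1 + t) powr real k * exp (- (r * c) * t powr \<sigma>)"
      using t by (intro mult_right_mono) (auto simp: powr_realpow intro: power_mono)
    finally show "norm (f t) \<le> B / (1 + t)\<^sup>2" using B[of t] t by simp
  qed simp
  define H where "H = (\<lambda>y. of_real (y powr (a - 1)) * exp (- (of_real r * cis \<theta>) * of_real y))"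
  note GH = gamma_integral_rotated[OF a1 r th, folded H_def]
  define g where "g = (\<lambda>y::real. y powr (1 / \<sigma>))"
  have sub: "integral {0..0 + g (real n)} f = of_real (1 / \<sigma>) * integral {0..0 + real n} H" for n
  proof -
    have sb: "((\<lambda>y. (1 / \<sigma> * y powr (1 / \<sigma> - 1)) *\<^sub>R f (g y)) has_integral (integral {g 0..g (real n)} f)) {0..real n}"
    proof (rule has_integral_substitution_strong[of "{0}" 0 "real n" g 0 "g (real n)"])
      show "g 0 \<le> g (real n)" by (simp add: g_def)
      show "g ` {0..real n} \<subseteq> {0..g (real n)}" using \<sigma> by (auto simp: g_def intro!: powr_mono2)
      show "continuous_on {0..g (real n)} f" by (rule continuous_on_subset[OF contf]) auto
      show "continuous_on {0..real n} g" unfolding g_def by (intro continuous_on_powr' continuous_intros) (use \<sigma> in auto)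
      fix y assume y: "y \<in> {0..real n} - {0}"
      then have "(g has_real_derivative 1 / \<sigma> * y powr (1 / \<sigma> - 1)) (at y)"
        unfolding g_def by (intro has_real_derivative_powr) auto
      then show "(g has_real_derivative 1 / \<sigma> * y powr (1 / \<sigma> - 1)) (at y within {0..real n})" by (rule has_field_derivative_at_within)
    qed auto
    have eqv: "(1 / \<sigma> * y powr (1 / \<sigma> - 1)) *\<^sub>R f (g y) = of_real (1 / \<sigma>) * H y" if y: "y \<in> {0..real n}" for y
    proof (cases "y = 0")
      case True
      then show ?thesis using a1 by (simp add: H_def)
    next
      case False
      then have y0: "y > 0" using y by simp
      have "g y ^ k = y powr (real k / \<sigma>)" using y0 by (simp add: g_def powr_powr flip: powr_realpow)
      moreover have "g y powr \<sigma> = y" using y0 \<sigma> by (simp add: g_def powr_powr)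
      moreover have "y powr (1 / \<sigma> - 1) * y powr (real k / \<sigma>) = y powr (a - 1)"
        using y0 by (simp add: a_def add_divide_distrib flip: powr_add) (simp add: algebra_simps)
      ultimately show ?thesis unfolding f_def H_def by (simp add: scaleR_conv_of_real flip: of_real_mult)
    qed
    have "((\<lambda>y. of_real (1 / \<sigma>) * H y) has_integral (integral {g 0..g (real n)} f)) {0..real n}"
      by (rule has_integral_eq[OF eqv sb])
    from integral_unique[OF this] show ?thesis by (simp add: g_def)
  qed
  have gl: "filterlim (\<lambda>n. g (real n)) at_top sequentially" unfolding g_def using \<sigma> by real_asymp
  have "(\<lambda>n. of_real (1 / \<sigma>) * integral {0..0 + real n} H) \<longlonglongrightarrow> integral {0..} f"
    using integral_atLeast_tendsto[OF fabs gl] unfolding sub .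
  moreover have "(\<lambda>n. of_real (1 / \<sigma>) * integral {0..0 + real n} H) \<longlonglongrightarrow> of_real (1 / \<sigma>) * integral {0..} H"
    by (intro tendsto_mult_left integral_atLeast_tendsto GH(1) filterlim_real_sequentially)
  ultimately have "integral {0..} f = of_real (1 / \<sigma>) * integral {0..} H" by (rule LIMSEQ_unique)
  then show "integral {0..} f = of_real (Gamma a / \<sigma> * r powr (- a)) * cis (- (a * \<theta>))"
    unfolding GH(2) by simp
qed

text \<open>
  When \<open>\<sigma> > 1/3\<close> the ray can be turned by an angle \<open>\<phi>\<close> such
  that the term with \<open>x\<close> decays by itself. Then the other exponential may be expanded
  in its Taylor series, and every term is an Euler integral. The angle \<open>\<theta>\<close> is
  what is left of the argument of the coefficient of \<open>x\<close> after its sign is taken out.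
\<close>

lemma algebraic_expansion:
  assumes \<sigma>: "1 / 3 < \<sigma>" "\<sigma> < 1" and N: "N \<ge> 1"
  shows "(\<lambda>x. M_wright \<sigma> (- x) - H_trunc \<sigma> N x) \<in> O[at_top](\<lambda>x. x powr (- (real N + \<sigma>) / \<sigma>))"
proof -
  have s: "0 < \<sigma>" "\<sigma> < 1" using \<sigma> by simp_all
  \<comment> \<open>beyond the angle \<open>pi / (2 * \<sigma>) - pi\<close> the term with \<open>x\<close> decays; \<open>\<phi>\<close> is halfway between that angle, or \<open>0\<close> if it is negative, and a right angle\<close>
  define L where "L = max 0 (pi / (2 * \<sigma>) - pi)"
  have "pi / (2 * \<sigma>) < pi / (2 * (1 / 3))" using \<sigma> pi_gt_zero by (intro divide_strict_left_mono) auto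
  then have l: "pi / (2 * \<sigma>) - pi < pi / 2" by simp
  have L: "0 \<le> L" "pi / (2 * \<sigma>) - pi \<le> L" unfolding L_def by (rule max.cobounded1, rule max.cobounded2)
  have L2: "L < pi / 2" unfolding L_def max_less_iff_conj using l pi_gt_zero by (intro conjI) linarith+
  define \<phi> where "\<phi> = L / 2 + pi / 4"
  have p1: "L < \<phi>" using L2 unfolding \<phi>_def by linarith
  have p2: "\<phi> < pi / 2" using L2 unfolding \<phi>_def by linarith
  have p3: "0 < \<phi>" using L(1) p1 by linarith
  note phi = p1 p2 p3
  define \<theta> where "\<theta> = \<sigma> * (pi + \<phi>) - pi"
  have "pi / (2 * \<sigma>) < pi + \<phi>" using phi L by linarith
  then have "pi / 2 < \<sigma> * (pi + \<phi>)" using s by (simp add: field_simps)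
  moreover have "\<sigma> * (pi + \<phi>) < 1 * (pi + pi / 2)" using s phi pi_gt_zero by (intro mult_strict_mono) auto
  moreover have "\<bar>z - pi\<bar> < pi / 2" if "pi / 2 < z" "z < 1 * (pi + pi / 2)" for z :: real
    using that unfolding mult_1 abs_less_iff by (intro conjI) linarith+
  ultimately have th: "\<bar>\<theta>\<bar> < pi / 2" unfolding \<theta>_def by blast
  have ct: "cos \<theta> > 0" using th by (intro cos_gt_zero_pi) auto
  have ph: "\<bar>\<phi>\<bar> < pi / 2" using phi by simp
  have cph: "cos \<phi> > 0" using ph by (intro cos_gt_zero_pi) auto
  define n where "n = N - 1"
  have n: "Suc n = N" using N by (simp add: n_def)
  define aa where "aa = (\<lambda>k::nat. real (k + 1) / \<sigma>)"
  define K where "K = Gamma (aa n) / \<sigma> * cos \<theta> powr (- aa n) / (pi * \<sigma>)"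
  have main: "\<bar>M_wright \<sigma> (- x) - H_trunc \<sigma> N x\<bar> \<le> K * x powr (- (real N + \<sigma>) / \<sigma>)" if x: "x > 0" for x
  proof -
    define E where "E = (\<lambda>t. exp (- (of_real x * cis \<theta>) * of_real (t powr \<sigma>)))"
    define f where "f = (\<lambda>k t. of_real (t ^ k) * E t)"
    have fk: "f k absolutely_integrable_on {0..}"
      "integral {0..} (f k) = of_real (Gamma (aa k) / \<sigma> * x powr (- aa k)) * cis (- (aa k * \<theta>))" for k
      using power_exp_powr_integral[OF s x th, of k] by (simp_all only: f_def E_def aa_def)
    have fki: "f k integrable_on {0..}" for k using fk(1)[of k] unfolding absolutely_integrable_on_def by blast
    define g where "g = (\<lambda>t. exp (- (of_real t * cis \<phi>) + of_real x * cis (\<sigma> * (pi + \<phi>)) * of_real (t powr \<sigma>)) * cis \<phi>)"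
    note rot = wright_int_rotate[OF s x ph, folded g_def]
    have ge: "g t = exp (- (of_real t * cis \<phi>)) * E t * cis \<phi>" for t
    proof -
      have "cis (\<sigma> * (pi + \<phi>)) = - cis \<theta>" unfolding \<theta>_def by (simp add: complex_eq_iff cos_diff sin_diff)
      then show ?thesis unfolding g_def E_def by (simp add: mult_exp_exp)
    qed
    define co where "co = (\<lambda>k. (- 1) ^ k / fact k * cis (real (k + 1) * \<phi>))"
    have tk: "(- (of_real t * cis \<phi>)) ^ k / fact k * E t * cis \<phi> = co k * f k t" for k t
    proof -
      have "(- (of_real t * cis \<phi>)) ^ k = (- 1) ^ k * (of_real (t ^ k) * cis (real k * \<phi>))"
        by (subst power_minus) (simp add: power_mult_distrib Complex.DeMoivre)
      moreover have "cis (real k * \<phi>) * cis \<phi> = cis (real (k + 1) * \<phi>)" by (simp add: cis_mult algebra_simps)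
      ultimately show ?thesis unfolding co_def f_def by (simp add: mult_ac divide_inverse)
    qed
    define err where "err = (\<lambda>t. g t - (\<Sum>k<n. co k * f k t))"
    have ei: "(\<lambda>t. \<Sum>k<n. co k * f k t) integrable_on {0..}"
      by (intro integrable_sum integrable_on_mult_right fki) simp
    have gi: "g integrable_on {0..}" using rot(2) by (simp add: absolutely_integrable_on_def)
    have split: "wright_int \<sigma> (- x) = (\<Sum>k<n. co k * integral {0..} (f k)) + integral {0..} err"
    proof -
      have "integral {0..} err = integral {0..} g - integral {0..} (\<lambda>t. \<Sum>k<n. co k * f k t)"
        unfolding err_def by (rule integral_diff[OF gi ei])
      also have "integral {0..} (\<lambda>t. \<Sum>k<n. co k * f k t) = (\<Sum>k<n. integral {0..} (\<lambda>t. co k * f k t))"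
        by (rule integral_sum) (auto intro!: integrable_on_mult_right fki)
      finally show ?thesis unfolding rot(1) integral_mult_right by simp
    qed
    have errb: "norm (integral {0..} err) \<le> Gamma (aa n) / \<sigma> * (x * cos \<theta>) powr (- aa n)"
    proof -
      have xc: "x * cos \<theta> > 0" using x ct by simp
      have z: "\<bar>0\<bar> < pi / 2" by simp
      define h where "h = (\<lambda>t. of_real (t ^ n) * exp (- (of_real (x * cos \<theta>) * cis 0) * of_real (t powr \<sigma>)))"
      note hn = power_exp_powr_integral[OF s xc z, of n, folded h_def aa_def]
      have hr: "h t = complex_of_real (t ^ n * exp (- (x * cos \<theta>) * t powr \<sigma>))" for t
        unfolding h_def by (simp flip: exp_of_real)
      have hi: "h integrable_on {0..}" using hn(1) by (simp add: absolutely_integrable_on_def)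
      have hc: "integral {0..} h = of_real (Gamma (aa n) / \<sigma> * (x * cos \<theta>) powr (- aa n))" using hn(2) unfolding aa_def by simp
      have "norm (integral {0..} err) \<le> integral {0..} (\<lambda>t. Re (h t))"
      proof (rule integral_norm_bound_integral)
        show "err integrable_on {0..}" unfolding err_def by (rule integrable_diff[OF gi ei])
        show "(\<lambda>t. Re (h t)) integrable_on {0..}" using integrable_linear[OF hi bounded_linear_Re] by (simp add: o_def)
        fix t :: real assume t: "t \<in> {0..}"
        have "err t = (exp (- (of_real t * cis \<phi>)) - (\<Sum>k<n. (- (of_real t * cis \<phi>)) ^ k / fact k)) * E t * cis \<phi>"
          unfolding err_def ge tk[symmetric] left_diff_distrib sum_distrib_right ..
        then have "norm (err t) = norm (exp (- (of_real t * cis \<phi>)) - (\<Sum>k<n. (- (of_real t * cis \<phi>)) ^ k / fact k)) * norm (E t)"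
          by (simp add: norm_mult)
        also have "\<dots> \<le> norm (of_real t * cis \<phi>) ^ n * norm (E t)"
          by (intro mult_right_mono exp_minus_taylor_bound) (use t cph in auto)
        also have "\<dots> = t ^ n * exp (- (x * cos \<theta>) * t powr \<sigma>)"
          using t by (simp add: norm_mult E_def norm_exp_eq_Re)
        finally show "norm (err t) \<le> Re (h t)" unfolding hr Re_complex_of_real .
      qed
      also have "\<dots> = Re (integral {0..} h)" using integral_linear[OF hi bounded_linear_Re] by (simp add: o_def)
      finally show ?thesis unfolding hc Re_complex_of_real .
    qed
    have trm: "Im (co k * integral {0..} (f k)) / (pi * \<sigma> * x) = 1 / \<sigma> * (x powr (- (real (Suc k) + \<sigma>) / \<sigma>) / fact (Suc k) * rGamma (- (real (Suc k) / \<sigma>)))" for k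
    proof -
      define a where "a = aa k"
      have a: "a > 0" using s by (simp add: a_def aa_def)
      have ak: "a * \<sigma> = real (k + 1)" using s by (simp add: a_def aa_def)
      have "co k * integral {0..} (f k) = of_real ((- 1) ^ k / fact k * (Gamma a / \<sigma> * x powr (- a))) * (cis (real (k + 1) * \<phi>) * cis (- (a * \<theta>)))"
        unfolding co_def fk(2) a_def[symmetric] by (simp add: mult_ac)
      also have "cis (real (k + 1) * \<phi>) * cis (- (a * \<theta>)) = cis (pi * a - real (k + 1) * pi)"
      proof -
        have "a * \<theta> = (a * \<sigma>) * (pi + \<phi>) - a * pi" by (simp add: \<theta>_def algebra_simps)
        then show ?thesis unfolding ak cis_mult by (intro arg_cong[of _ _ cis]) (simp add: algebra_simps)
      qed
      finally have "Im (co k * integral {0..} (f k)) = (- 1) ^ k / fact k * (Gamma a / \<sigma> * x powr (- a)) * sin (pi * a - real (k + 1) * pi)"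
        by (simp only: Im_of_real_mult cis.sel)
      also have "sin (pi * a - real (k + 1) * pi) = sin (pi * a) * (- 1) ^ (k + 1)"
        unfolding sin_diff sin_npi cos_npi by simp
      finally have 1: "Im (co k * integral {0..} (f k)) = - (Gamma a * sin (pi * a)) / (fact k * \<sigma>) * x powr (- a) * ((- 1) ^ k * (- 1) ^ k)"
        by (simp add: field_simps)
      have m1: "((- 1) ^ k * (- 1) ^ k :: real) = 1" by (simp flip: power_mult_distrib)
      have "rGamma (- a) = - a * rGamma (1 - a)" using rGamma_real_plus1[of "- a"] by (simp add: add.commute)
      also have "rGamma (1 - a) = Gamma a * sin (pi * a) / pi" by (rule rGamma_reflect_real[OF a])
      finally have g1: "rGamma (- a) = - (a * (Gamma a * sin (pi * a))) / pi" by simp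
      have ek: "real (Suc k) / \<sigma> = a" by (simp add: a_def aa_def)
      have e1: "- (real (Suc k) + \<sigma>) / \<sigma> = - a - 1" using s by (simp add: a_def aa_def field_simps)
      have xp: "x powr (- a - 1) = x powr (- a) / x" using x by (simp add: powr_diff)
      have fs: "(fact (Suc k) :: real) = a * \<sigma> * fact k" unfolding ak by simp
      show ?thesis unfolding 1 m1 e1 xp ek g1 fs using a s x by (simp add: field_simps)
    qed
    have Hs: "H_trunc \<sigma> N x = (\<Sum>k<n. Im (co k * integral {0..} (f k)) / (pi * \<sigma> * x))"
    proof -
      have e: "(\<Sum>k=1..<N. x powr (- (real k + \<sigma>) / \<sigma>) / fact k * rGamma (- (real k / \<sigma>))) =
          (\<Sum>k<n. x powr (- (real (Suc k) + \<sigma>) / \<sigma>) / fact (Suc k) * rGamma (- (real (Suc k) / \<sigma>)))"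
        unfolding n[symmetric] One_nat_def sum.shift_bounds_Suc_ivl lessThan_atLeast0 ..
      show ?thesis unfolding H_trunc_def e trm sum_distrib_left ..
    qed
    have "M_wright \<sigma> (- x) = Im (wright_int \<sigma> (- x)) / (pi * \<sigma> * x)"
      using M_wright_eq_wright_int[OF s, of "- x"] x s by (simp add: field_simps)
    then have "M_wright \<sigma> (- x) - H_trunc \<sigma> N x = Im (integral {0..} err) / (pi * \<sigma> * x)"
      unfolding Hs split by (simp add: add_divide_distrib sum_divide_distrib)
    then have "\<bar>M_wright \<sigma> (- x) - H_trunc \<sigma> N x\<bar> = \<bar>Im (integral {0..} err)\<bar> / (pi * \<sigma> * x)" using x s by (simp add: abs_mult)
    also have "\<dots> \<le> (Gamma (aa n) / \<sigma> * (x * cos \<theta>) powr (- aa n)) / (pi * \<sigma> * x)"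
      using order_trans[OF abs_Im_le_cmod errb] x s by (intro divide_right_mono) auto
    also have "\<dots> = K * (x powr (- aa n) / x)" using x ct s by (simp add: K_def powr_mult field_simps)
    also have "x powr (- aa n) / x = x powr (- (real N + \<sigma>) / \<sigma>)"
    proof -
      have "- (real N + \<sigma>) / \<sigma> = - aa n - 1" using s unfolding n[symmetric] by (simp add: aa_def field_simps)
      then show ?thesis using x by (simp add: powr_diff)
    qed
    finally show ?thesis .
  qed
  show ?thesis
  proof (rule bigoI[of _ K])
    show "\<forall>\<^sub>F x in at_top. norm (M_wright \<sigma> (- x) - H_trunc \<sigma> N x) \<le> K * norm (x powr (- (real N + \<sigma>) / \<sigma>))"
      using eventually_gt_at_top[of 0] by eventually_elim (use main in simp)
  qed
qed

section \<open>Assembly of the asymptotic expansions\<close>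

text \<open>
  The contour is the complete vertical line through the saddle. Its lower half is the complex
  conjugate of the upper one, so the difference of the two descent integrals is twice the imaginary
  part that occurs in the representation of \<open>M_wright\<close>.
\<close>

lemma recessive_expansion:
  assumes \<sigma>: "0 < \<sigma>" "\<sigma> < 1" and coeffs: "inverse_factorial_coeffs \<sigma> c"
  shows "(\<lambda>x. M_wright \<sigma> x / (Apar \<sigma> / (2 * pi) * Xvar \<sigma> x powr vth \<sigma> * exp (- Xvar \<sigma> x))
              - (\<Sum>j<M. c j / (- Xvar \<sigma> x) ^ j))
          \<in> O[at_top](\<lambda>x. 1 / Xvar \<sigma> x ^ M)"
proof -
  note pos = positive_parameters[OF \<sigma>]
  define q where "q = sqrt (2 * pi / \<sigma>)"
  have q: "q > 0" using \<sigma> by (simp add: q_def)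
  define J where "J = (\<lambda>X. integral {0..} (\<lambda>t. exp (of_real X * - (phase \<sigma> (1 + \<i> * of_real t) - 1)) * \<i>))"
  define S where "S = (\<lambda>X::real. \<Sum>j<M. c j / (- X) ^ j)"
  \<comment> \<open>with \<open>\<mu> = - \<i>\<close> the exponent near the saddle is \<open>- (phase - 1)\<close>, since \<open>\<mu>\<^sup>2 = - 1\<close>\<close>
  define err where "err = (\<lambda>X. J X - integral {0..} (\<lambda>t. exp (of_real X * - (phase \<sigma> (1 - \<i> * of_real t) - 1)) * - \<i>)
      - of_real q / (- \<i> * of_real (sqrt X)) * (\<Sum>j<M. of_real (c j) / (of_real X * (- \<i>)\<^sup>2) ^ j))"
  have "err \<in> O[at_top](\<lambda>X. complex_of_real (X powr (-1/2 - real M)))"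
    unfolding err_def J_def q_def
    by (rule saddle_expansion[OF \<sigma> coeffs, of "- \<i>"]) (use descent_vertical[OF \<sigma>] in simp_all)
  then obtain C where C: "C > 0" "\<forall>\<^sub>F X in at_top. norm (err X) \<le> C * norm (complex_of_real (X powr (-1/2 - real M)))"
    by (rule landau_o.bigE)
  have C': "\<forall>\<^sub>F x in at_top. norm (err (Xvar \<sigma> x)) \<le> C * Xvar \<sigma> x powr (-1/2 - real M)"
    using eventually_compose_filterlim[OF C(2) filterlim_Xvar[OF \<sigma>]] by simp
  have err: "norm (err X) = \<bar>2 * Im (J X) - q / sqrt X * S X\<bar>" for X
  proof -
    have "integral {0..} (\<lambda>t. exp (of_real X * - (phase \<sigma> (1 - \<i> * of_real t) - 1)) * - \<i>) = cnj (J X)"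
      unfolding J_def integral_cnj by (simp add: phase_vertical_cnj exp_cnj)
    moreover have "(\<Sum>j<M. of_real (c j) / (of_real X * (- \<i>)\<^sup>2) ^ j) = complex_of_real (S X)"
      unfolding S_def by simp
    moreover have "of_real q / (- \<i> * of_real (sqrt X)) = \<i> * complex_of_real (q / sqrt X)"
      by (simp add: divide_inverse)
    ultimately have "err X = \<i> * of_real (2 * Im (J X) - q / sqrt X * S X)"
      unfolding err_def by (simp only: complex_diff_cnj of_real_diff of_real_mult right_diff_distrib) (simp add: mult_ac)
    then show ?thesis by (simp only: norm_mult norm_ii norm_of_real mult_1)
  qed
  show ?thesis
  proof (rule bigoI[of _ "C / q"])
    show "\<forall>\<^sub>F x in at_top. norm (M_wright \<sigma> x / (Apar \<sigma> / (2 * pi) * Xvar \<sigma> x powr vth \<sigma> * exp (- Xvar \<sigma> x))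
              - (\<Sum>j<M. c j / (- Xvar \<sigma> x) ^ j)) \<le> C / q * norm (1 / Xvar \<sigma> x ^ M)"
      using C' eventually_gt_at_top[of 0]
    proof eventually_elim
      case (elim x)
      define X where "X = Xvar \<sigma> x"
      define m where "m = \<sigma> * Xvar \<sigma> x / kap \<sigma>"
      note sc = saddle_scaling[OF \<sigma> elim(2), folded X_def m_def q_def]
      have X: "X > 0" "sqrt X > 0" using sc(1) by simp_all
      define P where "P = Apar \<sigma> / (2 * pi) * X powr vth \<sigma> * exp (- X)"
      have P: "P > 0" using pos X by (simp add: P_def)
      have "pi * \<sigma> * x * M_wright \<sigma> x = - Im (wright_int \<sigma> x)"
        by (rule M_wright_eq_wright_int[OF \<sigma>]) (use elim(2) in simp)
      also have "\<dots> = m * (exp (- X) * Im (J X))"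
        using wright_int_vertical[OF \<sigma> elim(2)] unfolding J_def X_def m_def by (simp only: mult.assoc)
      finally have "pi * \<sigma> * x * M_wright \<sigma> x = m * (exp (- X) * Im (J X))" .
      moreover have "pi * \<sigma> * x \<noteq> 0" using elim(2) \<sigma> by simp
      ultimately have "M_wright \<sigma> x = m / (pi * \<sigma> * x) * (exp (- X) * Im (J X))"
        by (metis nonzero_mult_div_cancel_left times_divide_eq_left)
      then have "M_wright \<sigma> x = P * (sqrt X / q * (2 * Im (J X)))" unfolding sc(4) P_def by simp
      then have "M_wright \<sigma> x / P = sqrt X / q * (2 * Im (J X))" using P by simp
      moreover have "S X = sqrt X / q * (q / sqrt X * S X)" using X q by simp
      ultimately have "M_wright \<sigma> x / P - S X = sqrt X / q * (2 * Im (J X) - q / sqrt X * S X)"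
        by (metis right_diff_distrib)
      then have "norm (M_wright \<sigma> x / P - S X) = sqrt X / q * norm (err X)"
        unfolding err using X q by (simp add: abs_mult)
      also have "\<dots> \<le> sqrt X / q * (C * X powr (-1/2 - real M))"
        using elim(1) X q by (intro mult_left_mono) (simp_all add: X_def)
      also have "\<dots> = C / q * (sqrt X * X powr (-1/2 - real M))" by simp
      also have "sqrt X * X powr (-1/2 - real M) = X powr (- real M)"
        using X by (simp flip: powr_half_sqrt powr_add)
      also have "\<dots> = 1 / X ^ M" using X by (simp add: powr_minus powr_realpow divide_inverse)
      finally show ?case using X unfolding P_def S_def X_def by simp
    qed
  qed
qed

text \<open>
  The contour is the ray through the saddle, split there into its outer and its inner part.
\<close>

lemma exponential_expansion_below_third:
  assumes \<sigma>: "0 < \<sigma>" "\<sigma> < 1 / 3" and coeffs: "inverse_factorial_coeffs \<sigma> c"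
  shows "(\<lambda>x. M_wright \<sigma> (- x) - E_trunc \<sigma> c M x)
    \<in> O[at_top](\<lambda>x. Xvar \<sigma> x powr (vth \<sigma> - real M) * exp (Xvar \<sigma> x * cos (pi * \<sigma> / kap \<sigma>)))"
proof -
  have s1: "\<sigma> < 1" using \<sigma> by simp
  define \<beta> where "\<beta> = pi * \<sigma> / kap \<sigma>"
  have "\<sigma> / kap \<sigma> < 1 / 2" using \<sigma> by (simp add: kap_def field_simps)
  from mult_strict_left_mono[OF this pi_gt_zero] have b: "0 < \<beta>" "\<beta> < pi / 2"
    using \<sigma> positive_parameters(1)[OF \<sigma>(1) s1] by (simp_all add: \<beta>_def)
  have cb: "cos \<beta> > 0" "cos (\<beta> / 2) > 0" using b by (auto intro: cos_gt_zero)
  have sq: "(cis (\<beta> / 2))\<^sup>2 = cis \<beta>" by (simp add: power2_eq_square cis_mult)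
  have w: "Re (cis \<beta>) > 0" using cb by simp
  define D where "D = (\<lambda>X. integral {0..} (\<lambda>t. exp (of_real X * (cis \<beta> * (of_real (rphase \<sigma> (1 + t)) - 1))) * 1)
       - integral {0..1} (\<lambda>t. exp (of_real X * (cis \<beta> * (of_real (rphase \<sigma> (1 - t)) - 1))) * (- 1)))"
  have ex: "(\<lambda>X. D X - of_real (sqrt (2 * pi / \<sigma>)) / (cis (\<beta> / 2) * of_real (sqrt X))
        * (\<Sum>j<M. of_real (c j) / (of_real X * (cis (\<beta> / 2))\<^sup>2) ^ j))
        \<in> O[at_top](\<lambda>X. complex_of_real (X powr (-1/2 - real M)))"
    unfolding D_def
    by (rule saddle_expansion[OF \<sigma>(1) s1 coeffs, of "cis (\<beta> / 2)"])
       (use descent_real_right[OF \<sigma>(1) s1 w] descent_real_left[OF \<sigma>(1) s1 w] cb in \<open>simp_all add: sq\<close>)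
  have rep: "\<forall>\<^sub>F x in at_top. Im (wright_int \<sigma> (- x)) =
      Im (cis \<beta> * of_real (\<sigma> * Xvar \<sigma> x / kap \<sigma>) * exp (of_real (Xvar \<sigma> x) * cis \<beta>) * D (Xvar \<sigma> x))"
    using eventually_gt_at_top[of 0]
    by eventually_elim (simp only: wright_int_real_axis[OF \<sigma>, folded \<beta>_def] D_def)
  show ?thesis
    by (rule exponential_expansion[OF \<sigma>(1) s1 rep[unfolded \<beta>_def] ex[unfolded sq, unfolded \<beta>_def]])
qed

lemma exponential_expansion_third:
  assumes coeffs: "inverse_factorial_coeffs (1 / 3) c"
  shows "(\<lambda>x. M_wright (1 / 3) (- x) - E_trunc (1 / 3) c M x)
    \<in> O[at_top](\<lambda>x. Xvar (1 / 3) x powr (vth (1 / 3) - real M) * exp (Xvar (1 / 3) x * cos (pi * (1 / 3) / kap (1 / 3))))"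
proof -
  have \<sigma>: "0 < (1 / 3 :: real)" "(1 / 3 :: real) < 1" by simp_all
  define \<beta> where "\<beta> = pi * (1 / 3) / kap (1 / 3)"
  have b: "\<beta> = pi / 2" by (simp add: \<beta>_def kap_def)
  have sq: "(cis (\<beta> / 2))\<^sup>2 = cis \<beta>" by (simp add: power2_eq_square cis_mult)
  have ci: "cis \<beta> = \<i>" by (simp add: b)
  define D where "D = (\<lambda>X. integral {0..} (\<lambda>t. exp (of_real X * airy_exponent (cis (- (pi / 6))) t) * airy_amplitude (cis (- (pi / 6))) t)
       - integral {0..2} (\<lambda>t. exp (of_real X * airy_exponent (cis (2 * pi / 3)) t) * airy_amplitude (cis (2 * pi / 3)) t))"
  have p1: "Re (cis (\<beta> / 2) * airy_amplitude (cis (- (pi / 6))) 0) > 0"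
  proof -
    have "Re (cis (\<beta> / 2) * airy_amplitude (cis (- (pi / 6))) 0) = 3 * cos (pi / 4 + - (pi / 6))"
      unfolding cos_add[of "pi / 4" "- (pi / 6)"] by (simp add: airy_amplitude_def b algebra_simps)
    moreover have "cos (pi / 4 + - (pi / 6)) > 0" using pi_gt_zero by (intro cos_gt_zero) auto
    ultimately show ?thesis by linarith
  qed
  have p2: "Re (cis (\<beta> / 2) * airy_amplitude (cis (2 * pi / 3)) 0) < 0"
  proof -
    have "Re (cis (\<beta> / 2) * airy_amplitude (cis (2 * pi / 3)) 0) = 3 * cos (pi / 4 + 2 * pi / 3)"
      unfolding cos_add[of "pi / 4" "2 * pi / 3"] by (simp add: airy_amplitude_def b algebra_simps)
    moreover have "cos (pi / 4 + 2 * pi / 3) < 0" using pi_gt_zero by (intro cos_lt_zero_pi) auto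
    ultimately show ?thesis by linarith
  qed
  have d: "descent_path (1 / 3) ((cis (\<beta> / 2))\<^sup>2) {0..} (airy_exponent (cis (- (pi / 6)))) (airy_amplitude (cis (- (pi / 6))))"
    "descent_path (1 / 3) ((cis (\<beta> / 2))\<^sup>2) {0..2} (airy_exponent (cis (2 * pi / 3))) (airy_amplitude (cis (2 * pi / 3)))"
    unfolding sq ci by (rule descent_airy[OF airy_directions(1-3)], simp, rule descent_airy[OF airy_directions(4-6)], simp)
  have n: "norm (cis (\<beta> / 2)) = 1" by simp
  have ex: "(\<lambda>X. D X - of_real (sqrt (2 * pi / (1 / 3))) / (cis (\<beta> / 2) * of_real (sqrt X))
        * (\<Sum>j<M. of_real (c j) / (of_real X * (cis (\<beta> / 2))\<^sup>2) ^ j))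
        \<in> O[at_top](\<lambda>X. complex_of_real (X powr (-1/2 - real M)))"
    unfolding D_def by (rule saddle_expansion[OF \<sigma> coeffs n d(1) p1 d(2) p2])
  have "\<forall>\<^sub>F x in at_top. Xvar (1 / 3) x \<ge> 1"
    using filterlim_Xvar[OF \<sigma>] unfolding filterlim_at_top by blast
  then have rep: "\<forall>\<^sub>F x in at_top. Im (wright_int (1 / 3) (- x)) =
      Im (cis \<beta> * of_real ((1 / 3) * Xvar (1 / 3) x / kap (1 / 3)) * exp (of_real (Xvar (1 / 3) x) * cis \<beta>) * D (Xvar (1 / 3) x))"
    using eventually_gt_at_top[of 0]
    by eventually_elim (simp only: wright_int_third D_def ci)
  show ?thesis
    by (rule exponential_expansion[OF \<sigma> rep[unfolded \<beta>_def] ex[unfolded sq, unfolded \<beta>_def]])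
qed

lemma H_trunc_bounded:
  assumes "\<sigma> > 0"
  shows "H_trunc \<sigma> N \<in> O[at_top](\<lambda>_. 1)"
proof -
  have "(\<lambda>x. x powr (- (real k + \<sigma>) / \<sigma>) / fact k * rGamma (- (real k / \<sigma>))) \<in> O[at_top](\<lambda>_. 1)" for k
  proof (rule bigoI[of _ "\<bar>rGamma (- (real k / \<sigma>))\<bar> / fact k"])
    show "\<forall>\<^sub>F x in at_top. norm (x powr (- (real k + \<sigma>) / \<sigma>) / fact k * rGamma (- (real k / \<sigma>)))
        \<le> \<bar>rGamma (- (real k / \<sigma>))\<bar> / fact k * norm (1::real)"
      using eventually_ge_at_top[of 1]
    proof eventually_elim
      case (elim x)
      have "x powr (- (real k + \<sigma>) / \<sigma>) \<le> x powr 0" using elim assms by (intro powr_mono) (auto simp: field_simps)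
      then have "x powr (- (real k + \<sigma>) / \<sigma>) * (\<bar>rGamma (- (real k / \<sigma>))\<bar> / fact k) \<le> 1 * (\<bar>rGamma (- (real k / \<sigma>))\<bar> / fact k)"
        using elim by (intro mult_right_mono) auto
      then show ?case by (simp add: abs_mult)
    qed
  qed
  from big_sum_in_bigo[OF this] have "(\<lambda>x. \<Sum>k=1..<N. x powr (- (real k + \<sigma>) / \<sigma>) / fact k * rGamma (- (real k / \<sigma>))) \<in> O[at_top](\<lambda>_. 1)"
    by simp
  then show ?thesis using assms unfolding H_trunc_def[abs_def] by simp
qed

text \<open>
  The cosine of \<open>pi * \<sigma> / kap \<sigma>\<close> is negative in this range, so the
  exponential expansion is smaller than every power.
\<close>

lemma E_trunc_negligible:
  assumes \<sigma>: "1 / 3 < \<sigma>" "\<sigma> < 1 / 2"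
  shows "E_trunc \<sigma> c M \<in> O[at_top](\<lambda>x. x powr p)"
proof -
  have s: "0 < \<sigma>" "\<sigma> < 1" using \<sigma> by simp_all
  note pos = positive_parameters[OF s]
  define \<beta> where "\<beta> = pi * \<sigma> / kap \<sigma>"
  have "1 / 2 < \<sigma> / kap \<sigma>" "\<sigma> / kap \<sigma> < 1" using \<sigma> by (simp_all add: kap_def field_simps)
  from this[THEN mult_strict_left_mono[OF _ pi_gt_zero]] have "pi / 2 < \<beta>" "\<beta> < pi" by (simp_all add: \<beta>_def)
  then have cb: "cos \<beta> < 0" using pi_gt_zero by (intro cos_lt_zero_pi) auto
  define F where "F = (\<lambda>x. Xvar \<sigma> x powr vth \<sigma> * exp (Xvar \<sigma> x * cos \<beta>))"
  have "E_trunc \<sigma> c M \<in> O[at_top](F)"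
  proof (rule bigoI[of _ "Apar \<sigma> / pi * (\<Sum>j<M. \<bar>c j\<bar>)"])
    have "\<forall>\<^sub>F x in at_top. Xvar \<sigma> x \<ge> 1"
      using filterlim_Xvar[OF s] unfolding filterlim_at_top by blast
    then show "\<forall>\<^sub>F x in at_top. norm (E_trunc \<sigma> c M x) \<le> Apar \<sigma> / pi * (\<Sum>j<M. \<bar>c j\<bar>) * norm (F x)"
    proof eventually_elim
      case (elim x)
      define T where "T = (\<Sum>j<M. c j / (- Xvar \<sigma> x) ^ j *
        cos (Xvar \<sigma> x * sin \<beta> + pi / kap \<sigma> * (vth \<sigma> - real j)))"
      have T: "norm T \<le> (\<Sum>j<M. \<bar>c j\<bar>)" unfolding T_def
      proof (rule sum_norm_le)
        fix j
        have "\<bar>c j\<bar> / Xvar \<sigma> x ^ j \<le> \<bar>c j\<bar> / 1" using elim by (intro divide_left_mono) (auto simp: one_le_power)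
        then have "\<bar>c j\<bar> / Xvar \<sigma> x ^ j * \<bar>cos (Xvar \<sigma> x * sin \<beta> + pi / kap \<sigma> * (vth \<sigma> - real j))\<bar> \<le> \<bar>c j\<bar> * 1"
          using elim by (intro mult_mono) auto
        then show "norm (c j / (- Xvar \<sigma> x) ^ j * cos (Xvar \<sigma> x * sin \<beta> + pi / kap \<sigma> * (vth \<sigma> - real j))) \<le> \<bar>c j\<bar>"
          using elim by (simp add: abs_mult power_abs)
      qed
      have F: "F x \<ge> 0" by (simp add: F_def)
      have "E_trunc \<sigma> c M x = Apar \<sigma> / pi * F x * T"
        unfolding E_trunc_def F_def T_def \<beta>_def by (simp only: mult.assoc)
      then have "norm (E_trunc \<sigma> c M x) = Apar \<sigma> / pi * F x * norm T" using pos F by (simp add: abs_mult)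
      also have "\<dots> \<le> Apar \<sigma> / pi * F x * (\<Sum>j<M. \<bar>c j\<bar>)"
        using T pos F by (intro mult_left_mono) auto
      finally show ?case using F by (simp add: mult_ac)
    qed
  qed
  also have "F \<in> O[at_top](\<lambda>x. x powr p)"
  proof -
    have "(\<lambda>x. (k * (h * x) powr (1 / k)) powr v * exp ((k * (h * x) powr (1 / k)) * - d)) \<in> O[at_top](\<lambda>x. x powr p)"
      if "k > 0" "h > 0" "d > 0" for k h d v :: real
      using that by real_asymp
    from this[OF pos(1,2), of "- cos \<beta>" "vth \<sigma>"] cb show ?thesis unfolding F_def Xvar_def by simp
  qed
  finally show ?thesis .
qed

theorem theorem2:
  fixes \<sigma> :: real and c :: "nat \<Rightarrow> real"
  assumes "0 < \<sigma>" and "\<sigma> < 1"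
    and "inverse_factorial_coeffs \<sigma> c"
  shows
    "(\<forall>M\<ge>1.
        (\<lambda>x. M_wright \<sigma> x / (Apar \<sigma> / (2 * pi) * Xvar \<sigma> x powr vth \<sigma> * exp (- Xvar \<sigma> x))
              - (\<Sum>j<M. c j / (- Xvar \<sigma> x) ^ j))
          \<in> O[at_top](\<lambda>x. 1 / Xvar \<sigma> x ^ M)) \<and>
     (\<sigma> < 1 / 2 \<longrightarrow>
       (\<forall>M\<ge>1. \<forall>N\<ge>1.
          (\<lambda>x. M_wright \<sigma> (- x) - (E_trunc \<sigma> c M x + H_trunc \<sigma> N x))
            \<in> O[at_top](\<lambda>x.
                Xvar \<sigma> x powr (vth \<sigma> - real M) * exp (Xvar \<sigma> x * cos (pi * \<sigma> / kap \<sigma>))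
                + x powr (- (real N + \<sigma>) / \<sigma>)))) \<and>
     (1 / 2 < \<sigma> \<longrightarrow>
       (\<forall>N\<ge>1.
          (\<lambda>x. M_wright \<sigma> (- x) - H_trunc \<sigma> N x)
            \<in> O[at_top](\<lambda>x. x powr (- (real N + \<sigma>) / \<sigma>))))"
proof (intro conjI impI allI)
  fix M :: nat
  show "(\<lambda>x. M_wright \<sigma> x / (Apar \<sigma> / (2 * pi) * Xvar \<sigma> x powr vth \<sigma> * exp (- Xvar \<sigma> x))
              - (\<Sum>j<M. c j / (- Xvar \<sigma> x) ^ j)) \<in> O[at_top](\<lambda>x. 1 / Xvar \<sigma> x ^ M)"
    by (rule recessive_expansion[OF assms])
next
  fix M N :: nat
  assume half: "\<sigma> < 1 / 2" and N: "N \<ge> 1"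
  define F where "F = (\<lambda>x. Xvar \<sigma> x powr (vth \<sigma> - real M) * exp (Xvar \<sigma> x * cos (pi * \<sigma> / kap \<sigma>)))"
  define G where "G = (\<lambda>x. x powr (- (real N + \<sigma>) / \<sigma>))"
  have FG: "F \<in> O[at_top](\<lambda>x. F x + G x)" "G \<in> O[at_top](\<lambda>x. F x + G x)"
    by (auto intro!: bigoI[of _ 1] always_eventually simp: F_def G_def)
  consider "\<sigma> < 1 / 3" | "\<sigma> = 1 / 3" | "1 / 3 < \<sigma>" by linarith
  then have "(\<lambda>x. M_wright \<sigma> (- x) - (E_trunc \<sigma> c M x + H_trunc \<sigma> N x)) \<in> O[at_top](\<lambda>x. F x + G x)"
  proof cases
    case 1
    have "\<sigma> / kap \<sigma> < 1 / 2" using 1 assms by (simp add: kap_def field_simps)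
    from mult_strict_left_mono[OF this pi_gt_zero] have "cos (pi * \<sigma> / kap \<sigma>) > 0"
      using assms positive_parameters(1)[OF assms(1,2)] by (intro cos_gt_zero) simp_all
    then have "\<forall>\<^sub>F X in at_top. 1 \<le> X powr (vth \<sigma> - real M) * exp (X * cos (pi * \<sigma> / kap \<sigma>))"
      by real_asymp
    from eventually_compose_filterlim[OF this filterlim_Xvar[OF assms(1,2)]]
    have "(\<lambda>_. 1) \<in> O[at_top](F)"
      by (intro bigoI[of _ 1]) (simp add: F_def)
    with H_trunc_bounded[OF assms(1)] have "H_trunc \<sigma> N \<in> O[at_top](F)" by (rule landau_o.big_trans)
    with exponential_expansion_below_third[OF assms(1) 1 assms(3), of M]
    have "(\<lambda>x. (M_wright \<sigma> (- x) - E_trunc \<sigma> c M x) - H_trunc \<sigma> N x) \<in> O[at_top](F)"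
      unfolding F_def by (rule sum_in_bigo)
    from landau_o.big_trans[OF this FG(1)] show ?thesis by (simp add: algebra_simps)
  next
    case 2
    have "rGamma (- (real k / \<sigma>)) = 0" for k
    proof -
      have "- (real k / \<sigma>) = - real (3 * k)" unfolding 2 by simp
      then show ?thesis by (simp add: rGamma_eq_zero_iff del: of_nat_mult)
    qed
    then have "H_trunc \<sigma> N x = 0" for x by (simp add: H_trunc_def)
    with exponential_expansion_third[of c M] assms(3)
    have "(\<lambda>x. M_wright \<sigma> (- x) - (E_trunc \<sigma> c M x + H_trunc \<sigma> N x)) \<in> O[at_top](F)"
      unfolding F_def 2 by simp
    then show ?thesis by (rule landau_o.big_trans[OF _ FG(1)])
  next
    case 3
    have "(\<lambda>x. (M_wright \<sigma> (- x) - H_trunc \<sigma> N x) - E_trunc \<sigma> c M x) \<in> O[at_top](G)"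
      unfolding G_def using 3 half assms N by (intro sum_in_bigo algebraic_expansion E_trunc_negligible) simp_all
    from landau_o.big_trans[OF this FG(2)] show ?thesis by (simp add: algebra_simps)
  qed
  then show "(\<lambda>x. M_wright \<sigma> (- x) - (E_trunc \<sigma> c M x + H_trunc \<sigma> N x))
            \<in> O[at_top](\<lambda>x. Xvar \<sigma> x powr (vth \<sigma> - real M) * exp (Xvar \<sigma> x * cos (pi * \<sigma> / kap \<sigma>))
                + x powr (- (real N + \<sigma>) / \<sigma>))"
    unfolding F_def G_def .
next
  fix N :: nat
  assume "1 / 2 < \<sigma>" "N \<ge> 1"
  then show "(\<lambda>x. M_wright \<sigma> (- x) - H_trunc \<sigma> N x) \<in> O[at_top](\<lambda>x. x powr (- (real N + \<sigma>) / \<sigma>))"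
    using assms by (intro algebraic_expansion) simp_all
qed

end
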